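(* Let $N\geq 5$, $\alpha>0$ and $\beta>(\alpha-2)^+$. There exists $\lambda_0>0$, depending only on $N,\alpha,\beta$, such that for every $\lambda\geq\lambda_0$ the operator $(-A_\lambda,D(A_\lambda))$, where $A_\lambda$ is the operator on $L^2(\mathbb{R}^N)$ associated with the closure of the form $\mathfrak{a}_\lambda$, generates a strongly continuous analytic contraction semigroup on $L^2(\mathbb{R}^N)$.
   Context: Notation: $(\alpha-2)^+=\max\{\alpha-2,0\}$; $L^2(\mathbb{R}^N)$ is the complex Hilbert space with inner product $\langle u,v\rangle=\int_{\mathbb{R}^N}u\,\overline v\,dx$; $a(x)=1+|x|^\alpha$ and $V(x)=|x|^\beta$. For $\lambda>0$ define on $C_c^\infty(\mathbb{R}^N\setminus\{0\})$ (complex-valued functions) the sesquilinear form $$\mathfrak{a}_\lambda(u,v)=\int_{\mathbb{R}^N}\left[a^2\,\Delta u\,\Delta\overline v+2\,\nabla a^2\cdot\nabla\overline v\,\Delta u+\Delta (a^2)\,\Delta u\,\overline v+(V^2+\lambda)u\,\overline v\right]dx .$$ Let $$D=\{u\in H^2(\mathbb{R}^N):(1+|x|^\alpha)\Delta u,\ |x|^{\alpha-1}\nabla u,\ |x|^{\alpha-2}u,\ Vu\in L^2(\mathbb{R}^N)\}.$$ For $\lambda\ge\lambda_0$ ($\lambda_0$ large enough) the form $\mathfrak{a}_\lambda$ is densely defined, accretive, continuous and closable, and the domain of its closure $\overline{\mathfrak{a}}_\lambda$ is $D$. The associated operator is defined by $$D(A_\lambda)=\{u\in D:\exists\, v\in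 L^2(\mathbb{R}^N)\text{ such that }\overline{\mathfrak{a}}_\lambda(u,h)=\langle v,h\rangle\ \ \forall h\in D\},\qquad A_\lambda u=v .$$ *)

theory Defs
  imports "HOL-Analysis.Analysis"
begin

section \<open>Square integrable functions\<close>

text \<open>Elements of the complex Hilbert space \<open>L\<^sup>2\<close> are represented by functions, and equality
  in \<open>L\<^sup>2\<close> by equality almost everywhere.  Accordingly, an operator on \<open>L\<^sup>2\<close> is either a map on
  representatives whose laws hold almost everywhere, or a graph of pairs of representatives.\<close>

definition L2 :: "('a::euclidean_space \<Rightarrow> complex) set" where
  "L2 = {f. f \<in> borel_measurable lborel \<and> integrable lborel (\<lambda>x. (cmod (f x))\<^sup>2)}"

definition l2inner :: "('a::euclidean_space \<Rightarrow> complex) \<Rightarrow> ('a \<Rightarrow> complex) \<Rightarrow> complex" where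
  "l2inner u v = (LINT x|lborel. u x * cnj (v x))"

definition l2norm :: "('a::euclidean_space \<Rightarrow> complex) \<Rightarrow> real" where
  "l2norm u = sqrt (LINT x|lborel. (cmod (u x))\<^sup>2)"

definition ae_eq :: "('a::euclidean_space \<Rightarrow> complex) \<Rightarrow> ('a \<Rightarrow> complex) \<Rightarrow> bool" where
  "ae_eq u v \<longleftrightarrow> (AE x in lborel. u x = v x)"

text \<open>Boundedness and linearity make such a map compatible with equality almost everywhere.\<close>

definition bounded_op :: "(('a::euclidean_space \<Rightarrow> complex) \<Rightarrow> ('a \<Rightarrow> complex)) \<Rightarrow> bool" where
  "bounded_op S \<longleftrightarrow>
     (\<forall>f\<in>L2. S f \<in> L2) \<and>
     (\<forall>f\<in>L2. \<forall>g\<in>L2. \<forall>c. ae_eq (S (\<lambda>x. c * f x + g x)) (\<lambda>x. c * S f x + S g x)) \<and>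
     (\<exists>C. \<forall>f\<in>L2. l2norm (S f) \<le> C * l2norm f)"


section \<open>Classical and weak derivatives\<close>

definition partial :: "'a::euclidean_space \<Rightarrow> ('a \<Rightarrow> 'b::real_normed_vector) \<Rightarrow> 'a \<Rightarrow> 'b" where
  "partial b f x = frechet_derivative f (at x) b"

definition laplacian :: "('a::euclidean_space \<Rightarrow> 'b::real_normed_vector) \<Rightarrow> 'a \<Rightarrow> 'b" where
  "laplacian f x = (\<Sum>b\<in>Basis. partial b (partial b f) x)"

text \<open>\<open>C\<^sup>\<infinity>\<close>: all iterated partial derivatives, in any order, are (Frechet) differentiable.\<close>

definition smooth :: "('a::euclidean_space \<Rightarrow> complex) \<Rightarrow> bool" where
  "smooth f \<longleftrightarrow> (\<forall>bs. set bs \<subseteq> Basis \<longrightarrow> fold partial bs f differentiable_on UNIV)"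

definition test_functions :: "'a::euclidean_space set \<Rightarrow> ('a \<Rightarrow> complex) set" where
  "test_functions \<Omega> = {u. smooth u \<and> compact (closure {x. u x \<noteq> 0}) \<and> closure {x. u x \<noteq> 0} \<subseteq> \<Omega>}"

definition has_weak_partial ::
  "'a::euclidean_space \<Rightarrow> ('a \<Rightarrow> complex) \<Rightarrow> ('a \<Rightarrow> complex) \<Rightarrow> bool" where
  "has_weak_partial b u g \<longleftrightarrow>
     (\<forall>\<phi>\<in>test_functions UNIV.
        (LINT x|lborel. u x * partial b \<phi> x) = - (LINT x|lborel. g x * \<phi> x))"

text \<open>The choice in \<open>weak_partial\<close> is unique up to null sets whenever a candidate exists.\<close>

definition weak_partial :: "'a::euclidean_space \<Rightarrow> ('a \<Rightarrow> complex) \<Rightarrow> 'a \<Rightarrow> complex" where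
  "weak_partial b u = (SOME g. g \<in> L2 \<and> has_weak_partial b u g)"

definition sobolev_H1 :: "('a::euclidean_space \<Rightarrow> complex) set" where
  "sobolev_H1 = {u \<in> L2. \<forall>b\<in>Basis. \<exists>g\<in>L2. has_weak_partial b u g}"

definition sobolev_H2 :: "('a::euclidean_space \<Rightarrow> complex) set" where
  "sobolev_H2 = {u \<in> sobolev_H1. \<forall>b\<in>Basis. weak_partial b u \<in> sobolev_H1}"

definition weak_laplacian :: "('a::euclidean_space \<Rightarrow> complex) \<Rightarrow> 'a \<Rightarrow> complex" where
  "weak_laplacian u x = (\<Sum>b\<in>Basis. weak_partial b (weak_partial b u) x)"


section \<open>Closure of a form\<close>

text \<open>A form \<open>q\<close> with domain \<open>Q\<close> carries the norm \<open>u \<mapsto> sqrt (Re (q u u) + (l2norm u)\<^sup>2)\<close>.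
  The predicate \<open>form_approx Q q s u\<close> says that \<open>s\<close> is a Cauchy sequence in \<open>Q\<close> for
  this norm that converges to \<open>u\<close> in \<open>L\<^sup>2\<close>.\<close>

definition form_approx ::
  "('a::euclidean_space \<Rightarrow> complex) set \<Rightarrow>
   (('a \<Rightarrow> complex) \<Rightarrow> ('a \<Rightarrow> complex) \<Rightarrow> complex) \<Rightarrow>
   (nat \<Rightarrow> 'a \<Rightarrow> complex) \<Rightarrow> ('a \<Rightarrow> complex) \<Rightarrow> bool" where
  "form_approx Q q s u \<longleftrightarrow>
     (\<forall>n. s n \<in> Q) \<and>
     (\<forall>\<epsilon>>0. \<exists>M. \<forall>m\<ge>M. \<forall>n\<ge>M.
        Re (q (\<lambda>x. s m x - s n x) (\<lambda>x. s m x - s n x)) + (l2norm (\<lambda>x. s m x - s n x))\<^sup>2 < \<epsilon>) \<and>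
     (\<lambda>n. l2norm (\<lambda>x. s n x - u x)) \<longlonglongrightarrow> 0"

text \<open>The value of the closure at \<open>(u, v)\<close> is the common limit of \<open>q (s n) (t n)\<close> over all
  approximating sequences; it is meaningful for a closable form and \<open>u\<close>, \<open>v\<close> in the
  domain of its closure.\<close>

definition form_closure ::
  "('a::euclidean_space \<Rightarrow> complex) set \<Rightarrow>
   (('a \<Rightarrow> complex) \<Rightarrow> ('a \<Rightarrow> complex) \<Rightarrow> complex) \<Rightarrow>
   ('a \<Rightarrow> complex) \<Rightarrow> ('a \<Rightarrow> complex) \<Rightarrow> complex" where
  "form_closure Q q u v =
     (THE l. \<forall>s t. form_approx Q q s u \<and> form_approx Q q t v \<longrightarrow> (\<lambda>n. q (s n) (t n)) \<longlonglongrightarrow> l)"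


section \<open>The operator\<close>

definition coeff_a :: "real \<Rightarrow> 'a::euclidean_space \<Rightarrow> real" where
  "coeff_a \<alpha> x = 1 + norm x powr \<alpha>"

definition potential_V :: "real \<Rightarrow> 'a::euclidean_space \<Rightarrow> real" where
  "potential_V \<beta> x = norm x powr \<beta>"

text \<open>This form is only used on \<open>test_functions (- {0})\<close>, where all terms vanish near the
  origin, the one point at which \<open>coeff_a\<close> need not be smooth.\<close>

definition form_a ::
  "real \<Rightarrow> real \<Rightarrow> real \<Rightarrow> ('a::euclidean_space \<Rightarrow> complex) \<Rightarrow> ('a \<Rightarrow> complex) \<Rightarrow> complex" where
  "form_a \<alpha> \<beta> \<mu> u v =
     (LINT x|lborel.
        of_real ((coeff_a \<alpha> x)\<^sup>2) * laplacian u x * laplacian (\<lambda>y. cnj (v y)) x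
      + 2 * (\<Sum>b\<in>Basis. of_real (partial b (\<lambda>y. (coeff_a \<alpha> y)\<^sup>2) x) * partial b (\<lambda>y. cnj (v y)) x)
          * laplacian u x
      + of_real (laplacian (\<lambda>y. (coeff_a \<alpha> y)\<^sup>2) x) * laplacian u x * cnj (v x)
      + of_real ((potential_V \<beta> x)\<^sup>2 + \<mu>) * u x * cnj (v x))"

definition closed_form_a ::
  "real \<Rightarrow> real \<Rightarrow> real \<Rightarrow> ('a::euclidean_space \<Rightarrow> complex) \<Rightarrow> ('a \<Rightarrow> complex) \<Rightarrow> complex" where
  "closed_form_a \<alpha> \<beta> \<mu> = form_closure (test_functions (- {0})) (form_a \<alpha> \<beta> \<mu>)"

definition form_domain :: "real \<Rightarrow> real \<Rightarrow> ('a::euclidean_space \<Rightarrow> complex) set" where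
  "form_domain \<alpha> \<beta> = {u \<in> sobolev_H2.
     (\<lambda>x. of_real (1 + norm x powr \<alpha>) * weak_laplacian u x) \<in> L2 \<and>
     (\<forall>b\<in>Basis. (\<lambda>x. of_real (norm x powr (\<alpha> - 1)) * weak_partial b u x) \<in> L2) \<and>
     (\<lambda>x. of_real (norm x powr (\<alpha> - 2)) * u x) \<in> L2 \<and>
     (\<lambda>x. of_real (potential_V \<beta> x) * u x) \<in> L2}"

definition op_A ::
  "real \<Rightarrow> real \<Rightarrow> real \<Rightarrow> (('a::euclidean_space \<Rightarrow> complex) \<times> ('a \<Rightarrow> complex)) set" where
  "op_A \<alpha> \<beta> \<mu> = {(u, v). u \<in> form_domain \<alpha> \<beta> \<and> v \<in> L2 \<and>
     (\<forall>h\<in>form_domain \<alpha> \<beta>. closed_form_a \<alpha> \<beta> \<mu> u h = l2inner v h)}"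

definition neg_op ::
  "(('a \<Rightarrow> complex) \<times> ('a \<Rightarrow> complex)) set \<Rightarrow> (('a \<Rightarrow> complex) \<times> ('a \<Rightarrow> complex)) set" where
  "neg_op A = {(u, \<lambda>x. - v x) | u v. (u, v) \<in> A}"


section \<open>Semigroups on \<open>L\<^sup>2\<close>\<close>

definition C0_semigroup ::
  "(real \<Rightarrow> ('a::euclidean_space \<Rightarrow> complex) \<Rightarrow> ('a \<Rightarrow> complex)) \<Rightarrow> bool" where
  "C0_semigroup T \<longleftrightarrow>
     (\<forall>t\<ge>0. bounded_op (T t)) \<and>
     (\<forall>f\<in>L2. ae_eq (T 0 f) f) \<and>
     (\<forall>s\<ge>0. \<forall>t\<ge>0. \<forall>f\<in>L2. ae_eq (T (s + t) f) (T s (T t f))) \<and>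
     (\<forall>f\<in>L2. ((\<lambda>t. l2norm (\<lambda>x. T t f x - f x)) \<longlongrightarrow> 0) (at_right 0))"

definition generator ::
  "(real \<Rightarrow> ('a::euclidean_space \<Rightarrow> complex) \<Rightarrow> ('a \<Rightarrow> complex)) \<Rightarrow>
   (('a \<Rightarrow> complex) \<times> ('a \<Rightarrow> complex)) set" where
  "generator T = {(u, v). u \<in> L2 \<and> v \<in> L2 \<and>
     ((\<lambda>t. l2norm (\<lambda>x. (T t u x - u x) / of_real t - v x)) \<longlongrightarrow> 0) (at_right 0)}"

definition sector :: "real \<Rightarrow> complex set" where
  "sector \<delta> = {z. z \<noteq> 0 \<and> \<bar>Arg z\<bar> < \<delta>}"

text \<open>An analytic semigroup of angle \<open>\<delta>\<close>; analyticity on the open sector is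
  complex differentiability in the operator norm.\<close>

definition analytic_semigroup ::
  "real \<Rightarrow> (complex \<Rightarrow> ('a::euclidean_space \<Rightarrow> complex) \<Rightarrow> ('a \<Rightarrow> complex)) \<Rightarrow> bool" where
  "analytic_semigroup \<delta> S \<longleftrightarrow>
     0 < \<delta> \<and> \<delta> \<le> pi / 2 \<and>
     (\<forall>z\<in>insert 0 (sector \<delta>). bounded_op (S z)) \<and>
     (\<forall>f\<in>L2. ae_eq (S 0 f) f) \<and>
     (\<forall>z\<in>insert 0 (sector \<delta>). \<forall>w\<in>insert 0 (sector \<delta>). \<forall>f\<in>L2. ae_eq (S (z + w) f) (S z (S w f))) \<and>
     (\<forall>z\<in>sector \<delta>. \<exists>B. bounded_op B \<and>
        (\<forall>\<epsilon>>0. \<exists>r>0. \<forall>w\<in>sector \<delta>. cmod (w - z) < r \<longrightarrow>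
           (\<forall>f\<in>L2. l2norm (\<lambda>x. S w f x - S z f x - (w - z) * B f x) \<le> \<epsilon> * cmod (w - z) * l2norm f))) \<and>
     (\<forall>\<delta>'. 0 < \<delta>' \<and> \<delta>' < \<delta> \<longrightarrow>
        (\<forall>f\<in>L2. ((\<lambda>z. l2norm (\<lambda>x. S z f x - f x)) \<longlongrightarrow> 0) (at 0 within sector \<delta>')))"

definition generates_analytic_contraction_semigroup ::
  "(('a::euclidean_space \<Rightarrow> complex) \<times> ('a \<Rightarrow> complex)) set \<Rightarrow> bool" where
  "generates_analytic_contraction_semigroup G \<longleftrightarrow>
     (\<exists>T. C0_semigroup T \<and> generator T = G \<and>
        (\<forall>t\<ge>0. \<forall>f\<in>L2. l2norm (T t f) \<le> l2norm f) \<and>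
        (\<exists>\<delta> S. analytic_semigroup \<delta> S \<and> (\<forall>t\<ge>0. \<forall>f\<in>L2. ae_eq (S (of_real t) f) (T t f))))"

end

theory Submission
  imports Defs "HOL-Complex_Analysis.Complex_Analysis"
begin

text \<open>
 The quadratic form controls the \<open>L\<^sup>2\<close> norms of \<open>a \<Delta>u\<close>, \<open>\<bar>x\<bar>\<^bsup>\<alpha>-1\<^esup> \<nabla>u\<close>, \<open>\<bar>x\<bar>\<^bsup>\<alpha>-2\<^esup> u\<close> and \<open>V u\<close> once the
 spectral parameter is large. The lower order terms are absorbed by the pointwise interpolation
 \<open>\<bar>x\<bar>\<^bsup>\<alpha>-2\<^esup> \<le> \<epsilon> \<bar>x\<bar>\<^bsup>-2\<^esup> + \<epsilon> \<bar>x\<bar>\<^bsup>\<beta>\<^esup> + C\<close>, by Rellich's inequality (this needs \<open>N \<ge> 5\<close>) and by a weighted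
 gradient estimate obtained from integration by parts. Hence the form extends to a bounded coercive
 form on the closure of the test functions in a Hilbert space of tuples of these terms. Cutting off at
 the origin and at infinity and mollifying identifies this closure with the form domain. By the Lax-Milgram
 theorem, the associated operator \<open>A\<close> has contractive resolvents \<open>(1 + z A)\<^bsup>-1\<^esup>\<close> for \<open>z\<close> in a sector. The
 semigroup is the strong limit, locally uniform in \<open>z\<close>, of \<open>(1 + (z / m) A)\<^bsup>-m\<^esup>\<close> along \<open>m = 2\<^sup>k\<close>; it is weakly
 analytic because the approximants are, and Cauchy's estimates upgrade this to differentiability in the
 operator norm.
\<close>

section \<open>Hilbert spaces\<close>

text \<open>Two obstacles shape the proof. The closed form is given by limits along approximating
  sequences, its domain by weak derivatives. Both are transported to one closed subspace
  \<open>W\<close> of a product of \<open>L2\<close> spaces, on which the form is bounded and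
  coercive. Closability is then implicit: an element of \<open>W\<close> is determined by its first
  component, because weak derivatives and multiplications by weights are closed. The second obstacle
  is the origin. Test functions vanish near it while the weights may be singular there, so density
  holds only because the derivatives of a cutoff at radius \<open>1 / n\<close> cost
  \<open>|x|^-1\<close> and \<open>|x|^-2\<close>, which are weights that inequalities of Hardy and
  Rellich type control. Contractivity in a whole sector comes from the real part of \<open>z\<close>
  times the form; the half-angle is \<open>arctan (c / (2 M))\<close> with \<open>c\<close> the
  coercivity constant and \<open>M\<close> a bound of the form. Halving the step compares the
  resolvent of step \<open>2 h\<close> with two resolvents of step \<open>h\<close>, at a cost of
  \<open>|h|^2\<close> times the norm of \<open>A^2 f\<close>; the errors are summable on the domain
  of \<open>A^2\<close>, which is dense.\<close>

lemma riesz_closed_subspace: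
 fixes F :: "'a::{real_inner,complete_space} \<Rightarrow> real"
 assumes W: "closed W" "subspace W" and F: "bounded_linear F"
 obtains w where "w \<in> W" "\<And>x. x \<in> W \<Longrightarrow> F x = inner w x"
proof -
 interpret F: bounded_linear F by fact
 \<comment> \<open>The energy whose minimiser over \<open>W\<close> is the representing vector.
   Boundedness of \<open>F\<close> bounds it from below, so a minimising sequence exists.\<close>
 define J where "J x = inner x x - 2 * F x" for x
 obtain K where K: "\<And>x. \<bar>F x\<bar> \<le> norm x * K" using F.bounded by auto
 have "- K\<^sup>2 \<le> J x" for x
 proof -
  have "0 \<le> (norm x - K)^2" by simp
  then show ?thesis using K[of x] unfolding J_def power2_norm_eq_inner[symmetric]
   by (simp add: power2_eq_square algebra_simps)
 qed
 then have bdd: "bdd_below (J ` W)" by (auto simp: bdd_below_def)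
 have ne: "W \<noteq> {}" using W(2) subspace_0 by auto
 define m where "m = Inf (J ` W)"
 have m_le: "m \<le> J x" if "x \<in> W" for x unfolding m_def using bdd that by (simp add: cInf_lower)
 have "\<exists>x\<in>W. J x < m + e" if "e > 0" for e
  using cInf_less_iff[of "J ` W" "m + e"] ne bdd that by (auto simp: m_def)
 then have "\<forall>n. \<exists>x\<in>W. J x < m + inverse (real (Suc n))" by simp
 then obtain x where x: "\<And>n. x n \<in> W" "\<And>n. J (x n) < m + inverse (real (Suc n))" by metis
 \<comment> \<open>Parallelogram identity at the midpoint of \<open>y\<close> and \<open>z\<close>:
   almost minimal values of \<open>J\<close> force small distances, so the minimising sequence is
   Cauchy.\<close>
 have par: "(norm (y - z))^2 \<le> 2 * (J y + J z - 2 * m)" if "y \<in> W" "z \<in> W" for y z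
 proof -
  have "(1/2) *\<^sub>R (y + z) \<in> W" using W(2) that by (simp add: subspace_add subspace_scale)
  then have "m \<le> J ((1/2) *\<^sub>R (y + z))" by (rule m_le)
  then show ?thesis by (simp add: J_def power2_norm_eq_inner F.add F.scaleR inner_diff inner_add
     inner_commute[of z y] algebra_simps)
 qed
 have "Cauchy x"
 proof (rule metric_CauchyI)
  fix e :: real assume e: "e > 0"
  obtain N where N: "inverse (real (Suc N)) < e\<^sup>2 / 4" using reals_Archimedean[of "e\<^sup>2/4"] e by auto
  show "\<exists>M. \<forall>p\<ge>M. \<forall>n\<ge>M. dist (x p) (x n) < e"
  proof (intro exI allI impI)
   fix p n assume "N \<le> p" "N \<le> n"
   then have "inverse (real (Suc p)) \<le> inverse (real (Suc N))"
    "inverse (real (Suc n)) \<le> inverse (real (Suc N))" by auto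
   then have "J (x p) < m + e\<^sup>2 / 4" "J (x n) < m + e\<^sup>2 / 4"
    using order.strict_trans[OF x(2)[of p] add_strict_left_mono[OF le_less_trans[OF _ N]]]
     order.strict_trans[OF x(2)[of n] add_strict_left_mono[OF le_less_trans[OF _ N]]] by blast+
   then have "(norm (x p - x n))^2 < e\<^sup>2" using par[OF x(1)[of p] x(1)[of n]] by argo
   then show "dist (x p) (x n) < e" using e by (simp add: dist_norm power2_less_imp_less)
  qed
 qed
 then obtain w where w: "x \<longlonglongrightarrow> w" using Cauchy_convergent convergent_def by auto
 have wW: "w \<in> W" using closed_sequentially[OF W(1)] x(1) w by auto
 have "(\<lambda>n. J (x n)) \<longlonglongrightarrow> J w" unfolding J_def by (intro tendsto_intros w F.tendsto)
 moreover have "(\<lambda>n. m + inverse (real (Suc n))) \<longlonglongrightarrow> m + 0" by (intro tendsto_intros LIMSEQ_inverse_real_of_nat)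
 ultimately have "J w \<le> m"
  using LIMSEQ_le[of "\<lambda>n. J (x n)" "J w" "\<lambda>n. m + inverse (real (Suc n))" "m + 0"] x(2)
  by (force intro: less_imp_le)
 have "F y = inner w y" if y: "y \<in> W" for y
 proof -
  define d where "d = inner w y - F y"
  \<comment> \<open>Minimality of \<open>w\<close> along the line in direction \<open>y\<close>. A
    quadratic in \<open>t\<close> that is never negative and vanishes at 0 has no linear
    term.\<close>
  have *: "0 \<le> 2 * t * d + t\<^sup>2 * (norm y)^2" for t
  proof -
   have "w + t *\<^sub>R y \<in> W" using W(2) wW y by (simp add: subspace_add subspace_scale)
   then have "J w \<le> J (w + t *\<^sub>R y)" using m_le \<open>J w \<le> m\<close> by fastforce
   then show ?thesis unfolding power2_norm_eq_inner by (simp add: J_def d_def F.add F.scaleR inner_add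
     inner_commute[of y w] algebra_simps power2_eq_square)
  qed
  show ?thesis
  proof (rule ccontr)
   assume "F y \<noteq> inner w y"
   then have "d \<noteq> 0" by (auto simp: d_def)
   define s where "s = (norm y)^2 + 1"
   \<comment> \<open>Close to the minimiser of the quadratic; the summand 1 in \<open>s\<close>
     keeps the denominator positive when \<open>y\<close> is zero.\<close>
   define t where "t = - d / s"
   have pos: "s > 0" by (simp add: s_def add_nonneg_pos)
   have "t\<^sup>2 * (norm y)^2 \<le> t\<^sup>2 * s" by (simp add: s_def mult_left_mono)
   also have "\<dots> = - t * d" using pos unfolding t_def by (simp add: power2_eq_square field_simps)
   finally have "0 \<le> t * d" using *[of t] by linarith
   moreover have "t * d = - (d\<^sup>2 / s)" by (simp add: t_def power2_eq_square)
   moreover have "d\<^sup>2 / s > 0" using pos \<open>d \<noteq> 0\<close> by simp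
   ultimately show False by linarith
  qed
 qed
 then show ?thesis using that wW by blast
qed

lemma subspace_closure:
 fixes S :: "'a::real_normed_vector set"
 assumes S: "subspace S" shows "subspace (closure S)"
proof (rule subspaceI)
 show "0 \<in> closure S" using subspace_0[OF S] closure_subset by auto
 show "x + y \<in> closure S" if xy: "x \<in> closure S" "y \<in> closure S" for x y
 proof -
  obtain f g where "\<forall>n. f n \<in> S" "f \<longlonglongrightarrow> x" "\<forall>n. g n \<in> S" "g \<longlonglongrightarrow> y" using xy by (auto simp: closure_sequential)
  then have "\<forall>n. f n + g n \<in> S" "(\<lambda>n. f n + g n) \<longlonglongrightarrow> x + y"
   using subspace_add[OF S] by (auto intro: tendsto_add)
  then show ?thesis unfolding closure_sequential by (intro exI[of _ "\<lambda>n. f n + g n"] conjI)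
 qed
 show "c *\<^sub>R x \<in> closure S" if x: "x \<in> closure S" for c x
 proof -
  obtain f where "\<forall>n. f n \<in> S" "f \<longlonglongrightarrow> x" using x by (auto simp: closure_sequential)
  then have "\<forall>n. c *\<^sub>R f n \<in> S" "(\<lambda>n. c *\<^sub>R f n) \<longlonglongrightarrow> c *\<^sub>R x"
   using subspace_scale[OF S] by (auto intro: tendsto_intros)
  then show ?thesis unfolding closure_sequential by (intro exI[of _ "\<lambda>n. c *\<^sub>R f n"] conjI)
 qed
qed

text \<open>The vector \<open>w\<close> that represents \<open>inner y\<close> on the closure is the
  orthogonal projection of \<open>y\<close>. The remainder \<open>y - w\<close> annihilates
  \<open>S\<close>, so it vanishes and \<open>y\<close> lies in the closure.\<close>

lemma dense_subspaceI:
 fixes S :: "'a::{real_inner,complete_space} set"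
 assumes S: "subspace S" and orth: "\<And>g. (\<And>x. x \<in> S \<Longrightarrow> inner g x = 0) \<Longrightarrow> g = 0"
 shows "closure S = UNIV"
proof -
 have "y \<in> closure S" for y
 proof -
  obtain w where w: "w \<in> closure S" "\<And>x. x \<in> closure S \<Longrightarrow> inner y x = inner w x"
   using riesz_closed_subspace[OF closed_closure subspace_closure[OF S] bounded_linear_inner_right[of y]] by metis
  have "y - w = 0" by (rule orth) (use w(2) closure_subset in \<open>auto simp: inner_diff_left\<close>)
  then show ?thesis using w(1) by simp
 qed
 then show ?thesis by auto
qed

text \<open>The form \<open>b\<close> is not assumed symmetric, so it is no inner product to which
  Riesz's theorem could be applied. Instead \<open>b u\<close> is represented by a vector
  \<open>B u\<close> of \<open>W\<close>, and \<open>B w = f\<close> is solved as a fixed point of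
  \<open>u - r (B u - f)\<close>, a contraction by coercivity.\<close>

lemma lax_milgram:
 fixes b :: "'a::{real_inner,complete_space} \<Rightarrow> 'a \<Rightarrow> real"
 assumes W: "closed W" "subspace W" and b: "bounded_bilinear b" and F: "bounded_linear F"
  and c: "c > 0" "\<And>w. w \<in> W \<Longrightarrow> c * (norm w)^2 \<le> b w w"
 obtains w where "w \<in> W" "\<And>x. x \<in> W \<Longrightarrow> b w x = F x"
proof -
 interpret b: bounded_bilinear b by fact
 obtain M where M: "M > 0" "\<And>x y. \<bar>b x y\<bar> \<le> norm x * norm y * M" using b.pos_bounded by auto
 have "\<exists>w\<in>W. \<forall>x\<in>W. b u x = inner w x" for u
  using riesz_closed_subspace[OF W b.bounded_linear_right[of u]] by metis
 then obtain B where B: "\<And>u. B u \<in> W" "\<And>u x. x \<in> W \<Longrightarrow> b u x = inner (B u) x" by metis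
 obtain f where f: "f \<in> W" "\<And>x. x \<in> W \<Longrightarrow> F x = inner f x" using riesz_closed_subspace[OF W F] by metis
 have Bdiff: "B u - B v = B (u - v)" for u v
 proof -
  let ?d = "B u - B v - B (u - v)"
  have "?d \<in> W" using B(1) W(2) by (simp add: subspace_diff)
  then have "inner ?d ?d = 0"
   using B(2)[of ?d u] B(2)[of ?d v] B(2)[of ?d "u - v"] by (simp add: inner_diff_left b.diff_left)
  then show ?thesis by simp
 qed
 have Bn: "norm (B u) \<le> M * norm u" for u
 proof -
  have "(norm (B u))^2 = b u (B u)" using B by (simp add: power2_norm_eq_inner)
  also have "\<dots> \<le> norm u * norm (B u) * M" using M(2)[of u "B u"] by linarith
  finally have "norm (B u) * norm (B u) \<le> norm (B u) * (M * norm u)" by (simp add: power2_eq_square mult_ac)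
  then show ?thesis using M(1) by (cases "norm (B u) = 0") (simp_all only: mult_le_cancel_left_pos, auto)
 qed
 \<comment> \<open>A bound strictly larger than \<open>c\<close>, so that the contraction factor
   \<open>q\<close> below is real and smaller than 1.\<close>
 define M' where "M' = M + c"
 have M': "M' > 0" "M \<le> M'" "c < M'" using M c by (auto simp: M'_def)
 \<comment> \<open>Minimises \<open>1 - 2 r c + r^2 M'^2\<close>, the bound for the squared
   contraction factor; its minimum is \<open>1 - c^2 / M'^2\<close>.\<close>
 define r where "r = c / M'\<^sup>2"
 define q where "q = sqrt (1 - c\<^sup>2 / M'\<^sup>2)"
 have "c\<^sup>2 / M'\<^sup>2 < 1" "0 < c\<^sup>2 / M'\<^sup>2" using c M' by (auto simp: field_simps power_strict_mono)
 then have q: "0 \<le> q" "q < 1" "q\<^sup>2 = 1 - c\<^sup>2 / M'\<^sup>2" by (auto simp: q_def)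
 define G where "G u = u - r *\<^sub>R (B u - f)" for u
 have "\<exists>!x. x \<in> W \<and> G x = x"
 proof (rule Banach_fix[of W q G])
  show "complete W" using W(1) by (simp add: complete_eq_closed)
  show "W \<noteq> {}" using W(2) subspace_0 by auto
  show "G ` W \<subseteq> W" using W(2) B(1) f(1) by (auto simp: G_def subspace_diff subspace_scale)
  show "dist (G u) (G v) \<le> q * dist u v" if "u \<in> W" "v \<in> W" for u v
  proof -
   let ?w = "u - v"
   have wW: "?w \<in> W" using that W(2) by (simp add: subspace_diff)
   have "G u - G v = ?w - r *\<^sub>R B ?w" by (simp add: G_def Bdiff[symmetric] algebra_simps)
   moreover have "(norm (x - r *\<^sub>R y))^2 = (norm x)^2 - 2 * r * inner y x + r\<^sup>2 * (norm y)^2" for x y :: 'a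
    unfolding power2_norm_eq_inner
    by (simp add: inner_diff inner_commute[of x y] power2_eq_square algebra_simps)
   ultimately have "(norm (G u - G v))^2 = (norm ?w)^2 - 2 * r * b ?w ?w + r\<^sup>2 * (norm (B ?w))^2"
    using B(2)[OF wW, of ?w] by simp
   also have "\<dots> \<le> (norm ?w)^2 - 2 * r * (c * (norm ?w)^2) + r\<^sup>2 * (M' * norm ?w)^2"
   proof -
    have "r > 0" using c M' by (simp add: r_def)
    then have "2 * r * (c * (norm ?w)^2) \<le> 2 * r * b ?w ?w" using c(2)[OF wW] by (intro mult_left_mono) auto
    moreover have "norm (B ?w) \<le> M' * norm ?w"
     using Bn[of ?w] M'(2) by (meson mult_right_mono norm_ge_zero order_trans)
    then have "r\<^sup>2 * (norm (B ?w))^2 \<le> r\<^sup>2 * (M' * norm ?w)^2" by (intro mult_left_mono power_mono) auto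
    ultimately show ?thesis by linarith
   qed
   also have "\<dots> = (q * norm ?w)^2"
    unfolding power_mult_distrib q(3) using M'(1) by (simp add: r_def power2_eq_square field_simps)
   finally have "norm (G u - G v) \<le> q * norm ?w" using q(1) by (auto intro: power2_le_imp_le)
   then show ?thesis by (simp add: dist_norm)
  qed
 qed (use q in auto)
 then obtain w where w: "w \<in> W" "G w = w" by auto
 then have "B w = f" using c M' by (simp add: G_def r_def)
 then show ?thesis using that w B(2) f(2) by force
qed

section \<open>Complex structure on real Hilbert spaces\<close>

class complex_hilbert = real_inner + complete_space +
 fixes scaleC :: "complex \<Rightarrow> 'a \<Rightarrow> 'a" (infixr "*\<^sub>C" 75)
 assumes scaleC_add_right: "c *\<^sub>C (x + y) = c *\<^sub>C x + c *\<^sub>C y"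
  and scaleC_add_left: "(c + d) *\<^sub>C x = c *\<^sub>C x + d *\<^sub>C x"
  and scaleC_scaleC [simp]: "c *\<^sub>C d *\<^sub>C x = (c * d) *\<^sub>C x"
  and scaleC_of_real: "of_real r *\<^sub>C x = r *\<^sub>R x"
  and inner_scaleC_left: "inner (c *\<^sub>C x) y = inner x (cnj c *\<^sub>C y)"

context complex_hilbert
begin

lemma scaleC_one [simp]: "1 *\<^sub>C x = x" using scaleC_of_real[of 1 x] scaleR_one by simp

lemma scaleC_zero_left [simp]: "0 *\<^sub>C x = 0" using scaleC_add_left[of 0 0 x] by simp

lemma scaleC_zero_right [simp]: "c *\<^sub>C 0 = 0" using scaleC_add_right[of c 0 0] by simp

lemma scaleC_minus_right [simp]: "c *\<^sub>C (- x) = - (c *\<^sub>C x)"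
 using scaleC_add_right[of c x "- x"] by (simp add: eq_neg_iff_add_eq_0 add.commute)

lemma scaleC_minus_left [simp]: "(- c) *\<^sub>C x = - (c *\<^sub>C x)"
 using scaleC_add_left[of c "- c" x] by (simp add: eq_neg_iff_add_eq_0 add.commute)

lemma scaleC_diff_right: "c *\<^sub>C (x - y) = c *\<^sub>C x - c *\<^sub>C y" using scaleC_add_right[of c x "- y"] by simp

lemma scaleC_diff_left: "(c - d) *\<^sub>C x = c *\<^sub>C x - d *\<^sub>C x" using scaleC_add_left[of c "- d" x] by simp

end

lemma norm_scaleC [simp]: "norm (c *\<^sub>C x) = cmod c * norm (x::'a::complex_hilbert)"
proof -
 have "cnj c * c = of_real ((cmod c)^2)" by (metis complex_norm_square mult.commute)
 then have "(norm (c *\<^sub>C x))^2 = (cmod c * norm x)^2"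
  by (simp add: power2_norm_eq_inner inner_scaleC_left scaleC_of_real power_mult_distrib del: of_real_power)
 then show ?thesis by (simp add: power2_eq_iff_nonneg)
qed

lemma bounded_bilinear_scaleC: "bounded_bilinear ((*\<^sub>C) :: complex \<Rightarrow> 'a::complex_hilbert \<Rightarrow> 'a)"
proof
 show "(r *\<^sub>R c) *\<^sub>C x = r *\<^sub>R c *\<^sub>C x" "c *\<^sub>C (r *\<^sub>R x) = r *\<^sub>R c *\<^sub>C x"
  for r :: real and c and x :: 'a
  by (simp_all add: scaleC_of_real[symmetric] scaleR_conv_of_real mult.commute)
 show "\<exists>K. \<forall>c x. norm (c *\<^sub>C (x::'a)) \<le> norm c * norm x * K" by (rule exI[of _ 1]) simp
qed (simp_all add: scaleC_add_left scaleC_add_right)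

lemmas tendsto_scaleC [tendsto_intros] = bounded_bilinear.tendsto[OF bounded_bilinear_scaleC]
text \<open>The complex inner product recovered from the real one: the imaginary part of the pairing
  of \<open>x\<close> with \<open>y\<close> is the real part of the pairing of \<open>x\<close> with
  \<open>i y\<close>, by conjugate linearity in the second argument.\<close>

definition cinner :: "'a::complex_hilbert \<Rightarrow> 'a \<Rightarrow> complex" where
 "cinner x y = Complex (inner x y) (inner x (\<i> *\<^sub>C y))"

lemma cinner_add_left: "cinner (x + y) z = cinner x z + cinner y z"
 by (simp add: cinner_def inner_add_left complex_eq_iff)

lemma cinner_diff_left: "cinner (x - y) z = cinner x z - cinner y z"
 by (simp add: cinner_def inner_diff_left complex_eq_iff)

lemma cinner_zero_left [simp]: "cinner 0 z = 0" by (simp add: cinner_def complex_eq_iff)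

lemma cinner_scaleC_left: "cinner (c *\<^sub>C x) y = c * cinner x y"
proof -
 have c: "cnj c = of_real (Re c) + of_real (- Im c) * \<i>" "cnj c * \<i> = of_real (Im c) + of_real (Re c) * \<i>"
  by (auto simp: complex_eq_iff)
 show ?thesis unfolding cinner_def inner_scaleC_left scaleC_scaleC c
  unfolding scaleC_add_left scaleC_scaleC[symmetric] scaleC_of_real
  by (simp add: complex_eq_iff inner_add_right inner_minus_right algebra_simps)
qed

lemma cinner_zero_right [simp]: "cinner z 0 = 0" by (simp add: cinner_def complex_eq_iff)

lemma cinner_add_right: "cinner z (x + y) = cinner z x + cinner z y"
 by (simp add: cinner_def scaleC_add_right inner_add_right complex_eq_iff)

lemma cinner_scaleC_right: "cinner x (c *\<^sub>C y) = cnj c * cinner x y"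
proof -
 have "cinner x (c *\<^sub>C y) = cinner (cnj c *\<^sub>C x) y"
  unfolding cinner_def inner_scaleC_left by (simp add: mult.commute)
 then show ?thesis by (simp add: cinner_scaleC_left)
qed

lemma cinner_self: "Re (cinner x x) = (norm x)^2" by (simp add: cinner_def power2_norm_eq_inner)

text \<open>Multiplying \<open>x\<close> by a phase makes the pairing real and nonnegative, which
  reduces the bound to the real Cauchy-Schwarz inequality.\<close>

lemma norm_cinner_le: "cmod (cinner x y) \<le> norm x * norm y"
proof (cases "cinner x y = 0")
 case False
 define c where "c = of_real (cmod (cinner x y)) / cinner x y"
 have c: "cmod c = 1" "c * cinner x y = of_real (cmod (cinner x y))" using False by (auto simp: c_def norm_divide)
 have "cmod (cinner x y) = Re (cinner (c *\<^sub>C x) y)" by (simp add: cinner_scaleC_left c)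
 also have "\<dots> = inner (c *\<^sub>C x) y" by (simp add: cinner_def)
 also have "\<dots> \<le> norm (c *\<^sub>C x) * norm y" by (rule norm_cauchy_schwarz)
 finally show ?thesis by (simp add: c)
qed simp

lemma tendsto_cinner_left: "(f \<longlongrightarrow> l) F \<Longrightarrow> ((\<lambda>x. cinner (f x) y) \<longlongrightarrow> cinner l y) F"
 unfolding cinner_def by (simp add: tendsto_complex_iff tendsto_inner)

section \<open>Sectorial operators and analytic semigroups\<close>

text \<open>The open sector of half-angle \<open>arctan \<tau>\<close>, described without arguments,
  so that openness and stability under sums and positive multiples are read off from linear
  inequalities.\<close>

definition cone :: "real \<Rightarrow> complex set" where
 "cone \<tau> = {z. \<bar>Im z\<bar> < \<tau> * Re z}"

lemma cone_Re_pos: "0 < \<tau> \<Longrightarrow> z \<in> cone \<tau> \<Longrightarrow> 0 < Re z" by (simp add: cone_def) (smt (verit) zero_less_mult_iff)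

lemma cone_nonzero: "0 < \<tau> \<Longrightarrow> z \<in> cone \<tau> \<Longrightarrow> z \<noteq> 0" using cone_Re_pos by fastforce

lemma cone_add: "z \<in> cone \<tau> \<Longrightarrow> w \<in> cone \<tau> \<Longrightarrow> z + w \<in> cone \<tau>" by (simp add: cone_def distrib_left)

lemma cone_scaleR: "z \<in> cone \<tau> \<Longrightarrow> 0 < r \<Longrightarrow> r *\<^sub>R z \<in> cone \<tau>" by (simp add: cone_def abs_mult)

lemma of_real_in_cone: "0 < \<tau> \<Longrightarrow> 0 < r \<Longrightarrow> of_real r \<in> cone \<tau>" by (simp add: cone_def)

lemma open_cone: "open (cone \<tau>)" unfolding cone_def by (intro open_Collect_less continuous_intros)

lemma sector_eq_cone:
 assumes "0 < \<tau>" shows "sector (arctan \<tau>) = cone \<tau>"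
proof -
 have "z \<in> sector (arctan \<tau>) \<longleftrightarrow> z \<in> cone \<tau>" for z
 proof (cases "0 < Re z")
  case True
  have "\<bar>arctan x\<bar> < arctan \<tau> \<longleftrightarrow> \<bar>x\<bar> < \<tau>" for x
   by (simp only: abs_less_iff arctan_minus[symmetric] arctan_less_iff)
  then show ?thesis using True
   by (auto simp: sector_def cone_def arg_conv_arctan pos_divide_less_eq complex_eq_iff)
 next
  case False
  then have "z \<notin> cone \<tau>" using cone_Re_pos assms by blast
  moreover have "z \<notin> sector (arctan \<tau>)"
   using False Arg_Re_pos[of z] arctan_ubound[of \<tau>] by (auto simp: sector_def)
  ultimately show ?thesis by simp
 qed
 then show ?thesis by blast
qed

text \<open>Telescoping for commuting contractions: factors \<open>X\<close> are exchanged for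
  \<open>Y\<close> one at a time, and each exchange costs at most \<open>norm (X f - Y f)\<close>
  because the remaining factors do not increase norms.\<close>

lemma funpow_diff_le:
 fixes X Y :: "'a::real_normed_vector \<Rightarrow> 'a"
 assumes X: "\<And>a b. X (a - b) = X a - X b" "\<And>a. norm (X a) \<le> norm a"
  and Y: "\<And>a b. Y (a - b) = Y a - Y b" "\<And>a. norm (Y a) \<le> norm a"
  and XY: "\<And>a. X (Y a) = Y (X a)"
 shows "norm ((X ^^ n) f - (Y ^^ n) f) \<le> real n * norm (X f - Y f)"
proof (induction n arbitrary: f)
 case (Suc n)
 have Xn: "norm ((X ^^ m) a - (X ^^ m) b) \<le> norm (a - b)" for a b m
  by (induction m) (auto simp flip: X(1) intro: order_trans[OF X(2)])
 have "norm ((X ^^ Suc n) f - (Y ^^ Suc n) f)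
   \<le> norm ((X ^^ n) (X f) - (X ^^ n) (Y f)) + norm ((X ^^ n) (Y f) - (Y ^^ n) (Y f))"
  using norm_triangle_ineq[of "(X ^^ n) (X f) - (X ^^ n) (Y f)" "(X ^^ n) (Y f) - (Y ^^ n) (Y f)"]
  by (simp add: funpow_Suc_right del: funpow.simps)
 also have "\<dots> \<le> norm (X f - Y f) + n * norm (X (Y f) - Y (Y f))" by (intro add_mono Xn Suc.IH)
 also have "\<dots> \<le> norm (X f - Y f) + n * norm (X f - Y f)"
  unfolding XY Y(1)[symmetric] by (intro add_left_mono mult_left_mono Y(2)) auto
 finally show ?case by (simp add: algebra_simps)
qed simp

lemma norm_triangle3: "norm (a + b + c) \<le> norm a + norm b + norm (c :: 'a::real_normed_vector)"
 using norm_triangle_ineq[of "a + b" c] norm_triangle_ineq[of a b] by linarith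

lemma divide_mult_le: "0 \<le> e \<Longrightarrow> 0 \<le> n \<Longrightarrow> 0 < c \<Longrightarrow> e / (c * (n + 1)) * n \<le> e / (c::real)"
 using mult_left_mono[of n "n + 1" "e / (c * (n + 1))"] by simp

lemma divide_mult_less: "0 < e \<Longrightarrow> 0 \<le> n \<Longrightarrow> e / (n + 1) * n < (e::real)" by (simp add: pos_divide_less_eq)

text \<open>The operator is a graph. Accretivity of \<open>z A\<close> for every \<open>z\<close> in
  the cone, rather than for \<open>z = 1\<close> alone, makes the resolvents contractive throughout
  the sector. Surjectivity of \<open>1 + z A\<close> is also asked for every such \<open>z\<close>,
  since the Lax-Milgram lemma delivers it in this form.\<close>

locale sectorial_operator =
 fixes A :: "('h::complex_hilbert \<times> 'h) set" and \<tau> :: real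
 assumes tau_pos: "0 < \<tau>"
  and A_add: "(u, v) \<in> A \<Longrightarrow> (u', v') \<in> A \<Longrightarrow> (u + u', v + v') \<in> A"
  and A_scaleC: "(u, v) \<in> A \<Longrightarrow> (c *\<^sub>C u, c *\<^sub>C v) \<in> A"
  and A_single: "(0, v) \<in> A \<Longrightarrow> v = 0"
  and A_accretive: "(u, v) \<in> A \<Longrightarrow> z \<in> cone \<tau> \<Longrightarrow> 0 \<le> inner (z *\<^sub>C v) u"
  and A_range: "z \<in> cone \<tau> \<Longrightarrow> \<exists>u v. (u, v) \<in> A \<and> u + z *\<^sub>C v = f"
begin

abbreviation "C \<equiv> insert 0 (cone \<tau>)"

lemma A_diff: "(u, v) \<in> A \<Longrightarrow> (u', v') \<in> A \<Longrightarrow> (u - u', v - v') \<in> A"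
 using A_add[of u v "- u'" "- v'"] A_scaleC[of u' v' "-1"] by simp

lemma C_nonzero: "z \<in> cone \<tau> \<Longrightarrow> z \<noteq> 0" using cone_nonzero tau_pos by blast

lemma one_cone: "1 \<in> cone \<tau>" using of_real_in_cone[OF tau_pos, of 1] by simp

lemma div_cone: "z \<in> cone \<tau> \<Longrightarrow> z / 2 ^ k \<in> cone \<tau>"
 using cone_scaleR[of z \<tau> "1 / 2 ^ k"] by (simp add: scaleR_conv_of_real divide_inverse mult.commute)

lemma div_C: "z \<in> C \<Longrightarrow> z / 2 ^ k \<in> C" using div_cone by auto

lemma add_C: "z \<in> C \<Longrightarrow> w \<in> C \<Longrightarrow> z + w \<in> C" using cone_add[of z \<tau> w] by auto

text \<open>Pairing with \<open>u\<close>: the accretive term can only increase the inner product,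
  so Cauchy-Schwarz bounds \<open>norm u\<close> by the norm of the right-hand side.\<close>

lemma norm_le_resolvent:
 assumes "(u, v) \<in> A" "z \<in> C" shows "norm u \<le> norm (u + z *\<^sub>C v)"
proof (cases "z = 0")
 case False
 then have "0 \<le> inner (z *\<^sub>C v) u" using assms A_accretive by auto
 then have "norm u * norm u \<le> inner (u + z *\<^sub>C v) u"
  by (simp add: inner_add_left power2_norm_eq_inner[symmetric] power2_eq_square)
 also have "\<dots> \<le> norm (u + z *\<^sub>C v) * norm u" by (rule norm_cauchy_schwarz)
 finally show ?thesis by (cases "u = 0") auto
qed simp

text \<open>The resolvent \<open>(1 + z A)^-1\<close>. The identity is its value at the vertex of
  the cone, so that estimates on \<open>C\<close> include \<open>z = 0\<close>.\<close>

definition R :: "complex \<Rightarrow> 'h \<Rightarrow> 'h" where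
 "R z f = (if z = 0 then f else (THE u. \<exists>v. (u, v) \<in> A \<and> u + z *\<^sub>C v = f))"

lemma R_zero [simp]: "R 0 f = f" by (simp add: R_def)

lemma R_eqI:
 assumes "(u, v) \<in> A" "z \<in> C" "u + z *\<^sub>C v = f" shows "R z f = u"
proof (cases "z = 0")
 case False
 have uniq: "u' = u" if "(u', v') \<in> A" "u' + z *\<^sub>C v' = f" for u' v'
 proof -
  have "norm (u' - u) \<le> norm (u' - u + z *\<^sub>C (v' - v))"
   using norm_le_resolvent[OF A_diff[OF that(1) assms(1)] assms(2)] .
  also have "u' - u + z *\<^sub>C (v' - v) = 0"
   using that(2) assms(3) by (simp add: scaleC_diff_right algebra_simps)
  finally show ?thesis by simp
 qed
 have "(THE u. \<exists>v. (u, v) \<in> A \<and> u + z *\<^sub>C v = f) = u"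
 proof (rule the_equality)
  show "\<exists>v. (u, v) \<in> A \<and> u + z *\<^sub>C v = f" using assms by blast
  show "u' = u" if "\<exists>v. (u', v) \<in> A \<and> u' + z *\<^sub>C v = f" for u' using uniq that by blast
 qed
 then show ?thesis using False by (simp add: R_def)
qed (use assms in auto)

lemma R_in_A:
 assumes "z \<in> cone \<tau>" shows "(R z f, (1 / z) *\<^sub>C (f - R z f)) \<in> A"
proof -
 obtain u v where uv: "(u, v) \<in> A" "u + z *\<^sub>C v = f" using A_range[OF assms] by blast
 then have "R z f = u" using R_eqI assms by auto
 moreover have "(1 / z) *\<^sub>C (f - u) = v" using uv C_nonzero[OF assms] by auto
 ultimately show ?thesis using uv by simp
qed

text \<open>The resolvent commutes with \<open>A\<close>. For \<open>v = (f - R z f) / z\<close>,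
  subtracting the pair \<open>(R z f, v)\<close> from \<open>(f, g)\<close> and dividing by
  \<open>z\<close> exhibits \<open>v\<close> as the solution of the resolvent equation with
  right-hand side \<open>g\<close>.\<close>

lemma R_of_A:
 assumes fg: "(f, g) \<in> A" and z: "z \<in> C"
 shows "(R z f, R z g) \<in> A" "R z f + z *\<^sub>C R z g = f"
proof -
 have "(R z f, R z g) \<in> A \<and> R z f + z *\<^sub>C R z g = f"
 proof (cases "z = 0")
  case False
  then have zc: "z \<in> cone \<tau>" using z by simp
  define u where "u = R z f"
  define v where "v = (1 / z) *\<^sub>C (f - u)"
  have uv: "(u, v) \<in> A" using R_in_A[OF zc] by (simp add: u_def v_def)
  then have "((1 / z) *\<^sub>C (f - u), (1 / z) *\<^sub>C (g - v)) \<in> A" by (intro A_scaleC A_diff fg)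
  moreover have "(1 / z) *\<^sub>C (f - u) + z *\<^sub>C (1 / z) *\<^sub>C (g - v) = g" using False by (simp add: v_def)
  ultimately have "R z g = v" using R_eqI z unfolding v_def by blast
  then show ?thesis using uv False unfolding u_def v_def by simp
 qed (use fg in simp)
 then show "(R z f, R z g) \<in> A" "R z f + z *\<^sub>C R z g = f" by auto
qed

lemma ex_resolvent:
 assumes "z \<in> cone \<tau>" shows "\<exists>v. (R z f, v) \<in> A \<and> R z f + z *\<^sub>C v = f"
proof -
 have "z *\<^sub>C (1 / z) *\<^sub>C (f - R z f) = f - R z f" using C_nonzero[OF assms] by simp
 then have "R z f + z *\<^sub>C (1 / z) *\<^sub>C (f - R z f) = f" by (simp del: scaleC_scaleC)
 then show ?thesis using R_in_A[OF assms] by blast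
qed

lemma R_diff: assumes "z \<in> C" shows "R z (f - g) = R z f - R z g"
proof (cases "z = 0")
 case False
 then have z: "z \<in> cone \<tau>" using assms by simp
 obtain u where u: "(R z f, u) \<in> A" "R z f + z *\<^sub>C u = f" using ex_resolvent[OF z] by blast
 obtain v where v: "(R z g, v) \<in> A" "R z g + z *\<^sub>C v = g" using ex_resolvent[OF z] by blast
 have "R z f - R z g + z *\<^sub>C (u - v) = (R z f + z *\<^sub>C u) - (R z g + z *\<^sub>C v)" by (simp add: scaleC_diff_right)
 then show ?thesis using u v assms by (intro R_eqI[OF A_diff[OF u(1) v(1)]]) auto
qed simp

lemma R_add: assumes "z \<in> C" shows "R z (f + g) = R z f + R z g"
 using R_diff[OF assms, of "f + g" g] by (simp add: algebra_simps)

lemma R_scaleC: assumes "z \<in> C" shows "R z (c *\<^sub>C f) = c *\<^sub>C R z f"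
proof (cases "z = 0")
 case False
 then have z: "z \<in> cone \<tau>" using assms by simp
 obtain u where u: "(R z f, u) \<in> A" "R z f + z *\<^sub>C u = f" using ex_resolvent[OF z] by blast
 have "c *\<^sub>C R z f + z *\<^sub>C c *\<^sub>C u = c *\<^sub>C (R z f + z *\<^sub>C u)" by (simp add: scaleC_add_right mult.commute)
 then show ?thesis using u assms by (intro R_eqI[OF A_scaleC[OF u(1)]]) auto
qed simp

lemma R_norm: assumes "z \<in> C" shows "norm (R z f) \<le> norm f"
proof (cases "z = 0")
 case False
 then have z: "z \<in> cone \<tau>" using assms by simp
 obtain u where "(R z f, u) \<in> A" "R z f + z *\<^sub>C u = f" using ex_resolvent[OF z] by blast
 then show ?thesis using norm_le_resolvent[of "R z f" u z] assms by simp
qed simp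

lemma R_zero_right: assumes "z \<in> C" shows "R z 0 = 0" using R_norm[OF assms, of 0] by simp

lemma R_commute: assumes "z \<in> C" "w \<in> C" shows "R z (R w f) = R w (R z f)"
proof (cases "w = 0")
 case False
 then have w: "w \<in> cone \<tau>" using assms by simp
 have "(R z (R w f), (1 / w) *\<^sub>C (R z f - R z (R w f))) \<in> A"
  using R_of_A(1)[OF R_in_A[OF w, of f] assms(1)] assms(1) by (simp add: R_diff R_scaleC)
 moreover have "R z (R w f) + w *\<^sub>C (1 / w) *\<^sub>C (R z f - R z (R w f)) = R z f" using False by simp
 ultimately have "R w (R z f) = R z (R w f)" using assms(2) by (intro R_eqI)
 then show ?thesis by simp
qed simp

text \<open>From \<open>(1 + p A) (1 + q A) = 1 + (p + q) A + p q A^2\<close>: one step of length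
  \<open>p + q\<close> differs from two steps only through the quadratic term. This is the local
  error of the time discretisation.\<close>

lemma R_add_time:
 assumes f: "(f, f1) \<in> A" "(f1, f2) \<in> A" and p: "p \<in> cone \<tau>" and q: "q \<in> cone \<tau>"
 shows "norm (R (p + q) f - R p (R q f)) \<le> cmod (p * q) * norm f2"
proof -
 have pC: "p \<in> C" "q \<in> C" "p + q \<in> C" using p q add_C[of p q] by auto
 define y y1 y2 where "y = R p (R q f)" and "y1 = R p (R q f1)" and "y2 = R p (R q f2)"
 have q1: "(R q f, R q f1) \<in> A" "R q f + q *\<^sub>C R q f1 = f" using R_of_A[OF f(1) pC(2)] .
 have q2: "(R q f1, R q f2) \<in> A" "R q f1 + q *\<^sub>C R q f2 = f1" using R_of_A[OF f(2) pC(2)] .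
 have yA: "(y, y1) \<in> A" "y + p *\<^sub>C y1 = R q f" using R_of_A[OF q1(1) pC(1)] by (auto simp: y_def y1_def)
 have y1A: "y1 + p *\<^sub>C y2 = R q f1" using R_of_A[OF q2(1) pC(1)] by (auto simp: y1_def y2_def)
 have "f = (y + p *\<^sub>C y1) + q *\<^sub>C (y1 + p *\<^sub>C y2)" using q1(2) yA y1A by simp
 then have f_eq: "f = (y + (p + q) *\<^sub>C y1) + (p * q) *\<^sub>C y2"
  by (simp add: scaleC_add_left scaleC_add_right mult.commute algebra_simps)
 have "R (p + q) (y + (p + q) *\<^sub>C y1) = y" by (rule R_eqI[OF yA(1) pC(3)]) simp
 then have "R (p + q) f - y = (p * q) *\<^sub>C R (p + q) y2" by (simp add: f_eq R_add[OF pC(3)] R_scaleC[OF pC(3)])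
 then have "norm (R (p + q) f - y) \<le> cmod (p * q) * norm y2"
  using R_norm[OF pC(3), of y2] by (simp add: mult_left_mono)
 also have "\<dots> \<le> cmod (p * q) * norm f2"
  unfolding y2_def by (intro mult_left_mono order_trans[OF R_norm[OF pC(1)] R_norm[OF pC(2)]]) simp
 finally show ?thesis by (simp add: y_def)
qed

section \<open>Implicit Euler approximants with dyadic step size\<close>

definition Sk :: "nat \<Rightarrow> complex \<Rightarrow> 'h \<Rightarrow> 'h" where
 "Sk k z f = (R (z / 2 ^ k) ^^ (2 ^ k)) f"

lemma Rpow_diff: "z \<in> C \<Longrightarrow> (R z ^^ n) (f - g) = (R z ^^ n) f - (R z ^^ n) g"
 by (induction n) (simp_all add: R_diff)
lemma Rpow_scaleC: "z \<in> C \<Longrightarrow> (R z ^^ n) (c *\<^sub>C f) = c *\<^sub>C (R z ^^ n) f"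
 by (induction n) (simp_all add: R_scaleC)
lemma Rpow_norm: "z \<in> C \<Longrightarrow> norm ((R z ^^ n) f) \<le> norm f" by (induction n) (auto intro: order_trans[OF R_norm])

lemma Sk_diff: assumes "z \<in> C" shows "Sk k z (f - g) = Sk k z f - Sk k z g"
 unfolding Sk_def by (rule Rpow_diff[OF div_C[OF assms]])

lemma Sk_scaleC: assumes "z \<in> C" shows "Sk k z (c *\<^sub>C f) = c *\<^sub>C Sk k z f"
 unfolding Sk_def by (rule Rpow_scaleC[OF div_C[OF assms]])

lemma Sk_norm: assumes "z \<in> C" shows "norm (Sk k z f) \<le> norm f"
 unfolding Sk_def by (rule Rpow_norm[OF div_C[OF assms]])

text \<open>Each of the \<open>2^k\<close> long steps is compared with two steps of half the length
  \<open>h\<close>. The local errors have size \<open>|h|^2\<close>, and adding \<open>2^k\<close>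
  of them leaves a factor \<open>2^-k\<close>.\<close>

lemma Sk_Suc:
 assumes f: "(f, f1) \<in> A" "(f1, f2) \<in> A" and z: "z \<in> cone \<tau>"
 shows "norm (Sk (Suc k) z f - Sk k z f) \<le> (cmod z)^2 * norm f2 / (4 * 2 ^ k)"
proof -
 define h where "h = z / 2 ^ Suc k"
 have h: "h \<in> cone \<tau>" "h \<in> C" "z / 2 ^ k = h + h" "h + h \<in> C"
 proof -
  show "h \<in> cone \<tau>" unfolding h_def by (rule div_cone[OF z])
  then show "h \<in> C" "h + h \<in> C" using add_C[of h h] by auto
  show "z / 2 ^ k = h + h" by (simp add: h_def field_simps)
 qed
 have R2: "R h ^^ 2 = (\<lambda>f. R h (R h f))" by (auto simp: eval_nat_numeral)
 have "norm (Sk (Suc k) z f - Sk k z f) = norm ((R (h + h) ^^ 2 ^ k) f - ((R h ^^ 2) ^^ 2 ^ k) f)"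
  by (simp add: Sk_def h_def[symmetric] funpow_mult norm_minus_commute h(3) del: power_Suc)
   (simp add: norm_minus_commute)
 also have "\<dots> \<le> real (2 ^ k) * norm (R (h + h) f - (R h ^^ 2) f)"
 proof (rule funpow_diff_le)
  show "norm ((R h ^^ 2) a) \<le> norm a" for a by (rule Rpow_norm[OF h(2)])
  show "R (h + h) ((R h ^^ 2) a) = (R h ^^ 2) (R (h + h) a)" for a
   unfolding R2 using R_commute[OF h(4,2)] by simp
 qed (use h in \<open>simp_all add: R_diff Rpow_diff R_norm\<close>)
 also have "\<dots> \<le> real (2 ^ k) * (cmod (h * h) * norm f2)"
  unfolding R2 using R_add_time[OF f h(1) h(1)] by (intro mult_left_mono) auto
 also have "\<dots> = (cmod z)^2 * norm f2 / (4 * 2 ^ k)"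
  by (simp add: h_def norm_mult norm_divide norm_power power2_eq_square field_simps)
 finally show ?thesis .
qed

text \<open>The error of a single refinement is written as
  \<open>c (1 / 2^j - 1 / 2^(j + 1))\<close>, so that the sum over all refinements
  telescopes.\<close>

lemma Sk_telescope:
 assumes f: "(f, f1) \<in> A" "(f1, f2) \<in> A" and z: "z \<in> C"
 shows "norm (Sk (k + m) z f - Sk k z f) \<le> (cmod z)^2 * norm f2 / (2 * 2 ^ k)"
proof (cases "z = 0")
 case True
 have "(R 0 ^^ n) f = f" for n by (induction n) auto
 then show ?thesis using True by (simp add: Sk_def)
next
 case False
 define c where "c = (cmod z)^2 * norm f2 / 2"
 have c: "c \<ge> 0" by (simp add: c_def)
 have "norm (Sk (k + m) z f - Sk k z f) \<le> c * (1 / 2 ^ k - 1 / 2 ^ (k + m))"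
 proof (induction m)
  case (Suc m)
  have "norm (Sk (k + Suc m) z f - Sk k z f) \<le> norm (Sk (Suc (k + m)) z f - Sk (k + m) z f) + norm (Sk (k + m) z f - Sk k z f)"
   using norm_triangle_ineq[of "Sk (Suc (k + m)) z f - Sk (k + m) z f" "Sk (k + m) z f - Sk k z f"] by simp
  also have "\<dots> \<le> (cmod z)^2 * norm f2 / (4 * 2 ^ (k + m)) + c * (1 / 2 ^ k - 1 / 2 ^ (k + m))"
   using z False by (intro add_mono Sk_Suc[OF f] Suc.IH) auto
  also have "\<dots> = c * (1 / 2 ^ k - 1 / 2 ^ (k + Suc m))" by (simp add: c_def field_simps)
  finally show ?case .
 qed simp
 also have "\<dots> \<le> c * (1 / 2 ^ k)" using c by (intro mult_left_mono) auto
 finally show ?thesis by (simp add: c_def)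
qed

text \<open>A vector \<open>g\<close> orthogonal to the domain can be written as
  \<open>u + v\<close> with \<open>(u, v)\<close> in \<open>A\<close>. Pairing with \<open>u\<close>
  and using accretivity gives \<open>u = 0\<close>, hence \<open>v = 0\<close> because the operator
  is single valued.\<close>

lemma dense_domain:
 assumes "e > 0" obtains u v where "(u, v) \<in> A" "norm (f - u) < e"
proof -
 have "closure (fst ` A) = UNIV"
 proof (rule dense_subspaceI)
  have "(0, 0) \<in> A" using R_in_A[OF one_cone, of 0] R_zero_right[of 1] one_cone by simp
  moreover have "x + y \<in> fst ` A" if "x \<in> fst ` A" "y \<in> fst ` A" for x y
   using that A_add by (force simp: image_iff)
  moreover have "r *\<^sub>R x \<in> fst ` A" if "x \<in> fst ` A" for x r
   using that A_scaleC[of _ _ "of_real r"] by (force simp: image_iff scaleC_of_real)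
  ultimately show "subspace (fst ` A)" unfolding subspace_def by (metis fst_conv image_eqI)
  fix g assume orth: "\<And>x. x \<in> fst ` A \<Longrightarrow> inner g x = 0"
  obtain u v where uv: "(u, v) \<in> A" "u + v = g" using A_range[OF one_cone, of g] by auto
  then have "inner g u = 0" using orth by force
  moreover have "0 \<le> inner v u" using A_accretive[OF uv(1) one_cone] by simp
  ultimately have "inner u u \<le> 0" using uv(2) by (auto simp: inner_add_left)
  then have "u = 0" by (metis inner_ge_zero inner_eq_zero_iff order_antisym)
  then show "g = 0" using uv A_single by auto
 qed
 then have "f \<in> closure (fst ` A)" by simp
 then obtain x where "x \<in> fst ` A" "dist x f < e" using assms unfolding closure_approachable by blast
 then show ?thesis using that by (force simp: dist_norm norm_minus_commute)
qed

text \<open>The resolvent maps the domain of \<open>A\<close> into that of \<open>A^2\<close>. A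
  first approximation is \<open>u = R 1 g\<close>; replacing \<open>g\<close> by some
  \<open>g'\<close> in the domain changes it little because \<open>R 1\<close> is a
  contraction.\<close>

lemma dense_domain2:
 assumes "e > 0" obtains u u1 u2 where "(u, u1) \<in> A" "(u1, u2) \<in> A" "norm (f - u) < e"
proof -
 have e2: "e / 2 > 0" using assms by simp
 have oneC: "1 \<in> C" using one_cone by simp
 obtain u v where u: "(u, v) \<in> A" "norm (f - u) < e / 2" by (rule dense_domain[OF e2])
 define g where "g = u + v"
 have Rg: "R 1 g = u" by (rule R_eqI[OF u(1) oneC]) (simp add: g_def)
 obtain g' g1 where g': "(g', g1) \<in> A" "norm (g - g') < e / 2" by (rule dense_domain[OF e2])
 have "(R 1 g', R 1 g1) \<in> A" using R_of_A[OF g'(1) oneC] by blast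
 moreover obtain u2 where "(R 1 g1, u2) \<in> A" using ex_resolvent[OF one_cone] by blast
 moreover have "norm (u - R 1 g') \<le> norm (g - g')"
  using R_norm[OF oneC, of "g - g'"] by (simp add: R_diff[OF oneC] Rg)
 then have "norm (f - R 1 g') < e" using u(2) g'(2) norm_triangle_ineq[of "f - u" "u - R 1 g'"] by simp
 ultimately show ?thesis by (rule that)
qed

text \<open>Density of the domain of \<open>A^2\<close> and contractivity of the approximants carry
  the rate of \<open>Sk_telescope\<close> over to plain convergence for every vector. Uniformity on
  bounded parts of the sector is what later preserves holomorphy.\<close>

lemma Sk_uniform_Cauchy:
 assumes "e > 0"
 shows "\<exists>K. \<forall>z\<in>C. cmod z \<le> B \<longrightarrow> (\<forall>k\<ge>K. \<forall>l\<ge>K. norm (Sk k z f - Sk l z f) < e)"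
proof -
 obtain u u1 u2 where u: "(u, u1) \<in> A" "(u1, u2) \<in> A" "norm (f - u) < e / 4"
  by (rule dense_domain2[of "e / 4" f]) (use assms in auto)
 define c where "c = B\<^sup>2 * norm u2 / 2"
 have c: "c \<ge> 0" by (simp add: c_def)
 have "(\<lambda>k. c * (1/2) ^ k) \<longlonglongrightarrow> c * 0" by (intro tendsto_intros LIMSEQ_power_zero) auto
 then have "\<forall>\<^sub>F k in sequentially. c * (1/2) ^ k < e / 4" using assms by (intro order_tendstoD(2)) auto
 then obtain K where K: "\<And>k. k \<ge> K \<Longrightarrow> c * (1/2) ^ k < e / 4" by (auto simp: eventually_sequentially)
 show ?thesis
 proof (intro exI[of _ K] ballI impI allI)
  fix z k l assume z: "z \<in> C" "cmod z \<le> B" and kl: "K \<le> k" "K \<le> l"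
  have near: "norm (Sk k z f - Sk K z u) < e / 2" if "K \<le> k" for k
  proof -
   have "norm (Sk k z f - Sk k z u) < e / 4"
    using Sk_norm[OF z(1), of k "f - u"] u(3) by (simp add: Sk_diff[OF z(1)])
   moreover have "norm (Sk k z u - Sk K z u) < e / 4"
   proof -
    have "norm (Sk k z u - Sk K z u) \<le> (cmod z)^2 * norm u2 / (2 * 2 ^ K)"
     using Sk_telescope[OF u(1,2) z(1), of K "k - K"] that by simp
    also have "\<dots> \<le> B\<^sup>2 * norm u2 / (2 * 2 ^ K)"
     using z(2) by (intro divide_right_mono mult_right_mono power_mono) auto
    also have "\<dots> < e / 4" using K[of K] by (simp add: c_def power_one_over)
    finally show ?thesis .
   qed
   ultimately show ?thesis using norm_triangle_ineq[of "Sk k z f - Sk k z u" "Sk k z u - Sk K z u"] by simp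
  qed
  show "norm (Sk k z f - Sk l z f) < e"
   using near[OF kl(1)] near[OF kl(2)] norm_triangle_ineq4[of "Sk k z f - Sk K z u" "Sk l z f - Sk K z u"]
   by simp
 qed
qed

section \<open>The limit semigroup\<close>

definition S :: "complex \<Rightarrow> 'h \<Rightarrow> 'h" where
 "S z f = lim (\<lambda>k. Sk k z f)"

lemma Sk_tendsto: assumes "z \<in> C" shows "(\<lambda>k. Sk k z f) \<longlonglongrightarrow> S z f"
proof -
 have "Cauchy (\<lambda>k. Sk k z f)"
 proof (rule metric_CauchyI)
  fix e :: real assume "e > 0"
  from Sk_uniform_Cauchy[OF this, of "cmod z" f]
  obtain K where "\<forall>k\<ge>K. \<forall>l\<ge>K. norm (Sk k z f - Sk l z f) < e" using assms order_refl[of "cmod z"] by blast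
  then show "\<exists>K. \<forall>k\<ge>K. \<forall>l\<ge>K. dist (Sk k z f) (Sk l z f) < e" unfolding dist_norm by blast
 qed
 then show ?thesis unfolding S_def by (simp add: Cauchy_convergent_iff convergent_LIMSEQ_iff)
qed

lemma Sk_uniform:
 assumes "e > 0"
 shows "\<exists>K. \<forall>z\<in>C. cmod z \<le> B \<longrightarrow> (\<forall>k\<ge>K. norm (Sk k z f - S z f) < e)"
proof -
 obtain K where K: "\<And>z k l. z \<in> C \<Longrightarrow> cmod z \<le> B \<Longrightarrow> k \<ge> K \<Longrightarrow> l \<ge> K \<Longrightarrow> norm (Sk k z f - Sk l z f) < e/2"
  using Sk_uniform_Cauchy[of "e/2" B f] half_gt_zero[OF assms] by blast
 have "norm (Sk k z f - S z f) < e" if "z \<in> C" "cmod z \<le> B" "k \<ge> K" for z k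
 proof -
  have "norm (Sk k z f - S z f) \<le> e / 2"
  proof (rule tendsto_upperbound)
   show "(\<lambda>l. norm (Sk k z f - Sk l z f)) \<longlonglongrightarrow> norm (Sk k z f - S z f)" by (intro tendsto_intros Sk_tendsto that)
   show "\<forall>\<^sub>F l in sequentially. norm (Sk k z f - Sk l z f) \<le> e / 2"
    using K that by (auto simp: eventually_sequentially intro!: exI[of _ K] less_imp_le)
  qed simp
  then show ?thesis using assms by simp
 qed
 then show ?thesis by blast
qed

lemma S_zero_time [simp]: "S 0 f = f"
proof -
 have "R 0 = id" by (auto simp: fun_eq_iff)
 then have "Sk k 0 f = f" for k by (simp add: Sk_def)
 then show ?thesis by (simp add: S_def)
qed

lemma S_norm: assumes "z \<in> C" shows "norm (S z f) \<le> norm f"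
 by (rule tendsto_upperbound[OF tendsto_norm[OF Sk_tendsto[OF assms]]
    always_eventually[OF allI[OF Sk_norm[OF assms]]]]) simp

lemma S_diff: assumes "z \<in> C" shows "S z (f - g) = S z f - S z g"
 by (rule LIMSEQ_unique[OF Sk_tendsto[OF assms]])
  (simp add: Sk_diff[OF assms] tendsto_diff Sk_tendsto[OF assms])

lemma S_scaleC: assumes "z \<in> C" shows "S z (c *\<^sub>C f) = c *\<^sub>C S z f"
 by (rule LIMSEQ_unique[OF Sk_tendsto[OF assms]])
  (simp add: Sk_scaleC[OF assms] tendsto_scaleC Sk_tendsto[OF assms])

lemma S_add: assumes "z \<in> C" shows "S z (f + g) = S z f + S z g"
 using S_diff[OF assms, of "f + g" g] by (simp add: algebra_simps)

text \<open>The approximants obey the law only approximately: there are \<open>2^k\<close> local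
  errors of size \<open>|z w| / 4^k\<close> each. On the domain of \<open>A^2\<close> the total
  vanishes in the limit, and contractivity extends the law to all vectors.\<close>

lemma S_semigroup: assumes z: "z \<in> C" and w: "w \<in> C" shows "S (z + w) f = S z (S w f)"
proof (cases "z = 0 \<or> w = 0")
 case False
 then have zc: "z \<in> cone \<tau>" and wc: "w \<in> cone \<tau>" using z w by auto
 have zw: "z + w \<in> C" using add_C[OF z w] .
 have core: "S (z + w) u = S z (S w u)" if u: "(u, u1) \<in> A" "(u1, u2) \<in> A" for u u1 u2
 proof -
  have est: "norm (Sk k (z + w) u - Sk k z (Sk k w u)) \<le> (cmod (z * w) * norm u2) * (1/2) ^ k" for k
  proof -
   define p q where "p = z / 2 ^ k" and "q = w / 2 ^ k"
   have pq: "p \<in> cone \<tau>" "q \<in> cone \<tau>" "p \<in> C" "q \<in> C" "p + q \<in> C"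
    "(z + w) / 2 ^ k = p + q" using div_cone[OF zc, of k] div_cone[OF wc, of k] add_C[of p q]
    by (auto simp: p_def q_def add_divide_distrib)
   have comm: "(R p ^^ m) (R q a) = R q ((R p ^^ m) a)" for m a
    by (induction m) (simp_all add: R_commute[OF pq(3,4)])
   have mult: "((\<lambda>f. R p (R q f)) ^^ m) a = (R p ^^ m) ((R q ^^ m) a)" for m a
    by (induction m) (simp_all add: comm)
   have "norm (Sk k (z + w) u - Sk k z (Sk k w u))
     = norm ((R (p + q) ^^ 2 ^ k) u - ((\<lambda>f. R p (R q f)) ^^ 2 ^ k) u)"
    by (simp add: mult Sk_def pq(6) flip: p_def q_def)
   also have "\<dots> \<le> real (2 ^ k) * norm (R (p + q) u - R p (R q u))"
   proof (rule funpow_diff_le)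
    show "norm (R p (R q a)) \<le> norm a" for a by (rule order_trans[OF R_norm[OF pq(3)] R_norm[OF pq(4)]])
    show "R (p + q) (R p (R q a)) = R p (R q (R (p + q) a))" for a
     by (simp only: R_commute[OF pq(5,3)] R_commute[OF pq(5,4)])
   qed (simp_all only: R_diff[OF pq(3)] R_diff[OF pq(4)] R_diff[OF pq(5)] R_norm[OF pq(5)])
   also have "\<dots> \<le> real (2 ^ k) * (cmod (p * q) * norm u2)"
    using R_add_time[OF u pq(1,2)] by (intro mult_left_mono) auto
   also have "\<dots> = (cmod (z * w) * norm u2) * (1/2) ^ k"
    by (simp add: p_def q_def norm_mult norm_divide norm_power power_one_over field_simps)
   finally show ?thesis .
  qed
  have "(\<lambda>k. (cmod (z * w) * norm u2) * (1/2) ^ k) \<longlonglongrightarrow> (cmod (z * w) * norm u2) * 0"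
   by (intro tendsto_intros LIMSEQ_power_zero) auto
  then have "(\<lambda>k. (cmod (z * w) * norm u2) * (1/2) ^ k) \<longlonglongrightarrow> 0" by simp
  then have l1: "(\<lambda>k. Sk k (z + w) u - Sk k z (Sk k w u)) \<longlonglongrightarrow> 0"
   by (rule Lim_null_comparison[OF always_eventually[OF allI[OF est]]])
  \<comment> \<open>The inner approximant may be replaced by its limit, because the outer one is a
    contraction.\<close>
  have "(\<lambda>k. norm (Sk k w u - S w u)) \<longlonglongrightarrow> 0"
   using Sk_tendsto[OF w, of u] by (simp add: LIM_zero tendsto_norm_zero)
  then have l2: "(\<lambda>k. Sk k z (Sk k w u - S w u)) \<longlonglongrightarrow> 0"
   by (rule Lim_null_comparison[OF always_eventually[OF allI[OF Sk_norm[OF z]]]])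
  have "(\<lambda>k. (Sk k (z + w) u - Sk k z (Sk k w u)) + Sk k z (Sk k w u - S w u) + Sk k z (S w u))
    \<longlonglongrightarrow> 0 + 0 + S z (S w u)" by (intro tendsto_add l1 l2 Sk_tendsto z)
  then have "(\<lambda>k. Sk k (z + w) u) \<longlonglongrightarrow> S z (S w u)" by (simp add: Sk_diff[OF z])
  then show ?thesis using Sk_tendsto[OF zw] LIMSEQ_unique by blast
 qed
 have "norm (S (z + w) f - S z (S w f)) \<le> 2 * e" if e: "e > 0" for e
 proof -
  obtain u u1 u2 where u: "(u, u1) \<in> A" "(u1, u2) \<in> A" "norm (f - u) < e" by (rule dense_domain2[OF e])
  have "S (z + w) f - S z (S w f) = S (z + w) (f - u) - S z (S w (f - u))"
   by (simp add: S_diff[OF z] S_diff[OF w] S_diff[OF zw] core[OF u(1,2)])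
  also have "norm \<dots> \<le> norm (S (z + w) (f - u)) + norm (S z (S w (f - u)))" by (rule norm_triangle_ineq4)
  also have "\<dots> \<le> norm (f - u) + norm (f - u)"
   by (intro add_mono S_norm[OF zw] order_trans[OF S_norm[OF z] S_norm[OF w]])
  finally show ?thesis using u(3) by simp
 qed
 from this[of "norm (S (z + w) f - S z (S w f)) / 4"] show ?thesis by fastforce
qed auto

text \<open>Telescoping against the identity, with \<open>R h g - g = - h R h g1\<close>. The bound
  depends on \<open>n\<close> and \<open>h\<close> only through the elapsed time
  \<open>n |h|\<close>.\<close>

lemma Rpow_near_id:
 assumes g: "(g, g1) \<in> A" and h: "h \<in> C"
 shows "norm ((R h ^^ n) g - g) \<le> real n * cmod h * norm g1"
proof -
 have "((\<lambda>a. a) ^^ n) g = g" by (induction n) auto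
 then have "norm ((R h ^^ n) g - g) \<le> real n * norm (R h g - g)"
  using funpow_diff_le[of "R h" "\<lambda>a. a" n g] by (simp add: R_diff[OF h] R_norm[OF h])
 also have "R h g - g = - (h *\<^sub>C R h g1)" using R_of_A(2)[OF g h] by (simp add: algebra_simps)
 also have "real n * norm (- (h *\<^sub>C R h g1)) \<le> real n * (cmod h * norm g1)"
  using R_norm[OF h] by (auto intro!: mult_left_mono)
 finally show ?thesis by (simp add: mult.assoc)
qed

lemma S_near_id:
 assumes g: "(g, g1) \<in> A" and z: "z \<in> C"
 shows "norm (S z g - g) \<le> cmod z * norm g1"
proof (rule tendsto_upperbound)
 show "(\<lambda>k. norm (Sk k z g - g)) \<longlonglongrightarrow> norm (S z g - g)" by (intro tendsto_intros Sk_tendsto z)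
 have "norm (Sk k z g - g) \<le> cmod z * norm g1" for k using Rpow_near_id[OF g div_C[OF z, of k], of "2 ^ k"]
  by (simp add: Sk_def norm_divide norm_power)
 then show "\<forall>\<^sub>F k in sequentially. norm (Sk k z g - g) \<le> cmod z * norm g1" by simp
qed simp

lemma S_continuous_0: "((\<lambda>z. S z f) \<longlongrightarrow> f) (at 0 within cone \<tau>)"
proof (rule tendstoI)
 fix e :: real assume e: "e > 0"
 obtain g g1 where g: "(g, g1) \<in> A" "norm (f - g) < e / 3" by (rule dense_domain[of "e / 3" f]) (use e in auto)
 define d where "d = e / (3 * (norm g1 + 1))"
 have d: "d > 0" using e by (simp add: d_def add_nonneg_pos)
 have "dist (S z f) f < e" if z: "z \<in> cone \<tau>" "dist z 0 < d" for z
 proof -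
  have zC: "z \<in> C" using z by simp
  have "S z f - f = S z (f - g) + (S z g - g) + (g - f)" by (simp add: S_diff[OF zC])
  also have "norm \<dots> \<le> norm (S z (f - g)) + norm (S z g - g) + norm (g - f)" by (rule norm_triangle3)
  also have "\<dots> < e"
  proof -
   have "norm (S z g - g) \<le> d * norm g1"
    by (rule order_trans[OF S_near_id[OF g(1) zC]]) (use z(2) in \<open>auto intro!: mult_right_mono\<close>)
   also have "\<dots> \<le> e / 3" using e divide_mult_le[of e "norm g1" 3] by (simp add: d_def)
   finally show ?thesis using S_norm[OF zC, of "f - g"] g(2) by (simp add: norm_minus_commute)
  qed
  finally show ?thesis by (simp add: dist_norm)
 qed
 then show "\<forall>\<^sub>F z in at 0 within cone \<tau>. dist (S z f) f < e" unfolding eventually_at using d by blast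
qed

lemma tendsto_at_right_cone:
 assumes "(f \<longlongrightarrow> l) (at 0 within cone \<tau>)"
 shows "((\<lambda>t::real. f (of_real t)) \<longlongrightarrow> l) (at_right 0)"
proof (rule filterlim_compose[OF assms])
 show "filterlim of_real (at 0 within cone \<tau>) (at_right (0::real))" unfolding filterlim_at
 proof
  show "\<forall>\<^sub>F x in at_right 0. complex_of_real x \<in> cone \<tau> \<and> complex_of_real x \<noteq> 0"
   by (rule eventually_mono[OF eventually_at_right_less]) (simp add: of_real_in_cone[OF tau_pos])
  show "(complex_of_real \<longlongrightarrow> 0) (at_right 0)"
   using tendsto_of_real[OF tendsto_ident_at[of "0::real" "{0<..}"], where ?'a = complex] by simp
 qed
qed

text \<open>Iterating \<open>R h u = u - h R h v\<close> writes the deviation from \<open>u\<close>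
  as \<open>h\<close> times a sum of vectors \<open>(R h)^j v\<close>, each within \<open>M\<close>
  of \<open>v\<close>. This is a first-order expansion in the elapsed time.\<close>

lemma Rpow_expansion:
 assumes uv: "(u, v) \<in> A" and h: "h \<in> C" and M: "\<And>j. j \<le> n \<Longrightarrow> norm ((R h ^^ j) v - v) \<le> M"
 shows "norm ((R h ^^ n) u - u + (of_nat n * h) *\<^sub>C v) \<le> n * cmod h * M" using M
proof (induction n)
 case (Suc n)
 have "R h u = u - h *\<^sub>C R h v" using R_of_A(2)[OF uv h] by (simp add: algebra_simps)
 then have "(R h ^^ Suc n) u = (R h ^^ n) u - h *\<^sub>C (R h ^^ Suc n) v"
  unfolding funpow_Suc_right o_def by (simp add: Rpow_diff[OF h] Rpow_scaleC[OF h])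
 then have "(R h ^^ Suc n) u - u + (of_nat (Suc n) * h) *\<^sub>C v
   = ((R h ^^ n) u - u + (of_nat n * h) *\<^sub>C v) - h *\<^sub>C ((R h ^^ Suc n) v - v)"
  by (simp add: scaleC_diff_right distrib_right scaleC_add_left algebra_simps)
 also have "norm \<dots> \<le> norm ((R h ^^ n) u - u + (of_nat n * h) *\<^sub>C v) + norm (h *\<^sub>C ((R h ^^ Suc n) v - v))"
  by (rule norm_triangle_ineq4)
 also have "\<dots> \<le> n * cmod h * M + cmod h * M"
  using Suc.prems by (intro add_mono Suc.IH) (auto intro!: mult_left_mono simp del: funpow.simps)
 finally show ?case by (simp add: algebra_simps)
qed simp

section \<open>Identification of the generator\<close>

definition gen :: "('h \<times> 'h) set" where
 "gen = {(u, v). ((\<lambda>t. (1 / t) *\<^sub>R (S (of_real t) u - u)) \<longlongrightarrow> v) (at_right 0)}"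

lemma of_real_C: "0 \<le> t \<Longrightarrow> of_real t \<in> C" using of_real_in_cone[OF tau_pos, of t] by (cases "t = 0") auto

text \<open>The expansion of the approximants at time \<open>t\<close> has an error
  \<open>t M\<close> that does not depend on \<open>k\<close>, so it survives the limit. To make
  \<open>M\<close> small, \<open>v\<close> is compared with a nearby \<open>g\<close> in the domain,
  on which the powers of the resolvent stay close to the identity.\<close>

lemma A_imp_gen: assumes uv: "(u, v) \<in> A" shows "(u, - v) \<in> gen"
proof -
 have "((\<lambda>t. (1 / t) *\<^sub>R (S (of_real t) u - u)) \<longlongrightarrow> - v) (at_right 0)"
 proof (rule tendstoI)
  fix e :: real assume e: "e > 0"
  obtain g g1 where g: "(g, g1) \<in> A" "norm (v - g) < e / 6" by (rule dense_domain[of "e / 6" v]) (use e in auto)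
  define d where "d = e / (3 * (norm g1 + 1))"
  have d: "d > 0" using e by (simp add: d_def add_nonneg_pos)
  have "dist ((1 / t) *\<^sub>R (S (of_real t) u - u)) (- v) < e" if t: "0 < t" "t < d" for t
  proof -
   define M where "M = 2 * norm (v - g) + t * norm g1"
   have tC: "of_real t \<in> C" by (rule of_real_C[OF less_imp_le[OF t(1)]])
   have near: "norm (Sk k (of_real t) u - u + t *\<^sub>R v) \<le> t * M" for k
   proof -
    define h where "h = complex_of_real t / 2 ^ k"
    have h: "h \<in> C" "cmod h = t / 2 ^ k" "of_nat (2 ^ k) * h = of_real t"
     unfolding h_def by (rule div_C[OF tC]) (use t in \<open>simp_all add: norm_divide norm_power\<close>)
    have "norm ((R h ^^ j) v - v) \<le> M" if "j \<le> 2 ^ k" for j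
    proof -
     have "(R h ^^ j) v - v = (R h ^^ j) (v - g) + ((R h ^^ j) g - g) + (g - v)"
      by (simp add: Rpow_diff[OF h(1)])
     also have "norm \<dots> \<le> norm ((R h ^^ j) (v - g)) + norm ((R h ^^ j) g - g) + norm (g - v)"
      by (rule norm_triangle3)
     also have "\<dots> \<le> norm (v - g) + t * norm g1 + norm (v - g)"
     proof (intro add_mono)
      have "real j * cmod h \<le> 2 ^ k * cmod h"
       using that by (intro mult_right_mono) (metis of_nat_mono of_nat_numeral of_nat_power, simp)
      also have "\<dots> = t" by (simp add: h(2))
      finally have "real j * cmod h * norm g1 \<le> t * norm g1" by (intro mult_right_mono) auto
      then show "norm ((R h ^^ j) g - g) \<le> t * norm g1" using Rpow_near_id[OF g(1) h(1), of j] by linarith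
     qed (simp_all add: norm_minus_commute[of g v] Rpow_norm[OF h(1)])
     finally show ?thesis by (simp add: M_def)
    qed
    from Rpow_expansion[OF uv h(1) this, of "2 ^ k"] show ?thesis
     unfolding h(3) by (simp add: Sk_def h(2) flip: h_def scaleC_of_real)
   qed
   have "norm (S (of_real t) u - u + t *\<^sub>R v) \<le> t * M"
   proof (rule tendsto_upperbound[OF _ always_eventually[OF allI[OF near]]])
    show "(\<lambda>k. norm (Sk k (of_real t) u - u + t *\<^sub>R v)) \<longlonglongrightarrow> norm (S (of_real t) u - u + t *\<^sub>R v)"
     by (intro tendsto_intros Sk_tendsto tC)
   qed simp
   moreover have "(1 / t) *\<^sub>R (S (of_real t) u - u) - (- v) = (1 / t) *\<^sub>R (S (of_real t) u - u + t *\<^sub>R v)"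
    using t by (simp add: algebra_simps)
   ultimately have "norm ((1 / t) *\<^sub>R (S (of_real t) u - u) - (- v)) \<le> M"
    using t by (simp add: pos_divide_le_eq mult.commute[of t])
   also have "M < e"
   proof -
    have "t * norm g1 \<le> d * norm g1" using t by (intro mult_right_mono) auto
    also have "\<dots> \<le> e / 3" using e divide_mult_le[of e "norm g1" 3] by (simp add: d_def)
    finally show ?thesis using g(2) e by (simp add: M_def)
   qed
   finally show ?thesis by (simp add: dist_norm)
  qed
  then show "\<forall>\<^sub>F t in at_right 0. dist ((1 / t) *\<^sub>R (S (of_real t) u - u)) (- v) < e"
   unfolding eventually_at using d by (intro exI[of _ d]) auto
 qed
 then show ?thesis by (simp add: gen_def)
qed

text \<open>Maximality: \<open>1 + A\<close> is already surjective. Solving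
  \<open>p + q = u - v\<close> in \<open>A\<close> leaves a vector \<open>w = u - p\<close> that the
  generator maps to itself, and dissipativity of a contraction semigroup forces
  \<open>w = 0\<close>.\<close>

lemma gen_imp_A: assumes uv: "(u, v) \<in> gen" shows "(u, - v) \<in> A"
proof -
 obtain p q where pq: "(p, q) \<in> A" "p + q = u - v" using A_range[OF one_cone, of "u - v"] by auto
 define w where "w = u - p"
 have w: "w = v + q" using pq(2) by (simp add: w_def algebra_simps)
 have "((\<lambda>t. (1 / t) *\<^sub>R (S (of_real t) u - u) - (1 / t) *\<^sub>R (S (of_real t) p - p)) \<longlongrightarrow> v - - q) (at_right 0)"
  using uv A_imp_gen[OF pq(1)] by (intro tendsto_diff) (auto simp: gen_def)
 moreover have "\<forall>\<^sub>F t in at_right 0. (1 / t) *\<^sub>R (S (of_real t) u - u) - (1 / t) *\<^sub>R (S (of_real t) p - p)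
   = (1 / t) *\<^sub>R (S (of_real t) w - w)" by (rule eventually_mono[OF eventually_at_right_less])
   (simp add: w_def S_diff[OF of_real_C] algebra_simps)
 ultimately have "((\<lambda>t. (1 / t) *\<^sub>R (S (of_real t) w - w)) \<longlongrightarrow> w) (at_right 0)"
  using w by (simp add: tendsto_cong)
 then have "((\<lambda>t. inner ((1 / t) *\<^sub>R (S (of_real t) w - w)) w) \<longlongrightarrow> inner w w) (at_right 0)"
  by (intro tendsto_inner) auto
 moreover have "\<forall>\<^sub>F t in at_right 0. inner ((1 / t) *\<^sub>R (S (of_real t) w - w)) w \<le> 0"
 proof -
  have "inner ((1 / t) *\<^sub>R (S (of_real t) w - w)) w \<le> 0" if "t > 0" for t
  proof -
   have "inner (S (of_real t) w) w \<le> norm (S (of_real t) w) * norm w" by (rule norm_cauchy_schwarz)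
   also have "\<dots> \<le> norm w * norm w" using S_norm[OF of_real_C, of t w] that by (simp add: mult_right_mono)
   also have "\<dots> = inner w w" by (simp add: power2_norm_eq_inner[symmetric] power2_eq_square)
   finally show ?thesis using that by (simp add: inner_diff_left divide_le_0_iff)
  qed
  then show ?thesis by (rule eventually_mono[OF eventually_at_right_less])
 qed
 ultimately have "inner w w \<le> 0" by (rule tendsto_upperbound) simp
 then have w0: "w = 0" by (metis inner_ge_zero inner_eq_zero_iff order_antisym)
 then have "p = u" by (simp add: w_def)
 moreover have "q = - v" using minus_unique[of v q] w w0 by simp
 ultimately show ?thesis using pq(1) by simp
qed

section \<open>Holomorphic dependence on the parameter\<close>

lemma R_resolvent_eq:
 assumes z: "z \<in> cone \<tau>" and w: "w \<in> cone \<tau>"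
 shows "R w f - R z f = (z - w) *\<^sub>C R w ((1 / z) *\<^sub>C (f - R z f))"
proof -
 define p p1 where "p = R z f" and "p1 = (1 / z) *\<^sub>C (f - R z f)"
 have wC: "w \<in> C" using w by simp
 have pA: "(p, p1) \<in> A" using R_in_A[OF z] by (simp add: p_def p1_def)
 have "z *\<^sub>C p1 = f - p" using C_nonzero[OF z] by (simp add: p_def p1_def)
 then have "f = (p + w *\<^sub>C p1) + (z - w) *\<^sub>C p1" by (simp add: scaleC_diff_left)
 then have "R w f = R w ((p + w *\<^sub>C p1) + (z - w) *\<^sub>C p1)" by simp
 also have "\<dots> = R w (p + w *\<^sub>C p1) + (z - w) *\<^sub>C R w p1"
  unfolding R_add[OF wC, of "p + w *\<^sub>C p1"] R_scaleC[OF wC] ..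
 also have "R w (p + w *\<^sub>C p1) = p" by (rule R_eqI[OF pA wC]) simp
 finally show ?thesis by (simp add: p_def p1_def)
qed

lemma eventually_cone: "z \<in> cone \<tau> \<Longrightarrow> \<forall>\<^sub>F w in at z. w \<in> cone \<tau>"
 using open_cone by (rule eventually_at_in_open')

text \<open>The resolvent and its argument vary together, as they do in the difference quotients of
  powers; the resolvent identity handles the first variation and contractivity the second.\<close>

lemma R_tendsto:
 assumes z: "z \<in> cone \<tau>" and x: "(x \<longlongrightarrow> l) (at z)"
 shows "((\<lambda>w. R w (x w)) \<longlongrightarrow> R z l) (at z)"
proof -
 define p1 where "p1 = (1 / z) *\<^sub>C (l - R z l)"
 have "((\<lambda>w. norm (x w - l) + cmod (z - w) * norm p1) \<longlongrightarrow> norm (l - l) + cmod (z - z) * norm p1) (at z)"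
  by (intro tendsto_intros x)
 then have lim: "((\<lambda>w. norm (x w - l) + cmod (z - w) * norm p1) \<longlongrightarrow> 0) (at z)" by simp
 have "((\<lambda>w. R w (x w) - R z l) \<longlongrightarrow> 0) (at z)"
 proof (rule Lim_null_comparison[OF _ lim])
  have "norm (R w (x w) - R z l) \<le> norm (x w - l) + cmod (z - w) * norm p1" if w: "w \<in> cone \<tau>" for w
  proof -
   have wC: "w \<in> C" using w by simp
   have "R w (x w) - R z l = R w (x w - l) + (z - w) *\<^sub>C R w p1"
    using R_resolvent_eq[OF z w, of l] by (simp add: R_diff[OF wC] p1_def[symmetric] algebra_simps)
   also have "norm \<dots> \<le> norm (R w (x w - l)) + norm ((z - w) *\<^sub>C R w p1)" by (rule norm_triangle_ineq)
   also have "\<dots> \<le> norm (x w - l) + cmod (z - w) * norm p1"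
    using R_norm[OF wC] by (intro add_mono) (auto intro!: mult_left_mono)
   finally show ?thesis .
  qed
  then show "\<forall>\<^sub>F w in at z. norm (R w (x w) - R z l) \<le> norm (x w - l) + cmod (z - w) * norm p1"
   using eventually_cone[OF z] by (rule eventually_mono[rotated])
 qed
 then show ?thesis by (simp add: LIM_zero_iff)
qed

text \<open>Product rule by induction: the quotient for the next power is the resolvent applied to
  the previous quotient, plus the term that the resolvent identity gives for the fixed vector
  \<open>(R z)^n f\<close>.\<close>

lemma Rpow_complex_derivative:
 assumes z: "z \<in> cone \<tau>"
 shows "\<exists>D. ((\<lambda>w. inverse (w - z) *\<^sub>C ((R w ^^ n) f - (R z ^^ n) f)) \<longlongrightarrow> D) (at z)"
proof (induction n)
 case 0 then show ?case by (auto intro: exI[of _ 0])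
next
 case (Suc n)
 then obtain D where D: "((\<lambda>w. inverse (w - z) *\<^sub>C ((R w ^^ n) f - (R z ^^ n) f)) \<longlongrightarrow> D) (at z)" by blast
 define p where "p = (R z ^^ n) f"
 define p1 where "p1 = (1 / z) *\<^sub>C (p - R z p)"
 have lim: "((\<lambda>w. R w (inverse (w - z) *\<^sub>C ((R w ^^ n) f - p)) - R w p1) \<longlongrightarrow> R z D - R z p1) (at z)"
  unfolding p_def by (intro tendsto_diff R_tendsto z D tendsto_const)
 have ev: "\<forall>\<^sub>F w in at z. R w (inverse (w - z) *\<^sub>C ((R w ^^ n) f - p)) - R w p1
   = inverse (w - z) *\<^sub>C ((R w ^^ Suc n) f - (R z ^^ Suc n) f)"
 proof -
  have eq: "R w (inverse (w - z) *\<^sub>C ((R w ^^ n) f - p)) - R w p1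
   = inverse (w - z) *\<^sub>C ((R w ^^ Suc n) f - (R z ^^ Suc n) f)" if w: "w \<in> cone \<tau>" "w \<noteq> z" for w
  proof -
   have wC: "w \<in> C" using w by simp
   have "(R w ^^ Suc n) f - (R z ^^ Suc n) f = R w ((R w ^^ n) f - p) + (R w p - R z p)"
    by (simp add: R_diff[OF wC] p_def)
   also have "R w p - R z p = (z - w) *\<^sub>C R w p1" using R_resolvent_eq[OF z w(1)] by (simp add: p1_def)
   finally have "inverse (w - z) *\<^sub>C ((R w ^^ Suc n) f - (R z ^^ Suc n) f)
     = inverse (w - z) *\<^sub>C R w ((R w ^^ n) f - p) + (inverse (w - z) * (z - w)) *\<^sub>C R w p1"
    by (simp add: scaleC_add_right)
   moreover have "inverse (w - z) * (z - w) = -1" using w by (simp add: field_simps)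
   ultimately show ?thesis by (simp add: R_scaleC[OF wC])
  qed
  show ?thesis using eventually_cone[OF z] eventually_neq_at_within[of z z UNIV] by eventually_elim (rule eq)
 qed
 show ?case by (rule exI, rule Lim_transform_eventually[OF lim ev])
qed

lemma holomorphic_Sk: "(\<lambda>z. cinner (Sk k z f) g) holomorphic_on cone \<tau>"
proof -
 have "(\<lambda>z. cinner ((R z ^^ n) f) g) holomorphic_on cone \<tau>" for n unfolding holomorphic_on_open[OF open_cone]
 proof
  fix z assume z: "z \<in> cone \<tau>"
  obtain D where "((\<lambda>w. inverse (w - z) *\<^sub>C ((R w ^^ n) f - (R z ^^ n) f)) \<longlongrightarrow> D) (at z)"
   using Rpow_complex_derivative[OF z] by blast
  then have "((\<lambda>w. cinner (inverse (w - z) *\<^sub>C ((R w ^^ n) f - (R z ^^ n) f)) g) \<longlongrightarrow> cinner D g) (at z)"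
   by (rule tendsto_cinner_left)
  then have "((\<lambda>z. cinner ((R z ^^ n) f) g) has_field_derivative cinner D g) (at z)"
   by (simp add: has_field_derivative_iff cinner_scaleC_left cinner_diff_left divide_inverse mult.commute)
  then show "\<exists>f'. ((\<lambda>z. cinner ((R z ^^ n) f) g) has_field_derivative f') (at z)" ..
 qed
 note * = this
 have "(\<lambda>w. cinner ((R w ^^ 2 ^ k) f) g) \<circ> (\<lambda>z. z / 2 ^ k) holomorphic_on cone \<tau>"
  by (rule holomorphic_on_compose_gen[OF _ *]) (auto intro!: holomorphic_intros div_cone)
 then show ?thesis by (simp add: Sk_def o_def)
qed

text \<open>\<open>Sk_uniform\<close> holds uniformly on closed balls inside the cone, and locally
  uniform limits of holomorphic functions are holomorphic. Pairing with a fixed \<open>g\<close>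
  reduces this to scalar functions.\<close>

lemma holomorphic_S: "(\<lambda>z. cinner (S z f) g) holomorphic_on cone \<tau>"
proof (rule holomorphic_uniform_sequence[OF open_cone holomorphic_Sk])
 fix z assume z: "z \<in> cone \<tau>"
 obtain d where d: "d > 0" "cball z d \<subseteq> cone \<tau>" using open_cone z open_contains_cball by blast
 have "uniform_limit (cball z d) (\<lambda>k w. cinner (Sk k w f) g) (\<lambda>w. cinner (S w f) g) sequentially"
 proof (rule uniform_limitI)
  fix e :: real assume e: "e > 0"
  define e' where "e' = e / (norm g + 1)"
  have e': "e' > 0" using e by (simp add: e'_def add_nonneg_pos)
  obtain K where K: "\<And>w k. w \<in> C \<Longrightarrow> cmod w \<le> cmod z + d \<Longrightarrow> k \<ge> K \<Longrightarrow> norm (Sk k w f - S w f) < e'"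
   using Sk_uniform[OF e', of "cmod z + d" f] by blast
  have "dist (cinner (Sk k w f) g) (cinner (S w f) g) < e" if "k \<ge> K" "w \<in> cball z d" for k w
  proof -
   have "cmod w \<le> cmod z + d" using that(2) norm_triangle_ineq2[of w z] by (auto simp: dist_norm norm_minus_commute)
   then have *: "norm (Sk k w f - S w f) < e'" using K that d by auto
   have "dist (cinner (Sk k w f) g) (cinner (S w f) g) = cmod (cinner (Sk k w f - S w f) g)"
    by (simp add: dist_norm cinner_diff_left)
   also have "\<dots> \<le> norm (Sk k w f - S w f) * norm g" by (rule norm_cinner_le)
   also have "\<dots> \<le> e' * norm g" using * by (intro mult_right_mono) auto
   also have "\<dots> < e" using divide_mult_less[OF e, of "norm g"] by (simp add: e'_def)
   finally show ?thesis .
  qed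
  then show "\<forall>\<^sub>F k in sequentially. \<forall>w\<in>cball z d. dist (cinner (Sk k w f) g) (cinner (S w f) g) < e"
   unfolding eventually_sequentially by blast
 qed
 then show "\<exists>d>0. cball z d \<subseteq> cone \<tau> \<and>
   uniform_limit (cball z d) (\<lambda>k w. cinner (Sk k w f) g) (\<lambda>w. cinner (S w f) g) sequentially" using d by blast
qed

text \<open>Cauchy's estimate on discs of radius \<open>r / 4\<close> bounds the second derivative
  on \<open>ball z (r / 4)\<close> by \<open>2 M / (r / 4)^2 = 32 M / r^2\<close>; Taylor's formula
  turns this into a quadratic remainder.\<close>

lemma second_order_bound:
 assumes hol: "\<phi> holomorphic_on ball z r" and r: "r > 0" and M: "\<And>w. w \<in> ball z r \<Longrightarrow> cmod (\<phi> w) \<le> M"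
  and w: "cmod (w - z) < r / 4"
 shows "cmod (\<phi> w - \<phi> z - (w - z) * deriv \<phi> z) \<le> 32 * M / r\<^sup>2 * (cmod (w - z))^2"
proof -
 have b: "cmod ((deriv ^^ 2) \<phi> x) \<le> 32 * M / r\<^sup>2" if "x \<in> ball z (r / 4)" for x
 proof -
  have sub: "cball x (r / 4) \<subseteq> ball z r"
   using that r by (auto simp: dist_norm) (smt (verit) dist_norm dist_triangle2 dist_commute)
  then have h: "\<phi> holomorphic_on cball x (r / 4)" using hol holomorphic_on_subset by blast
  have "cmod ((deriv ^^ 2) \<phi> x) \<le> fact 2 * M / (r / 4) ^ 2"
  proof (rule Cauchy_inequality)
   show "\<phi> holomorphic_on ball x (r / 4)" using h holomorphic_on_subset ball_subset_cball by blast
   show "continuous_on (cball x (r / 4)) \<phi>" using h holomorphic_on_imp_continuous_on by blast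
   show "cmod (\<phi> y) \<le> M" if "cmod (x - y) = r / 4" for y using M sub that by (auto simp: dist_norm subset_iff)
  qed (use r in auto)
  then show ?thesis by (simp add: power_divide)
 qed
 have "cmod ((\<lambda>i. (deriv ^^ i) \<phi>) 0 w - (\<Sum>i\<le>1. (\<lambda>i. (deriv ^^ i) \<phi>) i z * (w - z) ^ i / fact i))
   \<le> 32 * M / r\<^sup>2 * cmod (w - z) ^ Suc 1 / fact 1"
 proof (rule complex_Taylor[where S = "ball z (r / 4)"])
  show "((deriv ^^ i) \<phi> has_field_derivative (deriv ^^ Suc i) \<phi> x) (at x within ball z (r / 4))"
   if "x \<in> ball z (r / 4)" for i x
  proof -
   have "(deriv ^^ i) \<phi> holomorphic_on ball z r" using hol by (rule holomorphic_higher_deriv) simp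
   then have "((deriv ^^ i) \<phi> has_field_derivative deriv ((deriv ^^ i) \<phi>) x) (at x)"
    using that r by (intro holomorphic_derivI[of _ "ball z r"]) auto
   then show ?thesis using DERIV_subset by fastforce
  qed
  show "cmod ((deriv ^^ Suc 1) \<phi> x) \<le> 32 * M / r\<^sup>2" if "x \<in> ball z (r / 4)" for x
   using b[OF that] by (simp add: numeral_2_eq_2)
 qed (use w r in \<open>auto simp: dist_norm norm_minus_commute\<close>)
 then show ?thesis by (simp add: algebra_simps power2_eq_square)
qed

text \<open>The derivatives of the scalar functions form a bounded sesquilinear expression in
  \<open>f\<close> and \<open>g\<close>, which Riesz's theorem represents by an operator
  \<open>B\<close>. The remainder bound is uniform over vectors of bounded norm, so weak
  differentiability improves to differentiability in the operator norm.\<close>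

lemma S_differentiable:
 assumes z: "z \<in> cone \<tau>"
 obtains B c r where "r > 0" "c \<ge> 0" "\<And>f g. B (f + g) = B f + B g" "\<And>a f. B (a *\<^sub>C f) = a *\<^sub>C B f"
  "\<And>f. norm (B f) \<le> c * norm f"
  "\<And>w f. cmod (w - z) < r \<Longrightarrow> w \<in> cone \<tau> \<and> norm (S w f - S z f - (w - z) *\<^sub>C B f) \<le> c * (cmod (w - z))^2 * norm f"
proof -
 obtain r where r: "r > 0" "ball z r \<subseteq> cone \<tau>" using open_cone z open_contains_ball by blast
 define D where "D f g = deriv (\<lambda>w. cinner (S w f) g) z" for f g
 note hol = holomorphic_on_subset[OF holomorphic_S r(2)]
 have d: "(\<lambda>w. cinner (S w f) g) field_differentiable at z" for f g
  by (rule holomorphic_on_imp_differentiable_at[OF holomorphic_S open_cone z])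
 have bd: "cmod (cinner (S w f) g) \<le> norm f * norm g" if "w \<in> ball z r" for w f g
  using norm_cinner_le[of "S w f" g] S_norm[of w f] that r
  by (meson insertCI mult_right_mono norm_ge_zero order_trans subsetD)
 have near: "\<forall>\<^sub>F w in nhds z. w \<in> cone \<tau>" by (rule eventually_nhds_in_open[OF open_cone z])
 have "D f (g + h) = D f g + D f h" "D f (a *\<^sub>C g) = cnj a * D f g" for f g h a
  unfolding D_def cinner_add_right cinner_scaleC_right using d by (simp_all add: deriv_add)
 note D_right = this
 have D_left: "D (f + g) h = D f h + D g h" "D (a *\<^sub>C f) g = a * D f g" for f g h a
 proof -
  have "D (f + g) h = deriv (\<lambda>w. cinner (S w f) h + cinner (S w g) h) z"
   unfolding D_def by (intro deriv_cong_ev eventually_mono[OF near] refl) (simp add: S_add cinner_add_left)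
  then show "D (f + g) h = D f h + D g h" using d by (simp add: D_def deriv_add)
  have "D (a *\<^sub>C f) g = deriv (\<lambda>w. a * cinner (S w f) g) z"
   unfolding D_def by (intro deriv_cong_ev eventually_mono[OF near] refl) (simp add: S_scaleC cinner_scaleC_left)
  then show "D (a *\<^sub>C f) g = a * D f g" using d by (simp add: D_def)
 qed
 have D_norm: "cmod (D f g) \<le> 2 / r * norm f * norm g" for f g
 proof -
  have s: "cball z (r / 2) \<subseteq> ball z r" using r(1) by (simp add: subset_iff)
  have h: "(\<lambda>w. cinner (S w f) g) holomorphic_on cball z (r / 2)" by (rule holomorphic_on_subset[OF hol s])
  have "cmod ((deriv ^^ 1) (\<lambda>w. cinner (S w f) g) z) \<le> fact 1 * (norm f * norm g) / (r / 2) ^ 1"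
  proof (rule Cauchy_inequality)
   show "cmod (cinner (S w f) g) \<le> norm f * norm g" if "cmod (z - w) = r / 2" for w
    using that r(1) by (intro bd) (simp add: dist_norm)
  qed (use r(1) h holomorphic_on_imp_continuous_on holomorphic_on_subset[OF h ball_subset_cball] in auto)
  then show ?thesis by (simp add: D_def field_simps)
 qed
 have "\<exists>b. \<forall>g. Re (D f g) = inner b g" for f
 proof -
  have "D f (t *\<^sub>R g) = t *\<^sub>R D f g" for t g
   using D_right(2)[of f "of_real t" g] by (simp add: scaleC_of_real scaleR_conv_of_real)
  then have "bounded_linear (\<lambda>g. Re (D f g))" using order_trans[OF abs_Re_le_cmod D_norm[of f]]
   by (intro bounded_linear_intro[of _ "2 / r * norm f"]) (simp_all add: D_right mult_ac)
  then show ?thesis using riesz_closed_subspace[OF closed_UNIV subspace_UNIV] by (metis UNIV_I)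
 qed
 then obtain B where B: "\<And>f g. Re (D f g) = inner (B f) g" by metis
 have BD: "cinner (B f) g = D f g" for f g
  using B[of f "\<i> *\<^sub>C g"] by (simp add: cinner_def complex_eq_iff B D_right)
 have Beq: "x = y" if "\<And>g. cinner x g = cinner y g" for x y
  using cinner_self[of "x - y"] that[of "x - y"] by (simp add: cinner_diff_left)
 \<comment> \<open>A single constant that dominates both the operator bound \<open>2 / r\<close> and
   the remainder constant \<open>32 / r^2\<close>.\<close>
 define c where "c = 32 / r\<^sup>2 + 2 / r"
 have c: "32 / r\<^sup>2 \<le> c" "2 / r \<le> c" "0 \<le> c" using r(1) by (simp_all add: c_def)
 show ?thesis
 proof (rule that[of "r / 4" c B])
  show "B (f + g) = B f + B g" "B (a *\<^sub>C f) = a *\<^sub>C B f" for f g a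
   by (rule Beq; simp add: BD D_left cinner_add_left cinner_scaleC_left)+
  show "norm (B f) \<le> c * norm f" for f
  proof -
   have "norm (B f) * norm (B f) \<le> cmod (D f (B f))"
    using complex_Re_le_cmod[of "cinner (B f) (B f)"] unfolding cinner_self by (simp add: BD power2_eq_square)
   also have "\<dots> \<le> (2 / r * norm f) * norm (B f)" by (rule D_norm)
   finally have "norm (B f) \<le> 2 / r * norm f"
    using r(1) by (cases "B f = 0") (simp, metis mult_right_le_imp_le zero_less_norm_iff)
   also have "\<dots> \<le> c * norm f" by (intro mult_right_mono c) simp
   finally show ?thesis .
  qed
  fix w f assume w: "cmod (w - z) < r / 4"
  \<comment> \<open>The weak remainder estimate is tested against the remainder itself, which gives
    its norm after cancelling one factor.\<close>
  define v where "v = S w f - S z f - (w - z) *\<^sub>C B f"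
  have "norm v * norm v \<le> cmod (cinner (S w f) v - cinner (S z f) v - (w - z) * D f v)"
   using complex_Re_le_cmod[of "cinner v v"] unfolding cinner_self
   by (subst (asm) (2) v_def) (simp add: cinner_diff_left cinner_scaleC_left BD power2_eq_square)
  also have "\<dots> \<le> 32 * (norm f * norm v) / r\<^sup>2 * (cmod (w - z))^2"
   unfolding D_def by (rule second_order_bound[OF hol r(1) bd w])
  also have "\<dots> = (32 / r\<^sup>2 * (cmod (w - z))^2 * norm f) * norm v" by simp
  finally have "norm v \<le> 32 / r\<^sup>2 * (cmod (w - z))^2 * norm f"
   by (cases "v = 0") (simp, metis mult_right_le_imp_le zero_less_norm_iff)
  also have "\<dots> \<le> c * (cmod (w - z))^2 * norm f" by (intro mult_right_mono c) simp_all
  finally show "w \<in> cone \<tau> \<and> norm (S w f - S z f - (w - z) *\<^sub>C B f) \<le> c * (cmod (w - z))^2 * norm f"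
   using r w unfolding v_def by (auto simp: dist_norm norm_minus_commute)
 qed (use r c in auto)
qed

end

section \<open>The space of square integrable functions\<close>

lemma borel_measurable_cnj [measurable (raw)]:
 "f \<in> borel_measurable M \<Longrightarrow> (\<lambda>x. cnj (f x)) \<in> borel_measurable M"
 by (erule measurable_compose) (intro borel_measurable_continuous_onI continuous_intros)

lemma L2_measurable [measurable_dest]: "f \<in> L2 \<Longrightarrow> f \<in> borel_measurable borel" by (simp add: L2_def)

lemma L2_integrable: "f \<in> L2 \<Longrightarrow> integrable lborel (\<lambda>x. (cmod (f x))^2)" by (simp add: L2_def)

lemma L2_nn_integral:
 assumes "f \<in> L2" shows "(\<integral>\<^sup>+x. ennreal ((cmod (f x))^2) \<partial>lborel) = ennreal ((l2norm f)^2)"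
 using nn_integral_eq_integral[OF L2_integrable[OF assms]] by (simp add: l2norm_def)

lemma L2_nn_integralI:
 assumes [measurable]: "f \<in> borel_measurable borel"
  and le: "(\<integral>\<^sup>+x. ennreal ((cmod (f x))^2) \<partial>lborel) \<le> ennreal c" and c: "0 \<le> c"
 shows "f \<in> L2" "(l2norm f)^2 \<le> c"
proof -
 have "integrable lborel (\<lambda>x. (cmod (f x))^2)"
  using le by (intro integrableI_nonneg) (auto simp: ennreal_less_top intro: le_less_trans)
 then show *: "f \<in> L2" by (simp add: L2_def)
 show "(l2norm f)^2 \<le> c" using le c L2_nn_integral[OF *] by (simp add: ennreal_le_iff)
qed

lemma L2_bound:
 assumes g: "g \<in> L2" and [measurable]: "f \<in> borel_measurable borel"
  and le: "AE x in lborel. cmod (f x) \<le> c * cmod (g x)"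
 shows "f \<in> L2" "(l2norm f)^2 \<le> c\<^sup>2 * (l2norm g)^2"
proof -
 have "AE x in lborel. ennreal ((cmod (f x))^2) \<le> ennreal (c\<^sup>2) * ennreal ((cmod (g x))^2)" using le
 proof eventually_elim
  case (elim x)
  then have "(cmod (f x))^2 \<le> (c * cmod (g x))^2" by (intro power_mono) auto
  then show ?case by (simp add: power_mult_distrib ennreal_mult[symmetric] ennreal_leI)
 qed
 then have "(\<integral>\<^sup>+x. ennreal ((cmod (f x))^2) \<partial>lborel) \<le> (\<integral>\<^sup>+x. ennreal (c\<^sup>2) * ennreal ((cmod (g x))^2) \<partial>lborel)"
  by (rule nn_integral_mono_AE)
 also have "\<dots> = ennreal (c\<^sup>2) * ennreal ((l2norm g)^2)"
  using g by (simp add: nn_integral_cmult L2_nn_integral L2_measurable)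
 finally have "(\<integral>\<^sup>+x. ennreal ((cmod (f x))^2) \<partial>lborel) \<le> ennreal (c\<^sup>2 * (l2norm g)^2)"
  by (simp add: ennreal_mult)
 then show "f \<in> L2" "(l2norm f)^2 \<le> c\<^sup>2 * (l2norm g)^2" using L2_nn_integralI[of f] by auto
qed

lemma L2_cong_AE:
 assumes "g \<in> L2" "f \<in> borel_measurable borel" "AE x in lborel. f x = g x" shows "f \<in> L2"
 by (rule L2_bound(1)[OF assms(1,2), of 1]) (use assms(3) in auto)

lemma L2_zero [simp]: "(\<lambda>x. 0) \<in> L2" by (simp add: L2_def)

lemma L2_cmult [simp]: "f \<in> L2 \<Longrightarrow> (\<lambda>x. c * f x) \<in> L2"
 by (rule L2_bound(1)[of f _ "cmod c"]) (auto simp: norm_mult L2_measurable)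

lemma L2_uminus [simp]: "f \<in> L2 \<Longrightarrow> (\<lambda>x. - f x) \<in> L2" using L2_cmult[of f "-1"] by simp

lemma L2_cnj [simp]: "f \<in> L2 \<Longrightarrow> (\<lambda>x. cnj (f x)) \<in> L2"
 by (rule L2_bound(1)[of f _ 1]) (auto simp: L2_measurable)

lemma L2_add [simp]: assumes f: "f \<in> L2" and g: "g \<in> L2" shows "(\<lambda>x. f x + g x) \<in> L2"
proof -
 note [measurable] = L2_measurable[OF f] L2_measurable[OF g]
 have "integrable lborel (\<lambda>x. (cmod (f x + g x))^2)"
 proof (rule Bochner_Integration.integrable_bound)
  show "integrable lborel (\<lambda>x. 2 * (cmod (f x))^2 + 2 * (cmod (g x))^2)"
   using f g by (simp add: L2_integrable)
  show "AE x in lborel. norm ((cmod (f x + g x))^2) \<le> norm (2 * (cmod (f x))^2 + 2 * (cmod (g x))^2)"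
  proof (rule AE_I2)
   fix x
   have "(cmod (f x + g x))^2 \<le> (cmod (f x) + cmod (g x))^2" by (intro power_mono norm_triangle_ineq) auto
   also have "\<dots> \<le> 2 * (cmod (f x))^2 + 2 * (cmod (g x))^2" using sum_squares_bound[of "cmod (f x)" "cmod (g x)"]
    by (simp add: power2_sum)
   finally show "norm ((cmod (f x + g x))^2) \<le> norm (2 * (cmod (f x))^2 + 2 * (cmod (g x))^2)" by simp
  qed
 qed measurable
 then show ?thesis by (simp add: L2_def)
qed

lemma L2_diff [simp]: "f \<in> L2 \<Longrightarrow> g \<in> L2 \<Longrightarrow> (\<lambda>x. f x - g x) \<in> L2" using L2_add[of f "\<lambda>x. - g x"] by simp

lemma L2_sum [simp]: "(\<And>i. i \<in> I \<Longrightarrow> f i \<in> L2) \<Longrightarrow> (\<lambda>x. \<Sum>i\<in>I. f i x) \<in> L2"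
 by (induction I rule: infinite_finite_induct) auto

lemma L2_mult_integrable:
 assumes f: "f \<in> L2" and g: "g \<in> L2" shows "integrable lborel (\<lambda>x. f x * g x)"
proof (rule Bochner_Integration.integrable_bound)
 note [measurable] = L2_measurable[OF f] L2_measurable[OF g]
 show "integrable lborel (\<lambda>x. (cmod (f x))^2 + (cmod (g x))^2)" using f g by (simp add: L2_integrable)
 show "(\<lambda>x. f x * g x) \<in> borel_measurable lborel" by measurable
 show "AE x in lborel. norm (f x * g x) \<le> norm ((cmod (f x))^2 + (cmod (g x))^2)"
 proof (rule AE_I2)
  fix x
  have "2 * cmod (f x) * cmod (g x) \<le> (cmod (f x))^2 + (cmod (g x))^2" by (rule sum_squares_bound)
  moreover have "0 \<le> cmod (f x) * cmod (g x)" by simp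
  ultimately have "cmod (f x) * cmod (g x) \<le> (cmod (f x))^2 + (cmod (g x))^2" by linarith
  then show "norm (f x * g x) \<le> norm ((cmod (f x))^2 + (cmod (g x))^2)" by (simp add: norm_mult)
 qed
qed

lemma l2inner_integrable: "f \<in> L2 \<Longrightarrow> g \<in> L2 \<Longrightarrow> integrable lborel (\<lambda>x. f x * cnj (g x))"
 by (intro L2_mult_integrable L2_cnj)

section \<open>The Hilbert space of classes modulo equality almost everywhere\<close>

definition l2rel :: "('a::euclidean_space \<Rightarrow> complex) \<Rightarrow> ('a \<Rightarrow> complex) \<Rightarrow> bool" where
 "l2rel f g \<longleftrightarrow> f \<in> L2 \<and> g \<in> L2 \<and> ae_eq f g"

\<comment> \<open>The relation is reflexive exactly on \<open>L2\<close>, hence a partial quotient.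
  A type is wanted because the Hilbert space results above are stated for type classes.\<close>
quotient_type (overloaded) 'a l2 = "'a::euclidean_space \<Rightarrow> complex" / partial: l2rel
proof (rule part_equivpI)
 show "\<exists>x. l2rel x x" by (auto simp: l2rel_def ae_eq_def intro!: exI[of _ "\<lambda>x. 0"])
 show "symp l2rel" by (auto simp: symp_def l2rel_def ae_eq_def)
 show "transp l2rel" by (auto simp: transp_def l2rel_def ae_eq_def)
qed

lemma l2inner_cong:
 assumes "l2rel f f'" "l2rel g g'" shows "l2inner f g = l2inner f' g'"
proof -
 note [measurable] = assms[unfolded l2rel_def, THEN conjunct1, THEN L2_measurable]
  assms[unfolded l2rel_def, THEN conjunct2, THEN conjunct1, THEN L2_measurable]
 have "AE x in lborel. f x * cnj (g x) = f' x * cnj (g' x)" using assms by (auto simp: l2rel_def ae_eq_def)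
 then show ?thesis unfolding l2inner_def by (intro integral_cong_AE) measurable
qed

instantiation l2 :: (euclidean_space) real_inner
begin

lift_definition zero_l2 :: "'a l2" is "\<lambda>x. 0" by (auto simp: l2rel_def ae_eq_def)
lift_definition plus_l2 :: "'a l2 \<Rightarrow> 'a l2 \<Rightarrow> 'a l2" is "\<lambda>f g x. f x + g x" by (auto simp: l2rel_def ae_eq_def)
lift_definition minus_l2 :: "'a l2 \<Rightarrow> 'a l2 \<Rightarrow> 'a l2" is "\<lambda>f g x. f x - g x" by (auto simp: l2rel_def ae_eq_def)
lift_definition uminus_l2 :: "'a l2 \<Rightarrow> 'a l2" is "\<lambda>f x. - f x" by (auto simp: l2rel_def ae_eq_def)
lift_definition scaleR_l2 :: "real \<Rightarrow> 'a l2 \<Rightarrow> 'a l2" is "\<lambda>r f x. of_real r * f x"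
 by (auto simp: l2rel_def ae_eq_def)
lift_definition inner_l2 :: "'a l2 \<Rightarrow> 'a l2 \<Rightarrow> real" is "\<lambda>f g. Re (l2inner f g)" using l2inner_cong by metis

definition "norm_l2 (x::'a l2) = sqrt (inner x x)"
definition "sgn_l2 (x::'a l2) = scaleR (inverse (norm x)) x"
definition "dist_l2 (x::'a l2) y = norm (x - y)"
definition "uniformity_l2 = (INF e\<in>{0<..}. principal {(x::'a l2, y). dist x y < e})"
definition "open_l2 (U::'a l2 set) = (\<forall>x\<in>U. \<forall>\<^sub>F (x', y) in uniformity. x' = x \<longrightarrow> y \<in> U)"

instance
proof
 fix x y z :: "'a l2" and r s :: real
 show "x + y + z = x + (y + z)" by transfer (auto simp: l2rel_def ae_eq_def algebra_simps)
 show "x + y = y + x" by transfer (auto simp: l2rel_def ae_eq_def algebra_simps)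
 show "0 + x = x" by transfer (auto simp: l2rel_def ae_eq_def)
 show "- x + x = 0" by transfer (auto simp: l2rel_def ae_eq_def)
 show "x - y = x + - y" by transfer (auto simp: l2rel_def ae_eq_def)
 show "r *\<^sub>R (x + y) = r *\<^sub>R x + r *\<^sub>R y" by transfer (auto simp: l2rel_def ae_eq_def distrib_left)
 show "(r + s) *\<^sub>R x = r *\<^sub>R x + s *\<^sub>R x" by transfer (auto simp: l2rel_def ae_eq_def distrib_right)
 show "r *\<^sub>R s *\<^sub>R x = (r * s) *\<^sub>R x" by transfer (auto simp: l2rel_def ae_eq_def mult.assoc)
 show "1 *\<^sub>R x = x" by transfer (auto simp: l2rel_def ae_eq_def)
 show "sgn x = scaleR (inverse (norm x)) x" by (simp add: sgn_l2_def)
 show "dist x y = norm (x - y)" by (simp add: dist_l2_def)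
 show "uniformity = (INF e\<in>{0<..}. principal {(x::'a l2, y). dist x y < e})" by (simp add: uniformity_l2_def)
 show "open U = (\<forall>x\<in>U. \<forall>\<^sub>F (x', y) in uniformity. x' = x \<longrightarrow> y \<in> U)" for U :: "'a l2 set"
  by (simp add: open_l2_def)
 show "inner x y = inner y x"
 proof transfer
  fix f g :: "'a \<Rightarrow> complex"
  have "l2inner g f = cnj (l2inner f g)"
   unfolding l2inner_def by (subst Bochner_Integration.integral_cnj[symmetric]) (simp add: mult.commute)
  then show "Re (l2inner f g) = Re (l2inner g f)" by simp
 qed
 show "inner (x + y) z = inner x z + inner y z"
  by transfer (simp add: l2rel_def l2inner_def distrib_right l2inner_integrable)
 show "inner (r *\<^sub>R x) y = r * inner x y" by transfer (simp add: l2rel_def l2inner_def mult.assoc)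
 have sq: "Re (l2inner f f) = (LINT x|lborel. (cmod (f x))^2)" for f :: "'a \<Rightarrow> complex"
  by (simp add: l2inner_def complex_norm_square[symmetric] del: of_real_power)
 show "0 \<le> inner x x" by transfer (simp add: sq)
 show "inner x x = 0 \<longleftrightarrow> x = 0"
 proof transfer
  fix f :: "'a \<Rightarrow> complex" assume f: "l2rel f f"
  then have "(LINT x|lborel. (cmod (f x))^2) = 0 \<longleftrightarrow> (AE x in lborel. (cmod (f x))^2 = 0)"
   by (intro integral_nonneg_eq_0_iff_AE) (auto simp: l2rel_def L2_integrable)
  then show "Re (l2inner f f) = 0 \<longleftrightarrow> l2rel f (\<lambda>x. 0)" unfolding sq using f by (simp add: l2rel_def ae_eq_def)
 qed
 show "norm x = sqrt (inner x x)" by (simp add: norm_l2_def)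
qed

end

abbreviation l2of :: "('a::euclidean_space \<Rightarrow> complex) \<Rightarrow> 'a l2" where
 "l2of \<equiv> abs_l2"

lemma rep_l2_L2 [simp]: "rep_l2 x \<in> L2"
 using Quotient3_rep_reflp[OF Quotient3_l2, of x] by (simp add: l2rel_def)

lemma l2of_rep [simp]: "l2of (rep_l2 x) = x" using Quotient3_abs_rep[OF Quotient3_l2] .

lemma l2of_eq_iff: "f \<in> L2 \<Longrightarrow> g \<in> L2 \<Longrightarrow> l2of f = l2of g \<longleftrightarrow> ae_eq f g"
 using Quotient3_rel[OF Quotient3_l2, of f g] by (auto simp: l2rel_def ae_eq_def)

lemma rep_l2of: "f \<in> L2 \<Longrightarrow> ae_eq (rep_l2 (l2of f)) f" by (subst l2of_eq_iff[symmetric]) auto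

lemma l2of_zero: "l2of (\<lambda>x. 0) = 0" by (simp add: zero_l2_def)

lemma l2of_add: "f \<in> L2 \<Longrightarrow> g \<in> L2 \<Longrightarrow> l2of (\<lambda>x. f x + g x) = l2of f + l2of g"
 by (rule plus_l2.abs_eq[symmetric]) (auto simp: l2rel_def ae_eq_def)

lemma l2of_diff: "f \<in> L2 \<Longrightarrow> g \<in> L2 \<Longrightarrow> l2of (\<lambda>x. f x - g x) = l2of f - l2of g"
 by (rule minus_l2.abs_eq[symmetric]) (auto simp: l2rel_def ae_eq_def)

lemma inner_l2of: "f \<in> L2 \<Longrightarrow> g \<in> L2 \<Longrightarrow> inner (l2of f) (l2of g) = Re (l2inner f g)"
 by (rule inner_l2.abs_eq) (auto simp: l2rel_def ae_eq_def)

lemma norm_l2of: "f \<in> L2 \<Longrightarrow> norm (l2of f) = l2norm f"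
 by (simp add: norm_l2_def inner_l2of l2norm_def l2inner_def complex_norm_square[symmetric] del: of_real_power)

lemma dist_l2of: "f \<in> L2 \<Longrightarrow> g \<in> L2 \<Longrightarrow> dist (l2of f) (l2of g) = l2norm (\<lambda>x. f x - g x)"
 by (simp add: dist_norm l2of_diff[symmetric] norm_l2of)

text \<open>Fatou's lemma carries a uniform norm bound to an almost everywhere limit and yields its
  square integrability at the same time. It serves both completeness and the removal of the
  regularisation in Rellich's inequality.\<close>

lemma L2_fatou:
 assumes f: "\<And>n. f n \<in> L2" "\<And>n. (l2norm (f n))^2 \<le> c" and [measurable]: "g \<in> borel_measurable borel"
  and lim: "AE x in lborel. (\<lambda>n. f n x) \<longlonglongrightarrow> g x"
 shows "g \<in> L2" "(l2norm g)^2 \<le> c"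
proof -
 note [measurable] = L2_measurable[OF f(1)]
 have c: "0 \<le> c" using f(2)[of 0] by (smt (verit) zero_le_power2)
 have "(\<integral>\<^sup>+x. ennreal ((cmod (g x))^2) \<partial>lborel) = (\<integral>\<^sup>+x. liminf (\<lambda>n. ennreal ((cmod (f n x))^2)) \<partial>lborel)"
 proof (rule nn_integral_cong_AE)
  show "AE x in lborel. ennreal ((cmod (g x))^2) = liminf (\<lambda>n. ennreal ((cmod (f n x))^2))" using lim
  proof eventually_elim
   case (elim x)
   then have "(\<lambda>n. ennreal ((cmod (f n x))^2)) \<longlonglongrightarrow> ennreal ((cmod (g x))^2)"
    by (intro tendsto_ennrealI tendsto_power tendsto_norm)
   then show ?case by (rule lim_imp_Liminf[OF sequentially_bot, symmetric])
  qed
 qed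
 also have "\<dots> \<le> liminf (\<lambda>n. \<integral>\<^sup>+x. ennreal ((cmod (f n x))^2) \<partial>lborel)"
  by (intro nn_integral_liminf) measurable
 also have "\<dots> \<le> limsup (\<lambda>n. \<integral>\<^sup>+x. ennreal ((cmod (f n x))^2) \<partial>lborel)" by (rule Liminf_le_Limsup) simp
 also have "\<dots> \<le> ennreal c" by (rule Limsup_bounded) (simp add: L2_nn_integral f ennreal_leI)
 finally show "g \<in> L2" "(l2norm g)^2 \<le> c" using L2_nn_integralI[of g c] c by auto
qed

text \<open>Riesz-Fischer: a rapidly converging subsequence converges almost everywhere, Fatou's
  lemma bounds its distance to the pointwise limit, and a Cauchy sequence with a convergent
  subsequence converges.\<close>

instance l2 :: (euclidean_space) complete_space
proof
 fix X :: "nat \<Rightarrow> 'a l2" assume X: "Cauchy X"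
 have "\<forall>k. \<exists>N. \<forall>m\<ge>N. \<forall>n\<ge>N. dist (X m) (X n) < (1/2) ^ k" using X by (simp add: Cauchy_def)
 then obtain N where N: "\<And>k m n. m \<ge> N k \<Longrightarrow> n \<ge> N k \<Longrightarrow> dist (X m) (X n) < (1/2) ^ k" by metis
 \<comment> \<open>The sum makes \<open>r k\<close> at least \<open>N k\<close>, and the extra
   summand \<open>k\<close> makes \<open>r\<close> strictly increasing.\<close>
 define r where "r k = (\<Sum>i\<le>k. N i) + k" for k
 have rN: "N k \<le> r k" for k unfolding r_def by (meson atMost_iff finite_atMost le_add1 le_trans member_le_sum order_refl zero_le)
 have rmono: "strict_mono r" unfolding r_def by (rule strict_monoI_Suc) simp
 have rle: "r k \<le> r l" if "k \<le> l" for k l using rmono that by (simp add: strict_mono_less_eq)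
 define f where "f k = rep_l2 (X (r k))" for k
 have f: "f k \<in> L2" "l2of (f k) = X (r k)" for k by (simp_all add: f_def)
 note [measurable] = L2_measurable[OF f(1)]
 have fd: "(l2norm (\<lambda>x. f l x - f k x))^2 \<le> (1/4) ^ k" if "k \<le> l" for k l
 proof -
  have "l2norm (\<lambda>x. f l x - f k x) < (1/2) ^ k"
   using N[of k "r l" "r k"] rN[of k] rle[OF that] dist_l2of[OF f(1) f(1), of l k] by (simp add: f(2))
  moreover have "0 \<le> l2norm (\<lambda>x. f l x - f k x)" by (simp add: l2norm_def)
  ultimately have "(l2norm (\<lambda>x. f l x - f k x))^2 \<le> ((1/2) ^ k)^2" by (intro power_mono) auto
  also have "\<dots> = (1/4) ^ k" by (simp add: power2_eq_square power_mult_distrib[symmetric])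
  finally show ?thesis .
 qed
 \<comment> \<open>The squared increments have integrals at most \<open>4^-k\<close>. Even with
   weights \<open>2^k\<close> the integrals are summable, so almost everywhere
   \<open>2^k * a k x\<close> is bounded; the increments then decay like \<open>2^(-k/2)\<close> and
   are summable.\<close>
 define a where "a k x = (cmod (f (Suc k) x - f k x))^2" for k x
 have [measurable]: "a k \<in> borel_measurable borel" for k unfolding a_def by measurable
 have "(\<integral>\<^sup>+x. (\<Sum>k. ennreal (2 ^ k) * ennreal (a k x)) \<partial>lborel)
   = (\<Sum>k. \<integral>\<^sup>+x. ennreal (2 ^ k) * ennreal (a k x) \<partial>lborel)" by (intro nn_integral_suminf) measurable
 also have "\<dots> \<le> (\<Sum>k. ennreal ((1/2) ^ k))"
 proof (intro suminf_le)
  fix k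
  have "(\<integral>\<^sup>+x. ennreal (2 ^ k) * ennreal (a k x) \<partial>lborel) = ennreal (2 ^ k) * ennreal ((l2norm (\<lambda>x. f (Suc k) x - f k x))^2)"
   using f(1) by (simp add: nn_integral_cmult a_def L2_nn_integral)
  also have "\<dots> \<le> ennreal (2 ^ k) * ennreal ((1/4) ^ k)" using fd[of k "Suc k"] by (intro mult_left_mono ennreal_leI) auto
  also have "\<dots> = ennreal ((1/2) ^ k)" by (simp add: ennreal_mult[symmetric] power_mult_distrib[symmetric])
  finally show "(\<integral>\<^sup>+x. ennreal (2 ^ k) * ennreal (a k x) \<partial>lborel) \<le> ennreal ((1/2) ^ k)" .
 qed auto
 also have "\<dots> = ennreal (\<Sum>k. (1/2) ^ k)" by (intro suminf_ennreal2) (auto intro: summable_geometric)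
 also have "\<dots> < \<infinity>" by simp
 finally have "(\<integral>\<^sup>+x. (\<Sum>k. ennreal (2 ^ k) * ennreal (a k x)) \<partial>lborel) \<noteq> \<infinity>" by simp
 then have "AE x in lborel. (\<Sum>k. ennreal (2 ^ k) * ennreal (a k x)) \<noteq> \<infinity>"
  by (intro nn_integral_PInf_AE) measurable
 then have conv: "AE x in lborel. convergent (\<lambda>k. f k x)"
 proof eventually_elim
  case (elim x)
  have "ennreal (2 ^ k * a k x) = ennreal (2 ^ k) * ennreal (a k x)" for k
   by (rule ennreal_mult) (simp_all add: a_def)
  then have "(\<Sum>k. ennreal (2 ^ k * a k x)) \<noteq> top" using elim by (simp only: infinity_ennreal_def) simp
  then have "summable (\<lambda>k. 2 ^ k * a k x)" by (intro summable_suminf_not_top) (auto simp: a_def)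
  then have "(\<lambda>k. 2 ^ k * a k x) \<longlonglongrightarrow> 0" by (rule summable_LIMSEQ_zero)
  then have "Bseq (\<lambda>k. 2 ^ k * a k x)" by (intro convergent_imp_Bseq) (auto simp: convergent_def)
  then obtain H where H: "\<And>k. 2 ^ k * a k x \<le> H" "H > 0" unfolding Bseq_def by (force simp: a_def)
  have le: "norm (f (Suc k) x - f k x) \<le> sqrt H * (sqrt (1/2)) ^ k" for k
  proof (rule power2_le_imp_le)
   have "a k x \<le> H * (1/2) ^ k" using H(1)[of k] by (simp add: power_one_over field_simps)
   also have "\<dots> = (sqrt H * (sqrt (1/2)) ^ k)^2"
    using H(2) by (simp add: power_mult_distrib power_mult[symmetric] mult.commute[of k])
     (simp add: power_mult power_divide real_sqrt_divide)
   finally show "(norm (f (Suc k) x - f k x))^2 \<le> (sqrt H * (sqrt (1/2)) ^ k)^2" by (simp add: a_def)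
  qed (use H in auto)
  have "sqrt (1/2) < (1::real)" by (simp add: real_sqrt_lt_1_iff)
  then have "summable (\<lambda>k. sqrt H * (sqrt (1/2)) ^ k)" by (intro summable_mult summable_geometric) auto
  then have "summable (\<lambda>k. f (Suc k) x - f k x)" by (rule summable_comparison_test') (rule le)
  then have "convergent (\<lambda>n. \<Sum>k<n. f (Suc k) x - f k x)" by (simp add: summable_iff_convergent)
  moreover have "(\<Sum>k<n. f (Suc k) x - f k x) = f n x - f 0 x" for n
   by (rule sum_lessThan_telescope[of "\<lambda>k. f k x"])
  ultimately have "convergent (\<lambda>n. (f n x - f 0 x) + f 0 x)" by (intro convergent_add convergent_const) simp
  then show ?case by simp
 qed
 define g where "g x = lim (\<lambda>k. f k x)" for x
 have [measurable]: "g \<in> borel_measurable borel" unfolding g_def by (rule borel_measurable_lim_metric) measurable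
 have lim: "AE x in lborel. (\<lambda>k. f k x) \<longlonglongrightarrow> g x"
  using conv by eventually_elim (simp add: g_def convergent_LIMSEQ_iff)
 have d: "(\<lambda>x. g x - f k x) \<in> L2 \<and> (l2norm (\<lambda>x. g x - f k x))^2 \<le> (1/4) ^ k" for k
 proof -
  have "AE x in lborel. (\<lambda>n. f (n + k) x - f k x) \<longlonglongrightarrow> g x - f k x"
   using lim by eventually_elim (intro tendsto_intros LIMSEQ_ignore_initial_segment)
  then show ?thesis
   using L2_fatou[of "\<lambda>n x. f (n + k) x - f k x" "(1/4) ^ k" "\<lambda>x. g x - f k x"] fd f(1) by simp
 qed
 have gL: "g \<in> L2" using L2_add[OF conjunct1[OF d[of 0]] f(1)[of 0]] by simp
 have "(\<lambda>k. X (r k)) \<longlonglongrightarrow> l2of g"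
 proof (rule metric_LIMSEQ_I)
  fix e :: real assume e: "e > 0"
  obtain K where K: "(1/2) ^ K < e" using real_arch_pow_inv[of e "1/2"] e by auto
  show "\<exists>no. \<forall>n\<ge>no. dist (X (r n)) (l2of g) < e"
  proof (intro exI[of _ K] allI impI)
   fix n assume n: "K \<le> n"
   have "(l2norm (\<lambda>x. g x - f n x))^2 \<le> ((1/2) ^ n)^2"
    using d[of n] by (simp add: power2_eq_square power_mult_distrib[symmetric])
   then have "l2norm (\<lambda>x. g x - f n x) \<le> (1/2) ^ n" by (rule power2_le_imp_le) simp
   also have "\<dots> \<le> (1/2) ^ K" using n by (intro power_decreasing) auto
   finally have "l2norm (\<lambda>x. g x - f n x) < e" using K by simp
   then show "dist (X (r n)) (l2of g) < e" using dist_l2of[OF gL f(1)[of n]] by (simp add: f(2) dist_commute)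
  qed
 qed
 then have "X \<longlonglongrightarrow> l2of g" using X rmono Cauchy_converges_subseq[of X r] by (simp add: o_def)
 then show "convergent X" by (auto simp: convergent_def)
qed

instantiation l2 :: (euclidean_space) complex_hilbert
begin

lift_definition scaleC_l2 :: "complex \<Rightarrow> 'a l2 \<Rightarrow> 'a l2" is "\<lambda>c f x. c * f x"
 by (auto simp: l2rel_def ae_eq_def)

instance
proof
 fix x y :: "'a l2" and c d :: complex and r :: real
 show "c *\<^sub>C (x + y) = c *\<^sub>C x + c *\<^sub>C y" by transfer (auto simp: l2rel_def ae_eq_def distrib_left)
 show "(c + d) *\<^sub>C x = c *\<^sub>C x + d *\<^sub>C x" by transfer (auto simp: l2rel_def ae_eq_def distrib_right)
 show "c *\<^sub>C d *\<^sub>C x = (c * d) *\<^sub>C x" by transfer (auto simp: l2rel_def ae_eq_def mult.assoc)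
 show "of_real r *\<^sub>C x = r *\<^sub>R x" by transfer (auto simp: l2rel_def ae_eq_def)
 show "inner (c *\<^sub>C x) y = inner x (cnj c *\<^sub>C y)" by transfer (simp add: l2inner_def mult_ac)
qed

end

lemma l2of_scaleC: "f \<in> L2 \<Longrightarrow> l2of (\<lambda>x. c * f x) = c *\<^sub>C l2of f"
 by (rule scaleC_l2.abs_eq[symmetric]) (auto simp: l2rel_def ae_eq_def)

lemma l2of_uminus: "f \<in> L2 \<Longrightarrow> l2of (\<lambda>x. - f x) = - l2of f" using l2of_scaleC[of f "-1"] by simp

lemma l2of_sum: "(\<And>i. i \<in> I \<Longrightarrow> f i \<in> L2) \<Longrightarrow> l2of (\<lambda>x. \<Sum>i\<in>I. f i x) = (\<Sum>i\<in>I. l2of (f i))"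
 by (induction I rule: infinite_finite_induct) (auto simp: l2of_zero l2of_add)

lemma cinner_l2of: "f \<in> L2 \<Longrightarrow> g \<in> L2 \<Longrightarrow> cinner (l2of f) (l2of g) = l2inner f g" unfolding cinner_def
 by (simp add: l2of_scaleC[symmetric] inner_l2of complex_eq_iff) (simp add: l2inner_def mult.left_commute)

lemma cmod_l2inner_le: "f \<in> L2 \<Longrightarrow> g \<in> L2 \<Longrightarrow> cmod (l2inner f g) \<le> l2norm f * l2norm g"
 using norm_cinner_le[of "l2of f" "l2of g"] by (simp add: cinner_l2of norm_l2of)

section \<open>Convergence in norm and almost everywhere\<close>

lemma l2of_tendsto_iff:
 assumes "\<And>n. f n \<in> L2" "g \<in> L2"
 shows "(\<lambda>n. l2of (f n)) \<longlonglongrightarrow> l2of g \<longleftrightarrow> (\<lambda>n. l2norm (\<lambda>x. f n x - g x)) \<longlonglongrightarrow> 0"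
 using assms by (simp add: tendsto_dist_iff[of _ "l2of g"] dist_l2of)

lemma L2_AE_subseq:
 assumes f: "\<And>n. f n \<in> L2" and g: "g \<in> L2" and lim: "(\<lambda>n. l2of (f n)) \<longlonglongrightarrow> l2of g"
 shows "\<exists>r::nat \<Rightarrow> nat. strict_mono r \<and> (AE x in lborel. (\<lambda>n. f (r n) x) \<longlonglongrightarrow> g x)"
proof -
 have "(\<lambda>n. (l2norm (\<lambda>x. f n x - g x))^2) \<longlonglongrightarrow> 0\<^sup>2"
  using lim by (intro tendsto_power) (simp add: l2of_tendsto_iff f g)
 then have "(\<lambda>n. LINT x|lborel. norm ((cmod (f n x - g x))^2)) \<longlonglongrightarrow> 0" by (simp add: l2norm_def)
 then have "\<exists>r::nat\<Rightarrow>nat. strict_mono r \<and> (AE x in lborel. (\<lambda>n. (cmod (f (r n) x - g x))^2) \<longlonglongrightarrow> 0)"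
  by (rule tendsto_L1_AE_subseq[where u = "\<lambda>n x. (cmod (f n x - g x))^2", rotated])
   (rule L2_integrable[OF L2_diff[OF f g]])
 then obtain r :: "nat \<Rightarrow> nat" where r: "strict_mono r" "AE x in lborel. (\<lambda>n. (cmod (f (r n) x - g x))^2) \<longlonglongrightarrow> 0" by blast
 from r(2) have "AE x in lborel. (\<lambda>n. f (r n) x) \<longlonglongrightarrow> g x"
 proof eventually_elim
  case (elim x)
  then have "(\<lambda>n. sqrt ((cmod (f (r n) x - g x))^2)) \<longlonglongrightarrow> sqrt 0" by (rule tendsto_real_sqrt)
  then show ?case by (simp add: tendsto_norm_zero_iff LIM_zero_iff)
 qed
 with r(1) show ?thesis by blast
qed

lemma L2_dominated_convergence:
 fixes f :: "nat \<Rightarrow> 'a::euclidean_space \<Rightarrow> complex"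
 assumes g: "g \<in> L2" and f[measurable]: "\<And>n. f n \<in> borel_measurable borel" "l \<in> borel_measurable borel"
  and bound: "\<And>n. AE x in lborel. cmod (f n x) \<le> cmod (g x)"
  and lim: "AE x in lborel. (\<lambda>n. f n x) \<longlonglongrightarrow> l x"
 shows "l \<in> L2" "(\<lambda>n. l2of (f n)) \<longlonglongrightarrow> l2of l"
proof -
 note [measurable] = L2_measurable[OF g]
 have fL: "f n \<in> L2" for n using bound by (intro L2_bound(1)[OF g, of _ 1]) auto
 have "AE x in lborel. \<forall>n. cmod (f n x) \<le> cmod (g x)" using bound by (simp add: AE_all_countable)
 with lim have lb: "AE x in lborel. cmod (l x) \<le> cmod (g x)"
 proof eventually_elim
  case (elim x)
  show ?case by (rule tendsto_upperbound[OF tendsto_norm[OF elim(1)] always_eventually[OF elim(2)]]) simp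
 qed
 show lL: "l \<in> L2" using lb by (intro L2_bound(1)[OF g, of _ 1]) auto
 have "(\<lambda>n. LINT x|lborel. (cmod (f n x - l x))^2) \<longlonglongrightarrow> (LINT x::'a|lborel. (0::real))"
 proof (rule integral_dominated_convergence[where w = "\<lambda>x. 4 * (cmod (g x))^2"])
  show "integrable lborel (\<lambda>x. 4 * (cmod (g x))^2)" using L2_integrable[OF g] by simp
  show "AE x in lborel. (\<lambda>n. (cmod (f n x - l x))^2) \<longlonglongrightarrow> 0" using lim
  proof eventually_elim
   case (elim x)
   then have "(\<lambda>n. (cmod (f n x - l x))^2) \<longlonglongrightarrow> (cmod (l x - l x))\<^sup>2" by (intro tendsto_intros)
   then show ?case by simp
  qed
  show "AE x in lborel. norm ((cmod (f n x - l x))^2) \<le> 4 * (cmod (g x))^2" for n using bound[of n] lb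
  proof eventually_elim
   case (elim x)
   then have "cmod (f n x - l x) \<le> 2 * cmod (g x)" using norm_triangle_ineq4[of "f n x" "l x"] by linarith
   then have "(cmod (f n x - l x))^2 \<le> (2 * cmod (g x))^2" by (intro power_mono) auto
   then show ?case by (simp add: power_mult_distrib)
  qed
 qed measurable
 then have "(\<lambda>n. sqrt (LINT x|lborel. (cmod (f n x - l x))^2)) \<longlonglongrightarrow> sqrt 0" by (intro tendsto_real_sqrt) simp
 then show "(\<lambda>n. l2of (f n)) \<longlonglongrightarrow> l2of l" by (simp add: l2of_tendsto_iff fL lL l2norm_def)
qed

text \<open>Multiplication by a possibly unbounded function is a closed operator: along a common
  subsequence both sequences converge almost everywhere, and the limits are compared
  pointwise.\<close>

lemma L2_mult_closed:
 fixes m :: "'a::euclidean_space \<Rightarrow> complex"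
 assumes f: "\<And>n. f n \<in> L2" and g: "g \<in> L2" and lim: "(\<lambda>n. l2of (f n)) \<longlonglongrightarrow> l2of g"
  and mf: "\<And>n. (\<lambda>x. m x * f n x) \<in> L2" and h: "h \<in> L2" and lim': "(\<lambda>n. l2of (\<lambda>x. m x * f n x)) \<longlonglongrightarrow> l2of h"
 shows "AE x in lborel. m x * g x = h x"
proof -
 obtain r :: "nat \<Rightarrow> nat" where r: "strict_mono r" "AE x in lborel. (\<lambda>n. f (r n) x) \<longlonglongrightarrow> g x"
  using L2_AE_subseq[OF f g lim] by blast
 have "(\<lambda>n. l2of (\<lambda>x. m x * f (r n) x)) \<longlonglongrightarrow> l2of h"
  using LIMSEQ_subseq_LIMSEQ[OF lim' r(1)] by (simp add: o_def)
 then obtain s :: "nat \<Rightarrow> nat" where s: "strict_mono s" "AE x in lborel. (\<lambda>n. m x * f (r (s n)) x) \<longlonglongrightarrow> h x"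
  using L2_AE_subseq[of "\<lambda>n x. m x * f (r n) x" h] mf h by blast
 from r(2) s(2) show ?thesis
 proof eventually_elim
  case (elim x)
  have "(\<lambda>n. m x * f (r (s n)) x) \<longlonglongrightarrow> m x * g x"
   using LIMSEQ_subseq_LIMSEQ[OF elim(1) s(1)] by (intro tendsto_intros) (simp add: o_def)
  then show ?case using elim(2) LIMSEQ_unique by blast
 qed
qed

section \<open>Smooth functions and test functions\<close>

lemma smooth_differentiable: "smooth f \<Longrightarrow> f differentiable (at x)"
 unfolding smooth_def differentiable_on_def by (drule spec[of _ "[]"]) simp

lemma smooth_partial: assumes "smooth f" "b \<in> Basis" shows "smooth (partial b f)" unfolding smooth_def
proof (intro allI impI)
 fix bs :: "'a list" assume "set bs \<subseteq> Basis"
 then have "set (b # bs) \<subseteq> Basis" using assms(2) by simp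
 then have "fold partial (b # bs) f differentiable_on UNIV" using assms(1) unfolding smooth_def by blast
 then show "fold partial bs (partial b f) differentiable_on UNIV" by simp
qed

text \<open>Smoothness quantifies over lists of derivatives. Exhibiting an invariant family
  \<open>F\<close> replaces an induction over such lists in each closure proof.\<close>

lemma smooth_coinduct:
 assumes "f \<in> F" and diff: "\<And>f x. f \<in> F \<Longrightarrow> f differentiable (at x)"
  and part: "\<And>f b. f \<in> F \<Longrightarrow> b \<in> Basis \<Longrightarrow> partial b f \<in> F"
 shows "smooth f"
proof -
 have "fold partial bs f \<in> F" if "set bs \<subseteq> Basis" for bs using that assms(1)
 proof (induction bs arbitrary: f)
  case (Cons b bs)
  then show ?case using part[of f b] by simp
 qed simp
 then show ?thesis using diff by (simp add: smooth_def differentiable_on_def)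
qed

lemma partial_eq: "(f has_derivative D) (at x) \<Longrightarrow> partial b f x = D b"
 by (simp add: partial_def frechet_derivative_at[symmetric])

lemma has_derivative_partial:
 "f differentiable (at x) \<Longrightarrow> (f has_derivative frechet_derivative f (at x)) (at x)"
 by (simp add: frechet_derivative_works)

lemma partial_const [simp]: "partial b (\<lambda>x. c) = (\<lambda>x. 0)"
 by (rule ext, rule partial_eq[of _ "\<lambda>_. 0", simplified]) (rule has_derivative_const)

lemma partial_add:
 assumes "f differentiable (at x)" "g differentiable (at x)"
 shows "partial b (\<lambda>x. f x + g x) x = partial b f x + partial b g x"
 using partial_eq[OF has_derivative_add[OF assms[THEN has_derivative_partial]]] by (simp add: partial_def)

lemma partial_mult:
 fixes f g :: "'a::euclidean_space \<Rightarrow> 'b::real_normed_algebra"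
 assumes "f differentiable (at x)" "g differentiable (at x)"
 shows "partial b (\<lambda>x. f x * g x) x = f x * partial b g x + partial b f x * g x"
 using partial_eq[OF has_derivative_mult[OF assms[THEN has_derivative_partial]]] by (simp add: partial_def)

lemma partial_bounded_linear:
 assumes L: "bounded_linear L" and f: "f differentiable (at x)"
 shows "partial b (\<lambda>x. L (f x)) x = L (partial b f x)"
 using partial_eq[OF bounded_linear.has_derivative[OF L has_derivative_partial[OF f]]] by (simp add: partial_def)

lemma differentiable_bounded_linear:
 assumes L: "bounded_linear L" and f: "f differentiable (at x)"
 shows "(\<lambda>x. L (f x)) differentiable (at x)"
 using bounded_linear.has_derivative[OF L has_derivative_partial[OF f]] by (rule differentiableI)

lemma partial_real_compose:
 assumes psi: "(\<psi> has_real_derivative d) (at (g x))" and g: "(g :: 'a::euclidean_space \<Rightarrow> real) differentiable (at x)"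
 shows "(\<lambda>x. complex_of_real (\<psi> (g x))) differentiable (at x)"
  "partial b (\<lambda>x. complex_of_real (\<psi> (g x))) x = complex_of_real (d * partial b g x)"
proof -
 have "((\<lambda>x. \<psi> (g x)) has_derivative (\<lambda>h. d * frechet_derivative g (at x) h)) (at x)"
  using has_derivative_compose[OF has_derivative_partial[OF g], of \<psi> "(*) d"] psi
  by (simp add: has_field_derivative_def)
 then have "((\<lambda>x. complex_of_real (\<psi> (g x))) has_derivative
   (\<lambda>h. complex_of_real (d * frechet_derivative g (at x) h))) (at x)"
  by (rule bounded_linear.has_derivative[OF bounded_linear_of_real])
 then show "(\<lambda>x. complex_of_real (\<psi> (g x))) differentiable (at x)"
  "partial b (\<lambda>x. complex_of_real (\<psi> (g x))) x = complex_of_real (d * partial b g x)"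
  using partial_eq[of "\<lambda>x. complex_of_real (\<psi> (g x))"] by (auto simp: partial_def intro: differentiableI)
qed

text \<open>Differentiating a product leaves a given family of generators but not the algebra
  generated by it, so smoothness needs to be checked on the generators alone.\<close>

inductive_set fun_algebra :: "('a \<Rightarrow> complex) set \<Rightarrow> ('a \<Rightarrow> complex) set"
 for G :: "('a \<Rightarrow> complex) set" where
 fa_const: "(\<lambda>x. c) \<in> fun_algebra G"
| fa_gen: "g \<in> G \<Longrightarrow> g \<in> fun_algebra G"
| fa_add: "f \<in> fun_algebra G \<Longrightarrow> g \<in> fun_algebra G \<Longrightarrow> (\<lambda>x. f x + g x) \<in> fun_algebra G"
| fa_mult: "f \<in> fun_algebra G \<Longrightarrow> g \<in> fun_algebra G \<Longrightarrow> (\<lambda>x. f x * g x) \<in> fun_algebra G"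

lemma smooth_fun_algebra:
 fixes G :: "('a::euclidean_space \<Rightarrow> complex) set"
 assumes f: "f \<in> fun_algebra G"
  and diff: "\<And>g x. g \<in> G \<Longrightarrow> g differentiable (at x)"
  and part: "\<And>g b. g \<in> G \<Longrightarrow> b \<in> Basis \<Longrightarrow> partial b g \<in> fun_algebra G"
 shows "smooth f"
proof -
 have D: "(\<forall>x. f differentiable (at x)) \<and> (\<forall>b\<in>Basis. partial b f \<in> fun_algebra G)"
  if "f \<in> fun_algebra G" for f using that
 proof induction
  case (fa_const c) then show ?case by (simp add: fun_algebra.fa_const)
 next
  case (fa_gen g) then show ?case using diff part by blast
 next
  case (fa_add f g)
  then have "partial b (\<lambda>x. f x + g x) = (\<lambda>x. partial b f x + partial b g x)" for b
   by (intro ext partial_add) auto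
  then show ?case using fa_add by (auto intro!: fun_algebra.fa_add differentiable_add)
 next
  case (fa_mult f g)
  then have "partial b (\<lambda>x. f x * g x) = (\<lambda>x. f x * partial b g x + partial b f x * g x)" for b
   by (intro ext partial_mult) auto
  then show ?case using fa_mult by (auto intro!: fun_algebra.fa_add fun_algebra.fa_mult differentiable_mult)
 qed
 show ?thesis by (rule smooth_coinduct[OF f]) (use D in blast)+
qed

lemma smooth_algebra_closed: "f \<in> fun_algebra (Collect smooth) \<Longrightarrow> smooth f"
 by (erule smooth_fun_algebra) (auto simp: smooth_differentiable smooth_partial intro: fa_gen)

lemma smooth_const [simp]: "smooth (\<lambda>x. c)" by (rule smooth_algebra_closed) (rule fa_const)

lemma smooth_add: "smooth f \<Longrightarrow> smooth g \<Longrightarrow> smooth (\<lambda>x. f x + g x)"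
 by (rule smooth_algebra_closed) (auto intro: fun_algebra.intros)

lemma smooth_mult: "smooth f \<Longrightarrow> smooth g \<Longrightarrow> smooth (\<lambda>x. f x * g x)"
 by (rule smooth_algebra_closed) (auto intro: fun_algebra.intros)

lemma smooth_sum: "(\<And>i. i \<in> I \<Longrightarrow> smooth (f i)) \<Longrightarrow> smooth (\<lambda>x. \<Sum>i\<in>I. f i x)"
 by (induction I rule: infinite_finite_induct) (auto intro: smooth_add)

lemma smooth_prod: "(\<And>i. i \<in> I \<Longrightarrow> smooth (f i)) \<Longrightarrow> smooth (\<lambda>x. \<Prod>i\<in>I. f i x)"
 by (induction I rule: infinite_finite_induct) (auto intro: smooth_mult)

lemma smooth_bounded_linear:
 fixes f :: "'a::euclidean_space \<Rightarrow> complex" and L :: "complex \<Rightarrow> complex"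
 assumes f: "smooth f" and L: "bounded_linear L" shows "smooth (\<lambda>x. L (f x))"
proof (rule smooth_coinduct[where F = "{\<lambda>x. L (g x) | g :: 'a \<Rightarrow> complex. smooth g}"])
 show "(\<lambda>x. L (f x)) \<in> {\<lambda>x. L (g x) | g :: 'a \<Rightarrow> complex. smooth g}" using f by blast
 fix h x assume "h \<in> {\<lambda>x. L (g x) | g :: 'a \<Rightarrow> complex. smooth g}"
 then obtain g where g: "h = (\<lambda>x. L (g x))" "smooth g" by blast
 show "h differentiable (at x)"
  unfolding g(1) by (rule differentiable_bounded_linear[OF L smooth_differentiable[OF g(2)]])
 fix b :: 'a assume b: "b \<in> Basis"
 have "partial b h = (\<lambda>x. L (partial b g x))"
  unfolding g(1) by (intro ext partial_bounded_linear L smooth_differentiable g(2))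
 then show "partial b h \<in> {\<lambda>x. L (g x) | g :: 'a \<Rightarrow> complex. smooth g}" using smooth_partial[OF g(2) b] by blast
qed

lemma smooth_cnj: "smooth f \<Longrightarrow> smooth (\<lambda>x. cnj (f x))"
 by (erule smooth_bounded_linear) (rule bounded_linear_cnj)

lemma partial_cnj: "f differentiable (at x) \<Longrightarrow> partial b (\<lambda>x. cnj (f x)) x = cnj (partial b f x)"
 by (rule partial_bounded_linear[OF bounded_linear_cnj])

lemma inner_const_has_derivative: "((\<lambda>x. of_real (inner x a) :: complex) has_derivative (\<lambda>h. of_real (inner h a))) (at x)"
 by (intro bounded_linear_imp_has_derivative bounded_linear_compose[OF bounded_linear_of_real] bounded_linear_inner_left)

lemma partial_inner: "partial b (\<lambda>x. complex_of_real (inner x a)) = (\<lambda>x. of_real (inner b a))"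
 using partial_eq[OF inner_const_has_derivative] by blast

lemma smooth_inner: "smooth (\<lambda>x. complex_of_real (inner x a))"
proof (rule smooth_fun_algebra[where G = "{\<lambda>x. complex_of_real (inner x a)}"])
 show "g differentiable (at x)" if "g \<in> {\<lambda>x. complex_of_real (inner x a)}" for g x
  using that inner_const_has_derivative differentiableI by blast
qed (auto simp: partial_inner intro: fun_algebra.intros)

lemma smooth_norm_square: "smooth (\<lambda>x::'a::euclidean_space. complex_of_real ((norm x)^2))"
proof -
 have "complex_of_real ((norm x)^2) = (\<Sum>b\<in>Basis. of_real (inner x b) * of_real (inner x b))" for x :: 'a
  by (simp only: power2_norm_eq_inner euclidean_inner[of x x] of_real_sum of_real_mult)
 then show ?thesis by (simp only:) (intro smooth_sum smooth_mult smooth_inner)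
qed

lemma norm_square_has_derivative: "((\<lambda>x::'a::euclidean_space. (norm x)^2) has_derivative (\<lambda>h. 2 * inner x h)) (at x)"
 unfolding power2_norm_eq_inner by (auto intro!: derivative_eq_intros simp: inner_commute)

lemma differentiable_of_real_iff:
 "(\<lambda>x. complex_of_real (g x)) differentiable (at x) \<Longrightarrow> g differentiable (at x)"
 using differentiable_bounded_linear[OF bounded_linear_Re, of "\<lambda>x. complex_of_real (g x)" x] by simp

text \<open>The outer function comes with all its derivatives as a sequence, and the chain rule
  stays in the algebra generated by the \<open>\<psi> n\<close> composed with \<open>g\<close> and
  the smooth functions. Differentiability is asked only at values of \<open>g\<close>, so that
  reciprocals and real powers of a positive \<open>g\<close> are covered.\<close>

lemma smooth_compose_real:
 fixes g :: "'a::euclidean_space \<Rightarrow> real"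
 assumes g: "smooth (\<lambda>x. complex_of_real (g x))"
  and psi: "\<And>n x. (\<psi> n has_real_derivative \<psi> (Suc n) (g x)) (at (g x))"
 shows "smooth (\<lambda>x. complex_of_real (\<psi> n (g x)))"
proof (rule smooth_fun_algebra[where G = "Collect smooth \<union> {\<lambda>x. complex_of_real (\<psi> n (g x)) | n. True}"])
 let ?G = "Collect smooth \<union> {\<lambda>x. complex_of_real (\<psi> n (g x)) | n. True}"
 show "(\<lambda>x. complex_of_real (\<psi> n (g x))) \<in> fun_algebra ?G" by (rule fa_gen) blast
 have gd: "g differentiable (at x)" for x by (rule differentiable_of_real_iff[OF smooth_differentiable[OF g]])
 show "f differentiable (at x)" if "f \<in> ?G" for f x using that
 proof
  assume "f \<in> Collect smooth" then show ?thesis by (simp add: smooth_differentiable)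
 next
  assume "f \<in> {\<lambda>x. complex_of_real (\<psi> n (g x)) | n. True}"
  then obtain n where "f = (\<lambda>x. complex_of_real (\<psi> n (g x)))" by blast
  then show ?thesis using partial_real_compose(1)[of "\<psi> n" "\<psi> (Suc n) (g x)" g x, OF psi gd] by simp
 qed
 show "partial b f \<in> fun_algebra ?G" if f: "f \<in> ?G" and b: "b \<in> Basis" for f b using f
 proof
  assume "f \<in> Collect smooth"
  then show ?thesis using smooth_partial[of f b] b by (auto intro: fa_gen)
 next
  assume "f \<in> {\<lambda>x. complex_of_real (\<psi> n (g x)) | n. True}"
  then obtain n where n: "f = (\<lambda>x. complex_of_real (\<psi> n (g x)))" by blast
  have "partial b (\<lambda>x. complex_of_real (g x)) x = complex_of_real (partial b g x)" for x
   by (rule partial_bounded_linear[OF bounded_linear_of_real gd])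
  then have "partial b f = (\<lambda>x. complex_of_real (\<psi> (Suc n) (g x)) * partial b (\<lambda>x. complex_of_real (g x)) x)"
   unfolding n using partial_real_compose(2)[of "\<psi> n" "\<psi> (Suc n) (g x)" g x for x, OF psi gd]
   by (intro ext) simp
  moreover have "partial b (\<lambda>x. complex_of_real (g x)) \<in> fun_algebra ?G"
   using smooth_partial[OF g b] by (auto intro: fa_gen)
  moreover have "(\<lambda>x. complex_of_real (\<psi> (Suc n) (g x))) \<in> fun_algebra ?G" by (rule fa_gen) blast
  ultimately show ?thesis by (simp add: fun_algebra.fa_mult)
 qed
qed

lemma affine_derivative:
 assumes "f differentiable (at (c *\<^sub>R x + a))"
 shows "((\<lambda>x. f (c *\<^sub>R x + a)) has_derivative (\<lambda>h. frechet_derivative f (at (c *\<^sub>R x + a)) (c *\<^sub>R h))) (at x)"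
proof -
 have "((\<lambda>x. c *\<^sub>R x + a) has_derivative (\<lambda>h. c *\<^sub>R h)) (at x)" by (auto intro!: derivative_eq_intros)
 from has_derivative_compose[OF this has_derivative_partial[OF assms]] show ?thesis .
qed

lemma partial_affine:
 assumes "f differentiable (at (c *\<^sub>R x + a))"
 shows "partial b (\<lambda>x. f (c *\<^sub>R x + a)) x = c *\<^sub>R partial b f (c *\<^sub>R x + a)"
 using partial_eq[OF affine_derivative[OF assms], of b]
  linear_cmul[OF has_derivative_linear[OF has_derivative_partial[OF assms]]] by (simp add: partial_def)

lemma smooth_affine:
 assumes "smooth f" shows "smooth (\<lambda>x. f (c *\<^sub>R x + a))"
proof (rule smooth_coinduct[where F = "{\<lambda>x. g (c *\<^sub>R x + a) | g. smooth g}"])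
 show "(\<lambda>x. f (c *\<^sub>R x + a)) \<in> {\<lambda>x. g (c *\<^sub>R x + a) | g. smooth g}" using assms by blast
 fix h x assume "h \<in> {\<lambda>x. g (c *\<^sub>R x + a) | g. smooth g}"
 then obtain g where g: "h = (\<lambda>x. g (c *\<^sub>R x + a))" "smooth g" by blast
 show "h differentiable (at x)"
  unfolding g(1) by (rule differentiableI[OF affine_derivative[OF smooth_differentiable[OF g(2)]]])
 fix b :: 'a assume b: "b \<in> Basis"
 have "partial b h = (\<lambda>x. of_real c * partial b g (c *\<^sub>R x + a))"
  unfolding g(1) using partial_affine[OF smooth_differentiable[OF g(2)]] by (simp add: fun_eq_iff scaleR_conv_of_real)
 moreover have "smooth (\<lambda>y. of_real c * partial b g y)"
  by (intro smooth_mult smooth_const smooth_partial g(2) b)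
 ultimately show "partial b h \<in> {\<lambda>x. g (c *\<^sub>R x + a) | g. smooth g}"
  by (intro CollectI exI[of _ "\<lambda>y. of_real c * partial b g y"]) simp
qed

section \<open>Test functions and integration by parts\<close>

lemma test_functionsI:
 assumes "smooth u" "compact K" "K \<subseteq> \<Omega>" "\<And>x. x \<notin> K \<Longrightarrow> u x = 0"
 shows "u \<in> test_functions \<Omega>"
proof -
 have sub: "closure {x. u x \<noteq> 0} \<subseteq> K"
  using assms(2,4) by (intro closure_minimal) (auto simp: compact_imp_closed)
 then have "compact (closure {x. u x \<noteq> 0})"
  using compact_Int_closed[OF assms(2) closed_closure, of "{x. u x \<noteq> 0}"] by (simp add: Int_absorb1)
 then show ?thesis using assms sub by (auto simp: test_functions_def)
qed

lemma test_functionsD: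
 assumes "u \<in> test_functions \<Omega>"
 obtains K where "compact K" "K \<subseteq> \<Omega>" "\<And>x. x \<notin> K \<Longrightarrow> u x = 0"
 using assms closure_subset[of "{x. u x \<noteq> 0}"] unfolding test_functions_def by blast

lemma test_smooth: "u \<in> test_functions \<Omega> \<Longrightarrow> smooth u" by (simp add: test_functions_def)

lemma test_differentiable: "u \<in> test_functions \<Omega> \<Longrightarrow> u differentiable (at x)"
 by (rule smooth_differentiable[OF test_smooth])

lemma test_mono: "\<Omega> \<subseteq> \<Omega>' \<Longrightarrow> u \<in> test_functions \<Omega> \<Longrightarrow> u \<in> test_functions \<Omega>'" by (auto simp: test_functions_def)

lemma test_UNIV: "u \<in> test_functions \<Omega> \<Longrightarrow> u \<in> test_functions UNIV" by (erule test_mono[rotated]) simp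

lemma partial_zero_outside:
 assumes "closed K" "\<And>x. x \<notin> K \<Longrightarrow> u x = 0" "x \<notin> K" shows "partial b u x = 0"
proof -
 have "(u has_derivative (\<lambda>h. 0)) (at x)"
  by (rule has_derivative_transform_within_open[of "\<lambda>x. 0" _ _ _ "- K"])
   (use assms in auto)
 then show ?thesis by (rule partial_eq)
qed

lemma test_partial:
 assumes u: "u \<in> test_functions \<Omega>" and b: "b \<in> Basis" shows "partial b u \<in> test_functions \<Omega>"
proof -
 obtain K where K: "compact K" "K \<subseteq> \<Omega>" "\<And>x. x \<notin> K \<Longrightarrow> u x = 0" by (rule test_functionsD[OF u]) blast
 show ?thesis by (rule test_functionsI[OF smooth_partial[OF test_smooth[OF u] b] K(1,2)])
   (rule partial_zero_outside[OF compact_imp_closed[OF K(1)] K(3)])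
qed

lemma test_mult:
 assumes f: "smooth f" and u: "u \<in> test_functions \<Omega>" shows "(\<lambda>x. f x * u x) \<in> test_functions \<Omega>"
proof -
 obtain K where K: "compact K" "K \<subseteq> \<Omega>" "\<And>x. x \<notin> K \<Longrightarrow> u x = 0" by (rule test_functionsD[OF u]) blast
 show ?thesis by (rule test_functionsI[OF smooth_mult[OF f test_smooth[OF u]] K(1,2)]) (simp add: K(3))
qed

lemma test_cmult: "u \<in> test_functions \<Omega> \<Longrightarrow> (\<lambda>x. c * u x) \<in> test_functions \<Omega>"
 by (rule test_mult[OF smooth_const])

lemma test_add:
 assumes u: "u \<in> test_functions \<Omega>" and v: "v \<in> test_functions \<Omega>"
 shows "(\<lambda>x. u x + v x) \<in> test_functions \<Omega>"
proof -
 obtain K where K: "compact K" "K \<subseteq> \<Omega>" "\<And>x. x \<notin> K \<Longrightarrow> u x = 0" by (rule test_functionsD[OF u]) blast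
 obtain L where L: "compact L" "L \<subseteq> \<Omega>" "\<And>x. x \<notin> L \<Longrightarrow> v x = 0" by (rule test_functionsD[OF v]) blast
 show ?thesis
  by (rule test_functionsI[OF smooth_add[OF test_smooth[OF u] test_smooth[OF v]] compact_Un[OF K(1) L(1)]])
   (use K L in auto)
qed

lemma test_diff:
 assumes u: "u \<in> test_functions \<Omega>" and v: "v \<in> test_functions \<Omega>"
 shows "(\<lambda>x. u x - v x) \<in> test_functions \<Omega>" using test_add[OF u test_cmult[OF v, of "-1"]] by simp

lemma test_zero: "(\<lambda>x. 0) \<in> test_functions \<Omega>" by (rule test_functionsI[of _ "{}"]) auto

lemma test_sum: "(\<And>i. i \<in> I \<Longrightarrow> f i \<in> test_functions \<Omega>) \<Longrightarrow> (\<lambda>x. \<Sum>i\<in>I. f i x) \<in> test_functions \<Omega>"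
 by (induction I rule: infinite_finite_induct) (auto intro: test_add test_zero)

lemma test_cnj: assumes u: "u \<in> test_functions \<Omega>" shows "(\<lambda>x. cnj (u x)) \<in> test_functions \<Omega>"
proof -
 obtain K where K: "compact K" "K \<subseteq> \<Omega>" "\<And>x. x \<notin> K \<Longrightarrow> u x = 0" by (rule test_functionsD[OF u]) blast
 show ?thesis by (rule test_functionsI[OF smooth_cnj[OF test_smooth[OF u]] K(1,2)]) (simp add: K(3))
qed

lemma smooth_continuous: assumes "smooth u" shows "continuous_on S u"
 using smooth_differentiable[OF assms] by (auto intro!: continuous_at_imp_continuous_on differentiable_imp_continuous_within)

lemma smooth_measurable: "smooth u \<Longrightarrow> u \<in> borel_measurable borel"
 by (rule borel_measurable_continuous_onI[OF smooth_continuous])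

lemma test_bounded:
 assumes u: "u \<in> test_functions \<Omega>" obtains B where "B > 0" "\<And>x. cmod (u x) \<le> B"
proof -
 obtain K where K: "compact K" "K \<subseteq> \<Omega>" "\<And>x. x \<notin> K \<Longrightarrow> u x = 0" by (rule test_functionsD[OF u]) blast
 have "compact (u ` K)" by (rule compact_continuous_image[OF smooth_continuous[OF test_smooth[OF u]] K(1)])
 then have "bounded (u ` K)" by (rule compact_imp_bounded)
 then obtain B where B: "B > 0" "\<And>x. x \<in> K \<Longrightarrow> cmod (u x) \<le> B" unfolding bounded_pos by blast
 have "cmod (u x) \<le> B" for x using B K(3)[of x] by (cases "x \<in> K") auto
 then show ?thesis using B(1) that by blast
qed

lemma L2_bounded_support:
 fixes u :: "'a::euclidean_space \<Rightarrow> complex"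
 assumes [measurable]: "u \<in> borel_measurable borel" and B: "\<And>x. cmod (u x) \<le> B" and K: "compact K" "\<And>x. x \<notin> K \<Longrightarrow> u x = 0"
 shows "u \<in> L2" "(l2norm u)^2 \<le> B\<^sup>2 * measure lborel K"
proof -
 have [measurable]: "K \<in> sets borel" by (rule borel_compact[OF K(1)])
 have fin: "emeasure lborel K < \<infinity>" using K(1) emeasure_compact_finite by blast
 have "(\<integral>\<^sup>+x. ennreal ((cmod (u x))^2) \<partial>lborel) \<le> (\<integral>\<^sup>+x. ennreal (B\<^sup>2) * indicator K x \<partial>lborel)"
 proof (rule nn_integral_mono)
  fix x
  show "ennreal ((cmod (u x))^2) \<le> ennreal (B\<^sup>2) * indicator K x"
   using K(2)[of x] B[of x] by (cases "x \<in> K") (auto intro!: ennreal_leI power_mono)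
 qed
 also have "\<dots> = ennreal (B\<^sup>2) * emeasure lborel K" by (simp add: nn_integral_cmult)
 also have "\<dots> = ennreal (B\<^sup>2 * measure lborel K)"
  using fin by (simp add: emeasure_eq_ennreal_measure ennreal_mult less_top)
 finally show "u \<in> L2" "(l2norm u)^2 \<le> B\<^sup>2 * measure lborel K"
  using L2_nn_integralI[of u "B\<^sup>2 * measure lborel K"] by auto
qed

lemma test_L2: assumes u: "u \<in> test_functions \<Omega>" shows "u \<in> L2"
proof -
 obtain K where K: "compact K" "K \<subseteq> \<Omega>" "\<And>x. x \<notin> K \<Longrightarrow> u x = 0" by (rule test_functionsD[OF u]) blast
 obtain B where B: "\<And>x. cmod (u x) \<le> B" by (rule test_bounded[OF u]) blast
 show ?thesis by (rule L2_bounded_support(1)[OF smooth_measurable[OF test_smooth[OF u]] B K(1) K(3)])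
qed

lemma test_integrable: assumes u: "u \<in> test_functions \<Omega>" shows "integrable lborel u"
proof -
 obtain K where K: "compact K" "K \<subseteq> \<Omega>" "\<And>x. x \<notin> K \<Longrightarrow> u x = 0" by (rule test_functionsD[OF u]) blast
 have [measurable]: "K \<in> sets borel" by (rule borel_compact[OF K(1)])
 have "(\<lambda>x. indicat_real K x *\<^sub>R (1::complex)) \<in> L2"
  by (rule L2_bounded_support(1)[of _ 1 K]) (auto simp: K indicator_def)
 from L2_mult_integrable[OF test_L2[OF u] this]
 have "integrable lborel (\<lambda>x. u x * (indicat_real K x *\<^sub>R 1))" .
 moreover have "u x * (indicat_real K x *\<^sub>R 1) = u x" for x using K(3)[of x] by (auto simp: indicator_def)
 ultimately show ?thesis by simp
qed

lemma lborel_integral_translate: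
 fixes f :: "'a::euclidean_space \<Rightarrow> complex"
 assumes [measurable]: "f \<in> borel_measurable borel"
 shows "(LINT x|lborel. f (x + a)) = (LINT x|lborel. f x)"
proof -
 have "(LINT x|lborel. f x) = (LINT x|distr lborel borel ((+) a). f x)" by (simp add: lborel_distr_plus)
 also have "\<dots> = (LINT x|lborel. f (a + x))" by (rule integral_distr) measurable
 finally show ?thesis by (simp add: add.commute)
qed

lemma frechet_derivative_eq_sum:
 assumes "u differentiable (at x)"
 shows "frechet_derivative u (at x) h = (\<Sum>b\<in>Basis. inner h b *\<^sub>R partial b u x)"
proof -
 have lin: "linear (frechet_derivative u (at x))"
  by (rule has_derivative_linear[OF has_derivative_partial[OF assms]])
 have "frechet_derivative u (at x) (\<Sum>b\<in>Basis. inner h b *\<^sub>R b) = (\<Sum>b\<in>Basis. inner h b *\<^sub>R partial b u x)"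
  unfolding linear_sum[OF lin] linear_cmul[OF lin] partial_def ..
 then show ?thesis by (simp add: euclidean_representation)
qed

lemma test_lipschitz:
 fixes u :: "'a::euclidean_space \<Rightarrow> complex"
 assumes u: "u \<in> test_functions \<Omega>"
 obtains L where "L > 0" "\<And>x y. cmod (u x - u y) \<le> L * norm (x - y)"
proof -
 have "\<forall>b\<in>Basis. \<exists>C. \<forall>x. cmod (partial b u x) \<le> C" using test_bounded[OF test_partial[OF u]] by metis
 then obtain C where C: "\<And>b x. b \<in> Basis \<Longrightarrow> cmod (partial b u x) \<le> C b" by metis
 have C0: "0 \<le> C b" if "b \<in> Basis" for b using order_trans[OF norm_ge_zero C[OF that]] by blast
 define L where "L = (\<Sum>b\<in>Basis. C b) + 1"
 have "0 \<le> (\<Sum>b\<in>Basis. C b)" by (rule sum_nonneg) (rule C0)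
 then have L: "L > 0" by (simp add: L_def)
 have on: "onorm (frechet_derivative u (at x)) \<le> L" for x
 proof (rule onorm_le)
  fix h
  have "norm (frechet_derivative u (at x) h) \<le> (\<Sum>b\<in>Basis. norm (inner h b *\<^sub>R partial b u x))"
   unfolding frechet_derivative_eq_sum[OF test_differentiable[OF u]] by (rule norm_sum)
  also have "\<dots> \<le> (\<Sum>b\<in>Basis. norm h * C b)"
  proof (rule sum_mono)
   fix b :: 'a assume b: "b \<in> Basis"
   have "\<bar>inner h b\<bar> * norm (partial b u x) \<le> norm h * C b"
    by (rule mult_mono[OF Basis_le_norm[OF b] C[OF b]]) auto
   then show "norm (inner h b *\<^sub>R partial b u x) \<le> norm h * C b" by simp
  qed
  also have "\<dots> = norm h * (\<Sum>b\<in>Basis. C b)" by (rule sum_distrib_left[symmetric])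
  also have "\<dots> \<le> L * norm h" by (simp add: L_def algebra_simps)
  finally show "norm (frechet_derivative u (at x) h) \<le> L * norm h" .
 qed
 have "norm (u x - u y) \<le> L * norm (x - y)" for x y
  by (rule differentiable_bound[of UNIV u "\<lambda>x. frechet_derivative u (at x)"])
   (simp_all add: on has_derivative_partial[OF test_differentiable[OF u]])
 then show ?thesis using L that by blast
qed

text \<open>Lipschitz continuity of the partial derivatives makes the second-order remainder uniform
  in the base point; this uniformity is what permits integrating the remainder over the
  space.\<close>

lemma test_taylor:
 fixes u :: "'a::euclidean_space \<Rightarrow> complex"
 assumes u: "u \<in> test_functions UNIV"
 obtains C where "C > 0" "\<And>z h. cmod (u (z + h) - u z - (\<Sum>b\<in>Basis. inner h b *\<^sub>R partial b u z)) \<le> C * (norm h)^2"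
proof -
 have "\<forall>b\<in>Basis. \<exists>L>0. \<forall>x y. cmod (partial b u x - partial b u y) \<le> L * norm (x - y)"
  using test_lipschitz[OF test_partial[OF u]] by metis
 then obtain L where L: "\<And>b. b \<in> Basis \<Longrightarrow> L b > 0"
  "\<And>b x y. b \<in> Basis \<Longrightarrow> cmod (partial b u x - partial b u y) \<le> L b * norm (x - y)" by metis
 define C where "C = (\<Sum>b\<in>Basis. L b) + 1"
 have "0 \<le> (\<Sum>b\<in>Basis. L b)" by (rule sum_nonneg) (use L(1) in \<open>force intro: less_imp_le\<close>)
 then have C: "C > 0" by (simp add: C_def)
 have "cmod (u (z + h) - u z - (\<Sum>b\<in>Basis. inner h b *\<^sub>R partial b u z)) \<le> C * (norm h)^2" for z h
 proof -
  define D where "D = (\<lambda>x. frechet_derivative u (at x) h)"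
  \<comment> \<open>Subtracting the linear part leaves a curve whose derivative is itself of order
    \<open>|h|^2\<close>, so the mean value inequality gives the claim.\<close>
  define F where "F = (\<lambda>s. u (z + s *\<^sub>R h) - s *\<^sub>R D z)"
  have D: "D x = (\<Sum>b\<in>Basis. inner h b *\<^sub>R partial b u x)" for x
   unfolding D_def by (rule frechet_derivative_eq_sum[OF test_differentiable[OF u]])
  have F': "(F has_derivative (\<lambda>t. t *\<^sub>R (D (z + s *\<^sub>R h) - D z))) (at s within {0..1})" for s
  proof -
   have "((\<lambda>s. z + s *\<^sub>R h) has_derivative (\<lambda>t. t *\<^sub>R h)) (at s)" by (auto intro!: derivative_eq_intros)
   from has_derivative_compose[OF this has_derivative_partial[OF test_differentiable[OF u]]]
   have "((\<lambda>s. u (z + s *\<^sub>R h)) has_derivative (\<lambda>t. t *\<^sub>R D (z + s *\<^sub>R h))) (at s)"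
    using linear_cmul[OF has_derivative_linear[OF has_derivative_partial[OF test_differentiable[OF u]]]]
    by (simp add: D_def)
   moreover have "((\<lambda>s. s *\<^sub>R D z) has_derivative (\<lambda>t. t *\<^sub>R D z)) (at s)"
    by (auto intro!: derivative_eq_intros)
   ultimately have "(F has_derivative (\<lambda>t. t *\<^sub>R D (z + s *\<^sub>R h) - t *\<^sub>R D z)) (at s)"
    unfolding F_def by (rule has_derivative_diff)
   then have "(F has_derivative (\<lambda>t. t *\<^sub>R (D (z + s *\<^sub>R h) - D z))) (at s)" by (simp only: scaleR_diff_right)
   then show ?thesis by (rule has_derivative_at_withinI)
  qed
  have on: "onorm (\<lambda>t. t *\<^sub>R (D (z + s *\<^sub>R h) - D z)) \<le> C * (norm h)^2" if s: "s \<in> {0..1}" for s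
  proof (rule onorm_le)
   fix t :: real
   have "cmod (D (z + s *\<^sub>R h) - D z) = cmod (\<Sum>b\<in>Basis. inner h b *\<^sub>R (partial b u (z + s *\<^sub>R h) - partial b u z))"
    by (simp add: D scaleR_diff_right sum_subtractf)
   also have "\<dots> \<le> (\<Sum>b\<in>Basis. norm h * (L b * norm h))"
   proof (rule order_trans[OF norm_sum sum_mono])
    fix b :: 'a assume b: "b \<in> Basis"
    have "cmod (partial b u (z + s *\<^sub>R h) - partial b u z) \<le> L b * norm (s *\<^sub>R h)"
     using L(2)[OF b, of "z + s *\<^sub>R h" z] by simp
    also have "\<dots> \<le> L b * norm h" using s L(1)[OF b] by (intro mult_left_mono) (auto simp: mult_left_le_one_le)
    finally show "cmod (inner h b *\<^sub>R (partial b u (z + s *\<^sub>R h) - partial b u z)) \<le> norm h * (L b * norm h)"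
     using mult_mono[OF Basis_le_norm[OF b, of h]] by fastforce
   qed
   also have "\<dots> = (\<Sum>b\<in>Basis. L b) * (norm h)^2"
    unfolding sum_distrib_right by (rule sum.cong) (simp_all add: power2_eq_square)
   also have "\<dots> \<le> C * (norm h)^2" by (intro mult_right_mono) (simp_all add: C_def)
   finally have "\<bar>t\<bar> * cmod (D (z + s *\<^sub>R h) - D z) \<le> \<bar>t\<bar> * (C * (norm h)^2)" by (intro mult_left_mono) auto
   then show "cmod (t *\<^sub>R (D (z + s *\<^sub>R h) - D z)) \<le> C * (norm h)^2 * norm t" by (simp add: mult.commute)
  qed
  have "norm (F 1 - F 0) \<le> C * (norm h)^2 * norm (1 - 0 :: real)"
   by (rule differentiable_bound[OF _ F' on]) auto
  then show ?thesis by (simp add: F_def D algebra_simps)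
 qed
 then show ?thesis using C that by blast
qed

text \<open>By translation invariance the integral of a difference quotient is zero. The quotient
  differs from the partial derivative by at most a multiple of \<open>t\<close>, and only inside a
  fixed ball, so the integral of the derivative vanishes.\<close>

lemma integral_partial_zero:
 fixes u :: "'a::euclidean_space \<Rightarrow> complex"
 assumes u: "u \<in> test_functions \<Omega>" and b: "b \<in> Basis"
 shows "(LINT x|lborel. partial b u x) = 0"
proof -
 obtain K where K: "compact K" "K \<subseteq> \<Omega>" "\<And>x. x \<notin> K \<Longrightarrow> u x = 0" by (rule test_functionsD[OF u]) blast
 obtain R where R: "\<And>x. x \<in> K \<Longrightarrow> norm x \<le> R" using compact_imp_bounded[OF K(1)] bounded_iff by metis
 obtain C where C: "C > 0"
  "\<And>z h. cmod (u (z + h) - u z - (\<Sum>b\<in>Basis. inner h b *\<^sub>R partial b u z)) \<le> C * (norm h)^2"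
  by (rule test_taylor[OF test_UNIV[OF u]]) blast
 note [measurable] = smooth_measurable[OF test_smooth[OF u]] smooth_measurable[OF test_smooth[OF test_partial[OF u b]]]
 note i = test_integrable[OF u] test_integrable[OF test_partial[OF u b]]
 define I where "I = (LINT x|lborel. partial b u x)"
 \<comment> \<open>The volume of a ball that contains the supports of \<open>u\<close> and of all
   its translates by steps of length at most 1.\<close>
 define M where "M = (LINT x|lborel. indicat_real (cball 0 (R + 1)) (x::'a))"
 have ind: "integrable lborel (\<lambda>x::'a. indicat_real (cball 0 (R + 1)) x)"
  using emeasure_compact_finite[OF compact_cball, of "0::'a" "R + 1"] by (intro integrable_real_indicator) auto
 have le: "cmod I \<le> C * M * t" if t: "0 < t" "t \<le> 1" for t
 proof -
  define r where "r x = u (x + t *\<^sub>R b) - u x - t *\<^sub>R partial b u x" for x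
  have it: "integrable lborel (\<lambda>x. u (x + t *\<^sub>R b))"
  proof -
   have "integrable (distr lborel borel ((+) (t *\<^sub>R b))) u" using i(1) by (simp add: lborel_distr_plus)
   then have "integrable lborel (\<lambda>x. u (t *\<^sub>R b + x))" by (subst (asm) integrable_distr_eq) auto
   then show ?thesis by (simp add: add.commute)
  qed
  have rb: "cmod (r x) \<le> C * t\<^sup>2 * indicat_real (cball 0 (R + 1)) x" for x
  proof (cases "norm x \<le> R + 1")
   case True
   have "(\<Sum>c\<in>Basis. inner (t *\<^sub>R b) c *\<^sub>R partial c u x) = (\<Sum>c\<in>Basis. if c = b then t *\<^sub>R partial b u x else 0)"
    by (rule sum.cong) (auto simp: inner_Basis b)
   then show ?thesis using C(2)[of x "t *\<^sub>R b"] True b t(1) by (simp add: r_def)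
  next
   case False
   have "norm x \<le> norm (x + t *\<^sub>R b) + norm (t *\<^sub>R b)"
    using norm_triangle_ineq4[of "x + t *\<^sub>R b" "t *\<^sub>R b"] by simp
   then have "x + t *\<^sub>R b \<notin> K" "x \<notin> K" using R[of x] R[of "x + t *\<^sub>R b"] False b t by auto
   then show ?thesis
    using K(3) partial_zero_outside[OF compact_imp_closed[OF K(1)] K(3)] False by (simp add: r_def)
  qed
  have "(LINT x|lborel. r x) = - (t *\<^sub>R I)"
   unfolding r_def I_def using i it lborel_integral_translate[of u "t *\<^sub>R b"] by simp
  then have "t * cmod I = cmod (LINT x|lborel. r x)" using t(1) by simp
  also have "\<dots> \<le> (LINT x|lborel. C * t\<^sup>2 * indicat_real (cball 0 (R + 1)) (x::'a))"
   by (rule Bochner_Integration.integral_norm_bound_integral) (use i it ind rb in \<open>auto simp: r_def\<close>)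
  also have "\<dots> = t * (C * M * t)" by (simp add: M_def power2_eq_square)
  finally show ?thesis using t(1) by simp
 qed
 have "cmod I \<le> C * M * inverse (real (Suc n))" for n by (rule le) (simp_all add: inverse_le_1_iff)
 moreover have "(\<lambda>n. C * M * inverse (real (Suc n))) \<longlonglongrightarrow> C * M * 0"
  by (intro tendsto_intros LIMSEQ_inverse_real_of_nat)
 ultimately have "cmod I \<le> C * M * 0" by (intro LIMSEQ_le_const[of _ "C * M * 0"]) auto
 then show ?thesis by (simp add: I_def)
qed

lemma integration_by_parts:
 assumes f: "smooth f" and g: "g \<in> test_functions \<Omega>" and b: "b \<in> Basis"
 shows "(LINT x|lborel. f x * partial b g x) = - (LINT x|lborel. partial b f x * g x)"
proof -
 have i: "integrable lborel (\<lambda>x. f x * partial b g x)" "integrable lborel (\<lambda>x. partial b f x * g x)"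
  using test_integrable[OF test_mult[OF f test_partial[OF g b]]]
   test_integrable[OF test_mult[OF smooth_partial[OF f b] g]] by auto
 have "partial b (\<lambda>x. f x * g x) = (\<lambda>x. f x * partial b g x + partial b f x * g x)"
  by (intro ext partial_mult smooth_differentiable[OF f] test_differentiable[OF g])
 then have "0 = (LINT x|lborel. f x * partial b g x + partial b f x * g x)"
  using integral_partial_zero[OF test_mult[OF f g] b] by simp
 also have "\<dots> = (LINT x|lborel. f x * partial b g x) + (LINT x|lborel. partial b f x * g x)" using i by simp
 finally show ?thesis by (simp add: eq_neg_iff_add_eq_0)
qed

subsection \<open>A smooth bump\<close>

text \<open>The polynomial in \<open>1 / t\<close> is kept as a parameter because it makes this
  family of flat functions closed under differentiation.\<close>

definition bump_base :: "real poly \<Rightarrow> real \<Rightarrow> real" where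
 "bump_base p t = (if t > 0 then poly p (1 / t) * exp (- (1 / t)) else 0)"

text \<open>The derivative of \<open>p (1 / t) exp (- 1 / t)\<close> is
  \<open>t^-2 (p (1 / t) - p' (1 / t)) exp (- 1 / t)\<close>; the monomial is the factor
  \<open>t^-2\<close>.\<close>

definition bump_next :: "real poly \<Rightarrow> real poly" where
 "bump_next p = monom 1 2 * (p - pderiv p)"

lemma poly_times_exp_tendsto_0: "((\<lambda>s. poly p s * exp (- s)) \<longlongrightarrow> (0::real)) at_top"
proof -
 have "((\<lambda>s. \<Sum>i\<le>degree p. coeff p i * (s ^ i / exp s)) \<longlongrightarrow> (\<Sum>i\<le>degree p. coeff p i * 0)) at_top"
  by (intro tendsto_intros tendsto_power_div_exp_0)
 moreover have "poly p s * exp (- s) = (\<Sum>i\<le>degree p. coeff p i * (s ^ i / exp s))" for s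
  by (simp add: poly_altdef exp_minus sum_distrib_left divide_inverse mult_ac)
 ultimately show ?thesis by simp
qed

text \<open>Only the origin is delicate. From the right the difference quotient is again a
  polynomial in \<open>1 / t\<close>, with one more factor \<open>1 / t\<close>, times
  \<open>exp (- 1 / t)\<close>, and the exponential wins.\<close>

lemma bump_base_has_derivative: "(bump_base p has_real_derivative bump_base (bump_next p) t) (at t)"
proof -
 consider "t > 0" | "t < 0" | "t = 0" by linarith
 then show ?thesis
 proof cases
  case 1
  have "((\<lambda>t. poly p (1 / t) * exp (- (1 / t))) has_real_derivative
    poly (pderiv p) (1 / t) * (- 1 / t\<^sup>2) * exp (- (1 / t)) + exp (- (1 / t)) * (1 / t\<^sup>2) * poly p (1 / t)) (at t)"
   using 1 by (auto intro!: derivative_eq_intros poly_DERIV[THEN DERIV_chain2] simp: power2_eq_square divide_inverse)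
  moreover have "poly (pderiv p) (1 / t) * (- 1 / t\<^sup>2) * exp (- (1 / t)) + exp (- (1 / t)) * (1 / t\<^sup>2) * poly p (1 / t)
    = bump_base (bump_next p) t"
   using 1 by (simp add: bump_base_def bump_next_def poly_monom power_one_over algebra_simps)
  ultimately have "((\<lambda>t. poly p (1 / t) * exp (- (1 / t))) has_real_derivative bump_base (bump_next p) t) (at t)" by simp
  then show ?thesis by (rule has_field_derivative_transform_within_open[of _ _ _ "{0<..}"])
    (use 1 in \<open>auto simp: bump_base_def\<close>)
 next
  case 2
  have "((\<lambda>t. 0) has_real_derivative 0) (at t)" by simp
  then have "(bump_base p has_real_derivative 0) (at t)"
   by (rule has_field_derivative_transform_within_open[of _ _ _ "{..<0}"])
    (use 2 in \<open>auto simp: bump_base_def\<close>)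
  then show ?thesis using 2 by (simp add: bump_base_def)
 next
  case 3
  have "((\<lambda>t. bump_base p t / t) \<longlongrightarrow> 0) (at_left 0)" by (rule Lim_transform_eventually[OF tendsto_const])
    (auto simp: eventually_at_filter bump_base_def)
  moreover have "((\<lambda>t. bump_base p t / t) \<longlongrightarrow> 0) (at_right 0)"
  proof (rule Lim_transform_eventually)
   show "((\<lambda>t. poly (pCons 0 p) (inverse t) * exp (- inverse t)) \<longlongrightarrow> 0) (at_right 0)"
    by (rule filterlim_compose[OF poly_times_exp_tendsto_0 filterlim_inverse_at_top_right])
   show "\<forall>\<^sub>F t in at_right 0. poly (pCons 0 p) (inverse t) * exp (- inverse t) = bump_base p t / t"
    by (rule eventually_mono[OF eventually_at_right_less]) (simp add: bump_base_def divide_inverse mult_ac)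
  qed
  ultimately have "((\<lambda>t. bump_base p t / t) \<longlongrightarrow> 0) (at 0)" by (simp add: filterlim_at_split)
  then show ?thesis using 3 by (simp add: has_field_derivative_iff bump_base_def)
 qed
qed

text \<open>The \<open>n\<close>-th derivative of the function that equals
  \<open>exp (- 1 / t)\<close> for positive \<open>t\<close> and 0 elsewhere.\<close>

definition bump :: "nat \<Rightarrow> real \<Rightarrow> real" where
 "bump n = bump_base ((bump_next ^^ n) 1)"

lemma bump_has_derivative: "(bump n has_real_derivative bump (Suc n) t) (at t)"
 by (simp add: bump_def bump_base_has_derivative)

lemma bump_nonpos: "t \<le> 0 \<Longrightarrow> bump n t = 0" by (simp add: bump_def bump_base_def)

lemma bump_0: "0 < t \<Longrightarrow> bump 0 t = exp (- (1 / t))" by (simp add: bump_def bump_base_def)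

lemma bump_1: "0 < t \<Longrightarrow> bump (Suc 0) t = (1 / t)^2 * exp (- (1 / t))"
 by (simp add: bump_def bump_base_def bump_next_def poly_monom)

lemma bump_2: "0 < t \<Longrightarrow> bump (Suc (Suc 0)) t = ((1 / t) ^ 4 - 2 * (1 / t) ^ 3) * exp (- (1 / t))"
 by (simp add: bump_def bump_base_def bump_next_def poly_monom pderiv_monom pderiv_mult algebra_simps eval_nat_numeral)

lemma bump_0_pos: "0 < t \<Longrightarrow> 0 < bump 0 t" by (simp add: bump_0)
lemma bump_0_nonneg: "0 \<le> bump 0 t" by (cases "t > 0") (simp_all add: bump_0 bump_nonpos)
lemma bump_0_le_1: "bump 0 t \<le> 1" by (cases "t > 0") (simp_all add: bump_0 bump_nonpos)

lemma smooth_bump: "smooth (\<lambda>x. complex_of_real (g x)) \<Longrightarrow> smooth (\<lambda>x. complex_of_real (bump n (g x)))"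
 by (erule smooth_compose_real) (rule bump_has_derivative)

lemma power_exp_le_fact: "0 \<le> x \<Longrightarrow> x ^ n * exp (- x) \<le> (fact n :: real)"
proof -
 assume x: "0 \<le> x"
 have "(\<Sum>k\<in>{n}. x ^ k /\<^sub>R fact k) \<le> (\<Sum>k. x ^ k /\<^sub>R fact k)"
  by (rule sum_le_suminf) (use x summable_exp_generic[of x] in auto)
 then have "x ^ n / fact n \<le> exp x" by (simp add: exp_def divide_inverse mult.commute)
 then show ?thesis by (simp add: exp_minus field_simps)
qed

text \<open>With \<open>x = 1 / t\<close> the left-hand side is \<open>(x + x^2) exp (- x)\<close>,
  at most \<open>1! + 2! = 3\<close>. The weight \<open>t + 1\<close> dominates the term
  \<open>\<bar>c\<bar> |x|^2\<close> for the cutoffs built later with argument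
  \<open>t = c |x|^2 + d\<close>.\<close>

lemma bump_1_bound: "0 < t \<Longrightarrow> \<bar>bump (Suc 0) t\<bar> * (t + 1) \<le> 3"
proof -
 assume t: "0 < t"
 define x where "x = 1 / t"
 have x: "x > 0" "t = 1 / x" using t by (auto simp: x_def)
 have "\<bar>bump (Suc 0) t\<bar> = x ^ 2 * exp (- x)" by (simp add: bump_1[OF t] x_def)
 moreover have "x ^ 2 * exp (- x) * (1 / x + 1) = x ^ 1 * exp (- x) + x ^ 2 * exp (- x)"
  using x(1) by (simp add: field_simps power2_eq_square)
 ultimately have "\<bar>bump (Suc 0) t\<bar> * (t + 1) = x ^ 1 * exp (- x) + x ^ 2 * exp (- x)" using x(2) by simp
 also have "\<dots> \<le> fact 1 + fact 2" using x by (intro add_mono power_exp_le_fact) auto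
 finally show ?thesis by simp
qed

text \<open>Expanding in \<open>x = 1 / t\<close> gives the constant
  \<open>4! + 4 * 3! + 5 * 2! + 2 * 1! = 60\<close>.\<close>

lemma bump_2_bound: "0 < t \<Longrightarrow> \<bar>bump (Suc (Suc 0)) t\<bar> * (t + 1)^2 \<le> 60"
proof -
 assume t: "0 < t"
 define x where "x = 1 / t"
 have x: "x > 0" "t = 1 / x" using t by (auto simp: x_def)
 have "\<bar>bump (Suc (Suc 0)) t\<bar> = \<bar>x ^ 4 - 2 * x ^ 3\<bar> * exp (- x)"
  by (simp add: bump_2[OF t] x_def[symmetric] abs_mult)
 also have "\<dots> \<le> (x ^ 4 + 2 * x ^ 3) * exp (- x)"
  using x(1) abs_triangle_ineq4[of "x ^ 4" "2 * x ^ 3"] by (intro mult_right_mono) (auto simp: abs_mult)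
 finally have "\<bar>bump (Suc (Suc 0)) t\<bar> * (t + 1)^2 \<le> (x ^ 4 + 2 * x ^ 3) * exp (- x) * (t + 1)^2"
  by (rule mult_right_mono) simp
 also have "\<dots> = x ^ 4 * exp (- x) + 4 * (x ^ 3 * exp (- x)) + 5 * (x ^ 2 * exp (- x)) + 2 * (x ^ 1 * exp (- x))"
  using x(1) unfolding x(2) by (simp add: field_simps eval_nat_numeral)
 also have "\<dots> \<le> fact 4 + 4 * fact 3 + 5 * fact 2 + 2 * fact 1"
  using x by (intro add_mono mult_left_mono power_exp_le_fact) auto
 also have "\<dots> = (60::real)" by (simp add: fact_numeral)
 finally show ?thesis .
qed

section \<open>Density of test functions and mollification\<close>

lemma bump_0_tendsto_1: assumes "filterlim g at_top F" shows "((\<lambda>n. bump 0 (g n)) \<longlongrightarrow> 1) F"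
proof (rule Lim_transform_eventually)
 have "((\<lambda>n. exp (- inverse (g n))) \<longlongrightarrow> exp (- 0)) F" by (intro tendsto_intros tendsto_inverse_0_at_top assms)
 then show "((\<lambda>n. exp (- inverse (g n))) \<longlongrightarrow> 1) F" by simp
 have "\<forall>\<^sub>F n in F. 0 < g n" using assms by (simp add: filterlim_at_top_dense)
 then show "\<forall>\<^sub>F n in F. exp (- inverse (g n)) = bump 0 (g n)"
  by eventually_elim (simp add: bump_0 inverse_eq_divide)
qed

lemma filterlim_linear_at_top:
 assumes "0 < s" shows "filterlim (\<lambda>n. real (Suc n) * s + c) at_top sequentially"
proof -
 have "filterlim (\<lambda>n. c + s * real (Suc n)) at_top sequentially"
  by (intro filterlim_tendsto_add_at_top[OF tendsto_const]
    filterlim_tendsto_pos_mult_at_top[OF tendsto_const assms]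
    filterlim_compose[OF filterlim_real_sequentially filterlim_Suc])
 then show ?thesis by (simp add: add.commute mult.commute)
qed

lemma smooth_linear_norm_square: "smooth (\<lambda>x::'a::euclidean_space. complex_of_real (c * (norm x)^2 + d))"
 unfolding of_real_add of_real_mult[of c] by (intro smooth_add smooth_mult smooth_const smooth_norm_square)

lemma smooth_linear_inner: "smooth (\<lambda>x::'a::euclidean_space. complex_of_real (c * inner x a + d))"
 unfolding of_real_add of_real_mult[of c] by (intro smooth_add smooth_mult smooth_const smooth_inner)

text \<open>Bumps at both ends of every coordinate interval approximate the indicator of the open
  box from inside. The additional factor removes a shrinking ball around the origin, where the test
  functions have to vanish; in the limit it affects only one point.\<close>

lemma box_cutoff:
 fixes a b :: "'a::euclidean_space"
 obtains r :: "nat \<Rightarrow> 'a \<Rightarrow> real" where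
  "\<And>n. (\<lambda>x. complex_of_real (r n x)) \<in> test_functions (- {0})"
  "\<And>n x. \<bar>r n x\<bar> \<le> indicator (cbox a b) x"
  "\<And>x. x \<noteq> 0 \<Longrightarrow> (\<lambda>n. r n x) \<longlonglongrightarrow> indicator (box a b) x"
proof -
 define P where "P n x i = bump 0 (real (Suc n) * inner x i + - real (Suc n) * inner a i)
  * bump 0 (- real (Suc n) * inner x i + real (Suc n) * inner b i)" for n x i
 define r where "r n x = bump 0 (real (Suc n) * (norm x)^2 + - 1) * (\<Prod>i\<in>Basis. P n x i)" for n x
 have P01: "0 \<le> P n x i" "P n x i \<le> 1" for n x i
  unfolding P_def using bump_0_nonneg bump_0_le_1 by (auto intro!: mult_nonneg_nonneg mult_le_one)
 have P0: "P n x i = 0" if "inner x i \<le> inner a i \<or> inner b i \<le> inner x i" for n x i using that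
 proof
  assume "inner x i \<le> inner a i"
  from mult_left_mono[OF this, of "real (Suc n)"]
  have "real (Suc n) * inner x i + - real (Suc n) * inner a i \<le> 0" by (simp del: of_nat_Suc)
  then show ?thesis unfolding P_def by (simp only: bump_nonpos mult_zero_left)
 next
  assume "inner b i \<le> inner x i"
  from mult_left_mono[OF this, of "real (Suc n)"]
  have "- real (Suc n) * inner x i + real (Suc n) * inner b i \<le> 0" by (simp del: of_nat_Suc)
  then show ?thesis unfolding P_def by (simp only: bump_nonpos mult_zero_right)
 qed
 have r01: "0 \<le> r n x" "r n x \<le> 1" for n x unfolding r_def using P01 bump_0_nonneg bump_0_le_1
  by (auto intro!: mult_nonneg_nonneg mult_le_one prod_nonneg prod_le_1)
 have rbox: "r n x = 0" if xb: "x \<notin> box a b" for n x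
 proof -
  obtain i where "i \<in> Basis" "inner x i \<le> inner a i \<or> inner b i \<le> inner x i"
   using xb unfolding mem_box by (metis linorder_not_less)
  then have "(\<Prod>i\<in>Basis. P n x i) = 0" using P0 by (intro prod_zero) auto
  then show ?thesis by (simp add: r_def)
 qed
 show ?thesis
 proof (rule that[of r])
  fix n
  show "(\<lambda>x. complex_of_real (r n x)) \<in> test_functions (- {0})"
  proof (rule test_functionsI)
   show "smooth (\<lambda>x. complex_of_real (r n x))" unfolding r_def P_def of_real_mult of_real_prod
    by (intro smooth_mult smooth_prod smooth_bump smooth_linear_norm_square smooth_linear_inner)
   define K where "K = cbox a b \<inter> {x. 1 \<le> real (Suc n) * (norm x)^2}"
   have "closed {x::'a. 1 \<le> real (Suc n) * (norm x)^2}" by (intro closed_Collect_le continuous_intros)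
   then show "compact K" unfolding K_def by (intro compact_Int_closed compact_cbox)
   show "K \<subseteq> - {0}" by (auto simp: K_def)
   fix x assume "x \<notin> K"
   then consider "x \<notin> box a b" | "real (Suc n) * (norm x)^2 < 1"
    using box_subset_cbox[of a b] by (auto simp: K_def not_le)
   then show "complex_of_real (r n x) = 0"
   proof cases
    case 1 show ?thesis using rbox[OF 1, of n] by simp
   next
    case 2
    then have "real (Suc n) * (norm x)^2 + - 1 \<le> 0" by linarith
    then show ?thesis unfolding r_def by (simp only: bump_nonpos mult_zero_left of_real_0)
   qed
  qed
  show "\<bar>r n x\<bar> \<le> indicator (cbox a b) x" for x
   using r01[of n x] rbox[of x n] box_subset_cbox[of a b] by (cases "x \<in> cbox a b") auto
 next
  fix x :: 'a assume x: "x \<noteq> 0"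
  show "(\<lambda>n. r n x) \<longlonglongrightarrow> indicator (box a b) x"
  proof (cases "x \<in> box a b")
   case True
   have "(\<lambda>n. P n x i) \<longlonglongrightarrow> 1 * 1" if i: "i \<in> Basis" for i unfolding P_def
   proof (intro tendsto_mult bump_0_tendsto_1)
    have "inner x i - inner a i > 0" "inner b i - inner x i > 0" using True i by (auto simp: mem_box)
    then have *: "filterlim (\<lambda>n. real (Suc n) * (inner x i - inner a i) + 0) at_top sequentially"
     "filterlim (\<lambda>n. real (Suc n) * (inner b i - inner x i) + 0) at_top sequentially"
     using filterlim_linear_at_top by blast+
    show "filterlim (\<lambda>n. real (Suc n) * inner x i + - real (Suc n) * inner a i) at_top sequentially"
     using *(1) by (simp add: right_diff_distrib del: of_nat_Suc)
    show "filterlim (\<lambda>n. - real (Suc n) * inner x i + real (Suc n) * inner b i) at_top sequentially"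
     using *(2) by (simp add: right_diff_distrib add.commute del: of_nat_Suc)
   qed
   then have "(\<lambda>n. r n x) \<longlonglongrightarrow> 1 * (\<Prod>i\<in>(Basis::'a set). 1 * 1)" unfolding r_def using x
    by (intro tendsto_mult bump_0_tendsto_1 tendsto_prod filterlim_linear_at_top) auto
   then show ?thesis using True by simp
  next
   case False then show ?thesis by (simp add: rbox)
  qed
 qed
qed

text \<open>Approximating indicators shows that all integrals over boxes vanish; Lebesgue
  differentiation along the cubes from \<open>x\<close> to \<open>x + h One\<close> then gives
  \<open>f x = 0\<close> outside a negligible set.\<close>

lemma fundamental_lemma:
 fixes f :: "'a::euclidean_space \<Rightarrow> complex"
 assumes f: "f \<in> L2" and orth: "\<And>\<phi>. \<phi> \<in> test_functions (- {0}) \<Longrightarrow> (LINT x|lborel. f x * \<phi> x) = 0"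
 shows "AE x in lborel. f x = 0"
proof -
 note [measurable] = L2_measurable[OF f]
 have indL2: "(\<lambda>x. complex_of_real (indicator (cbox a b) x)) \<in> L2" for a b :: 'a
  by (rule L2_bounded_support(1)[of _ 1 "cbox a b"]) (auto simp: indicator_def)
 have box_int: "integrable lborel (\<lambda>x. f x * complex_of_real (indicator (cbox a b) x))" for a b
  by (rule L2_mult_integrable[OF f indL2])
 have zero: "(LINT x|lborel. f x * complex_of_real (indicator (box a b) x)) = 0" for a b
 proof -
  obtain r :: "nat \<Rightarrow> 'a \<Rightarrow> real" where r:
   "\<And>n. (\<lambda>x. complex_of_real (r n x)) \<in> test_functions (- {0})"
   "\<And>n x. \<bar>r n x\<bar> \<le> indicator (cbox a b) x"
   "\<And>x. x \<noteq> 0 \<Longrightarrow> (\<lambda>n. r n x) \<longlonglongrightarrow> indicator (box a b) x" by (rule box_cutoff[of a b]) blast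
  have [measurable]: "(\<lambda>x. complex_of_real (r n x)) \<in> borel_measurable borel" for n
   by (rule smooth_measurable[OF test_smooth[OF r(1)]])
  have "(\<lambda>n. LINT x|lborel. f x * complex_of_real (r n x)) \<longlonglongrightarrow> (LINT x|lborel. f x * complex_of_real (indicator (box a b) x))"
  proof (rule integral_dominated_convergence[where w = "\<lambda>x. norm (f x * complex_of_real (indicator (cbox a b) x))"])
   show "integrable lborel (\<lambda>x. norm (f x * complex_of_real (indicator (cbox a b) x)))"
    by (rule integrable_norm[OF box_int])
   show "AE x in lborel. (\<lambda>n. f x * complex_of_real (r n x)) \<longlonglongrightarrow> f x * complex_of_real (indicator (box a b) x)"
    using AE_lborel_singleton[of "0::'a"]
   proof eventually_elim
    case (elim x)
    then show ?case by (intro tendsto_intros r(3))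
   qed
   show "AE x in lborel. norm (f x * complex_of_real (r n x)) \<le> norm (f x * complex_of_real (indicator (cbox a b) x))" for n
   proof (rule AE_I2)
    fix x show "norm (f x * complex_of_real (r n x)) \<le> norm (f x * complex_of_real (indicator (cbox a b) x))"
     using r(2)[of n x] unfolding norm_mult by (intro mult_left_mono) auto
   qed
  qed measurable
  moreover have "(LINT x|lborel. f x * complex_of_real (r n x)) = 0" for n by (rule orth[OF r(1)])
  ultimately show ?thesis by (simp add: LIMSEQ_const_iff)
 qed
 have HK: "(f has_integral 0) (cbox a b)" for a b
 proof -
  have "integrable lborel (\<lambda>x. f x * complex_of_real (indicator (box a b) x))"
   by (rule Bochner_Integration.integrable_bound[OF box_int[of a b]])
    (auto simp: indicator_def box_subset_cbox[THEN subsetD])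
  from has_integral_integral_lborel[OF this]
  have "((\<lambda>x. f x * complex_of_real (indicator (box a b) x)) has_integral 0) UNIV" by (simp add: zero)
  moreover have "(\<lambda>x. f x * complex_of_real (indicator (box a b) x)) = (\<lambda>x. if x \<in> box a b then f x else 0)"
   by (auto simp: indicator_def)
  ultimately have "(f has_integral 0) (box a b)" using has_integral_restrict_UNIV[of "box a b" f 0] by simp
  then show ?thesis by (simp add: has_integral_open_interval)
 qed
 obtain N where N: "negligible N"
  "\<And>x e. \<lbrakk>x \<notin> N; 0 < e\<rbrakk> \<Longrightarrow> \<exists>d>0. \<forall>h. 0 < h \<and> h < d \<longrightarrow>
    norm (integral (cbox x (x + h *\<^sub>R One)) f /\<^sub>R h ^ DIM('a) - f x) < e"
  by (rule integrable_ccontinuous_explicit[OF has_integral_integrable[OF HK]]) blast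
 have "f x = 0" if xN: "x \<notin> N" for x
 proof (rule ccontr)
  assume "f x \<noteq> 0"
  then obtain d where d: "d > 0" "\<And>h. 0 < h \<and> h < d \<Longrightarrow>
    norm (integral (cbox x (x + h *\<^sub>R One)) f /\<^sub>R h ^ DIM('a) - f x) < norm (f x)"
   using N(2)[OF xN, of "norm (f x)"] by auto
  moreover have "integral (cbox x (x + (d/2) *\<^sub>R One)) f = 0" by (rule integral_unique[OF HK])
  ultimately show False using d(2)[of "d/2"] by simp
 qed
 then have "{x. f x \<noteq> 0} \<subseteq> N" by auto
 then have "negligible {x. f x \<noteq> 0}" using N(1) negligible_subset by blast
 moreover have "{x. f x \<noteq> 0} \<in> sets lborel" by measurable
 ultimately have "{x. f x \<noteq> 0} \<in> null_sets lborel"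
  using null_sets_completion_iff[of "{x. f x \<noteq> 0}" lborel] by (simp add: negligible_iff_null_sets)
 then show ?thesis by (rule AE_I') simp
qed

text \<open>The density criterion supplies only real orthogonality. Testing with a function and with
  \<open>i\<close> times it recovers complex orthogonality, to which the fundamental lemma
  applies.\<close>

lemma test_dense: "closure (l2of ` test_functions (- {0::'a::euclidean_space})) = UNIV"
proof (rule dense_subspaceI)
 let ?Q = "test_functions (- {0::'a})"
 show "subspace (l2of ` ?Q)"
 proof (rule subspaceI)
  show "0 \<in> l2of ` ?Q" using imageI[OF test_zero, of l2of "- {0}"] by (simp add: l2of_zero)
  show "x + y \<in> l2of ` ?Q" if xy: "x \<in> l2of ` ?Q" "y \<in> l2of ` ?Q" for x y
  proof -
   obtain u v where uv: "x = l2of u" "u \<in> ?Q" "y = l2of v" "v \<in> ?Q" using xy by blast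
   then have "x + y = l2of (\<lambda>x. u x + v x)" by (simp add: l2of_add test_L2)
   then show ?thesis using test_add[OF uv(2,4)] by blast
  qed
  show "c *\<^sub>R x \<in> l2of ` ?Q" if x: "x \<in> l2of ` ?Q" for c x
  proof -
   obtain u where u: "x = l2of u" "u \<in> ?Q" using x by blast
   then have "c *\<^sub>R x = l2of (\<lambda>x. of_real c * u x)" by (simp add: l2of_scaleC test_L2 scaleC_of_real)
   then show ?thesis using test_cmult[OF u(2)] by blast
  qed
 qed
 fix g :: "'a l2" assume orth: "\<And>x. x \<in> l2of ` ?Q \<Longrightarrow> inner g x = 0"
 have "AE x in lborel. rep_l2 g x = 0"
 proof (rule fundamental_lemma[OF rep_l2_L2])
  fix \<phi> :: "'a \<Rightarrow> complex" assume phi: "\<phi> \<in> ?Q"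
  let ?c = "\<lambda>x. cnj (\<phi> x)"
  have c: "?c \<in> ?Q" "(\<lambda>x. \<i> * ?c x) \<in> ?Q" using test_cnj[OF phi] test_cmult by blast+
  have "inner g (l2of ?c) = 0" "inner g (l2of (\<lambda>x. \<i> * ?c x)) = 0" using orth c by blast+
  then have "cinner g (l2of ?c) = 0" by (simp add: cinner_def complex_eq_iff l2of_scaleC[OF test_L2[OF c(1)]])
  then have "l2inner (rep_l2 g) ?c = 0" using cinner_l2of[OF rep_l2_L2 test_L2[OF c(1)], of g] by simp
  then show "(LINT x|lborel. rep_l2 g x * \<phi> x) = 0" by (simp add: l2inner_def)
 qed
 then have "l2of (rep_l2 g) = l2of (\<lambda>x. 0)" by (subst l2of_eq_iff) (auto simp: ae_eq_def)
 then show "g = 0" by (simp add: l2of_zero)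
qed

lemma nn_integral_reflect:
 fixes f :: "'a::euclidean_space \<Rightarrow> ennreal"
 assumes [measurable]: "f \<in> borel_measurable borel"
 shows "(\<integral>\<^sup>+x. f (t - x) \<partial>lborel) = (\<integral>\<^sup>+x. f x \<partial>lborel)"
proof -
 have "(\<integral>\<^sup>+x. f x \<partial>lborel) = (\<integral>\<^sup>+x. f x \<partial>density (distr lborel borel (\<lambda>x. t + (-1) *\<^sub>R x)) (\<lambda>_. \<bar>-1::real\<bar> ^ DIM('a)))"
  by (subst lborel_affine[of "-1" t]) auto
 also have "\<dots> = (\<integral>\<^sup>+x. f (t - x) \<partial>lborel)" by (simp add: nn_integral_density nn_integral_distr)
 finally show ?thesis by simp
qed

lemma nn_integral_translate:
 fixes f :: "'a::euclidean_space \<Rightarrow> ennreal"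
 assumes [measurable]: "f \<in> borel_measurable borel"
 shows "(\<integral>\<^sup>+x. f (x - t) \<partial>lborel) = (\<integral>\<^sup>+x. f x \<partial>lborel)"
proof -
 have "(\<integral>\<^sup>+x. f x \<partial>lborel) = (\<integral>\<^sup>+x. f x \<partial>distr lborel borel ((+) (- t)))" by (simp add: lborel_distr_plus)
 also have "\<dots> = (\<integral>\<^sup>+x. f (- t + x) \<partial>lborel)" by (rule nn_integral_distr) measurable
 finally show ?thesis by simp
qed

lemma test_reflect:
 fixes u :: "'a::euclidean_space \<Rightarrow> complex"
 assumes u: "u \<in> test_functions UNIV" shows "(\<lambda>y. u (x - y)) \<in> test_functions UNIV"
proof -
 obtain K where K: "compact K" "\<And>x. x \<notin> K \<Longrightarrow> u x = 0" by (rule test_functionsD[OF u]) blast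
 show ?thesis
 proof (rule test_functionsI)
  show "smooth (\<lambda>y. u (x - y))" using smooth_affine[OF test_smooth[OF u], of "-1" x] by (simp add: add.commute)
  show "compact ((\<lambda>k. x - k) ` K)" by (intro compact_continuous_image continuous_intros K(1))
  fix y assume "y \<notin> (\<lambda>k. x - k) ` K"
  then have "x - y \<notin> K" by (metis diff_diff_eq2 add_diff_cancel_left' image_eqI)
  then show "u (x - y) = 0" by (rule K(2))
 qed simp
qed

section \<open>Convolution and mollifiers\<close>

definition conv :: "('a::euclidean_space \<Rightarrow> complex) \<Rightarrow> ('a \<Rightarrow> complex) \<Rightarrow> 'a \<Rightarrow> complex" where
 "conv f \<rho> x = (LINT y|lborel. f y * \<rho> (x - y))"

lemma conv_integrable:
 "f \<in> L2 \<Longrightarrow> \<rho> \<in> test_functions UNIV \<Longrightarrow> integrable lborel (\<lambda>y. f y * \<rho> (x - y))"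
 by (intro L2_mult_integrable test_L2[OF test_reflect])

lemma conv_diff:
 assumes "f \<in> L2" "g \<in> L2" "\<rho> \<in> test_functions UNIV"
 shows "conv (\<lambda>x. f x - g x) \<rho> x = conv f \<rho> x - conv g \<rho> x"
 unfolding conv_def using conv_integrable[OF assms(1,3)] conv_integrable[OF assms(2,3)]
 by (simp add: left_diff_distrib)

lemma L2_integral_le:
 assumes f: "f \<in> L2" and g: "g \<in> L2" and c: "(l2norm g)^2 \<le> c\<^sup>2" "0 \<le> c"
 shows "cmod (LINT y|lborel. f y * g y) \<le> l2norm f * c"
proof -
 have "cmod (LINT y|lborel. f y * g y) = cmod (l2inner f (\<lambda>y. cnj (g y)))" by (simp add: l2inner_def)
 also have "\<dots> \<le> l2norm f * l2norm (\<lambda>y. cnj (g y))" by (intro cmod_l2inner_le f L2_cnj g)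
 also have "l2norm (\<lambda>y. cnj (g y)) = l2norm g" by (simp add: l2norm_def)
 also have "l2norm f * l2norm g \<le> l2norm f * c"
  using power2_le_imp_le[OF c] by (intro mult_left_mono) (simp_all add: l2norm_def)
 finally show ?thesis .
qed

text \<open>The derivative falls on the test function. Its Taylor remainder is of order
  \<open>|h|^2\<close> and, for \<open>|h| \<le> 1\<close>, lives in a fixed ball, so Cauchy-Schwarz
  against \<open>f\<close> leaves an error of order \<open>|h|^2\<close>.\<close>

lemma conv_has_derivative:
 fixes f \<rho> :: "'a::euclidean_space \<Rightarrow> complex"
 assumes f: "f \<in> L2" and rho: "\<rho> \<in> test_functions UNIV"
 shows "(conv f \<rho> has_derivative (\<lambda>h. \<Sum>b\<in>Basis. inner h b *\<^sub>R conv f (partial b \<rho>) x)) (at x)"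
proof -
 obtain C where C: "C > 0"
  "\<And>z h. cmod (\<rho> (z + h) - \<rho> z - (\<Sum>b\<in>Basis. inner h b *\<^sub>R partial b \<rho> z)) \<le> C * (norm h)^2"
  by (rule test_taylor[OF rho]) blast
 obtain K where K: "compact K" "\<And>x. x \<notin> K \<Longrightarrow> \<rho> x = 0" by (rule test_functionsD[OF rho]) blast
 obtain R where R: "\<And>x. x \<in> K \<Longrightarrow> norm x \<le> R" using compact_imp_bounded[OF K(1)] bounded_iff by metis
 note [measurable] = smooth_measurable[OF test_smooth[OF rho]]
 have [measurable]: "partial b \<rho> \<in> borel_measurable borel" if "b \<in> Basis" for b
  by (rule smooth_measurable[OF test_smooth[OF test_partial[OF rho that]]])
 define rem where "rem h y = \<rho> (x - y + h) - \<rho> (x - y) - (\<Sum>b\<in>Basis. inner h b *\<^sub>R partial b \<rho> (x - y))" for h y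
 define M where "M = measure lborel (cball x (R + 1))"
 have M: "M \<ge> 0" by (simp add: M_def)
 have rem_meas: "rem h \<in> borel_measurable borel" for h unfolding rem_def by measurable
 have rem: "rem h \<in> L2" "(l2norm (rem h))^2 \<le> (C * (norm h)^2 * sqrt M)^2" if h: "norm h \<le> 1" for h
 proof -
  have b: "cmod (rem h y) \<le> C * (norm h)^2" for y unfolding rem_def by (rule C(2))
  have z: "rem h y = 0" if "y \<notin> cball x (R + 1)" for y
  proof -
   have n: "norm (x - y) > R + 1" using that by (simp add: dist_norm)
   have "norm (x - y) \<le> norm (x - y + h) + norm h" using norm_triangle_ineq4[of "x - y + h" h] by simp
   then have "\<not> norm (x - y + h) \<le> R" "\<not> norm (x - y) \<le> R" using n h by linarith+
   then have k: "x - y + h \<notin> K" "x - y \<notin> K" using R by blast+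
   have "partial b \<rho> (x - y) = 0" for b
    by (rule partial_zero_outside[OF compact_imp_closed[OF K(1)] K(2) k(2)])
   then show ?thesis by (simp add: rem_def K(2) k)
  qed
  show "rem h \<in> L2" by (rule L2_bounded_support(1)[OF rem_meas b compact_cball z])
  have "(l2norm (rem h))^2 \<le> (C * (norm h)^2)^2 * M"
   unfolding M_def by (rule L2_bounded_support(2)[OF rem_meas b compact_cball z])
  then show "(l2norm (rem h))^2 \<le> (C * (norm h)^2 * sqrt M)^2" using M by (simp add: power_mult_distrib)
 qed
 have eq: "conv f \<rho> (x + h) - conv f \<rho> x - (\<Sum>b\<in>Basis. inner h b *\<^sub>R conv f (partial b \<rho>) x)
   = (LINT y|lborel. f y * rem h y)" for h
 proof -
  have i: "integrable lborel (\<lambda>y. f y * \<rho> (x + h - y))" "integrable lborel (\<lambda>y. f y * \<rho> (x - y))"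
   using conv_integrable[OF f rho] by blast+
  have ib: "integrable lborel (\<lambda>y. inner h b *\<^sub>R (f y * partial b \<rho> (x - y)))" if "b \<in> Basis" for b
   using conv_integrable[OF f test_partial[OF rho that]] by simp
  have "f y * rem h y = f y * \<rho> (x + h - y) - f y * \<rho> (x - y) - (\<Sum>b\<in>Basis. inner h b *\<^sub>R (f y * partial b \<rho> (x - y)))" for y
   by (simp add: rem_def right_diff_distrib sum_distrib_left scaleR_conv_of_real mult_ac algebra_simps)
  then have "(LINT y|lborel. f y * rem h y) = (LINT y|lborel. f y * \<rho> (x + h - y) - f y * \<rho> (x - y)
    - (\<Sum>b\<in>Basis. inner h b *\<^sub>R (f y * partial b \<rho> (x - y))))" by simp
  also have "\<dots> = (LINT y|lborel. f y * \<rho> (x + h - y)) - (LINT y|lborel. f y * \<rho> (x - y))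
    - (\<Sum>b\<in>Basis. LINT y|lborel. inner h b *\<^sub>R (f y * partial b \<rho> (x - y)))"
   using i ib by (simp add: Bochner_Integration.integral_sum)
  finally show ?thesis by (simp add: conv_def)
 qed
 have "bounded_linear (\<lambda>h. \<Sum>b\<in>Basis. inner h b *\<^sub>R conv f (partial b \<rho>) x)"
  by (intro bounded_linear_sum bounded_linear_scaleR_const bounded_linear_inner_left)
 moreover have "((\<lambda>h. norm (conv f \<rho> (x + h) - conv f \<rho> x - (\<Sum>b\<in>Basis. inner h b *\<^sub>R conv f (partial b \<rho>) x)) / norm h) \<longlongrightarrow> 0) (at 0)"
 proof (rule Lim_null_comparison)
  have "((\<lambda>h::'a. l2norm f * (C * sqrt M) * norm h) \<longlongrightarrow> l2norm f * (C * sqrt M) * norm (0::'a)) (at 0)"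
   by (intro tendsto_intros)
  then show "((\<lambda>h::'a. l2norm f * (C * sqrt M) * norm h) \<longlongrightarrow> 0) (at 0)" by simp
  have "norm (norm (conv f \<rho> (x + h) - conv f \<rho> x - (\<Sum>b\<in>Basis. inner h b *\<^sub>R conv f (partial b \<rho>) x)) / norm h)
    \<le> l2norm f * (C * sqrt M) * norm h" if h: "h \<noteq> 0" "dist h 0 < 1" for h
  proof -
   have "norm h \<le> 1" using h by simp
   note r = rem[OF this]
   have "0 \<le> C * (norm h)^2 * sqrt M" using C M by simp
   from L2_integral_le[OF f r this]
   have "cmod (LINT y|lborel. f y * rem h y) \<le> l2norm f * (C * (norm h)^2 * sqrt M)" .
   also have "\<dots> = l2norm f * (C * sqrt M) * norm h * norm h" by (simp add: power2_eq_square)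
   finally show ?thesis unfolding eq using h(1) by (simp add: pos_divide_le_eq)
  qed
  then show "\<forall>\<^sub>F h in at 0. norm (norm (conv f \<rho> (x + h) - conv f \<rho> x - (\<Sum>b\<in>Basis. inner h b *\<^sub>R conv f (partial b \<rho>) x)) / norm h)
    \<le> l2norm f * (C * sqrt M) * norm h" unfolding eventually_at by (intro exI[of _ 1]) simp
 qed
 ultimately show ?thesis unfolding has_derivative_at by blast
qed

lemma partial_conv:
 assumes f: "f \<in> L2" and rho: "\<rho> \<in> test_functions UNIV" and b: "b \<in> Basis"
 shows "partial b (conv f \<rho>) = conv f (partial b \<rho>)"
proof
 fix x
 have "partial b (conv f \<rho>) x = (\<Sum>c\<in>Basis. inner b c *\<^sub>R conv f (partial c \<rho>) x)"
  by (rule partial_eq[OF conv_has_derivative[OF f rho]])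
 also have "\<dots> = (\<Sum>c\<in>Basis. if c = b then conv f (partial c \<rho>) x else 0)"
  by (rule sum.cong) (auto simp: inner_Basis b)
 finally show "partial b (conv f \<rho>) x = conv f (partial b \<rho>) x" using b by simp
qed

lemma smooth_conv:
 fixes f \<rho> :: "'a::euclidean_space \<Rightarrow> complex"
 assumes f: "f \<in> L2" and rho: "\<rho> \<in> test_functions UNIV"
 shows "smooth (conv f \<rho>)"
proof (rule smooth_coinduct[where F = "{conv f \<sigma> | \<sigma>. \<sigma> \<in> test_functions UNIV}"])
 show "conv f \<rho> \<in> {conv f \<sigma> | \<sigma>. \<sigma> \<in> test_functions UNIV}" using rho by blast
 show "h differentiable (at x)" if "h \<in> {conv f \<sigma> | \<sigma>. \<sigma> \<in> test_functions UNIV}" for h x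
  using that conv_has_derivative[OF f] differentiableI by blast
 show "partial b h \<in> {conv f \<sigma> | \<sigma>. \<sigma> \<in> test_functions UNIV}"
  if h: "h \<in> {conv f \<sigma> | \<sigma>. \<sigma> \<in> test_functions UNIV}" and b: "b \<in> Basis" for h b
 proof -
  obtain \<sigma> where s: "h = conv f \<sigma>" "\<sigma> \<in> test_functions UNIV" using h by blast
  then have "partial b h = conv f (partial b \<sigma>)" using partial_conv[OF f s(2) b] by simp
  then show ?thesis using test_partial[OF s(2) b] by blast
 qed
qed

lemma conv_zero_outside:
 assumes "\<And>y. y \<notin> K \<Longrightarrow> f y = 0" "\<And>y. r < norm y \<Longrightarrow> \<rho> y = 0" "x \<notin> (\<Union>k\<in>K. cball k r)"
 shows "conv f \<rho> x = 0"
proof -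
 have "f y * \<rho> (x - y) = 0" for y
  using assms(1)[of y] assms(2)[of "x - y"] assms(3) by (cases "y \<in> K") (auto simp: dist_norm norm_minus_commute)
 then have "(\<lambda>y. f y * \<rho> (x - y)) = (\<lambda>y. 0)" by (intro ext)
 then show ?thesis by (simp only: conv_def Bochner_Integration.integral_zero)
qed

text \<open>The argument has the shape \<open>c |x|^2 + d\<close>, for which smoothness is already
  available.\<close>

abbreviation ball_bump :: "nat \<Rightarrow> 'a::euclidean_space \<Rightarrow> real" where
 "ball_bump n y \<equiv> bump 0 (- (real (Suc n))\<^sup>2 * (norm y)^2 + 1)"

text \<open>Supported in the ball of radius \<open>1 / (n + 1)\<close>. Dividing by the mass for
  each \<open>n\<close> separately makes it unnecessary to compute how the integral scales.\<close>

definition mollifier :: "nat \<Rightarrow> 'a::euclidean_space \<Rightarrow> real" where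
 "mollifier n x = ball_bump n x /
   (LINT y|lborel. ball_bump n (y::'a))"

lemma mollifier_bump_zero:
 assumes "1 / real (Suc n) < norm (x::'a::euclidean_space)"
 shows "ball_bump n x = 0"
proof (rule bump_nonpos)
 have "1 < real (Suc n) * norm x" using assms by (simp add: pos_divide_less_eq mult.commute del: of_nat_Suc)
 then have "1 < (real (Suc n) * norm x)^2" by (rule one_less_power) simp
 then show "- (real (Suc n))\<^sup>2 * (norm x)^2 + 1 \<le> 0" by (simp add: power_mult_distrib)
qed

lemma mollifier_bump_test:
 "(\<lambda>x::'a::euclidean_space. complex_of_real (ball_bump n x)) \<in> test_functions UNIV"
proof (rule test_functionsI)
 show "smooth (\<lambda>x::'a. complex_of_real (ball_bump n x))" by (intro smooth_bump smooth_linear_norm_square)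
 show "complex_of_real (ball_bump n x) = 0"
  if "x \<notin> cball 0 (1 / real (Suc n))" for x :: 'a
  using mollifier_bump_zero[of n x] that by (simp del: of_nat_Suc)
qed auto

lemma mollifier_mass_pos: "0 < (LINT y|lborel. ball_bump n (y::'a::euclidean_space))"
proof -
 define g where "g y = ball_bump n (y::'a)" for y
 have "integrable lborel (\<lambda>y. complex_of_real (g y))"
  unfolding g_def by (rule test_integrable[OF mollifier_bump_test])
 then have i: "integrable lborel g" by (simp add: complex_of_real_integrable_eq)
 have g0: "0 \<le> g y" for y by (simp add: g_def bump_0_nonneg)
 have "(LINT y|lborel. g y) \<noteq> 0"
 proof
  assume "(LINT y|lborel. g y) = 0"
  then have ae: "AE y in lborel. g y = 0" using integral_nonneg_eq_0_iff_AE[OF i] g0 by auto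
  define B where "B = ball (0::'a) (1 / real (Suc n))"
  have "g y \<noteq> 0" if "y \<in> B" for y
  proof -
   have "real (Suc n) * norm y < 1" using that by (simp add: B_def field_simps)
   then have "(real (Suc n) * norm y)^2 < 1" by (intro power_less_one_iff[THEN iffD2]) auto
   then have "0 < - (real (Suc n))\<^sup>2 * (norm y)^2 + 1" by (simp add: power_mult_distrib)
   then show ?thesis unfolding g_def using bump_0_pos by (metis less_irrefl)
  qed
  then have "AE y in lborel. y \<notin> B" using ae by (auto elim: eventually_mono)
  then have "B \<in> null_sets lborel" by (subst AE_iff_null_sets) (auto simp: B_def)
  then have "measure lborel B = 0" by (simp add: null_sets_def measure_def)
  moreover have "0 < measure lborel B" unfolding B_def by (rule content_ball_pos) simp
  ultimately show False by simp
 qed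
 moreover have "0 \<le> (LINT y|lborel. g y)" using g0 by (intro integral_nonneg_AE) auto
 ultimately show ?thesis unfolding g_def by linarith
qed

lemma mollifier_nonneg: "0 \<le> mollifier n x"
 unfolding mollifier_def using mollifier_mass_pos bump_0_nonneg by (intro divide_nonneg_pos) auto

lemma mollifier_zero: "1 / real (Suc n) < norm x \<Longrightarrow> mollifier n x = 0"
 unfolding mollifier_def by (simp only: mollifier_bump_zero div_0)

lemma mollifier_test: "(\<lambda>x::'a::euclidean_space. complex_of_real (mollifier n x)) \<in> test_functions UNIV"
proof -
 define c where "c = (LINT y|lborel. ball_bump n (y::'a))"
 have "complex_of_real (mollifier n x) = of_real (1 / c) * of_real (ball_bump n x)" for x :: 'a
  unfolding mollifier_def c_def[symmetric] by simp
 then show ?thesis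
  using test_cmult[OF mollifier_bump_test, of "of_real (1 / c)" n, where ?'a = 'a] by (simp only:)
qed

lemma mollifier_measurable [measurable]: "mollifier n \<in> borel_measurable borel"
proof -
 have "(\<lambda>x. Re (complex_of_real (mollifier n x))) \<in> borel_measurable borel"
  using smooth_measurable[OF test_smooth[OF mollifier_test]] by measurable
 then show ?thesis by simp
qed

lemma mollifier_nn_integral: "(\<integral>\<^sup>+x. ennreal (mollifier n x) \<partial>(lborel::'a::euclidean_space measure)) = 1"
proof -
 have i: "integrable lborel (mollifier n :: 'a \<Rightarrow> real)"
  using test_integrable[OF mollifier_test] by (simp add: complex_of_real_integrable_eq)
 have "(LINT x|lborel. mollifier n (x::'a)) = 1"
  unfolding mollifier_def using mollifier_mass_pos[of n, where ?'a = 'a] by simp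
 then show ?thesis using nn_integral_eq_integral[OF i AE_I2[OF mollifier_nonneg]] by simp
qed

abbreviation mollify :: "nat \<Rightarrow> ('a::euclidean_space \<Rightarrow> complex) \<Rightarrow> 'a \<Rightarrow> complex" where
 "mollify n f \<equiv> conv f (\<lambda>x. complex_of_real (mollifier n x))"

text \<open>Splitting the mollifier into two square roots and applying Cauchy-Schwarz gives Jensen's
  inequality at the point \<open>x\<close>, since the mollifier has mass 1.\<close>

lemma conv_mollifier_bound:
 fixes f :: "'a::euclidean_space \<Rightarrow> complex"
 assumes f: "f \<in> L2"
 shows "ennreal ((cmod (mollify n f x))^2)
  \<le> (\<integral>\<^sup>+y. ennreal ((cmod (f y))^2) * ennreal (mollifier n (x - y)) \<partial>lborel)"
proof -
 note [measurable] = L2_measurable[OF f]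
 define r where "r y = mollifier n (x - y)" for y
 have r0: "0 \<le> r y" for y by (simp add: r_def mollifier_nonneg)
 have [measurable]: "r \<in> borel_measurable borel" unfolding r_def by measurable
 have one: "(\<integral>\<^sup>+y. ennreal (r y) \<partial>lborel) = 1"
  unfolding r_def using nn_integral_reflect[of "\<lambda>y. ennreal (mollifier n y)" x] by (simp add: mollifier_nn_integral)
 obtain B where B: "B > 0" "\<And>x. cmod (of_real (mollifier n (x::'a))) \<le> B"
  by (rule test_bounded[OF mollifier_test]) blast
 define g where "g y = complex_of_real (sqrt (r y))" for y
 define k where "k y = f y * complex_of_real (sqrt (r y))" for y
 have [measurable]: "g \<in> borel_measurable borel" "k \<in> borel_measurable borel"
  unfolding g_def k_def by measurable
 have g2: "(cmod (g y))^2 = r y" "(cmod (k y))^2 = (cmod (f y))^2 * r y" for y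
  using r0[of y] by (simp_all add: g_def k_def norm_mult power_mult_distrib)
 have gL: "g \<in> L2" "(l2norm g)^2 \<le> 1\<^sup>2" using L2_nn_integralI[of g 1] by (simp_all add: g2 one)
 have kL: "k \<in> L2"
 proof (rule L2_bound(1)[OF f, of _ "sqrt B"])
  have "sqrt (r y) \<le> sqrt B" for y using B(2)[of "x - y"] r0[of y] by (simp add: r_def)
  then show "AE y in lborel. cmod (k y) \<le> sqrt B * cmod (f y)"
   using r0 by (auto simp: k_def norm_mult mult.commute intro!: mult_right_mono AE_I2)
 qed measurable
 have "mollify n f x = (LINT y|lborel. k y * g y)"
  unfolding conv_def k_def g_def using r0 by (simp add: r_def mult.assoc flip: of_real_mult)
 then have "cmod (mollify n f x) \<le> l2norm k" using L2_integral_le[OF kL gL] by simp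
 then have "ennreal ((cmod (mollify n f x))^2) \<le> ennreal ((l2norm k)^2)"
  by (intro ennreal_leI power_mono) auto
 also have "\<dots> = (\<integral>\<^sup>+y. ennreal ((cmod (f y))^2 * r y) \<partial>lborel)"
  unfolding L2_nn_integral[OF kL, symmetric] g2 ..
 also have "\<dots> = (\<integral>\<^sup>+y. ennreal ((cmod (f y))^2) * ennreal (mollifier n (x - y)) \<partial>lborel)"
  using r0 by (simp add: ennreal_mult r_def)
 finally show ?thesis .
qed

lemma conv_mollifier_L2:
 fixes f :: "'a::euclidean_space \<Rightarrow> complex"
 assumes f: "f \<in> L2"
 shows "mollify n f \<in> L2"
  "l2norm (mollify n f) \<le> l2norm f"
proof -
 note [measurable] = L2_measurable[OF f] smooth_measurable[OF smooth_conv[OF f mollifier_test]]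
 have "(\<integral>\<^sup>+x. ennreal ((cmod (mollify n f x))^2) \<partial>lborel)
   \<le> (\<integral>\<^sup>+x. \<integral>\<^sup>+y. ennreal ((cmod (f y))^2) * ennreal (mollifier n (x - y)) \<partial>lborel \<partial>lborel)"
  by (intro nn_integral_mono conv_mollifier_bound f)
 also have "\<dots> = (\<integral>\<^sup>+y. \<integral>\<^sup>+x. ennreal ((cmod (f y))^2) * ennreal (mollifier n (x - y)) \<partial>lborel \<partial>lborel)"
  by (rule lborel_pair.Fubini') measurable
 also have "\<dots> = (\<integral>\<^sup>+y. ennreal ((cmod (f y))^2) \<partial>lborel)"
 proof (rule nn_integral_cong)
  fix y :: 'a
  have "(\<integral>\<^sup>+x. ennreal (mollifier n (x - y)) \<partial>lborel) = 1"
   using nn_integral_translate[of "\<lambda>x. ennreal (mollifier n x)" y] by (simp add: mollifier_nn_integral)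
  then show "(\<integral>\<^sup>+x. ennreal ((cmod (f y))^2) * ennreal (mollifier n (x - y)) \<partial>lborel) = ennreal ((cmod (f y))^2)"
   by (simp add: nn_integral_cmult)
 qed
 also have "\<dots> = ennreal ((l2norm f)^2)" by (rule L2_nn_integral[OF f])
 finally have *: "(\<integral>\<^sup>+x. ennreal ((cmod (mollify n f x))^2) \<partial>lborel) \<le> ennreal ((l2norm f)^2)" .
 show "mollify n f \<in> L2" by (rule L2_nn_integralI(1)[OF _ *]) measurable
 have "(l2norm (mollify n f))^2 \<le> (l2norm f)^2" by (rule L2_nn_integralI(2)[OF _ *]) measurable
 then show "l2norm (mollify n f) \<le> l2norm f" by (rule power2_le_imp_le) (simp add: l2norm_def)
qed

text \<open>A Lipschitz function is moved by at most \<open>L / (n + 1)\<close>, and the difference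
  vanishes outside a fixed ball, so the uniform bound becomes a bound in norm.\<close>

lemma conv_mollifier_tendsto_test:
 fixes u :: "'a::euclidean_space \<Rightarrow> complex"
 assumes u: "u \<in> test_functions \<Omega>"
 shows "(\<lambda>n. l2of (mollify n u)) \<longlonglongrightarrow> l2of u"
proof -
 have uU: "u \<in> test_functions UNIV" by (rule test_UNIV[OF u])
 obtain K where K: "compact K" "\<And>x. x \<notin> K \<Longrightarrow> u x = 0" by (rule test_functionsD[OF u]) blast
 obtain R where R: "\<And>x. x \<in> K \<Longrightarrow> norm x \<le> R" using compact_imp_bounded[OF K(1)] bounded_iff by metis
 obtain L where L: "L > 0" "\<And>x y. cmod (u x - u y) \<le> L * norm (x - y)" by (rule test_lipschitz[OF u]) blast
 note uL = test_L2[OF u]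
 define M where "M = measure lborel (cball (0::'a) (R + 1))"
 define d where "d n x = mollify n u x - u x" for n x
 have dm: "d n \<in> borel_measurable borel" for n
  unfolding d_def using smooth_measurable[OF smooth_conv[OF uL mollifier_test]] L2_measurable[OF uL] by measurable
 have b: "cmod (d n x) \<le> L / real (Suc n)" for n x
 proof -
  define r where "r y = mollifier n (x - y)" for y
  have [measurable]: "r \<in> borel_measurable borel" unfolding r_def by measurable
  have r0: "0 \<le> r y" for y by (simp add: r_def mollifier_nonneg)
  have one: "(\<integral>\<^sup>+y. ennreal (r y) \<partial>lborel) = 1"
   unfolding r_def using nn_integral_reflect[of "\<lambda>y. ennreal (mollifier n y)" x] by (simp add: mollifier_nn_integral)
  have ri: "integrable lborel r" using one r0 by (intro integrableI_nonneg) auto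
  have r1: "(LINT y|lborel. r y) = 1" using nn_integral_eq_integral[OF ri] one r0 by (simp add: ennreal_eq_1)
  have i1: "integrable lborel (\<lambda>y. u y * complex_of_real (r y))"
   using conv_integrable[OF uL mollifier_test, of n x] unfolding r_def .
  have i2: "integrable lborel (\<lambda>y. u x * complex_of_real (r y))" using ri by simp
  have "d n x = (LINT y|lborel. u y * of_real (r y)) - u x * of_real (LINT y|lborel. r y)"
   by (simp add: d_def conv_def r_def[symmetric] r1)
  also have "\<dots> = (LINT y|lborel. u y * of_real (r y) - u x * of_real (r y))"
   unfolding Bochner_Integration.integral_diff[OF i1 i2] by simp
  finally have dn: "d n x = (LINT y|lborel. u y * of_real (r y) - u x * of_real (r y))" .
  have "cmod (d n x) \<le> (LINT y|lborel. L / real (Suc n) * r y)" unfolding dn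
  proof (rule order_trans[OF integral_norm_bound integral_mono])
   show "integrable lborel (\<lambda>y. norm (u y * complex_of_real (r y) - u x * complex_of_real (r y)))"
    by (intro integrable_norm Bochner_Integration.integrable_diff[OF i1 i2])
   show "integrable lborel (\<lambda>y. L / real (Suc n) * r y)" using ri by simp
   show "norm (u y * complex_of_real (r y) - u x * complex_of_real (r y)) \<le> L / real (Suc n) * r y" for y
   proof (cases "1 / real (Suc n) < norm (x - y)")
    case True then show ?thesis by (simp add: r_def mollifier_zero del: of_nat_Suc)
   next
    case False
    then have "L * norm (y - x) \<le> L * (1 / real (Suc n))"
     using L(1) by (intro mult_left_mono) (simp_all add: norm_minus_commute not_less del: of_nat_Suc)
    then have "cmod (u y - u x) \<le> L / real (Suc n)" using L(2)[of y x] by simp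
    then have "cmod (u y - u x) * r y \<le> L / real (Suc n) * r y" by (rule mult_right_mono) (rule r0)
    moreover have "norm (u y * complex_of_real (r y) - u x * complex_of_real (r y)) = cmod (u y - u x) * r y"
     using r0[of y] by (simp flip: left_diff_distrib add: norm_mult)
    ultimately show ?thesis by simp
   qed
  qed
  then show ?thesis by (simp add: r1)
 qed
 have z: "d n x = 0" if x: "x \<notin> cball 0 (R + 1)" for n x
 proof -
  have n: "norm x > R + 1" using x by simp
  then have "x \<notin> K" using R by fastforce
  moreover have "mollify n u x = 0"
  proof (rule conv_zero_outside)
   show "u y = 0" if "y \<notin> K" for y using K(2) that .
   show "complex_of_real (mollifier n y) = 0" if "1 / real (Suc n) < norm y" for y :: 'a
    using mollifier_zero[OF that] by simp
   show "x \<notin> (\<Union>k\<in>K. cball k (1 / real (Suc n)))"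
   proof
    assume "x \<in> (\<Union>k\<in>K. cball k (1 / real (Suc n)))"
    then obtain k where k: "k \<in> K" "norm (k - x) \<le> 1 / real (Suc n)" by (auto simp: dist_norm simp del: of_nat_Suc)
    have "1 / real (Suc n) \<le> 1" by simp
    then show False using k(2) R[OF k(1)] n norm_triangle_ineq2[of x k] norm_minus_commute[of x k] by linarith
   qed
  qed
  ultimately show ?thesis by (simp add: d_def K(2))
 qed
 have le: "l2norm (d n) \<le> L * sqrt M * inverse (real (Suc n))" for n
 proof (rule power2_le_imp_le)
  have "(l2norm (d n))^2 \<le> (L / real (Suc n))^2 * M"
   unfolding M_def by (rule L2_bounded_support(2)[OF dm b compact_cball z])
  also have "\<dots> = (L * sqrt M * inverse (real (Suc n)))^2"
   by (simp add: power_mult_distrib power_divide M_def divide_inverse power_inverse del: of_nat_Suc)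
  finally show "(l2norm (d n))^2 \<le> (L * sqrt M * inverse (real (Suc n)))^2" .
  show "0 \<le> L * sqrt M * inverse (real (Suc n))" using L(1) by (simp add: M_def)
 qed
 have "(\<lambda>n. L * sqrt M * inverse (real (Suc n))) \<longlonglongrightarrow> L * sqrt M * 0"
  by (intro tendsto_intros LIMSEQ_inverse_real_of_nat)
 then have lim0: "(\<lambda>n. L * sqrt M * inverse (real (Suc n))) \<longlonglongrightarrow> 0" by simp
 have "(\<lambda>n. l2norm (d n)) \<longlonglongrightarrow> 0" by (rule Lim_null_comparison[OF _ lim0]) (use le in \<open>simp add: l2norm_def\<close>)
 then show ?thesis unfolding l2of_tendsto_iff[OF conv_mollifier_L2(1)[OF uL] uL] d_def .
qed

text \<open>Mollification does not increase the norm, so convergence spreads from the dense set of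
  test functions to all of \<open>L2\<close>.\<close>

lemma conv_mollifier_tendsto:
 fixes f :: "'a::euclidean_space \<Rightarrow> complex"
 assumes f: "f \<in> L2"
 shows "(\<lambda>n. l2of (mollify n f)) \<longlonglongrightarrow> l2of f"
proof (rule metric_LIMSEQ_I)
 fix e :: real assume e: "e > 0"
 have "l2of f \<in> closure (l2of ` test_functions (- {0}))" by (simp add: test_dense)
 then obtain y where "y \<in> l2of ` test_functions (- {0})" "dist y (l2of f) < e / 3"
  using e unfolding closure_approachable by (meson divide_pos_pos zero_less_numeral)
 then obtain u where u: "u \<in> test_functions (- {0})" "dist (l2of u) (l2of f) < e / 3" by blast
 note uL = test_L2[OF u(1)]
 define m where "m n = (\<lambda>x::'a. complex_of_real (mollifier n x))" for n
 have mt: "m n \<in> test_functions UNIV" for n unfolding m_def by (rule mollifier_test)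
 have cL: "conv g (m n) \<in> L2" "l2norm (conv g (m n)) \<le> l2norm g" if "g \<in> L2" for g n
  unfolding m_def using conv_mollifier_L2[OF that] by auto
 have "(\<lambda>n. l2of (conv u (m n))) \<longlonglongrightarrow> l2of u" unfolding m_def by (rule conv_mollifier_tendsto_test[OF u(1)])
 then obtain N where N: "\<And>n. n \<ge> N \<Longrightarrow> dist (l2of (conv u (m n))) (l2of u) < e / 3"
  using e metric_LIMSEQ_D[of _ "l2of u" "e / 3"] by auto
 have near: "dist (l2of (conv f (m n))) (l2of (conv u (m n))) < e / 3" for n
 proof -
  have "dist (l2of (conv f (m n))) (l2of (conv u (m n))) = l2norm (conv (\<lambda>x. f x - u x) (m n))"
   by (simp add: dist_l2of cL f uL conv_diff[OF f uL mt, symmetric])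
  also have "\<dots> \<le> l2norm (\<lambda>x. f x - u x)" by (intro cL(2) L2_diff f uL)
  also have "\<dots> < e / 3" using u(2) by (simp add: dist_commute dist_l2of[OF f uL, symmetric])
  finally show ?thesis .
 qed
 show "\<exists>N. \<forall>n\<ge>N. dist (l2of (mollify n f)) (l2of f) < e"
 proof (intro exI[of _ N] allI impI)
  fix n assume "n \<ge> N"
  have "dist (l2of (conv f (m n))) (l2of f)
    \<le> dist (l2of (conv f (m n))) (l2of (conv u (m n))) + dist (l2of (conv u (m n))) (l2of u) + dist (l2of u) (l2of f)"
   using dist_triangle[of "l2of (conv f (m n))" "l2of f" "l2of (conv u (m n))"]
    dist_triangle[of "l2of (conv u (m n))" "l2of f" "l2of u"] by linarith
  also have "\<dots> < e" using near[of n] N[OF \<open>n \<ge> N\<close>] u(2) by linarith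
  finally show "dist (l2of (mollify n f)) (l2of f) < e" by (simp only: m_def)
 qed
qed

subsection \<open>Weak derivatives\<close>

lemma weak_partial_test: "smooth u \<Longrightarrow> b \<in> Basis \<Longrightarrow> has_weak_partial b u (partial b u)"
 unfolding has_weak_partial_def using integration_by_parts by blast

lemma weak_partial_integrable:
 assumes "u \<in> L2" "\<phi> \<in> test_functions UNIV"
 shows "integrable lborel (\<lambda>x. u x * \<phi> x)" "b \<in> Basis \<Longrightarrow> integrable lborel (\<lambda>x. u x * partial b \<phi> x)"
 using L2_mult_integrable[OF assms(1) test_L2[OF assms(2)]]
  L2_mult_integrable[OF assms(1) test_L2[OF test_partial[OF assms(2)]]] by auto

lemma has_weak_partial_add:
 assumes "u \<in> L2" "v \<in> L2" "g \<in> L2" "k \<in> L2" "b \<in> Basis" "has_weak_partial b u g" "has_weak_partial b v k"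
 shows "has_weak_partial b (\<lambda>x. u x + v x) (\<lambda>x. g x + k x)"
 using assms unfolding has_weak_partial_def by (simp add: distrib_right weak_partial_integrable)

text \<open>The product of the smooth factor with a test function is again a test function; the
  defining identity for \<open>u\<close> is applied to it.\<close>

lemma has_weak_partial_leibniz:
 assumes z: "smooth \<zeta>" and u: "u \<in> L2" and g: "g \<in> L2" and b: "b \<in> Basis" and w: "has_weak_partial b u g"
 shows "has_weak_partial b (\<lambda>x. \<zeta> x * u x) (\<lambda>x. \<zeta> x * g x + partial b \<zeta> x * u x)"
 unfolding has_weak_partial_def
proof
 fix \<phi> :: "'a \<Rightarrow> complex" assume phi: "\<phi> \<in> test_functions UNIV"
 have t: "(\<lambda>x. \<zeta> x * \<phi> x) \<in> test_functions UNIV" "(\<lambda>x. partial b \<zeta> x * \<phi> x) \<in> test_functions UNIV"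
  "(\<lambda>x. \<zeta> x * partial b \<phi> x) \<in> test_functions UNIV" by (intro test_mult z phi smooth_partial b test_partial)+
 have "partial b (\<lambda>x. \<zeta> x * \<phi> x) = (\<lambda>x. \<zeta> x * partial b \<phi> x + partial b \<zeta> x * \<phi> x)"
  by (intro ext partial_mult smooth_differentiable[OF z] test_differentiable[OF phi])
 then have "(LINT x|lborel. u x * (\<zeta> x * partial b \<phi> x + partial b \<zeta> x * \<phi> x)) = - (LINT x|lborel. g x * (\<zeta> x * \<phi> x))"
  using w t(1) unfolding has_weak_partial_def by metis
 moreover have "(LINT x|lborel. u x * (\<zeta> x * partial b \<phi> x + partial b \<zeta> x * \<phi> x))
   = (LINT x|lborel. u x * (\<zeta> x * partial b \<phi> x)) + (LINT x|lborel. u x * (partial b \<zeta> x * \<phi> x))"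
  using weak_partial_integrable(1)[OF u t(2)] weak_partial_integrable(1)[OF u t(3)] by (simp add: distrib_left)
 moreover have "(LINT x|lborel. (\<zeta> x * g x + partial b \<zeta> x * u x) * \<phi> x)
   = (LINT x|lborel. g x * (\<zeta> x * \<phi> x) + u x * (partial b \<zeta> x * \<phi> x))"
  by (rule Bochner_Integration.integral_cong) (simp_all add: algebra_simps)
 moreover have "(LINT x|lborel. g x * (\<zeta> x * \<phi> x) + u x * (partial b \<zeta> x * \<phi> x))
   = (LINT x|lborel. g x * (\<zeta> x * \<phi> x)) + (LINT x|lborel. u x * (partial b \<zeta> x * \<phi> x))"
  using weak_partial_integrable(1)[OF u t(2)] weak_partial_integrable(1)[OF g t(1)] by simp
 moreover have "(LINT x|lborel. \<zeta> x * u x * partial b \<phi> x) = (LINT x|lborel. u x * (\<zeta> x * partial b \<phi> x))"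
  by (rule Bochner_Integration.integral_cong) (simp_all add: mult_ac)
 ultimately show "(LINT x|lborel. \<zeta> x * u x * partial b \<phi> x) = - (LINT x|lborel. (\<zeta> x * g x + partial b \<zeta> x * u x) * \<phi> x)"
  by (simp add: eq_neg_iff_add_eq_0 algebra_simps)
qed

text \<open>\<open>weak_partial\<close> chooses some representative, so the relation must be
  transferable along equality almost everywhere before second derivatives can be formed.\<close>

lemma has_weak_partial_cong:
 assumes "has_weak_partial b u g" "u \<in> L2" "g \<in> L2" "u' \<in> L2" "g' \<in> L2" "ae_eq u u'" "ae_eq g g'" "b \<in> Basis"
 shows "has_weak_partial b u' g'" unfolding has_weak_partial_def
proof
 fix \<phi> :: "'a \<Rightarrow> complex" assume phi: "\<phi> \<in> test_functions UNIV"
 note m = borel_measurable_integrable[OF weak_partial_integrable(2)[OF _ phi assms(8)]]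
  borel_measurable_integrable[OF weak_partial_integrable(1)[OF _ phi]]
 have "(LINT x|lborel. u' x * partial b \<phi> x) = (LINT x|lborel. u x * partial b \<phi> x)"
  using assms(6) unfolding ae_eq_def
  by (intro integral_cong_AE[OF m(1)[OF assms(4)] m(1)[OF assms(2)]]) (erule eventually_mono, simp)
 moreover have "(LINT x|lborel. g' x * \<phi> x) = (LINT x|lborel. g x * \<phi> x)" using assms(7) unfolding ae_eq_def
  by (intro integral_cong_AE[OF m(2)[OF assms(5)] m(2)[OF assms(3)]]) (erule eventually_mono, simp)
 moreover have "(LINT x|lborel. u x * partial b \<phi> x) = - (LINT x|lborel. g x * \<phi> x)"
  using assms(1) phi unfolding has_weak_partial_def by (rule bspec)
 ultimately show "(LINT x|lborel. u' x * partial b \<phi> x) = - (LINT x|lborel. g' x * \<phi> x)" by (simp only:)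
qed

lemma has_weak_partial_unique:
 assumes "has_weak_partial b u g" "has_weak_partial b u g'" "g \<in> L2" "g' \<in> L2"
 shows "ae_eq g g'"
proof -
 have "AE x in lborel. g x - g' x = 0"
 proof (rule fundamental_lemma)
  show "(\<lambda>x. g x - g' x) \<in> L2" by (intro L2_diff assms)
  fix \<phi> :: "'a \<Rightarrow> complex" assume phi: "\<phi> \<in> test_functions (- {0})"
  have phiU: "\<phi> \<in> test_functions UNIV" by (rule test_UNIV[OF phi])
  have "(LINT x|lborel. (g x - g' x) * \<phi> x) = (LINT x|lborel. g x * \<phi> x) - (LINT x|lborel. g' x * \<phi> x)"
   using weak_partial_integrable(1)[OF assms(3) phiU] weak_partial_integrable(1)[OF assms(4) phiU]
   by (simp add: left_diff_distrib)
  also have "\<dots> = 0" using assms(1,2) phiU unfolding has_weak_partial_def by (metis diff_self neg_equal_iff_equal)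
  finally show "(LINT x|lborel. (g x - g' x) * \<phi> x) = 0" .
 qed
 then show ?thesis by (auto simp: ae_eq_def)
qed

lemma L2_tendsto_integral:
 assumes f: "\<And>n. f n \<in> L2" "g \<in> L2" "(\<lambda>n. l2of (f n)) \<longlonglongrightarrow> l2of g" and h: "h \<in> L2"
 shows "(\<lambda>n. LINT x|lborel. f n x * h x) \<longlonglongrightarrow> (LINT x|lborel. g x * h x)"
proof -
 have "(\<lambda>n. cinner (l2of (f n)) (l2of (\<lambda>x. cnj (h x)))) \<longlonglongrightarrow> cinner (l2of g) (l2of (\<lambda>x. cnj (h x)))"
  by (rule tendsto_cinner_left[OF f(3)])
 then show ?thesis using h f by (simp add: cinner_l2of l2inner_def)
qed

lemma has_weak_partial_limit:
 assumes f: "\<And>n. f n \<in> L2" "u \<in> L2" "(\<lambda>n. l2of (f n)) \<longlonglongrightarrow> l2of u"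
  and g: "\<And>n. g n \<in> L2" "v \<in> L2" "(\<lambda>n. l2of (g n)) \<longlonglongrightarrow> l2of v"
  and w: "\<And>n. has_weak_partial b (f n) (g n)" and b: "b \<in> Basis"
 shows "has_weak_partial b u v" unfolding has_weak_partial_def
proof
 fix \<phi> :: "'a \<Rightarrow> complex" assume phi: "\<phi> \<in> test_functions UNIV"
 have lim1: "(\<lambda>n. LINT x|lborel. f n x * partial b \<phi> x) \<longlonglongrightarrow> (LINT x|lborel. u x * partial b \<phi> x)"
  by (rule L2_tendsto_integral[OF f test_L2[OF test_partial[OF phi b]]])
 have lim2: "(\<lambda>n. - (LINT x|lborel. g n x * \<phi> x)) \<longlonglongrightarrow> - (LINT x|lborel. v x * \<phi> x)"
  by (intro tendsto_minus L2_tendsto_integral[OF g test_L2[OF phi]])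
 have eq: "(\<lambda>n. LINT x|lborel. f n x * partial b \<phi> x) = (\<lambda>n. - (LINT x|lborel. g n x * \<phi> x))"
  using w phi unfolding has_weak_partial_def by blast
 show "(LINT x|lborel. u x * partial b \<phi> x) = - (LINT x|lborel. v x * \<phi> x)"
  by (rule LIMSEQ_unique[OF lim1[unfolded eq] lim2])
qed

text \<open>The reflected kernel is itself a test function. The sign produced by the reflection
  cancels the sign in the definition of the weak derivative.\<close>

lemma partial_conv_weak:
 assumes u: "u \<in> L2" and g: "g \<in> L2" and w: "has_weak_partial b u g" and b: "b \<in> Basis" and rho: "\<rho> \<in> test_functions UNIV"
 shows "partial b (conv u \<rho>) = conv g \<rho>"
proof
 fix x
 have d: "\<rho> differentiable (at z)" for z by (rule test_differentiable[OF rho])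
 have "partial b (\<lambda>y. \<rho> (x - y)) y = - partial b \<rho> (x - y)" for y
  using partial_affine[of \<rho> "-1" y x b] d by simp
 then have "(LINT y|lborel. u y * - partial b \<rho> (x - y)) = - (LINT y|lborel. g y * \<rho> (x - y))"
  using w test_reflect[OF rho, of x] unfolding has_weak_partial_def by fastforce
 then have "conv u (partial b \<rho>) x = conv g \<rho> x" by (simp add: conv_def)
 then show "partial b (conv u \<rho>) x = conv g \<rho> x" using partial_conv[OF u rho b] by simp
qed

text \<open>All approximants keep their support in one compact set \<open>K'\<close> inside the open
  set, so weights singular outside it do no harm later. Only pure second derivatives are followed,
  which is all that the Laplacian uses.\<close>

lemma mollify:
 fixes v :: "'a::euclidean_space \<Rightarrow> complex"
 assumes Om: "open \<Omega>" and K: "compact K" "K \<subseteq> \<Omega>"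
  and v: "v \<in> L2" "\<And>x. x \<notin> K \<Longrightarrow> v x = 0"
  and g: "\<And>b. b \<in> Basis \<Longrightarrow> g b \<in> L2" "\<And>b. b \<in> Basis \<Longrightarrow> has_weak_partial b v (g b)"
  and l: "\<And>b. b \<in> Basis \<Longrightarrow> l b \<in> L2" "\<And>b. b \<in> Basis \<Longrightarrow> has_weak_partial b (g b) (l b)"
 obtains s K' where "compact K'" "K \<subseteq> K'" "K' \<subseteq> \<Omega>" "\<And>n. s n \<in> test_functions \<Omega>" "\<And>n x. x \<notin> K' \<Longrightarrow> s n x = 0"
  "(\<lambda>n. l2of (s n)) \<longlonglongrightarrow> l2of v"
  "\<And>b. b \<in> Basis \<Longrightarrow> (\<lambda>n. l2of (partial b (s n))) \<longlonglongrightarrow> l2of (g b)"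
  "\<And>b. b \<in> Basis \<Longrightarrow> (\<lambda>n. l2of (partial b (partial b (s n)))) \<longlonglongrightarrow> l2of (l b)"
proof -
 obtain e where e: "e > 0" "(\<Union>x\<in>K. cball x e) \<subseteq> \<Omega>"
  using compact_subset_open_imp_cball_epsilon_subset[OF K(1) Om K(2)] by blast
 define K' where "K' = {x + y | x y. x \<in> K \<and> y \<in> cball 0 e}"
 have K'eq: "K' = (\<Union>x\<in>K. cball x e)"
 proof
  show "K' \<subseteq> (\<Union>x\<in>K. cball x e)" by (auto simp: K'_def dist_norm)
  show "(\<Union>x\<in>K. cball x e) \<subseteq> K'"
  proof
   fix z assume "z \<in> (\<Union>x\<in>K. cball x e)"
   then obtain x where "x \<in> K" "dist x z \<le> e" by auto
   then have "x \<in> K \<and> z - x \<in> cball 0 e \<and> z = x + (z - x)" by (simp add: dist_norm norm_minus_commute)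
   then show "z \<in> K'" unfolding K'_def by blast
  qed
 qed
 have K': "compact K'" "K \<subseteq> K'" "K' \<subseteq> \<Omega>"
 proof -
  show "compact K'" unfolding K'_def using compact_sums[OF K(1) compact_cball[of 0 e]] by simp
  show "K \<subseteq> K'" unfolding K'eq using e(1) by fastforce
  show "K' \<subseteq> \<Omega>" unfolding K'eq by (rule e(2))
 qed
 obtain N where N: "inverse (real (Suc N)) < e" using reals_Archimedean[OF e(1)] by blast
 \<comment> \<open>The index is shifted by \<open>N\<close> so that every mollifier radius is below
   \<open>e\<close>.\<close>
 define m where "m n = (\<lambda>x::'a. complex_of_real (mollifier (n + N) x))" for n
 have mt: "m n \<in> test_functions UNIV" for n unfolding m_def by (rule mollifier_test)
 define s where "s n = conv v (m n)" for n
 have lim: "(\<lambda>n. l2of (conv f (m n))) \<longlonglongrightarrow> l2of f" if "f \<in> L2" for f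
  unfolding m_def by (rule LIMSEQ_ignore_initial_segment[OF conv_mollifier_tendsto[OF that]])
 have z: "s n x = 0" if x: "x \<notin> K'" for n x unfolding s_def
 proof (rule conv_zero_outside[OF v(2)])
  have "inverse (real (Suc (n + N))) \<le> inverse (real (Suc N))" by (intro le_imp_inverse_le) auto
  then have i: "inverse (real (Suc (n + N))) < e" using N by linarith
  show "m n y = 0" if y: "e < norm y" for y
  proof -
   have "1 / real (Suc (n + N)) < norm y" using i y by (simp add: inverse_eq_divide)
   then show ?thesis using mollifier_zero[of "n + N" y] by (simp add: m_def)
  qed
  show "x \<notin> (\<Union>k\<in>K. cball k e)" using x unfolding K'eq .
 qed
 have st: "s n \<in> test_functions \<Omega>" for n
 proof (rule test_functionsI[OF _ K'(1) K'(3)])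
  show "smooth (s n)" unfolding s_def by (rule smooth_conv[OF v(1) mt])
  show "s n x = 0" if "x \<notin> K'" for x by (rule z[OF that])
 qed
 have p1: "partial b (s n) = conv (g b) (m n)" if b: "b \<in> Basis" for b n
  unfolding s_def by (rule partial_conv_weak[OF v(1) g(1)[OF b] g(2)[OF b] b mt])
 have p2: "partial b (partial b (s n)) = conv (l b) (m n)" if b: "b \<in> Basis" for b n
  unfolding p1[OF b] by (rule partial_conv_weak[OF g(1)[OF b] l(1)[OF b] l(2)[OF b] b mt])
 show ?thesis
 proof (rule that[where s = s and K' = K'])
  show "(\<lambda>n. l2of (s n)) \<longlonglongrightarrow> l2of v" unfolding s_def by (rule lim[OF v(1)])
  show "(\<lambda>n. l2of (partial b (s n))) \<longlonglongrightarrow> l2of (g b)" if "b \<in> Basis" for b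
   unfolding p1[OF that] by (rule lim[OF g(1)[OF that]])
  show "(\<lambda>n. l2of (partial b (partial b (s n)))) \<longlonglongrightarrow> l2of (l b)" if "b \<in> Basis" for b
   unfolding p2[OF that] by (rule lim[OF l(1)[OF that]])
 qed (use K' st z in blast)+
qed

lemma weak_partial_spec:
 assumes "u \<in> sobolev_H1" "b \<in> Basis"
 shows "weak_partial b u \<in> L2" "has_weak_partial b u (weak_partial b u)"
proof -
 have "\<exists>g. g \<in> L2 \<and> has_weak_partial b u g" using assms by (auto simp: sobolev_H1_def)
 then have "weak_partial b u \<in> L2 \<and> has_weak_partial b u (weak_partial b u)"
  unfolding weak_partial_def by (rule someI_ex)
 then show "weak_partial b u \<in> L2" "has_weak_partial b u (weak_partial b u)" by auto
qed

lemma weak_partial_eqI: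
 assumes "g \<in> L2" "has_weak_partial b u g"
 shows "weak_partial b u \<in> L2" "ae_eq (weak_partial b u) g"
proof -
 have "\<exists>g. g \<in> L2 \<and> has_weak_partial b u g" using assms by auto
 then have *: "weak_partial b u \<in> L2 \<and> has_weak_partial b u (weak_partial b u)"
  unfolding weak_partial_def by (rule someI_ex)
 then show "weak_partial b u \<in> L2" by simp
 show "ae_eq (weak_partial b u) g" using has_weak_partial_unique[of b u "weak_partial b u" g] * assms by blast
qed

section \<open>Integral inequalities for test functions\<close>

abbreviation real_mult :: "('a::real_normed_vector \<Rightarrow> real) \<Rightarrow> ('a \<Rightarrow> complex) \<Rightarrow> 'a \<Rightarrow> complex" (infixr "\<odot>" 75) where
 "m \<odot> f \<equiv> (\<lambda>x. complex_of_real (m x) * f x)"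

abbreviation npow :: "real \<Rightarrow> 'a::real_normed_vector \<Rightarrow> real" where
 "npow \<gamma> \<equiv> (\<lambda>x. norm x powr \<gamma>)"

lemma l2norm_nonneg [simp]: "0 \<le> l2norm f" by (simp add: l2norm_def)

lemma l2norm_square: "(l2norm f)^2 = (LINT x|lborel. (cmod (f x))^2)" by (simp add: l2norm_def)

lemma laplacian_eq: "laplacian u = (\<lambda>x. \<Sum>b\<in>Basis. partial b (partial b u) x)"
 by (rule ext) (simp add: laplacian_def)

lemma test_laplacian: "u \<in> test_functions \<Omega> \<Longrightarrow> laplacian u \<in> test_functions \<Omega>"
 unfolding laplacian_eq by (intro test_sum test_partial)

lemma l2of_laplacian:
 assumes "u \<in> test_functions \<Omega>"
 shows "l2of (laplacian u) = (\<Sum>b\<in>Basis. l2of (partial b (partial b u)))"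
 unfolding laplacian_eq by (intro l2of_sum test_L2[OF test_partial[OF test_partial[OF assms]]])

lemma line_has_derivative:
 assumes u: "u \<in> test_functions \<Omega>"
 shows "((\<lambda>s. u (z + s *\<^sub>R k)) has_derivative (\<lambda>t. t *\<^sub>R frechet_derivative u (at (z + s *\<^sub>R k)) k)) (at s)"
proof -
 have "((\<lambda>s. z + s *\<^sub>R k) has_derivative (\<lambda>t. t *\<^sub>R k)) (at s)" by (auto intro!: derivative_eq_intros)
 from has_derivative_compose[OF this has_derivative_partial[OF test_differentiable[OF u]]]
 show ?thesis
  using linear_cmul[OF has_derivative_linear[OF has_derivative_partial[OF test_differentiable[OF u]]]] by simp
qed

lemma sum_inner_scaleR_Basis:
 fixes b :: "'a::euclidean_space" and f :: "'a \<Rightarrow> 'b::real_vector"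
 assumes "b \<in> Basis" shows "(\<Sum>c\<in>Basis. inner (h *\<^sub>R b) c *\<^sub>R f c) = h *\<^sub>R f b"
proof -
 have "(\<Sum>c\<in>Basis. inner (h *\<^sub>R b) c *\<^sub>R f c) = (\<Sum>c\<in>Basis. if c = b then h *\<^sub>R f c else 0)"
  by (rule sum.cong) (auto simp: inner_Basis assms)
 then show ?thesis using assms by simp
qed

text \<open>The mixed second difference is symmetric in \<open>b\<close> and \<open>c\<close>. Being
  within order \<open>h^3\<close> of \<open>h^2\<close> times a mixed derivative, it forces the two
  mixed derivatives to coincide. The mean value inequality in direction \<open>c\<close> reduces it
  to a first difference of \<open>partial c u\<close>.\<close>

lemma second_difference_bound:
 fixes u :: "'a::euclidean_space \<Rightarrow> complex"
 assumes u: "u \<in> test_functions UNIV" and b: "b \<in> Basis" and c: "c \<in> Basis"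
 obtains C where "0 < C" "\<And>x h. 0 < h \<Longrightarrow> cmod (u (x + h *\<^sub>R b + h *\<^sub>R c) - u (x + h *\<^sub>R b) - u (x + h *\<^sub>R c) + u x
  - h\<^sup>2 *\<^sub>R partial b (partial c u) x) \<le> C * h ^ 3"
proof -
 define v where "v = partial c u"
 have v: "v \<in> test_functions UNIV" unfolding v_def by (rule test_partial[OF u c])
 obtain C where C: "C > 0"
  "\<And>z h. cmod (v (z + h) - v z - (\<Sum>b\<in>Basis. inner h b *\<^sub>R partial b v z)) \<le> C * (norm h)^2"
  by (rule test_taylor[OF v]) blast
 obtain L where L: "L > 0" "\<And>x y. cmod (partial b v x - partial b v y) \<le> L * norm (x - y)"
  by (rule test_lipschitz[OF test_partial[OF v b]]) blast
 have "cmod (u (x + h *\<^sub>R b + h *\<^sub>R c) - u (x + h *\<^sub>R b) - u (x + h *\<^sub>R c) + u x - h\<^sup>2 *\<^sub>R partial b v x)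
   \<le> (C + L) * h ^ 3" if h: "0 < h" for x h
 proof -
  define m where "m = partial b v x"
  define F where "F = (\<lambda>s. u (x + h *\<^sub>R b + s *\<^sub>R (h *\<^sub>R c)) - u (x + s *\<^sub>R (h *\<^sub>R c)) - s *\<^sub>R (h\<^sup>2 *\<^sub>R m))"
  define G where "G s = h *\<^sub>R v (x + s *\<^sub>R (h *\<^sub>R c) + h *\<^sub>R b) - h *\<^sub>R v (x + s *\<^sub>R (h *\<^sub>R c)) - h\<^sup>2 *\<^sub>R m" for s
  have fr: "frechet_derivative u (at y) (h *\<^sub>R c) = h *\<^sub>R v y" for y
   unfolding frechet_derivative_eq_sum[OF test_differentiable[OF u]] v_def
   by (rule sum_inner_scaleR_Basis[OF c])
  have F': "(F has_derivative (\<lambda>t. t *\<^sub>R G s)) (at s within {0..1})" for s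
  proof -
   have "((\<lambda>s. s *\<^sub>R (h\<^sup>2 *\<^sub>R m)) has_derivative (\<lambda>t. t *\<^sub>R (h\<^sup>2 *\<^sub>R m))) (at s)"
    by (auto intro!: derivative_eq_intros)
   from has_derivative_diff[OF has_derivative_diff[OF line_has_derivative[OF u, of "x + h *\<^sub>R b" "h *\<^sub>R c"]
      line_has_derivative[OF u, of x "h *\<^sub>R c"]] this]
   have "(F has_derivative (\<lambda>t. t *\<^sub>R G s)) (at s)"
    unfolding F_def fr by (simp add: G_def scaleR_diff_right add_ac)
   then show ?thesis by (rule has_derivative_at_withinI)
  qed
  have Gb: "cmod (G s) \<le> (C + L) * h ^ 3" if s: "s \<in> {0..1}" for s
  proof -
   define y where "y = x + s *\<^sub>R (h *\<^sub>R c)"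
   have 1: "cmod (v (y + h *\<^sub>R b) - v y - h *\<^sub>R partial b v y) \<le> C * h\<^sup>2"
    using C(2)[of y "h *\<^sub>R b"] b unfolding sum_inner_scaleR_Basis[OF b] by simp
   have "norm (s *\<^sub>R (h *\<^sub>R c)) \<le> h" using s h c by (simp add: mult_left_le_one_le)
   then have "L * norm (y - x) \<le> L * h" using L(1) by (intro mult_left_mono) (simp_all add: y_def)
   then have "cmod (partial b v y - m) \<le> L * h" using L(2)[of y x] by (simp add: m_def)
   then have 2: "cmod (h *\<^sub>R (partial b v y - m)) \<le> h * (L * h)" using h by (simp add: mult_left_mono)
   have "G s = h *\<^sub>R ((v (y + h *\<^sub>R b) - v y - h *\<^sub>R partial b v y) + h *\<^sub>R (partial b v y - m))"
    by (simp add: G_def y_def scaleR_diff_right scaleR_add_right power2_eq_square)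
   also have "cmod \<dots> = h * cmod ((v (y + h *\<^sub>R b) - v y - h *\<^sub>R partial b v y) + h *\<^sub>R (partial b v y - m))"
    using h by simp
   also have "\<dots> \<le> h * (C * h\<^sup>2 + h * (L * h))"
    using h by (intro mult_left_mono order_trans[OF norm_triangle_ineq] add_mono 1 2) auto
   also have "\<dots> = (C + L) * h ^ 3" by (simp add: power2_eq_square power3_eq_cube algebra_simps)
   finally show ?thesis .
  qed
  have "norm (F 1 - F 0) \<le> (C + L) * h ^ 3 * norm (1 - 0 :: real)"
  proof (rule differentiable_bound[OF _ F'])
   show "onorm (\<lambda>t. t *\<^sub>R G s) \<le> (C + L) * h ^ 3" if "s \<in> {0..1}" for s
    by (rule onorm_le) (use mult_left_mono[OF Gb[OF that] abs_ge_zero] in \<open>simp add: mult.commute\<close>)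
  qed auto
  then show ?thesis by (simp add: F_def m_def algebra_simps)
 qed
 moreover have "0 < C + L" using C(1) L(1) by simp
 ultimately show ?thesis using that unfolding v_def by blast
qed

lemma partial_commute:
 fixes u :: "'a::euclidean_space \<Rightarrow> complex"
 assumes u: "u \<in> test_functions \<Omega>" and b: "b \<in> Basis" and c: "c \<in> Basis"
 shows "partial b (partial c u) = partial c (partial b u)"
proof
 fix x
 have uU: "u \<in> test_functions UNIV" by (rule test_UNIV[OF u])
 obtain C where C: "0 < C" "\<And>x h. 0 < h \<Longrightarrow> cmod (u (x + h *\<^sub>R b + h *\<^sub>R c) - u (x + h *\<^sub>R b) - u (x + h *\<^sub>R c) + u x
  - h\<^sup>2 *\<^sub>R partial b (partial c u) x) \<le> C * h ^ 3" by (rule second_difference_bound[OF uU b c]) blast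
 obtain D where D: "0 < D" "\<And>x h. 0 < h \<Longrightarrow> cmod (u (x + h *\<^sub>R c + h *\<^sub>R b) - u (x + h *\<^sub>R c) - u (x + h *\<^sub>R b) + u x
  - h\<^sup>2 *\<^sub>R partial c (partial b u) x) \<le> D * h ^ 3" by (rule second_difference_bound[OF uU c b]) blast
 define d where "d = cmod (partial b (partial c u) x - partial c (partial b u) x)"
 have le: "d \<le> (C + D) * h" if h: "0 < h" for h
 proof -
  let ?S = "u (x + h *\<^sub>R b + h *\<^sub>R c) - u (x + h *\<^sub>R b) - u (x + h *\<^sub>R c) + u x"
  have eq: "u (x + h *\<^sub>R c + h *\<^sub>R b) - u (x + h *\<^sub>R c) - u (x + h *\<^sub>R b) + u x = ?S" by (simp add: add_ac)
  have 2: "cmod (?S - h\<^sup>2 *\<^sub>R partial c (partial b u) x) \<le> D * h ^ 3" using D(2)[OF h, of x] unfolding eq .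
  have "h\<^sup>2 * d = cmod (h\<^sup>2 *\<^sub>R (partial b (partial c u) x - partial c (partial b u) x))" by (simp add: d_def)
  also have "\<dots> = cmod ((?S - h\<^sup>2 *\<^sub>R partial c (partial b u) x) - (?S - h\<^sup>2 *\<^sub>R partial b (partial c u) x))"
   by (simp add: scaleR_diff_right)
  also have "\<dots> \<le> D * h ^ 3 + C * h ^ 3"
   by (rule order_trans[OF norm_triangle_ineq4 add_mono[OF 2 C(2)[OF h]]])
  also have "\<dots> = h\<^sup>2 * ((C + D) * h)" by (simp add: power2_eq_square power3_eq_cube algebra_simps)
  finally show ?thesis using h by simp
 qed
 have "d = 0"
 proof (rule ccontr)
  assume "d \<noteq> 0"
  then have "d > 0" by (simp add: d_def)
  then have "d \<le> (C + D) * (d / (2 * (C + D)))" using C(1) D(1) by (intro le) simp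
  also have "\<dots> = ((C + D) * d) / ((C + D) * 2)" by (simp add: mult.commute)
  also have "\<dots> = d / 2" using C(1) D(1) by (intro nonzero_mult_divide_mult_cancel_left) simp
  finally show False using \<open>d > 0\<close> by simp
 qed
 then show "partial b (partial c u) x = partial c (partial b u) x" by (simp add: d_def)
qed

lemma l2inner_parts:
 assumes f: "f \<in> test_functions UNIV" and g: "g \<in> test_functions UNIV" and b: "b \<in> Basis"
 shows "l2inner (partial b f) g = - l2inner f (partial b g)"
proof -
 have "(LINT x|lborel. cnj (g x) * partial b f x) = - (LINT x|lborel. partial b (\<lambda>x. cnj (g x)) x * f x)"
  by (rule integration_by_parts[OF smooth_cnj[OF test_smooth[OF g]] f b])
 then show ?thesis by (simp add: l2inner_def partial_cnj[OF test_differentiable[OF g]] mult.commute)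
qed

lemma inner_parts:
 assumes f: "f \<in> test_functions UNIV" and g: "g \<in> test_functions UNIV" and b: "b \<in> Basis"
 shows "inner (l2of (partial b f)) (l2of g) = - inner (l2of f) (l2of (partial b g))"
 using l2inner_parts[OF assms] by (simp add: inner_l2of test_L2[OF f] test_L2[OF g] test_L2[OF test_partial[OF f b]] test_L2[OF test_partial[OF g b]])

text \<open>Two integrations by parts turn the squared norm of a mixed derivative into the pairing
  of two pure second derivatives; summed over all \<open>b\<close> and \<open>c\<close> these
  pairings give the squared norm of the Laplacian. Convergence of Laplacians therefore controls the
  whole Hessian.\<close>

lemma hessian_bound:
 fixes u :: "'a::euclidean_space \<Rightarrow> complex"
 assumes u: "u \<in> test_functions \<Omega>" and b: "b \<in> Basis" and c: "c \<in> Basis"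
 shows "norm (l2of (partial b (partial c u))) \<le> norm (l2of (laplacian u))"
proof -
 have uU: "u \<in> test_functions UNIV" by (rule test_UNIV[OF u])
 have key: "(norm (l2of (partial b (partial c u))))^2 = inner (l2of (partial b (partial b u))) (l2of (partial c (partial c u)))"
  if b: "b \<in> Basis" and c: "c \<in> Basis" for b c :: 'a
 proof -
  note t = test_partial[OF uU]
  have "inner (l2of (partial b (partial c u))) (l2of (partial b (partial c u)))
    = inner (l2of (partial b (partial c u))) (l2of (partial c (partial b u)))"
   by (simp add: partial_commute[OF uU b c])
  also have "\<dots> = - inner (l2of (partial c u)) (l2of (partial b (partial c (partial b u))))"
   by (rule inner_parts[OF t[OF c] test_partial[OF t[OF b] c] b])
  also have "partial b (partial c (partial b u)) = partial c (partial b (partial b u))"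
   by (rule partial_commute[OF t[OF b] b c])
  also have "- inner (l2of (partial c u)) (l2of (partial c (partial b (partial b u))))
    = inner (l2of (partial c (partial c u))) (l2of (partial b (partial b u)))"
   using inner_parts[OF t[OF c] test_partial[OF t[OF b] b] c] by simp
  finally show ?thesis by (simp add: power2_norm_eq_inner inner_commute)
 qed
 have "(norm (l2of (partial b (partial c u))))^2 \<le> (\<Sum>c\<in>Basis. (norm (l2of (partial b (partial c u))))^2)"
  by (rule member_le_sum[OF c]) auto
 also have "\<dots> \<le> (\<Sum>b\<in>Basis. \<Sum>c\<in>Basis. (norm (l2of (partial b (partial c u))))^2)"
  by (rule member_le_sum[OF b, of "\<lambda>b. \<Sum>c\<in>Basis. (norm (l2of (partial b (partial c u))))^2"])
   (auto intro: sum_nonneg)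
 also have "\<dots> = (\<Sum>b\<in>Basis. \<Sum>c\<in>Basis. inner (l2of (partial b (partial b u))) (l2of (partial c (partial c u))))"
  by (intro sum.cong refl key)
 also have "\<dots> = (norm (l2of (laplacian u)))^2"
  unfolding l2of_laplacian[OF u] power2_norm_eq_inner inner_sum_left inner_sum_right by (rule sum.swap)
 finally show ?thesis by (rule power2_le_imp_le) simp
qed

text \<open>One integration by parts, summed over all directions, pairs \<open>u\<close> with minus
  its Laplacian; Cauchy-Schwarz does the rest.\<close>

lemma gradient_bound:
 fixes u :: "'a::euclidean_space \<Rightarrow> complex"
 assumes u: "u \<in> test_functions \<Omega>" and b: "b \<in> Basis"
 shows "(norm (l2of (partial b u)))^2 \<le> norm (l2of u) * norm (l2of (laplacian u))"
proof -
 have uU: "u \<in> test_functions UNIV" by (rule test_UNIV[OF u])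
 have "(norm (l2of (partial b u)))^2 \<le> (\<Sum>b\<in>Basis. (norm (l2of (partial b u)))^2)"
  by (rule member_le_sum[OF b]) auto
 also have "\<dots> = (\<Sum>b\<in>Basis. - inner (l2of u) (l2of (partial b (partial b u))))"
  unfolding power2_norm_eq_inner by (intro sum.cong refl inner_parts[OF uU test_partial[OF uU]])
 also have "\<dots> = inner (l2of u) (- l2of (laplacian u))"
  unfolding l2of_laplacian[OF u] by (simp add: inner_sum_right sum_negf)
 also have "\<dots> \<le> norm (l2of u) * norm (- l2of (laplacian u))" by (rule norm_cauchy_schwarz)
 finally show ?thesis by simp
qed

subsection \<open>Rellich's inequality\<close>

lemma partial_regularized_weight:
 fixes \<delta> :: real assumes d: "\<delta> > 0"
 defines "W \<equiv> (\<lambda>x::'a::euclidean_space. complex_of_real (1 / ((norm x)^2 + \<delta>)))"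
 shows "smooth W" "partial b W x = - 2 * of_real (inner x b) * (W x)^2"
proof -
 define g where "g x = (norm x)^2 + \<delta>" for x :: 'a
 have g0: "g x > 0" for x using d by (simp add: g_def add_nonneg_pos)
 have gs: "smooth (\<lambda>x. complex_of_real (g x))" using smooth_linear_norm_square[of 1 \<delta>] by (simp add: g_def)
 define \<psi> where "\<psi> n s = (-1) ^ n * fact n * inverse s ^ Suc n" for n and s :: real
 have psi: "(\<psi> n has_real_derivative \<psi> (Suc n) s) (at s)" if "s > 0" for n s
 proof -
  have "(inverse has_real_derivative - (inverse s ^ Suc (Suc 0))) (at s)"
   using that by (intro DERIV_inverse) simp
  from DERIV_cmult[OF DERIV_power[OF this, of "Suc n"], of "(-1) ^ n * fact n"]
  show ?thesis unfolding \<psi>_def by (simp add: algebra_simps)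
 qed
 have W: "W = (\<lambda>x. complex_of_real (\<psi> 0 (g x)))" by (simp add: W_def \<psi>_def g_def inverse_eq_divide)
 show "smooth W" unfolding W by (rule smooth_compose_real[where \<psi> = \<psi> and g = g, OF gs psi[OF g0]])
 have gd: "g differentiable (at x)" by (rule differentiable_of_real_iff[OF smooth_differentiable[OF gs]])
 have "(g has_derivative (\<lambda>h. 2 * inner x h)) (at x)"
  unfolding g_def using has_derivative_add[OF norm_square_has_derivative[of x] has_derivative_const[of \<delta>]] by simp
 then have pg: "partial b g x = 2 * inner x b" by (rule partial_eq)
 have "partial b W x = complex_of_real (\<psi> (Suc 0) (g x) * partial b g x)"
  unfolding W using partial_real_compose(2)[of "\<psi> 0" "\<psi> (Suc 0) (g x)" g x, OF psi[OF g0] gd] by simp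
 also have "\<dots> = - 2 * of_real (inner x b) * (W x)^2" by (simp add: pg W \<psi>_def power2_eq_square)
 finally show "partial b W x = - 2 * of_real (inner x b) * (W x)^2" .
qed

lemma inner_mult_commute:
 assumes "f \<in> L2" "g \<in> L2" "m \<odot> f \<in> L2" "m \<odot> g \<in> L2"
 shows "inner (l2of (m \<odot> f)) (l2of g) = inner (l2of f) (l2of (m \<odot> g))"
 using assms by (simp add: inner_l2of l2inner_def mult_ac)

lemma inner_mult_self:
 assumes f: "f \<in> L2" "m \<odot> f \<in> L2"
 shows "inner (l2of (m \<odot> f)) (l2of f) = (LINT x|lborel. m x * (cmod (f x))^2)"
proof -
 have "(\<lambda>x. of_real (m x) * f x * cnj (f x)) = (\<lambda>x. complex_of_real (m x * (cmod (f x))^2))"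
  by (simp add: mult.assoc complex_norm_square[symmetric] del: of_real_power)
 then show ?thesis using f by (simp add: inner_l2of l2inner_def integral_complex_of_real del: of_real_mult of_real_power)
qed

text \<open>Multiplier method: minus the Laplacian is paired with \<open>w u\<close> for
  \<open>w = 1 / (|x|^2 + \<delta>)\<close>. This produces a weighted gradient term and a zero-order
  term that dominates \<open>w^2 |u|^2\<close>. The regularisation keeps \<open>w\<close> bounded at
  the origin, where these test functions need not vanish, and the constant 1 does not depend on
  \<open>\<delta>\<close>.\<close>

lemma rellich_regularized:
 fixes u :: "'a::euclidean_space \<Rightarrow> complex" and \<delta> :: real
 assumes N: "DIM('a) \<ge> 5" and u: "u \<in> test_functions UNIV" and d: "\<delta> > 0"
 shows "(l2norm ((\<lambda>x. 1 / ((norm x)^2 + \<delta>)) \<odot> u))^2 \<le> (l2norm (laplacian u))^2"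
  and "b \<in> Basis \<Longrightarrow> (l2norm ((\<lambda>x. sqrt (1 / ((norm x)^2 + \<delta>))) \<odot> partial b u))^2 \<le> (l2norm (laplacian u))^2"
proof -
 define w where "w x = 1 / ((norm x)^2 + \<delta>)" for x :: 'a
 \<comment> \<open>\<open>y b\<close> is minus one half of the derivative of \<open>w\<close> in
   direction \<open>b\<close>, and \<open>z b\<close> is the derivative of \<open>y b\<close> in the
   same direction.\<close>
 define y where "y b x = inner x b * (w x)^2" for b x :: 'a
 define z where "z b x = (w x)^2 - 4 * (inner x b)^2 * (w x) ^ 3" for b x :: 'a
 have g0: "0 < (norm x)^2 + \<delta>" for x :: 'a using d by (simp add: add_nonneg_pos)
 have w0: "0 < w x" for x using g0 by (simp add: w_def)
 have w1: "(norm x)^2 * w x \<le> 1" for x using g0[of x] d by (simp add: w_def)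
 let ?W = "\<lambda>x. complex_of_real (w x)" and ?y = "\<lambda>b x. complex_of_real (y b x)"
 have W: "smooth ?W" "partial b ?W x = - 2 * of_real (inner x b) * (?W x)^2" for b x
  unfolding w_def by (rule partial_regularized_weight[OF d])+
 have sd: "s differentiable (at x)" if "smooth s" for s :: "'a \<Rightarrow> complex" and x by (rule smooth_differentiable[OF that])
 have W2: "smooth (\<lambda>x. ?W x * ?W x)" by (intro smooth_mult W)
 have ye: "?y b = (\<lambda>x. of_real (inner x b) * (?W x * ?W x))" for b by (simp add: y_def power2_eq_square)
 have ys: "smooth (?y b)" for b unfolding ye by (intro smooth_mult smooth_inner W2)
 have yp: "partial b (?y b) = (\<lambda>x. of_real (z b x))" if b: "b \<in> Basis" for b
 proof
  fix x
  have "partial b (\<lambda>x. ?W x * ?W x) x = - 4 * of_real (inner x b) * ?W x ^ 3"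
   using partial_mult[OF sd[OF W(1)] sd[OF W(1)], of b x] W(2)[of b x] by (simp add: power2_eq_square power3_eq_cube)
  moreover have "partial b (\<lambda>x. complex_of_real (inner x b)) x = 1" unfolding partial_inner using b by simp
  ultimately show "partial b (?y b) x = of_real (z b x)"
   unfolding ye using partial_mult[OF sd[OF smooth_inner] sd[OF W2], of b b x]
   by (simp add: z_def power2_eq_square algebra_simps)
 qed
 have zs: "smooth (\<lambda>x. complex_of_real (z b x))" if "b \<in> Basis" for b
  using smooth_partial[OF ys that, of b] unfolding yp[OF that] .
 have w2s: "smooth (\<lambda>x. complex_of_real ((w x)^2))" using W2 by (simp add: power2_eq_square)
 note tu = test_mult[OF _ u] and tp = test_partial[OF u]
 note uL = test_L2[OF u] and pL = test_L2[OF tp]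
 define P L G where "P = l2norm (w \<odot> u)" and "L = l2norm (laplacian u)" and "G b = l2norm ((\<lambda>x. sqrt (w x)) \<odot> partial b u)" for b
 have P2: "P\<^sup>2 = inner (l2of ((\<lambda>x. (w x)^2) \<odot> u)) (l2of u)"
  unfolding P_def l2norm_square inner_mult_self[OF uL test_L2[OF tu[OF w2s]]]
  by (simp add: norm_mult power_mult_distrib)
 have G2: "(G b)^2 = inner (l2of (w \<odot> partial b u)) (l2of (partial b u))" if b: "b \<in> Basis" for b
  unfolding G_def l2norm_square inner_mult_self[OF pL[OF b] test_L2[OF test_mult[OF W(1) tp[OF b]]]]
  using w0[THEN less_imp_le] by (simp add: norm_mult power_mult_distrib)
 \<comment> \<open>The first integration by parts produces a cross term of \<open>y b u\<close> with
   the derivative of \<open>u\<close>; a second one turns twice this cross term into minus the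
   zero-order term with weight \<open>z b\<close>.\<close>
 have key: "(G b)^2 + inner (l2of (z b \<odot> u)) (l2of u) = - inner (l2of (w \<odot> u)) (l2of (partial b (partial b u)))"
  if b: "b \<in> Basis" for b
 proof -
  note t = tu[OF W(1)] tu[OF ys, of b] tu[OF zs[OF b]] test_mult[OF W(1) tp[OF b]] test_mult[OF ys tp[OF b], of b]
  note L = t[THEN test_L2]
  have "partial b (w \<odot> u) = (\<lambda>x. (w \<odot> partial b u) x - 2 * (y b \<odot> u) x)"
   using partial_mult[OF sd[OF W(1)] test_differentiable[OF u], of b] by (simp add: fun_eq_iff W(2) y_def)
  then have "l2of (partial b (w \<odot> u)) = l2of (w \<odot> partial b u) - 2 *\<^sub>R l2of (y b \<odot> u)"
   using l2of_scaleC[OF L(2), of 2] scaleC_of_real[of 2 "l2of (y b \<odot> u)"] by (simp only: l2of_diff[OF L(4) L2_cmult[OF L(2)]]) simp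
  then have 1: "inner (l2of (w \<odot> partial b u)) (l2of (partial b u)) - 2 * inner (l2of (y b \<odot> u)) (l2of (partial b u))
    = - inner (l2of (w \<odot> u)) (l2of (partial b (partial b u)))"
   using inner_parts[OF t(1) tp[OF b] b] by (simp add: inner_diff_left)
  have "partial b (y b \<odot> u) = (\<lambda>x. (z b \<odot> u) x + (y b \<odot> partial b u) x)"
   using partial_mult[OF sd[OF ys] test_differentiable[OF u], of b b] by (simp add: fun_eq_iff yp[OF b])
  then have "inner (l2of (z b \<odot> u)) (l2of u) + inner (l2of (y b \<odot> partial b u)) (l2of u) = - inner (l2of (y b \<odot> u)) (l2of (partial b u))"
   using inner_parts[OF t(2) u b] by (simp add: l2of_add L inner_add_left)
  moreover have "inner (l2of (y b \<odot> partial b u)) (l2of u) = inner (l2of (y b \<odot> u)) (l2of (partial b u))"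
   using inner_mult_commute[OF pL[OF b] uL L(5,2)] by (simp add: inner_commute)
  ultimately show ?thesis using 1 G2[OF b] by linarith
 qed
 have "0 \<le> (\<Sum>b\<in>Basis. inner (l2of (z b \<odot> u)) (l2of u)) - P\<^sup>2"
 proof -
  define q where "q x = (\<Sum>b\<in>Basis. z b x) - (w x)^2" for x
  \<comment> \<open>Here the dimension enters: since \<open>|x|^2 w \<le> 1\<close>, the weights
    \<open>z b\<close> add up to at least \<open>(N - 4) w^2\<close>, and
    \<open>N - 4 \<ge> 1\<close>.\<close>
  have "0 \<le> q x" for x
  proof -
   have "(\<Sum>b\<in>Basis. z b x) = DIM('a) * (w x)^2 - 4 * (norm x)^2 * (w x) ^ 3"
    unfolding z_def power2_norm_eq_inner euclidean_inner[of x x]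
    by (simp add: sum_subtractf sum_distrib_left sum_distrib_right power2_eq_square)
   moreover have "4 * ((norm x)^2 * w x) * (w x)^2 \<le> 4 * 1 * (w x)^2"
    using w1[of x] by (intro mult_right_mono mult_left_mono) auto
   moreover have "5 * (w x)^2 \<le> real DIM('a) * (w x)^2" using N by (intro mult_right_mono) auto
   moreover have "4 * (norm x)^2 * (w x) ^ 3 = 4 * ((norm x)^2 * w x) * (w x)^2"
    by (simp add: power2_eq_square power3_eq_cube)
   ultimately show ?thesis unfolding q_def by linarith
  qed
  moreover have zL: "z b \<odot> u \<in> L2" if "b \<in> Basis" for b by (rule test_L2[OF tu[OF zs[OF that]]])
  have e: "q \<odot> u = (\<lambda>x. (\<Sum>b\<in>Basis. (z b \<odot> u) x) - ((\<lambda>x. (w x)^2) \<odot> u) x)"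
   by (simp add: q_def fun_eq_iff left_diff_distrib sum_distrib_right)
  have sL: "(\<lambda>x. \<Sum>b\<in>Basis. (z b \<odot> u) x) \<in> L2" by (rule L2_sum[OF zL])
  have se: "l2of (\<lambda>x. \<Sum>b\<in>Basis. (z b \<odot> u) x) = (\<Sum>b\<in>Basis. l2of (z b \<odot> u))" by (rule l2of_sum[OF zL])
  have "q \<odot> u \<in> L2" unfolding e by (rule L2_diff[OF sL test_L2[OF tu[OF w2s]]])
  ultimately have "0 \<le> inner (l2of (q \<odot> u)) (l2of u)" unfolding inner_mult_self[OF uL \<open>q \<odot> u \<in> L2\<close>] by simp
  then show ?thesis
   unfolding e l2of_diff[OF sL test_L2[OF tu[OF w2s]]] se P2 by (simp add: inner_diff_left inner_sum_left)
 qed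
 moreover have "(\<Sum>b\<in>Basis. (G b)^2) + (\<Sum>b\<in>Basis. inner (l2of (z b \<odot> u)) (l2of u)) = - inner (l2of (w \<odot> u)) (l2of (laplacian u))"
  unfolding l2of_laplacian[OF u] by (simp add: key inner_sum_right sum_negf flip: sum.distrib)
 moreover have "- inner (l2of (w \<odot> u)) (l2of (laplacian u)) \<le> P * L"
  using norm_cauchy_schwarz[of "l2of (w \<odot> u)" "- l2of (laplacian u)"]
  by (simp add: P_def L_def norm_l2of test_L2[OF tu[OF W(1)]] test_L2[OF test_laplacian[OF u]])
 ultimately have main: "(\<Sum>b\<in>Basis. (G b)^2) + P\<^sup>2 \<le> P * L" by linarith
 have Gs: "0 \<le> (\<Sum>b\<in>Basis. (G b)^2)" by (intro sum_nonneg) auto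
 have P0: "0 \<le> P" by (simp add: P_def)
 have PL: "P \<le> L"
 proof (cases "P = 0")
  case False
  have "P * P \<le> P * L" using main Gs by (simp add: power2_eq_square)
  then show ?thesis using False P0 by simp
 qed (simp add: L_def)
 show "(l2norm ((\<lambda>x. 1 / ((norm x)^2 + \<delta>)) \<odot> u))^2 \<le> (l2norm (laplacian u))^2"
  using power_mono[OF PL P0, of 2] by (simp only: P_def L_def w_def)
 assume b: "b \<in> Basis"
 have "(G b)^2 \<le> (\<Sum>b\<in>Basis. (G b)^2)" by (rule member_le_sum[OF b]) auto
 also have "\<dots> \<le> P * L" using main zero_le_power2[of P] by linarith
 also have "\<dots> \<le> L\<^sup>2" unfolding power2_eq_square by (rule mult_right_mono[OF PL]) (simp add: L_def)
 finally show "(l2norm ((\<lambda>x. sqrt (1 / ((norm x)^2 + \<delta>))) \<odot> partial b u))^2 \<le> (l2norm (laplacian u))^2"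
  by (simp only: G_def L_def w_def)
qed

text \<open>Passing to the limit \<open>\<delta> \<rightarrow> 0\<close> by Fatou's lemma.\<close>

lemma regularized_weight_limit:
 fixes k :: "real \<Rightarrow> 'a::euclidean_space \<Rightarrow> real"
 assumes l: "l \<in> L2" "(\<lambda>n. l2of (r n)) \<longlonglongrightarrow> l2of l" "\<And>n. r n \<in> L2"
  and f: "f \<in> L2" and t: "\<And>n. t n \<in> L2" "(\<lambda>n. l2of (t n)) \<longlonglongrightarrow> l2of f"
  and k: "\<And>\<delta>. k \<delta> \<in> borel_measurable borel" "\<And>\<delta>. 0 < \<delta> \<Longrightarrow> \<exists>C. \<forall>x. \<bar>k \<delta> x\<bar> \<le> C"
  and bound: "\<And>\<delta> n. 0 < \<delta> \<Longrightarrow> (l2norm (k \<delta> \<odot> t n))^2 \<le> (l2norm (r n))^2"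
  and klim: "\<And>x. x \<noteq> 0 \<Longrightarrow> (\<lambda>n. k (inverse (real (Suc n))) x) \<longlonglongrightarrow> k 0 x"
 shows "(k 0 \<odot> f) \<in> L2" "(l2norm (k 0 \<odot> f))^2 \<le> (l2norm l)^2"
proof -
 note [measurable] = L2_measurable[OF f] k(1) L2_measurable[OF t(1)]
 have step: "(k \<delta> \<odot> f) \<in> L2 \<and> (l2norm (k \<delta> \<odot> f))^2 \<le> (l2norm l)^2" if d: "0 < \<delta>" for \<delta>
 proof -
  obtain C where C: "\<And>x. \<bar>k \<delta> x\<bar> \<le> C" using k(2)[OF d] by blast
  have m: "(k \<delta> \<odot> h) \<in> L2" "(l2norm (k \<delta> \<odot> h))^2 \<le> C\<^sup>2 * (l2norm h)^2"
   if h: "h \<in> L2" for h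
  proof -
   note [measurable] = L2_measurable[OF h]
   have "AE x in lborel. cmod (of_real (k \<delta> x) * h x) \<le> C * cmod (h x)"
    by (intro AE_I2) (simp add: norm_mult C mult_right_mono)
   then show "(k \<delta> \<odot> h) \<in> L2" "(l2norm (k \<delta> \<odot> h))^2 \<le> C\<^sup>2 * (l2norm h)^2"
    using L2_bound[OF h, of "\<lambda>x. of_real (k \<delta> x) * h x" C] by auto
  qed
  have C0: "0 \<le> C" using C[of 0] by simp
  have "(\<lambda>n. l2of (k \<delta> \<odot> t n)) \<longlonglongrightarrow> l2of (k \<delta> \<odot> f)" unfolding l2of_tendsto_iff[OF m(1)[OF t(1)] m(1)[OF f]]
  proof (rule Lim_null_comparison)
   have "(\<lambda>n. C * l2norm (\<lambda>x. t n x - f x)) \<longlonglongrightarrow> C * 0"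
    using t f by (intro tendsto_intros) (simp add: l2of_tendsto_iff)
   then show "(\<lambda>n. C * l2norm (\<lambda>x. t n x - f x)) \<longlonglongrightarrow> 0" by simp
   have "l2norm (\<lambda>x. of_real (k \<delta> x) * t n x - of_real (k \<delta> x) * f x) \<le> C * l2norm (\<lambda>x. t n x - f x)" for n
    using m(2)[OF L2_diff[OF t(1) f], of n] C0
    by (intro power2_le_imp_le[of "l2norm (\<lambda>x. of_real (k \<delta> x) * t n x - of_real (k \<delta> x) * f x)"])
     (simp_all add: power_mult_distrib right_diff_distrib)
   then show "\<forall>\<^sub>F n in sequentially. norm (l2norm (\<lambda>x. of_real (k \<delta> x) * t n x - of_real (k \<delta> x) * f x)) \<le> C * l2norm (\<lambda>x. t n x - f x)"
    by simp
  qed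
  then have "(\<lambda>n. norm (l2of (k \<delta> \<odot> t n))) \<longlonglongrightarrow> norm (l2of (k \<delta> \<odot> f))" by (rule tendsto_norm)
  moreover have "(\<lambda>n. norm (l2of (r n))) \<longlonglongrightarrow> norm (l2of l)" by (rule tendsto_norm[OF l(2)])
  moreover have "norm (l2of (k \<delta> \<odot> t n)) \<le> norm (l2of (r n))" for n
   using power2_le_imp_le[OF bound[OF d]] m(1)[OF t(1)] l(3) by (simp add: norm_l2of)
  ultimately have "norm (l2of (k \<delta> \<odot> f)) \<le> norm (l2of l)"
   by (intro LIMSEQ_le[of "\<lambda>n. norm (l2of (k \<delta> \<odot> t n))"]) auto
  then have "l2norm (k \<delta> \<odot> f) \<le> l2norm l" using m(1)[OF f] l(1) by (simp add: norm_l2of)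
  then show ?thesis using m(1)[OF f] by (auto intro: power_mono)
 qed
 have "AE x in lborel. (\<lambda>n. complex_of_real (k (inverse (real (Suc n))) x) * f x) \<longlonglongrightarrow> of_real (k 0 x) * f x"
  using AE_lborel_singleton[of "0::'a"]
 proof eventually_elim
  case (elim x)
  then show ?case by (intro tendsto_intros klim)
 qed
 from L2_fatou[of "\<lambda>n x. complex_of_real (k (inverse (real (Suc n))) x) * f x" "(l2norm l)^2", OF _ _ _ this] step
 show "(k 0 \<odot> f) \<in> L2" "(l2norm (k 0 \<odot> f))^2 \<le> (l2norm l)^2" by auto
qed

text \<open>Stated for limits of test functions, so that it covers mollified functions from the
  Sobolev space as well as, with constant sequences, the test functions themselves.\<close>

lemma rellich_limit:
 fixes v :: "'a::euclidean_space \<Rightarrow> complex"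
 assumes N: "DIM('a) \<ge> 5" and s: "\<And>n. s n \<in> test_functions UNIV"
  and v: "v \<in> L2" "(\<lambda>n. l2of (s n)) \<longlonglongrightarrow> l2of v"
  and g: "\<And>b. b \<in> Basis \<Longrightarrow> g b \<in> L2" "\<And>b. b \<in> Basis \<Longrightarrow> (\<lambda>n. l2of (partial b (s n))) \<longlonglongrightarrow> l2of (g b)"
  and l: "l \<in> L2" "(\<lambda>n. l2of (laplacian (s n))) \<longlonglongrightarrow> l2of l"
 shows "(npow (-2) \<odot> v) \<in> L2" "(l2norm (npow (-2) \<odot> v))^2 \<le> (l2norm l)^2"
  and "b \<in> Basis \<Longrightarrow> (npow (-1) \<odot> g b) \<in> L2"
  and "b \<in> Basis \<Longrightarrow> (l2norm (npow (-1) \<odot> g b))^2 \<le> (l2norm l)^2"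
proof -
 have npos: "0 < (norm x)^2 + inverse (real (Suc n))" for x :: 'a and n by (simp add: add_nonneg_pos)
 have lim: "(\<lambda>n. 1 / ((norm x)^2 + inverse (real (Suc n)))) \<longlonglongrightarrow> 1 / ((norm x)^2 + 0)" if "x \<noteq> 0" for x :: 'a
  using that by (intro tendsto_intros LIMSEQ_inverse_real_of_nat) auto
 have bd: "\<bar>1 / ((norm x)^2 + \<delta>)\<bar> \<le> 1 / \<delta>" if "0 < \<delta>" for \<delta> and x :: 'a
  using that by (simp add: frac_le add_nonneg_pos)
 have m1: "(\<lambda>x::'a. 1 / ((norm x)^2 + \<delta>)) \<in> borel_measurable borel" for \<delta> :: real by measurable
 have x1: "\<exists>C. \<forall>x::'a. \<bar>1 / ((norm x)^2 + \<delta>)\<bar> \<le> C" if "0 < \<delta>" for \<delta> using bd[OF that] by blast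
 note 1 = regularized_weight_limit[where k = "\<lambda>\<delta> x. 1 / ((norm x)^2 + \<delta>)" and t = s,
   OF l test_L2[OF test_laplacian[OF s]] v(1) test_L2[OF s] v(2) m1 x1 rellich_regularized(1)[OF N s] lim]
 have e1: "1 / ((norm x)^2 + 0) = norm x powr -2" for x :: 'a
  by (cases "x = 0") (simp_all add: powr_minus_divide)
 show "(npow (-2) \<odot> v) \<in> L2" "(l2norm (npow (-2) \<odot> v))^2 \<le> (l2norm l)^2" using 1 unfolding e1 by auto
 assume b: "b \<in> Basis"
 have lim2: "(\<lambda>n. sqrt (1 / ((norm x)^2 + inverse (real (Suc n))))) \<longlonglongrightarrow> sqrt (1 / ((norm x)^2 + 0))" if "x \<noteq> 0" for x :: 'a
  by (rule tendsto_real_sqrt[OF lim[OF that]])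
 have bd2: "\<bar>sqrt (1 / ((norm x)^2 + \<delta>))\<bar> \<le> sqrt (1 / \<delta>)" if "0 < \<delta>" for \<delta> and x :: 'a
 proof -
  have "0 \<le> 1 / ((norm x)^2 + \<delta>)" using that by (simp add: add_nonneg_pos)
  then show ?thesis using real_sqrt_le_mono[OF abs_le_D1[OF bd[OF that, of x]]] by simp
 qed
 have m2: "(\<lambda>x::'a. sqrt (1 / ((norm x)^2 + \<delta>))) \<in> borel_measurable borel" for \<delta> :: real by measurable
 have x2: "\<exists>C. \<forall>x::'a. \<bar>sqrt (1 / ((norm x)^2 + \<delta>))\<bar> \<le> C" if "0 < \<delta>" for \<delta> using bd2[OF that] by blast
 note 2 = regularized_weight_limit[where k = "\<lambda>\<delta> x. sqrt (1 / ((norm x)^2 + \<delta>))",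
   OF l test_L2[OF test_laplacian[OF s]] g(1)[OF b] test_L2[OF test_partial[OF s b]] g(2)[OF b] m2 x2 rellich_regularized(2)[OF N s _ b] lim2]
 have e2: "sqrt (1 / ((norm x)^2 + 0)) = norm x powr -1" for x :: 'a
  by (cases "x = 0") (simp_all add: powr_minus_divide real_sqrt_divide)
 show "(npow (-1) \<odot> g b) \<in> L2" "(l2norm (npow (-1) \<odot> g b))^2 \<le> (l2norm l)^2" using 2 unfolding e2 by auto
qed

section \<open>Power weights and the form\<close>

lemma multiplier_L2:
 fixes m :: "'a::euclidean_space \<Rightarrow> real"
 assumes [measurable]: "m \<in> borel_measurable borel" and C: "\<And>x. \<bar>m x\<bar> \<le> C" and f: "f \<in> L2"
 shows "(m \<odot> f) \<in> L2" "l2norm (m \<odot> f) \<le> C * l2norm f"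
proof -
 note [measurable] = L2_measurable[OF f]
 have C0: "0 \<le> C" using C[of 0] by linarith
 have le: "AE x in lborel. cmod (complex_of_real (m x) * f x) \<le> C * cmod (f x)"
  by (intro AE_I2) (simp add: norm_mult C mult_right_mono)
 show "(m \<odot> f) \<in> L2" by (rule L2_bound(1)[OF f _ le]) measurable
 have "(l2norm (m \<odot> f))^2 \<le> C\<^sup>2 * (l2norm f)^2" by (rule L2_bound(2)[OF f _ le]) measurable
 then show "l2norm (m \<odot> f) \<le> C * l2norm f"
  using C0 by (intro power2_le_imp_le[of "l2norm (m \<odot> f)"]) (simp_all add: power_mult_distrib)
qed

lemma l2norm_mono:
 assumes g: "g \<in> L2" and [measurable]: "f \<in> borel_measurable borel" and le: "AE x in lborel. cmod (f x) \<le> cmod (g x)"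
 shows "f \<in> L2" "l2norm f \<le> l2norm g"
proof -
 have le': "AE x in lborel. cmod (f x) \<le> 1 * cmod (g x)" using le by simp
 show "f \<in> L2" by (rule L2_bound(1)[OF g _ le']) measurable
 have "(l2norm f)^2 \<le> 1\<^sup>2 * (l2norm g)^2" by (rule L2_bound(2)[OF g _ le']) measurable
 then show "l2norm f \<le> l2norm g" by (intro power2_le_imp_le[of "l2norm f"]) simp_all
qed

lemma l2norm_triangle: "f \<in> L2 \<Longrightarrow> g \<in> L2 \<Longrightarrow> l2norm (\<lambda>x. f x + g x) \<le> l2norm f + l2norm g"
 using norm_triangle_ineq[of "l2of f" "l2of g"] by (simp add: l2of_add[symmetric] norm_l2of)

lemma norm_powr_has_derivative:
 fixes x :: "'a::euclidean_space"
 assumes "x \<noteq> 0"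
 shows "((\<lambda>x. norm x powr \<gamma>) has_derivative (\<lambda>h. \<gamma> * norm x powr (\<gamma> - 2) * inner x h)) (at x)"
proof -
 have n: "0 < norm x" using assms by simp
 have "((\<lambda>t. t powr \<gamma>) has_real_derivative \<gamma> * norm x powr (\<gamma> - 1)) (at (norm x))"
  by (rule has_real_derivative_powr[OF n])
 then have "((\<lambda>t. t powr \<gamma>) has_derivative (*) (\<gamma> * norm x powr (\<gamma> - 1))) (at (norm x))"
  by (simp add: has_field_derivative_def)
 from has_derivative_compose[OF has_derivative_norm[OF assms] this]
 have "((\<lambda>x. norm x powr \<gamma>) has_derivative (\<lambda>h. \<gamma> * norm x powr (\<gamma> - 1) * inner h (sgn x))) (at x)" by simp
 moreover have "\<gamma> * norm x powr (\<gamma> - 1) * inner h (sgn x) = \<gamma> * norm x powr (\<gamma> - 2) * inner x h" for h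
 proof -
  have "norm x powr (\<gamma> - 1) = norm x powr (\<gamma> - 2) * norm x" using n powr_add[of "norm x" "\<gamma> - 2" 1] by simp
  then show ?thesis using n by (simp add: sgn_div_norm inner_commute)
 qed
 ultimately show ?thesis by simp
qed

lemma smooth_norm_powr:
 fixes r :: real assumes r: "0 < r"
 obtains W :: "'a::euclidean_space \<Rightarrow> complex" where "smooth W"
  "\<And>x. r < norm x \<Longrightarrow> W x = complex_of_real (norm x powr \<gamma>)"
  "\<And>b x. r < norm x \<Longrightarrow> partial b W x = complex_of_real (\<gamma> * norm x powr (\<gamma> - 2) * inner x b)"
proof -
 \<comment> \<open>Equal to \<open>|x|^2\<close> outside the ball of radius \<open>r\<close> and
   positive everywhere, so its real powers are smooth on the whole space and replace powers of the
   norm.\<close>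
 define g where "g x = (norm x)^2 + bump 0 ((- 1) * (norm x)^2 + r\<^sup>2)" for x :: 'a
 have gp: "0 < g x" for x
 proof (cases "x = 0")
  case True then show ?thesis using r bump_0_pos[of "r\<^sup>2"] by (simp add: g_def)
 next
  case False then show ?thesis by (simp add: g_def add_pos_nonneg bump_0_nonneg)
 qed
 have gs: "smooth (\<lambda>x. complex_of_real (g x))"
  unfolding g_def of_real_add by (intro smooth_add smooth_norm_square smooth_bump smooth_linear_norm_square)
 define \<psi> where "\<psi> n s = (\<Prod>i<n. \<gamma> / 2 - real i) * s powr (\<gamma> / 2 - real n)" for n and s :: real
 have psi: "(\<psi> n has_real_derivative \<psi> (Suc n) s) (at s)" if s: "0 < s" for n s
 proof -
  have e1: "\<gamma> / 2 - real n - 1 = \<gamma> / 2 - real (Suc n)" by simp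
  have "((\<lambda>s. s powr (\<gamma> / 2 - real n)) has_real_derivative (\<gamma> / 2 - real n) * s powr (\<gamma> / 2 - real (Suc n))) (at s)"
   using has_real_derivative_powr[OF s, of "\<gamma> / 2 - real n"] unfolding e1 .
  from DERIV_cmult[OF this, of "\<Prod>i<n. \<gamma> / 2 - real i"] show ?thesis
   unfolding \<psi>_def by (simp add: mult.assoc del: of_nat_Suc)
 qed
 define W where "W x = complex_of_real (\<psi> 0 (g x))" for x
 have Ws: "smooth W" unfolding W_def by (rule smooth_compose_real[where \<psi> = \<psi> and g = g, OF gs psi[OF gp]])
 have We: "W x = complex_of_real (norm x powr \<gamma>)" if x: "r < norm x" for x
 proof -
  have "r\<^sup>2 \<le> (norm x)^2" using x r by (intro power_mono) auto
  then have "g x = (norm x)^2" by (simp add: g_def bump_nonpos)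
  moreover have "0 < norm x" using x r by linarith
  moreover from this have "((norm x)^2) powr (\<gamma> / 2) = norm x powr \<gamma>"
   by (simp add: powr_powr powr_numeral[symmetric] del: powr_numeral)
  ultimately show ?thesis by (simp add: W_def \<psi>_def)
 qed
 have "partial b W x = complex_of_real (\<gamma> * norm x powr (\<gamma> - 2) * inner x b)" if x: "r < norm x" for b x
 proof (rule partial_eq[where D = "\<lambda>h. complex_of_real (\<gamma> * norm x powr (\<gamma> - 2) * inner x h)"])
  have x0: "x \<noteq> 0" using x r by auto
  show "(W has_derivative (\<lambda>h. complex_of_real (\<gamma> * norm x powr (\<gamma> - 2) * inner x h))) (at x)"
  proof (rule has_derivative_transform_within_open[of "\<lambda>x. complex_of_real (norm x powr \<gamma>)" _ _ _ "{x. r < norm x}"])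
   show "((\<lambda>x. complex_of_real (norm x powr \<gamma>)) has_derivative (\<lambda>h. complex_of_real (\<gamma> * norm x powr (\<gamma> - 2) * inner x h))) (at x)"
    by (rule bounded_linear.has_derivative[OF bounded_linear_of_real norm_powr_has_derivative[OF x0]])
   show "open {x::'a. r < norm x}" by (intro open_Collect_less continuous_intros)
  qed (use x We in auto)
 qed
 with Ws We show ?thesis using that by blast
qed

lemma test_vanishes_near_0:
 assumes "u \<in> test_functions (- {0::'a::euclidean_space})"
 obtains r where "0 < r" "\<And>x. norm x \<le> r \<Longrightarrow> u x = 0"
proof -
 obtain K where K: "compact K" "K \<subseteq> - {0}" "\<And>x. x \<notin> K \<Longrightarrow> u x = 0" by (rule test_functionsD[OF assms]) blast
 have "open (- K)" "0 \<in> - K" using K compact_imp_closed by (auto simp: open_Compl)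
 then obtain r where "0 < r" "cball 0 r \<subseteq> - K" using open_contains_cball by blast
 then show ?thesis using K(3) that[of r] by (force simp: subset_iff)
qed

lemma test_powr:
 fixes u :: "'a::euclidean_space \<Rightarrow> complex"
 assumes u: "u \<in> test_functions (- {0})"
 shows "(npow \<gamma> \<odot> u) \<in> test_functions (- {0})"
  "partial b (npow \<gamma> \<odot> u) x
   = complex_of_real (norm x powr \<gamma>) * partial b u x + complex_of_real (\<gamma> * norm x powr (\<gamma> - 2) * inner x b) * u x"
proof -
 obtain r where r: "0 < r" "\<And>x. norm x \<le> r \<Longrightarrow> u x = 0" by (rule test_vanishes_near_0[OF u]) blast
 \<comment> \<open>Halving the radius makes the region where the smooth substitute is exact overlap
   the open set \<open>|x| < r\<close>, on which \<open>u\<close> and its derivatives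
   vanish.\<close>
 have r2: "0 < r / 2" using r(1) by simp
 obtain W :: "'a \<Rightarrow> complex" where W: "smooth W" "\<And>x. r / 2 < norm x \<Longrightarrow> W x = complex_of_real (norm x powr \<gamma>)"
  "\<And>b x. r / 2 < norm x \<Longrightarrow> partial b W x = complex_of_real (\<gamma> * norm x powr (\<gamma> - 2) * inner x b)"
  by (rule smooth_norm_powr[OF r2, of \<gamma>]) blast
 have eq: "(npow \<gamma> \<odot> u) = (\<lambda>x. W x * u x)"
 proof
  fix x show "complex_of_real (norm x powr \<gamma>) * u x = W x * u x"
   using r(1) r(2)[of x] W(2)[of x] by (cases "norm x \<le> r") auto
 qed
 show "(npow \<gamma> \<odot> u) \<in> test_functions (- {0})" unfolding eq by (rule test_mult[OF W(1) u])
 have "partial b (\<lambda>x. W x * u x) x = W x * partial b u x + partial b W x * u x"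
  by (intro partial_mult smooth_differentiable[OF W(1)] test_differentiable[OF u])
 moreover have "W x * partial b u x + partial b W x * u x = complex_of_real (norm x powr \<gamma>) * partial b u x
   + complex_of_real (\<gamma> * norm x powr (\<gamma> - 2) * inner x b) * u x"
 proof (cases "r / 2 < norm x")
  case False
  have "open {x::'a. norm x < r}" by (intro open_Collect_less continuous_intros)
  then have "closed {x::'a. r \<le> norm x}" by (intro closed_Collect_le continuous_intros)
  then have "partial b u x = 0" using False r by (intro partial_zero_outside[of "{x::'a. r \<le> norm x}"]) auto
  then show ?thesis using False r by simp
 qed (simp add: W)
 ultimately show "partial b (npow \<gamma> \<odot> u) x
   = complex_of_real (norm x powr \<gamma>) * partial b u x + complex_of_real (\<gamma> * norm x powr (\<gamma> - 2) * inner x b) * u x"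
  unfolding eq by simp
qed

lemma test_coeff:
 fixes u :: "'a::euclidean_space \<Rightarrow> complex"
 assumes u: "u \<in> test_functions (- {0})"
 shows "(coeff_a \<alpha> \<odot> u) \<in> test_functions (- {0})"
 using test_add[OF u test_powr(1)[OF u, of \<alpha>]] by (simp add: coeff_a_def distrib_right)

lemma powr_divide_self: "norm (x::'a::euclidean_space) powr (\<gamma> + 1) / norm x = norm x powr \<gamma>"
 by (cases "x = 0") (simp_all add: powr_add)

lemma powr_square_eq: "(norm (x::'a::euclidean_space) powr \<gamma>) * norm x powr \<gamma> = norm x powr (2 * \<gamma>)"
 by (simp add: powr_add[symmetric])

subsection \<open>The coefficients of the form\<close>

lemma coeff_square_has_derivative:
 fixes x :: "'a::euclidean_space"
 assumes x: "x \<noteq> 0"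
 shows "((\<lambda>x. (coeff_a \<alpha> x)^2) has_derivative
  (\<lambda>h. 2 * \<alpha> * (norm x powr (\<alpha> - 2) + norm x powr (2 * \<alpha> - 2)) * inner x h)) (at x)"
proof -
 have e: "(\<lambda>x::'a. (coeff_a \<alpha> x)^2) = (\<lambda>x. 1 + 2 * norm x powr \<alpha> + norm x powr (2 * \<alpha>))"
  by (rule ext) (simp add: coeff_a_def power2_eq_square algebra_simps powr_square_eq)
 show ?thesis unfolding e
  by (rule has_derivative_eq_rhs[OF has_derivative_add[OF has_derivative_add[OF has_derivative_const
     has_derivative_mult_right[OF norm_powr_has_derivative[OF x]]] norm_powr_has_derivative[OF x]]])
   (simp add: fun_eq_iff algebra_simps)
qed

lemma partial_coeff_square:
 fixes x :: "'a::euclidean_space"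
 assumes x: "x \<noteq> 0"
 shows "partial b (\<lambda>x. (coeff_a \<alpha> x)^2) x = 2 * \<alpha> * (norm x powr (\<alpha> - 2) + norm x powr (2 * \<alpha> - 2)) * inner x b"
 by (rule partial_eq[OF coeff_square_has_derivative[OF x]])

text \<open>Since \<open>a^2 = 1 + 2 |x|^\<alpha> + |x|^(2 \<alpha>)\<close>, this is the radial
  formula: the Laplacian of \<open>|x|^\<gamma>\<close> is
  \<open>\<gamma> (\<gamma> + N - 2) |x|^(\<gamma> - 2)\<close>.\<close>

lemma laplacian_coeff_square:
 fixes x :: "'a::euclidean_space"
 assumes x: "x \<noteq> 0"
 shows "laplacian (\<lambda>x. (coeff_a \<alpha> x)^2) x
  = 2 * \<alpha> * (\<alpha> + DIM('a) - 2) * norm x powr (\<alpha> - 2) + 2 * \<alpha> * (2 * \<alpha> + DIM('a) - 2) * norm x powr (2 * \<alpha> - 2)"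
proof -
 define n where "n = norm x"
 have p4: "n powr (\<gamma> - 2) * n\<^sup>2 = n powr \<gamma>" for \<gamma>
  using x by (simp add: n_def powr_numeral[symmetric] powr_add[symmetric] del: powr_numeral)
 have part: "partial b (partial b (\<lambda>x. (coeff_a \<alpha> x)^2)) x
   = 2 * \<alpha> * (((\<alpha> - 2) * n powr (\<alpha> - 2 - 2) + (2 * \<alpha> - 2) * n powr (2 * \<alpha> - 2 - 2)) * (inner x b * inner x b)
    + (n powr (\<alpha> - 2) + n powr (2 * \<alpha> - 2)))" if b: "b \<in> Basis" for b :: 'a
 proof -
  define D where "D = (\<lambda>h. 2 * \<alpha> * (((\<alpha> - 2) * n powr (\<alpha> - 2 - 2) * inner x h + (2 * \<alpha> - 2) * n powr (2 * \<alpha> - 2 - 2) * inner x h) * inner x b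
    + (n powr (\<alpha> - 2) + n powr (2 * \<alpha> - 2)) * inner h b))"
  have 0: "((\<lambda>y. inner y b) has_derivative (\<lambda>h. inner h b)) (at x)" by (auto intro!: derivative_eq_intros)
  have 1: "((\<lambda>y. 2 * \<alpha> * ((norm y powr (\<alpha> - 2) + norm y powr (2 * \<alpha> - 2)) * inner y b)) has_derivative D) (at x)"
   by (rule has_derivative_eq_rhs[OF has_derivative_mult_right[OF has_derivative_mult[OF has_derivative_add[OF norm_powr_has_derivative[OF x] norm_powr_has_derivative[OF x]] 0]]])
    (simp add: fun_eq_iff D_def n_def algebra_simps)
  have "(partial b (\<lambda>x. (coeff_a \<alpha> x)^2) has_derivative D) (at x)"
   by (rule has_derivative_transform_within_open[OF 1, of "- {0}"])
    (use x in \<open>auto simp: partial_coeff_square open_Compl mult.assoc\<close>)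
  then have "partial b (partial b (\<lambda>x. (coeff_a \<alpha> x)^2)) x = D b" by (rule partial_eq)
  then show ?thesis using b by (simp add: D_def algebra_simps)
 qed
 have s: "(\<Sum>b\<in>Basis. inner x b * inner x b) = n\<^sup>2"
  unfolding n_def power2_norm_eq_inner by (rule euclidean_inner[symmetric])
 have "laplacian (\<lambda>x. (coeff_a \<alpha> x)^2) x = 2 * \<alpha> * (((\<alpha> - 2) * n powr (\<alpha> - 2 - 2) + (2 * \<alpha> - 2) * n powr (2 * \<alpha> - 2 - 2)) * n\<^sup>2
    + DIM('a) * (n powr (\<alpha> - 2) + n powr (2 * \<alpha> - 2)))"
  unfolding laplacian_def s[symmetric] by (simp add: part sum.distrib flip: sum_distrib_left)
 also have "\<dots> = 2 * \<alpha> * ((\<alpha> - 2) * (n powr (\<alpha> - 2 - 2) * n\<^sup>2) + (2 * \<alpha> - 2) * (n powr (2 * \<alpha> - 2 - 2) * n\<^sup>2)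
    + DIM('a) * (n powr (\<alpha> - 2) + n powr (2 * \<alpha> - 2)))" by (simp add: algebra_simps)
 finally show ?thesis unfolding p4 by (simp add: n_def algebra_simps)
qed

text \<open>What is left of twice the derivative of \<open>a^2\<close> in direction \<open>b\<close>
  after splitting off the factors \<open>a\<close> and \<open>|x|^(\<alpha> - 1)\<close>.\<close>

definition grad_mult :: "real \<Rightarrow> 'a::euclidean_space \<Rightarrow> 'a \<Rightarrow> real" where
 "grad_mult \<alpha> b x = 4 * \<alpha> * (inner x b / norm x)"

text \<open>The Laplacian of \<open>a^2\<close> divided by \<open>a |x|^(\<alpha> - 2)\<close>; it
  is bounded because numerator and denominator are both affine in
  \<open>|x|^\<alpha>\<close>.\<close>

definition zero_mult :: "real \<Rightarrow> 'a::euclidean_space \<Rightarrow> real" where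
 "zero_mult \<alpha> x = (2 * \<alpha> * (\<alpha> + DIM('a) - 2) + 2 * \<alpha> * (2 * \<alpha> + DIM('a) - 2) * norm x powr \<alpha>) / (1 + norm x powr \<alpha>)"

lemma direction_bound: "b \<in> Basis \<Longrightarrow> \<bar>inner x b / norm (x::'a::euclidean_space)\<bar> \<le> 1"
 using Basis_le_norm[of b x] by (cases "x = 0") (simp_all add: divide_le_eq_1)

lemma grad_mult:
 shows grad_mult_measurable: "grad_mult \<alpha> b \<in> borel_measurable borel"
  and grad_mult_bound: "b \<in> Basis \<Longrightarrow> \<bar>grad_mult \<alpha> b x\<bar> \<le> 4 * \<bar>\<alpha>\<bar>"
proof -
 show "grad_mult \<alpha> b \<in> borel_measurable borel" unfolding grad_mult_def[abs_def] by measurable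
 show "\<bar>grad_mult \<alpha> b x\<bar> \<le> 4 * \<bar>\<alpha>\<bar>" if "b \<in> Basis"
  using mult_left_mono[OF direction_bound[OF that, of x], of "\<bar>\<alpha>\<bar>"] unfolding grad_mult_def abs_mult by simp
qed

lemma zero_mult:
 shows zero_mult_measurable: "zero_mult \<alpha> \<in> borel_measurable (borel :: 'a::euclidean_space measure)"
  and zero_mult_bound: "\<exists>C. \<forall>x::'a. \<bar>zero_mult \<alpha> x\<bar> \<le> C"
proof -
 show "zero_mult \<alpha> \<in> borel_measurable (borel :: 'a measure)" unfolding zero_mult_def[abs_def] by measurable
 define c1 c2 where "c1 = 2 * \<alpha> * (\<alpha> + DIM('a) - 2)" and "c2 = 2 * \<alpha> * (2 * \<alpha> + DIM('a) - 2)"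
 have "\<bar>zero_mult \<alpha> x\<bar> \<le> \<bar>c1\<bar> + \<bar>c2\<bar>" for x :: 'a
 proof -
  define p where "p = norm x powr \<alpha>"
  have p: "0 \<le> p" by (simp add: p_def)
  have "\<bar>c1 + c2 * p\<bar> \<le> \<bar>c1\<bar> + \<bar>c2\<bar> * p" using abs_triangle_ineq[of c1 "c2 * p"] p by (simp add: abs_mult)
  also have "\<dots> \<le> (\<bar>c1\<bar> + \<bar>c2\<bar>) * (1 + p)" using p by (simp add: algebra_simps)
  finally have "\<bar>c1 + c2 * p\<bar> / (1 + p) \<le> \<bar>c1\<bar> + \<bar>c2\<bar>" using p by (simp add: divide_le_eq)
  then show ?thesis using p by (simp add: zero_mult_def p_def[symmetric] c1_def[symmetric] c2_def[symmetric] abs_divide)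
 qed
 then show "\<exists>C. \<forall>x::'a. \<bar>zero_mult \<alpha> x\<bar> \<le> C" by blast
qed

text \<open>Distributing the weights makes every term a pairing of two square integrable quantities
  with a bounded multiplier between them, which exhibits the form as bounded for the tuple
  norm.\<close>

lemma form_eq:
 fixes \<alpha> \<beta> \<mu> :: real and u v :: "'a::euclidean_space \<Rightarrow> complex"
 assumes u: "u \<in> test_functions (- {0})" and v: "v \<in> test_functions (- {0})"
 defines "A \<equiv> (\<lambda>u x. complex_of_real (coeff_a \<alpha> x) * laplacian u x)"
  and "G \<equiv> (\<lambda>b u x. complex_of_real (norm x powr (\<alpha> - 1)) * partial b u x)"
  and "Z \<equiv> (\<lambda>u x. complex_of_real (norm x powr (\<alpha> - 2)) * u x)"
  and "V \<equiv> (\<lambda>u x. complex_of_real (potential_V \<beta> x) * u x)"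
 shows "form_a \<alpha> \<beta> \<mu> u v = l2inner (A u) (A v)
  + (\<Sum>b\<in>Basis. l2inner (grad_mult \<alpha> b \<odot> A u) (G b v))
  + l2inner (zero_mult \<alpha> \<odot> A u) (Z v) + l2inner (V u) (V v) + of_real \<mu> * l2inner u v"
proof -
 have AL: "A w \<in> L2" if "w \<in> test_functions (- {0})" for w
  unfolding A_def by (rule test_L2[OF test_coeff[OF test_laplacian[OF that]]])
 have GL: "G b v \<in> L2" if "b \<in> Basis" for b
  unfolding G_def by (rule test_L2[OF test_powr(1)[OF test_partial[OF v that]]])
 have ZL: "Z v \<in> L2" unfolding Z_def by (rule test_L2[OF test_powr(1)[OF v]])
 have VL: "V w \<in> L2" if "w \<in> test_functions (- {0})" for w
  unfolding V_def potential_V_def by (rule test_L2[OF test_powr(1)[OF that]])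
 obtain C where C: "\<And>x::'a. \<bar>zero_mult \<alpha> x\<bar> \<le> C" using zero_mult_bound by blast
 have gA: "(grad_mult \<alpha> b \<odot> A u) \<in> L2" if "b \<in> Basis" for b
  by (rule multiplier_L2(1)[OF grad_mult_measurable grad_mult_bound[OF that] AL[OF u]])
 have zA: "(zero_mult \<alpha> \<odot> A u) \<in> L2" by (rule multiplier_L2(1)[OF zero_mult_measurable C AL[OF u]])
 note int = l2inner_integrable[OF AL[OF u] AL[OF v]] l2inner_integrable[OF gA GL] l2inner_integrable[OF zA ZL]
  l2inner_integrable[OF VL[OF u] VL[OF v]] l2inner_integrable[OF test_L2[OF u] test_L2[OF v]]
 have pc: "partial b (\<lambda>y. cnj (v y)) x = cnj (partial b v x)" for b x
  by (rule partial_cnj[OF test_differentiable[OF v]])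
 have pc2: "partial b (\<lambda>y. cnj (partial b v y)) x = cnj (partial b (partial b v) x)" if "b \<in> Basis" for b x
  by (rule partial_cnj[OF test_differentiable[OF test_partial[OF v that]]])
 have lc: "laplacian (\<lambda>y. cnj (v y)) x = cnj (laplacian v x)" for x
  unfolding laplacian_def by (simp add: pc[abs_def] pc2)
 \<comment> \<open>At the origin the derivatives of the coefficients carry no information; the
   integrands agree there because \<open>u\<close> and its Laplacian vanish.\<close>
 have z: "u 0 = 0" "laplacian u 0 = 0"
 proof -
  show "u 0 = 0" by (rule test_vanishes_near_0[OF u]) simp
  show "laplacian u 0 = 0" by (rule test_vanishes_near_0[OF test_laplacian[OF u]]) simp
 qed
 have "form_a \<alpha> \<beta> \<mu> u v = (LINT x|lborel. A u x * cnj (A v x)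
  + (\<Sum>b\<in>Basis. of_real (grad_mult \<alpha> b x) * A u x * cnj (G b v x))
  + of_real (zero_mult \<alpha> x) * A u x * cnj (Z v x) + V u x * cnj (V v x) + of_real \<mu> * (u x * cnj (v x)))"
  unfolding form_a_def
 proof (rule Bochner_Integration.integral_cong[OF refl])
  fix x :: 'a
  define n where "n = norm x"
  show "complex_of_real ((coeff_a \<alpha> x)^2) * laplacian u x * laplacian (\<lambda>y. cnj (v y)) x
    + 2 * (\<Sum>b\<in>Basis. complex_of_real (partial b (\<lambda>y. (coeff_a \<alpha> y)^2) x) * partial b (\<lambda>y. cnj (v y)) x) * laplacian u x
    + complex_of_real (laplacian (\<lambda>y. (coeff_a \<alpha> y)^2) x) * laplacian u x * cnj (v x)
    + complex_of_real ((potential_V \<beta> x)^2 + \<mu>) * u x * cnj (v x)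
   = A u x * cnj (A v x) + (\<Sum>b\<in>Basis. of_real (grad_mult \<alpha> b x) * A u x * cnj (G b v x))
    + of_real (zero_mult \<alpha> x) * A u x * cnj (Z v x) + V u x * cnj (V v x) + of_real \<mu> * (u x * cnj (v x))"
  proof (cases "x = 0")
   case True
   then show ?thesis using z by (simp add: A_def V_def)
  next
   case False
   have n: "0 < n" using False by (simp add: n_def)
   have c: "coeff_a \<alpha> x = 1 + n powr \<alpha>" by (simp add: coeff_a_def n_def)
   have ne: "1 + n powr \<alpha> \<noteq> 0" by (smt (verit) powr_ge_zero)
   have p1: "n powr (2 * \<alpha> - 2) = n powr \<alpha> * n powr (\<alpha> - 2)" by (simp add: powr_add[symmetric])
   have p2: "n powr (\<alpha> - 1) = n powr (\<alpha> - 2) * n" using n powr_add[of n "\<alpha> - 2" 1] by simp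
   have 1: "complex_of_real ((coeff_a \<alpha> x)^2) * laplacian u x * laplacian (\<lambda>y. cnj (v y)) x = A u x * cnj (A v x)"
    unfolding A_def lc by (simp add: power2_eq_square)
   have 2: "2 * (\<Sum>b\<in>Basis. complex_of_real (partial b (\<lambda>y. (coeff_a \<alpha> y)^2) x) * partial b (\<lambda>y. cnj (v y)) x) * laplacian u x
     = (\<Sum>b\<in>Basis. of_real (grad_mult \<alpha> b x) * A u x * cnj (G b v x))"
    unfolding sum_distrib_left sum_distrib_right
   proof (rule sum.cong[OF refl])
    fix b :: 'a assume "b \<in> Basis"
    have "2 * partial b (\<lambda>y. (coeff_a \<alpha> y)^2) x = grad_mult \<alpha> b x * coeff_a \<alpha> x * n powr (\<alpha> - 1)"
     unfolding partial_coeff_square[OF False] grad_mult_def c n_def[symmetric] p1 p2 using n by (simp add: field_simps)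
    then have "2 * complex_of_real (partial b (\<lambda>y. (coeff_a \<alpha> y)^2) x)
      = of_real (grad_mult \<alpha> b x) * of_real (coeff_a \<alpha> x) * of_real (n powr (\<alpha> - 1))"
     by (metis of_real_mult of_real_numeral)
    then show "2 * (complex_of_real (partial b (\<lambda>y. (coeff_a \<alpha> y)^2) x) * partial b (\<lambda>y. cnj (v y)) x) * laplacian u x
      = of_real (grad_mult \<alpha> b x) * A u x * cnj (G b v x)"
     unfolding A_def G_def pc n_def[symmetric] by (simp add: mult_ac)
   qed
   have "laplacian (\<lambda>y. (coeff_a \<alpha> y)^2) x = zero_mult \<alpha> x * coeff_a \<alpha> x * n powr (\<alpha> - 2)"
    unfolding laplacian_coeff_square[OF False] zero_mult_def c n_def[symmetric] p1
    unfolding times_divide_eq_left nonzero_mult_div_cancel_right[OF ne] by (simp add: algebra_simps)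
   then have 3: "complex_of_real (laplacian (\<lambda>y. (coeff_a \<alpha> y)^2) x) * laplacian u x * cnj (v x)
     = of_real (zero_mult \<alpha> x) * A u x * cnj (Z v x)" unfolding A_def Z_def n_def[symmetric] by simp
   have 4: "complex_of_real ((potential_V \<beta> x)^2 + \<mu>) * u x * cnj (v x) = V u x * cnj (V v x) + of_real \<mu> * (u x * cnj (v x))"
    unfolding V_def by (simp add: power2_eq_square algebra_simps)
   show ?thesis unfolding 1 2 3 4 by simp
  qed
 qed
 also have "\<dots> = l2inner (A u) (A v)
  + (\<Sum>b\<in>Basis. l2inner (grad_mult \<alpha> b \<odot> A u) (G b v))
  + l2inner (zero_mult \<alpha> \<odot> A u) (Z v) + l2inner (V u) (V v) + of_real \<mu> * l2inner u v"
  unfolding l2inner_def using int by (simp add: Bochner_Integration.integral_sum Bochner_Integration.integral_add)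
 finally show ?thesis .
qed

subsection \<open>Coercivity\<close>

lemma l2norm_cmult: "f \<in> L2 \<Longrightarrow> 0 \<le> c \<Longrightarrow> l2norm (\<lambda>x. complex_of_real c * f x) = c * l2norm f"
 using l2of_scaleC[of f "of_real c"] L2_cmult[of f "of_real c"] by (simp add: norm_l2of[symmetric])

text \<open>Integration by parts of \<open>|x|^(2 \<alpha> - 2) |D_b u|^2\<close>: one term pairs
  the weighted \<open>u\<close> with the weighted second derivative, the other comes from
  differentiating the weight and is absorbed. Half of the weight always stays with
  \<open>u\<close>.\<close>

lemma weighted_gradient_bound:
 fixes \<alpha> :: real and u :: "'a::euclidean_space \<Rightarrow> complex"
 assumes u: "u \<in> test_functions (- {0})"
 defines "A \<equiv> l2norm (coeff_a \<alpha> \<odot> laplacian u)" and "G \<equiv> (\<lambda>b. l2norm (npow (\<alpha> - 1) \<odot> partial b u))"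
  and "U \<equiv> l2norm (npow (\<alpha> - 2) \<odot> u)"
 shows "(\<Sum>b\<in>Basis. (G b)^2) \<le> 2 * A * U + 4 * DIM('a) * (\<alpha> - 1)^2 * U\<^sup>2"
proof -
 note tp = test_partial[OF u] and tl = test_laplacian[OF u] and tw = test_powr(1)
 define H where "H b = npow (\<alpha> - 1) \<odot> partial b u" for b
 define Z where "Z = npow (\<alpha> - 2) \<odot> u"
 define e where "e b x = (2 * \<alpha> - 2) * (inner x b / norm x)" for b x :: 'a
 have ZL: "Z \<in> L2" unfolding Z_def by (rule test_L2[OF tw[OF u]])
 have HL: "H b \<in> L2" if "b \<in> Basis" for b unfolding H_def by (rule test_L2[OF tw[OF tp[OF that]]])
 have eb: "\<bar>e b x\<bar> \<le> \<bar>2 * \<alpha> - 2\<bar>" if "b \<in> Basis" for b x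
  using mult_left_mono[OF direction_bound[OF that, of x], of "\<bar>2 * \<alpha> - 2\<bar>"] unfolding e_def abs_mult by simp
 have em: "e b \<in> borel_measurable borel" for b unfolding e_def by measurable
 have split: "inner (l2of u) (l2of (npow (2 * \<alpha> - 2) \<odot> f)) = inner (l2of Z) (l2of (npow \<alpha> \<odot> f))"
  if f: "f \<in> test_functions (- {0})" for f
 proof -
  have "npow (2 * \<alpha> - 2) \<odot> f = npow (\<alpha> - 2) \<odot> npow \<alpha> \<odot> f"
   by (simp add: fun_eq_iff mult.assoc[symmetric] powr_add[symmetric] flip: of_real_mult)
  then show ?thesis unfolding Z_def
   using inner_mult_commute[OF test_L2[OF u] test_L2[OF tw[OF f]] test_L2[OF tw[OF u]] test_L2[OF tw[OF tw[OF f]]], of "\<alpha> - 2" \<alpha>]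
   by simp
 qed
 have key: "(G b)^2 = - inner (l2of Z) (l2of (npow \<alpha> \<odot> partial b (partial b u))) - inner (l2of Z) (l2of (e b \<odot> H b))"
  if b: "b \<in> Basis" for b
 proof -
  define p where "p = npow (2 * \<alpha> - 2) \<odot> partial b u"
  note tpp = test_partial[OF tp[OF b] b]
  have p: "p \<in> test_functions (- {0})" unfolding p_def by (rule tw[OF tp[OF b]])
  have eL: "e b \<odot> H b \<in> L2" by (rule multiplier_L2(1)[OF em eb[OF b] HL[OF b]])
  have ke: "(2 * \<alpha> - 2) * norm x powr (2 * \<alpha> - 2 - 2) * inner x b = norm x powr (\<alpha> - 2) * (e b x * norm x powr (\<alpha> - 1))" for x
  proof -
   have "norm x powr (2 * \<alpha> - 2 - 2) = norm x powr (\<alpha> - 2) * norm x powr (\<alpha> - 2)" by (simp add: powr_add[symmetric])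
   also have "\<dots> = norm x powr (\<alpha> - 2) * (norm x powr (\<alpha> - 1) / norm x)"
    using powr_divide_self[of x "\<alpha> - 2"] by simp
   finally show ?thesis by (simp add: e_def)
  qed
  have pd: "partial b p = (\<lambda>x. (npow (2 * \<alpha> - 2) \<odot> partial b (partial b u)) x + (npow (\<alpha> - 2) \<odot> (e b \<odot> H b)) x)"
   unfolding p_def by (rule ext, unfold test_powr(2)[OF tp[OF b]] ke H_def, simp only: of_real_mult mult.assoc)
  have wL: "npow (\<alpha> - 2) \<odot> (e b \<odot> H b) \<in> L2"
  proof -
   have "npow (\<alpha> - 2) \<odot> (e b \<odot> H b) = (\<lambda>x. partial b p x - (npow (2 * \<alpha> - 2) \<odot> partial b (partial b u)) x)"
    unfolding pd by simp
   then show ?thesis using L2_diff[OF test_L2[OF test_partial[OF p b]] test_L2[OF tw[OF tpp]]] by (simp only:)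
  qed
  have "(G b)^2 = inner (l2of p) (l2of (partial b u))"
   unfolding G_def l2norm_square p_def inner_mult_self[OF test_L2[OF tp[OF b]] test_L2[OF tw[OF tp[OF b]]]]
  proof -
   have "norm x powr (2 * \<alpha> - 2) = norm x powr (\<alpha> - 1) * norm x powr (\<alpha> - 1)" for x :: 'a by (simp add: powr_add[symmetric])
   then show "(LINT x|lborel. (cmod ((npow (\<alpha> - 1) \<odot> partial b u) x))^2) = (LINT x|lborel. norm x powr (2 * \<alpha> - 2) * (cmod (partial b u x))^2)"
    by (simp add: norm_mult power2_eq_square mult_ac)
  qed
  also have "\<dots> = - inner (l2of u) (l2of (partial b p))"
   using inner_parts[OF test_UNIV[OF u] test_UNIV[OF p] b] by (simp add: inner_commute)
  also have "l2of (partial b p) = l2of (npow (2 * \<alpha> - 2) \<odot> partial b (partial b u)) + l2of (npow (\<alpha> - 2) \<odot> (e b \<odot> H b))"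
   unfolding pd by (rule l2of_add[OF test_L2[OF tw[OF tpp]] wL])
  finally have 1: "(G b)^2 = - inner (l2of u) (l2of (npow (2 * \<alpha> - 2) \<odot> partial b (partial b u)) + l2of (npow (\<alpha> - 2) \<odot> (e b \<odot> H b)))" .
  have 2: "inner (l2of u) (l2of (npow (\<alpha> - 2) \<odot> (e b \<odot> H b))) = inner (l2of Z) (l2of (e b \<odot> H b))"
   unfolding Z_def by (rule inner_mult_commute[symmetric, OF test_L2[OF u] eL test_L2[OF tw[OF u]] wL])
  show ?thesis unfolding 1 inner_add_right 2 split[OF tpp] by simp
 qed
 \<comment> \<open>Young's inequality leaves half of \<open>(G b)^2\<close> for absorption on the
   left; doubling afterwards yields the factors 2 and 4 of the claim.\<close>
 have le2: "- inner (l2of Z) (l2of (e b \<odot> H b)) \<le> (G b)^2 / 2 + 2 * (\<alpha> - 1)^2 * U\<^sup>2" if b: "b \<in> Basis" for b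
 proof -
  note m = multiplier_L2[OF em eb[OF b] HL[OF b]]
  have "- inner (l2of Z) (l2of (e b \<odot> H b)) \<le> U * l2norm (e b \<odot> H b)"
   using norm_cauchy_schwarz[of "l2of Z" "- l2of (e b \<odot> H b)"] unfolding U_def Z_def[symmetric] by (simp add: norm_l2of ZL m(1))
  also have "\<dots> \<le> U * (\<bar>2 * \<alpha> - 2\<bar> * G b)" using m(2) by (intro mult_left_mono) (simp_all add: G_def H_def U_def)
  also have "\<dots> = 2 * (\<bar>\<alpha> - 1\<bar> * U) * G b" by (simp add: abs_if)
  also have "\<dots> \<le> (G b)^2 / 2 + 2 * (\<bar>\<alpha> - 1\<bar> * U)^2"
   using sum_squares_bound[of "2 * (\<bar>\<alpha> - 1\<bar> * U)" "G b"] by (simp add: power_mult_distrib)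
  finally show ?thesis by (simp add: power_mult_distrib)
 qed
 have le1: "- (\<Sum>b\<in>Basis. inner (l2of Z) (l2of (npow \<alpha> \<odot> partial b (partial b u)))) \<le> A * U"
 proof -
  have "npow \<alpha> \<odot> laplacian u = (\<lambda>x. \<Sum>b\<in>Basis. (npow \<alpha> \<odot> partial b (partial b u)) x)"
   by (simp add: fun_eq_iff laplacian_def sum_distrib_left)
  then have "l2of (npow \<alpha> \<odot> laplacian u) = (\<Sum>b\<in>Basis. l2of (npow \<alpha> \<odot> partial b (partial b u)))"
   using l2of_sum[OF test_L2[OF tw[OF test_partial[OF tp]]], of Basis "\<lambda>b. b" "\<lambda>b. b" "\<lambda>_. \<alpha>"] by simp
  then have "(\<Sum>b\<in>Basis. inner (l2of Z) (l2of (npow \<alpha> \<odot> partial b (partial b u)))) = inner (l2of Z) (l2of (npow \<alpha> \<odot> laplacian u))"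
   by (simp add: inner_sum_right)
  then have "- (\<Sum>b\<in>Basis. inner (l2of Z) (l2of (npow \<alpha> \<odot> partial b (partial b u)))) \<le> U * l2norm (npow \<alpha> \<odot> laplacian u)"
   using norm_cauchy_schwarz[of "l2of Z" "- l2of (npow \<alpha> \<odot> laplacian u)"] unfolding U_def Z_def[symmetric]
   by (simp add: norm_l2of ZL test_L2[OF tw[OF tl]])
  also have "\<dots> \<le> U * A"
  proof (rule mult_left_mono)
  show "l2norm (npow \<alpha> \<odot> laplacian u) \<le> A" unfolding A_def
  proof (rule l2norm_mono(2)[OF test_L2[OF test_coeff[OF tl]] L2_measurable[OF test_L2[OF tw[OF tl]]] AE_I2])
   show "cmod ((npow \<alpha> \<odot> laplacian u) x) \<le> cmod ((coeff_a \<alpha> \<odot> laplacian u) x)" for x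
    unfolding norm_mult norm_of_real coeff_a_def by (intro mult_right_mono) auto
  qed
  qed (simp add: U_def)
  finally show ?thesis by (simp only: mult.commute[of A])
 qed
 have "(\<Sum>b\<in>Basis. (G b)^2) = - (\<Sum>b\<in>Basis. inner (l2of Z) (l2of (npow \<alpha> \<odot> partial b (partial b u)))) + (\<Sum>b\<in>Basis. - inner (l2of Z) (l2of (e b \<odot> H b)))"
  by (simp add: key sum_subtractf sum_negf)
 also have "\<dots> \<le> A * U + (\<Sum>b\<in>(Basis::'a set). (G b)^2 / 2 + 2 * (\<alpha> - 1)^2 * U\<^sup>2)"
  by (intro add_mono le1 sum_mono le2)
 also have "(\<Sum>b\<in>(Basis::'a set). (G b)^2 / 2 + 2 * (\<alpha> - 1)^2 * U\<^sup>2)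
   = (\<Sum>b\<in>Basis. (G b)^2) / 2 + DIM('a) * (2 * (\<alpha> - 1)^2 * U\<^sup>2)" by (simp add: sum.distrib sum_divide_distrib)
 finally show ?thesis by simp
qed

text \<open>Near 0 the power \<open>t^-2\<close> wins because \<open>\<alpha> > 0\<close>, near
  infinity \<open>t^\<beta>\<close> wins because \<open>\<beta> > \<alpha> - 2\<close>. The
  thresholds solve \<open>r^\<alpha> = \<epsilon>\<close> and
  \<open>R^\<gamma> = 1 / \<epsilon>\<close>; between them the left-hand side is bounded by one of
  its values at the ends, according to the sign of \<open>\<alpha> - 2\<close>.\<close>

lemma power_interpolation:
 fixes \<epsilon> :: real
 assumes a: "\<alpha> > 0" and b: "\<beta> > max (\<alpha> - 2) 0" and e: "\<epsilon> > 0"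
 obtains C where "0 < C" "\<And>t. 0 < t \<Longrightarrow> t powr (\<alpha> - 2) \<le> \<epsilon> * t powr -2 + \<epsilon> * t powr \<beta> + C"
proof -
 define \<gamma> where "\<gamma> = \<beta> - (\<alpha> - 2)"
 have g: "\<gamma> > 0" using b by (simp add: \<gamma>_def)
 define r where "r = \<epsilon> powr (1 / \<alpha>)"
 define R where "R = (1 / \<epsilon>) powr (1 / \<gamma>)"
 have rp: "r > 0" "r powr \<alpha> = \<epsilon>" using e a by (auto simp: r_def powr_powr)
 have Rp: "R > 0" "R powr \<gamma> = 1 / \<epsilon>" using e g by (auto simp: R_def powr_powr)
 have "t powr (\<alpha> - 2) \<le> \<epsilon> * t powr -2 + \<epsilon> * t powr \<beta> + (r powr (\<alpha> - 2) + R powr (\<alpha> - 2))" if t: "0 < t" for t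
 proof -
  have nn: "0 \<le> \<epsilon> * t powr -2" "0 \<le> \<epsilon> * t powr \<beta>" "0 \<le> r powr (\<alpha> - 2)" "0 \<le> R powr (\<alpha> - 2)" using e by auto
  consider "t \<le> r" | "R \<le> t" | "r < t" "t < R" by linarith
  then show ?thesis
  proof cases
   case 1
   have "t powr (\<alpha> - 2) = t powr \<alpha> * t powr -2" by (simp add: powr_add[symmetric])
   also have "\<dots> \<le> \<epsilon> * t powr -2" using powr_mono2[of \<alpha> t r] 1 t a rp by (intro mult_right_mono) auto
   finally show ?thesis using nn by linarith
  next
   case 2
   have "1 / \<epsilon> \<le> t powr \<gamma>" using powr_mono2[of \<gamma> R t] 2 g Rp by simp
   then have "1 \<le> \<epsilon> * t powr \<gamma>" using e by (simp add: field_simps)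
   then have "1 * t powr (\<alpha> - 2) \<le> \<epsilon> * t powr \<gamma> * t powr (\<alpha> - 2)" by (intro mult_right_mono) auto
   also have "\<dots> = \<epsilon> * t powr \<beta>" by (simp add: powr_add[symmetric] \<gamma>_def)
   finally show ?thesis using nn by linarith
  next
   case 3
   show ?thesis
   proof (cases "\<alpha> - 2 \<ge> 0")
    case True
    then have "t powr (\<alpha> - 2) \<le> R powr (\<alpha> - 2)" using 3 t by (intro powr_mono2) auto
    then show ?thesis using nn by linarith
   next
    case False
    then have "t powr (\<alpha> - 2) \<le> r powr (\<alpha> - 2)" using 3 rp by (intro powr_mono2') auto
    then show ?thesis using nn by linarith
   qed
  qed
 qed
 moreover have "0 < r powr (\<alpha> - 2) + R powr (\<alpha> - 2)" using rp Rp by (intro add_pos_pos) simp_all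
 ultimately show ?thesis using that by blast
qed

text \<open>The interpolation inequality is multiplied by \<open>u\<close>; Rellich's inequality and
  \<open>1 \<le> a\<close> bound the part with weight \<open>|x|^-2\<close> by the leading
  term.\<close>

lemma weighted_zero_order_bound:
 assumes N: "DIM('a::euclidean_space) \<ge> 5" and a: "\<alpha> > 0" and b: "\<beta> > max (\<alpha> - 2) 0" and e: "\<epsilon> > 0"
 obtains C where "0 < C" "\<And>u. u \<in> test_functions (- {0::'a}) \<Longrightarrow>
   l2norm (npow (\<alpha> - 2) \<odot> u)
   \<le> \<epsilon> * l2norm (coeff_a \<alpha> \<odot> laplacian u)
    + \<epsilon> * l2norm (potential_V \<beta> \<odot> u) + C * l2norm u"
proof -
 obtain C where C: "0 < C" "\<And>t. 0 < t \<Longrightarrow> t powr (\<alpha> - 2) \<le> \<epsilon> * t powr -2 + \<epsilon> * t powr \<beta> + C"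
  by (rule power_interpolation[OF a b e]) blast
 have "l2norm (npow (\<alpha> - 2) \<odot> u)
   \<le> \<epsilon> * l2norm (coeff_a \<alpha> \<odot> laplacian u)
    + \<epsilon> * l2norm (potential_V \<beta> \<odot> u) + C * l2norm u"
  if u: "u \<in> test_functions (- {0})" for u :: "'a \<Rightarrow> complex"
 proof -
  define P where "P = (npow (-2) \<odot> u)"
  define V where "V = (potential_V \<beta> \<odot> u)"
  have uL: "u \<in> L2" by (rule test_L2[OF u])
  have PL: "P \<in> L2" unfolding P_def by (rule test_L2[OF test_powr(1)[OF u]])
  have VL: "V \<in> L2" unfolding V_def potential_V_def by (rule test_L2[OF test_powr(1)[OF u]])
  have "l2norm P \<le> l2norm (laplacian u)"
  proof (rule power2_le_imp_le)
   show "(l2norm P)^2 \<le> (l2norm (laplacian u))^2" unfolding P_def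
    by (rule rellich_limit(2)[where s = "\<lambda>n. u" and g = "\<lambda>b. partial b u", OF N test_UNIV[OF u] uL tendsto_const
       test_L2[OF test_partial[OF u]] tendsto_const test_L2[OF test_laplacian[OF u]] tendsto_const])
  qed simp
  also have "\<dots> \<le> l2norm (coeff_a \<alpha> \<odot> laplacian u)"
  proof (rule l2norm_mono(2)[OF test_L2[OF test_coeff[OF test_laplacian[OF u]]] L2_measurable[OF test_L2[OF test_laplacian[OF u]]] AE_I2])
   fix x :: 'a
   have "1 * cmod (laplacian u x) \<le> \<bar>coeff_a \<alpha> x\<bar> * cmod (laplacian u x)"
    unfolding coeff_a_def by (intro mult_right_mono) auto
   then show "cmod (laplacian u x) \<le> cmod (of_real (coeff_a \<alpha> x) * laplacian u x)" by (simp add: norm_mult)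
  qed
  finally have PA: "l2norm P \<le> l2norm (coeff_a \<alpha> \<odot> laplacian u)" .
  have cP: "(\<lambda>x. complex_of_real \<epsilon> * P x) \<in> L2" and cV: "(\<lambda>x. complex_of_real \<epsilon> * V x) \<in> L2" and cu: "(\<lambda>x. complex_of_real C * u x) \<in> L2"
   by (intro L2_cmult PL VL uL)+
  have "l2norm (npow (\<alpha> - 2) \<odot> u)
    \<le> l2norm (\<lambda>x. complex_of_real \<epsilon> * P x + complex_of_real \<epsilon> * V x + complex_of_real C * u x)"
  proof (rule l2norm_mono(2)[OF L2_add[OF L2_add[OF cP cV] cu] L2_measurable[OF test_L2[OF test_powr(1)[OF u]]] AE_I2])
   fix x :: 'a
   have e1: "complex_of_real \<epsilon> * P x + complex_of_real \<epsilon> * V x + complex_of_real C * u x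
     = complex_of_real (\<epsilon> * norm x powr -2 + \<epsilon> * norm x powr \<beta> + C) * u x"
    by (simp only: P_def V_def potential_V_def of_real_add of_real_mult distrib_right mult.assoc)
   have "norm x powr (\<alpha> - 2) \<le> \<bar>\<epsilon> * norm x powr -2 + \<epsilon> * norm x powr \<beta> + C\<bar>"
    using C(2)[of "norm x"] C(1) by (cases "x = 0") auto
   then show "cmod (complex_of_real (norm x powr (\<alpha> - 2)) * u x) \<le> cmod (complex_of_real \<epsilon> * P x + complex_of_real \<epsilon> * V x + complex_of_real C * u x)"
    unfolding e1 norm_mult norm_of_real by (intro mult_right_mono) auto
  qed
  also have "\<dots> \<le> l2norm (\<lambda>x. complex_of_real \<epsilon> * P x) + l2norm (\<lambda>x. complex_of_real \<epsilon> * V x) + l2norm (\<lambda>x. complex_of_real C * u x)"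
   using l2norm_triangle[OF L2_add[OF cP cV] cu] l2norm_triangle[OF cP cV] by linarith
  also have "\<dots> = \<epsilon> * l2norm P + \<epsilon> * l2norm V + C * l2norm u"
   using e C(1) by (simp only: l2norm_cmult[OF PL] l2norm_cmult[OF VL] l2norm_cmult[OF uL] less_imp_le)
  also have "\<dots> \<le> \<epsilon> * l2norm (coeff_a \<alpha> \<odot> laplacian u) + \<epsilon> * l2norm V + C * l2norm u"
   using mult_left_mono[OF PA, of \<epsilon>] e by linarith
  finally show ?thesis by (simp only: V_def)
 qed
 with C(1) show ?thesis using that by blast
qed

text \<open>All lower order terms are bounded through \<open>A U\<close> and \<open>U^2\<close>,
  where \<open>U\<close> is the weighted zero-order norm, and
  \<open>U \<le> e (A + V) + C n\<close>. A small \<open>e\<close> lets \<open>A^2\<close> and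
  \<open>V^2\<close> absorb them, and the spectral parameter pays for \<open>n^2\<close>. All
  constants are fixed before the spectral parameter.\<close>

lemma form_coercive:
 assumes N: "DIM('a::euclidean_space) \<ge> 5" and a: "\<alpha> > 0" and b: "\<beta> > max (\<alpha> - 2) 0"
 obtains \<mu>0 c where "0 < \<mu>0" "0 < c"
  "\<And>\<mu> u. \<mu>0 \<le> \<mu> \<Longrightarrow> u \<in> test_functions (- {0::'a}) \<Longrightarrow>
   c * ((l2norm u)^2 + (l2norm (potential_V \<beta> \<odot> u))^2
    + (l2norm (npow (\<alpha> - 2) \<odot> u))^2
    + (l2norm (coeff_a \<alpha> \<odot> laplacian u))^2
    + (\<Sum>b\<in>Basis. (l2norm (npow (\<alpha> - 1) \<odot> partial b u))^2))
   \<le> Re (form_a \<alpha> \<beta> \<mu> u u)"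
proof -
 define N' where "N' = real DIM('a)"
 have N': "N' > 0" by (simp add: N'_def)
 obtain z where z: "\<And>x::'a. \<bar>zero_mult \<alpha> x\<bar> \<le> z" using zero_mult_bound by blast
 have z0: "0 \<le> z" using z[of 0] by linarith
 \<comment> \<open>\<open>k1\<close> collects the coefficients of \<open>A U\<close> from the
   first-order and zero-order terms, and \<open>k2\<close> is the coefficient of \<open>U^2\<close>
   in the gradient bound. After \<open>k1 U A \<le> A^2 / 4 + k1^2 U^2\<close> the total coefficient
   of \<open>U^2\<close> is \<open>C3 - 1\<close>.\<close>
 define k1 where "k1 = 32 * \<alpha>\<^sup>2 * N' + z"
 define k2 where "k2 = 4 * N' * (\<alpha> - 1)^2"
 define C3 where "C3 = k1\<^sup>2 + 16 * \<alpha>\<^sup>2 * N' * k2 + 1"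
 have k0: "0 \<le> k1" "0 \<le> k2" using N' z0 by (auto simp: k1_def k2_def)
 have C3: "1 \<le> C3" using N' k0 by (simp add: C3_def)
 \<comment> \<open>Ensures \<open>4 C3 e^2 \<le> 1 / 4\<close>, so \<open>C3 U^2\<close> uses at
   most a quarter of \<open>A^2 + V^2\<close>.\<close>
 define e where "e = 1 / (4 * C3)"
 have e0: "0 < e" using C3 by (simp add: e_def)
 have "4 * C3 * e * e = 1 * e" using C3 by (intro arg_cong2[where f = "(*)"] refl) (simp add: e_def)
 moreover have "e \<le> 1 / 4" using C3 by (simp add: e_def field_simps)
 ultimately have e1: "4 * C3 * e\<^sup>2 \<le> 1 / 4" by (simp only: power2_eq_square mult.assoc mult_1)
 obtain C where C: "0 < C" "\<And>u. u \<in> test_functions (- {0::'a}) \<Longrightarrow>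
   l2norm (npow (\<alpha> - 2) \<odot> u)
   \<le> e * l2norm (coeff_a \<alpha> \<odot> laplacian u)
    + e * l2norm (potential_V \<beta> \<odot> u) + C * l2norm u" by (rule weighted_zero_order_bound[OF N a b e0]) blast
 \<comment> \<open>Pays for the term \<open>2 C^2 C3 n^2\<close> that remains from
   \<open>C3 U^2\<close> and leaves one full \<open>n^2\<close>.\<close>
 define \<mu>0 where "\<mu>0 = 2 * C\<^sup>2 * C3 + 1"
 \<comment> \<open>Bounds the squared tuple norm by \<open>L (A^2 + V^2 + n^2)\<close>; the form
   controls a quarter of the last factor, hence \<open>c = 1 / (4 L)\<close>.\<close>
 define L where "L = (k2 + 3) * (1 + 2 * C\<^sup>2) + 2"
 define c where "c = 1 / (4 * L)"
 have m0: "0 < \<mu>0" using C3 by (simp add: \<mu>0_def add_nonneg_pos)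
 have L2: "2 \<le> L" using k0 by (simp add: L_def)
 have c0: "0 < c" using L2 by (simp add: c_def)
 have "c * ((l2norm u)^2 + (l2norm (potential_V \<beta> \<odot> u))^2
    + (l2norm (npow (\<alpha> - 2) \<odot> u))^2
    + (l2norm (coeff_a \<alpha> \<odot> laplacian u))^2
    + (\<Sum>b\<in>Basis. (l2norm (npow (\<alpha> - 1) \<odot> partial b u))^2))
   \<le> Re (form_a \<alpha> \<beta> \<mu> u u)" if mu: "\<mu>0 \<le> \<mu>" and u: "u \<in> test_functions (- {0})" for \<mu> and u :: "'a \<Rightarrow> complex"
 proof -
  define Af where "Af = (coeff_a \<alpha> \<odot> laplacian u)"
  define Gf where "Gf b = (npow (\<alpha> - 1) \<odot> partial b u)" for b
  define Zf where "Zf = (npow (\<alpha> - 2) \<odot> u)"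
  define Vf where "Vf = (potential_V \<beta> \<odot> u)"
  define A V U n where "A = l2norm Af" and "V = l2norm Vf" and "U = l2norm Zf" and "n = l2norm u"
  define S where "S = (\<Sum>b\<in>(Basis::'a set). (l2norm (Gf b))^2)"
  have pos: "0 \<le> A" "0 \<le> V" "0 \<le> U" "0 \<le> n" by (auto simp: A_def V_def U_def n_def)
  have AL: "Af \<in> L2" unfolding Af_def by (rule test_L2[OF test_coeff[OF test_laplacian[OF u]]])
  have GL: "Gf b \<in> L2" if "b \<in> Basis" for b
   unfolding Gf_def by (rule test_L2[OF test_powr(1)[OF test_partial[OF u that]]])
  have ZL: "Zf \<in> L2" unfolding Zf_def by (rule test_L2[OF test_powr(1)[OF u]])
  have G: "S \<le> 2 * A * U + k2 * U\<^sup>2"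
   using weighted_gradient_bound[OF u, of \<alpha>] unfolding S_def A_def U_def Af_def Gf_def Zf_def k2_def N'_def by simp
  have U: "U \<le> e * A + e * V + C * n"
   using C(2)[OF u] unfolding A_def U_def V_def n_def Af_def Zf_def Vf_def .
  have self: "Re (l2inner f f) = (l2norm f)^2" for f :: "'a \<Rightarrow> complex"
   unfolding l2inner_def l2norm_square complex_norm_square[symmetric] by (simp del: of_real_power)
  have "form_a \<alpha> \<beta> \<mu> u u = l2inner Af Af + (\<Sum>b\<in>Basis. l2inner (grad_mult \<alpha> b \<odot> Af) (Gf b))
   + l2inner (zero_mult \<alpha> \<odot> Af) Zf + l2inner Vf Vf + of_real \<mu> * l2inner u u"
   unfolding Af_def Gf_def Zf_def Vf_def by (rule form_eq[OF u u])
  then have Re: "Re (form_a \<alpha> \<beta> \<mu> u u) = A\<^sup>2 + (\<Sum>b\<in>Basis. Re (l2inner (grad_mult \<alpha> b \<odot> Af) (Gf b)))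
   + Re (l2inner (zero_mult \<alpha> \<odot> Af) Zf) + V\<^sup>2 + \<mu> * n\<^sup>2" by (simp add: self A_def V_def n_def)
  have g: "- Re (l2inner (grad_mult \<alpha> b \<odot> Af) (Gf b)) \<le> A\<^sup>2 / (4 * N') + 16 * \<alpha>\<^sup>2 * N' * (l2norm (Gf b))^2"
   if b: "b \<in> Basis" for b
  proof -
   note m = multiplier_L2[OF grad_mult_measurable grad_mult_bound[OF b] AL, of \<alpha>]
   have "- Re (l2inner (grad_mult \<alpha> b \<odot> Af) (Gf b)) \<le> cmod (l2inner (grad_mult \<alpha> b \<odot> Af) (Gf b))"
    using abs_Re_le_cmod[of "l2inner (grad_mult \<alpha> b \<odot> Af) (Gf b)"] by linarith
   also have "\<dots> \<le> l2norm (grad_mult \<alpha> b \<odot> Af) * l2norm (Gf b)" by (rule cmod_l2inner_le[OF m(1) GL[OF b]])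
   also have "\<dots> \<le> 4 * \<alpha> * A * l2norm (Gf b)" using m(2) a unfolding A_def by (intro mult_right_mono) auto
   \<comment> \<open>The factors are balanced so that the sum over all \<open>N\<close> directions
     uses only \<open>A^2 / 4\<close> in total.\<close>
   also have "\<dots> = 2 * (A / (2 * sqrt N')) * (4 * \<alpha> * sqrt N' * l2norm (Gf b))" using N' by simp
   also have "\<dots> \<le> (A / (2 * sqrt N'))^2 + (4 * \<alpha> * sqrt N' * l2norm (Gf b))^2" by (rule sum_squares_bound)
   also have "\<dots> = A\<^sup>2 / (4 * N') + 16 * \<alpha>\<^sup>2 * N' * (l2norm (Gf b))^2"
    using N' by (simp add: power_mult_distrib power_divide)
   finally show ?thesis .
  qed
  have "- (\<Sum>b\<in>Basis. Re (l2inner (grad_mult \<alpha> b \<odot> Af) (Gf b))) \<le> (\<Sum>b\<in>(Basis::'a set). A\<^sup>2 / (4 * N') + 16 * \<alpha>\<^sup>2 * N' * (l2norm (Gf b))^2)"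
   unfolding sum_negf[symmetric] by (intro sum_mono g)
  also have "\<dots> = A\<^sup>2 / 4 + 16 * \<alpha>\<^sup>2 * N' * S"
   using N' unfolding S_def sum.distrib sum_distrib_left[symmetric] by (simp add: N'_def)
  finally have gs: "- (\<Sum>b\<in>Basis. Re (l2inner (grad_mult \<alpha> b \<odot> Af) (Gf b))) \<le> A\<^sup>2 / 4 + 16 * \<alpha>\<^sup>2 * N' * S" .
  have zs: "- Re (l2inner (zero_mult \<alpha> \<odot> Af) Zf) \<le> z * A * U"
  proof -
   note m = multiplier_L2[OF zero_mult_measurable z AL]
   have "- Re (l2inner (zero_mult \<alpha> \<odot> Af) Zf) \<le> cmod (l2inner (zero_mult \<alpha> \<odot> Af) Zf)"
    using abs_Re_le_cmod[of "l2inner (zero_mult \<alpha> \<odot> Af) Zf"] by linarith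
   also have "\<dots> \<le> l2norm (zero_mult \<alpha> \<odot> Af) * l2norm Zf" by (rule cmod_l2inner_le[OF m(1) ZL])
   also have "\<dots> \<le> z * A * U" using m(2) unfolding A_def U_def by (intro mult_right_mono) auto
   finally show ?thesis .
  qed
  have "16 * \<alpha>\<^sup>2 * N' * S \<le> 16 * \<alpha>\<^sup>2 * N' * (2 * A * U + k2 * U\<^sup>2)" using N' by (intro mult_left_mono G) auto
  then have "A\<^sup>2 - A\<^sup>2 / 4 - (16 * \<alpha>\<^sup>2 * N' * (2 * A * U + k2 * U\<^sup>2)) - z * A * U + V\<^sup>2 + \<mu> * n\<^sup>2 \<le> Re (form_a \<alpha> \<beta> \<mu> u u)"
   unfolding Re using gs zs by linarith
  moreover have "16 * \<alpha>\<^sup>2 * N' * (2 * A * U + k2 * U\<^sup>2) + z * A * U = k1 * U * A + (C3 - k1\<^sup>2 - 1) * U\<^sup>2"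
   by (simp add: k1_def C3_def algebra_simps)
  moreover have "k1 * U * A \<le> A\<^sup>2 / 4 + k1\<^sup>2 * U\<^sup>2"
   using sum_squares_bound[of "A / 2" "k1 * U"] by (simp add: power_mult_distrib power_divide mult_ac)
  ultimately have low: "A\<^sup>2 / 2 - (C3 - 1) * U\<^sup>2 + V\<^sup>2 + \<mu> * n\<^sup>2 \<le> Re (form_a \<alpha> \<beta> \<mu> u u)"
   by (simp add: algebra_simps)
  have U2: "U\<^sup>2 \<le> 4 * e\<^sup>2 * (A\<^sup>2 + V\<^sup>2) + 2 * C\<^sup>2 * n\<^sup>2"
  proof -
   have "U\<^sup>2 \<le> (e * A + e * V + C * n)^2" using U pos(3) by (rule power_mono)
   also have "\<dots> \<le> 2 * (e * A + e * V)^2 + 2 * (C * n)^2" using sum_squares_bound[of "e * A + e * V" "C * n"] unfolding power2_sum[of _ "C * n"] by linarith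
   also have "(e * A + e * V)^2 \<le> 2 * (e * A)^2 + 2 * (e * V)^2" using sum_squares_bound[of "e * A" "e * V"] by (simp add: power2_sum)
   finally show ?thesis by (simp add: power_mult_distrib algebra_simps)
  qed
  have "C3 * U\<^sup>2 \<le> C3 * (4 * e\<^sup>2 * (A\<^sup>2 + V\<^sup>2) + 2 * C\<^sup>2 * n\<^sup>2)" using U2 C3 by (intro mult_left_mono) auto
  also have "\<dots> = 4 * C3 * e\<^sup>2 * (A\<^sup>2 + V\<^sup>2) + 2 * C\<^sup>2 * C3 * n\<^sup>2" by (simp add: algebra_simps)
  also have "4 * C3 * e\<^sup>2 * (A\<^sup>2 + V\<^sup>2) \<le> 1 / 4 * (A\<^sup>2 + V\<^sup>2)" by (rule mult_right_mono[OF e1]) simp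
  finally have CU: "C3 * U\<^sup>2 \<le> A\<^sup>2 / 4 + V\<^sup>2 / 4 + 2 * C\<^sup>2 * C3 * n\<^sup>2" by (simp add: add_divide_distrib)
  have "\<mu>0 * n\<^sup>2 \<le> \<mu> * n\<^sup>2" using mu by (intro mult_right_mono) auto
  then have "2 * C\<^sup>2 * C3 * n\<^sup>2 + n\<^sup>2 \<le> \<mu> * n\<^sup>2" by (simp add: \<mu>0_def algebra_simps)
  moreover have "0 \<le> U\<^sup>2" "0 \<le> V\<^sup>2" "0 \<le> n\<^sup>2" by auto
  moreover have "(C3 - 1) * U\<^sup>2 = C3 * U\<^sup>2 - U\<^sup>2" by (simp add: algebra_simps)
  ultimately have "A\<^sup>2 / 4 + V\<^sup>2 / 4 + n\<^sup>2 / 4 \<le> Re (form_a \<alpha> \<beta> \<mu> u u)" using low CU by linarith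
  then have R: "(A\<^sup>2 + V\<^sup>2 + n\<^sup>2) / 4 \<le> Re (form_a \<alpha> \<beta> \<mu> u u)" by (simp add: add_divide_distrib)
  have "4 * e\<^sup>2 \<le> 1"
  proof -
   have "4 * e\<^sup>2 * 1 \<le> 4 * e\<^sup>2 * C3" using C3 by (intro mult_left_mono) auto
   then show ?thesis using e1 by (simp add: mult_ac)
  qed
  then have "4 * e\<^sup>2 * (A\<^sup>2 + V\<^sup>2) \<le> 1 * (A\<^sup>2 + V\<^sup>2)" by (intro mult_right_mono) auto
  then have "4 * e\<^sup>2 * (A\<^sup>2 + V\<^sup>2) \<le> A\<^sup>2 + V\<^sup>2" by simp
  then have "U\<^sup>2 \<le> A\<^sup>2 + V\<^sup>2 + 2 * C\<^sup>2 * n\<^sup>2" using U2 by linarith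
  moreover have "(1 + 2 * C\<^sup>2) * (A\<^sup>2 + V\<^sup>2 + n\<^sup>2) = A\<^sup>2 + V\<^sup>2 + 2 * C\<^sup>2 * n\<^sup>2 + (n\<^sup>2 + 2 * C\<^sup>2 * (A\<^sup>2 + V\<^sup>2))"
   by (simp add: algebra_simps)
  moreover have "0 \<le> n\<^sup>2 + 2 * C\<^sup>2 * (A\<^sup>2 + V\<^sup>2)" by simp
  ultimately have U3: "U\<^sup>2 \<le> (1 + 2 * C\<^sup>2) * (A\<^sup>2 + V\<^sup>2 + n\<^sup>2)" by linarith
  have "2 * A * U \<le> A\<^sup>2 + U\<^sup>2" by (rule sum_squares_bound)
  then have "n\<^sup>2 + V\<^sup>2 + U\<^sup>2 + A\<^sup>2 + S \<le> 2 * (A\<^sup>2 + V\<^sup>2 + n\<^sup>2) + (k2 + 2) * U\<^sup>2"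
   using G by (simp add: algebra_simps) (smt (verit) zero_le_power2)
  also have "\<dots> \<le> 2 * (A\<^sup>2 + V\<^sup>2 + n\<^sup>2) + (k2 + 3) * ((1 + 2 * C\<^sup>2) * (A\<^sup>2 + V\<^sup>2 + n\<^sup>2))"
   using k0 by (intro add_mono order_refl mult_mono U3) auto
  also have "\<dots> = L * (A\<^sup>2 + V\<^sup>2 + n\<^sup>2)" by (simp add: L_def algebra_simps)
  finally have "c * (n\<^sup>2 + V\<^sup>2 + U\<^sup>2 + A\<^sup>2 + S) \<le> c * (L * (A\<^sup>2 + V\<^sup>2 + n\<^sup>2))" using c0 by (intro mult_left_mono) auto
  also have "\<dots> = (A\<^sup>2 + V\<^sup>2 + n\<^sup>2) / 4" using L2 by (simp add: c_def)
  finally have "c * (n\<^sup>2 + V\<^sup>2 + U\<^sup>2 + A\<^sup>2 + S) \<le> Re (form_a \<alpha> \<beta> \<mu> u u)" using R by linarith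
  then show ?thesis unfolding n_def V_def U_def A_def S_def Vf_def Zf_def Af_def Gf_def .
 qed
 with m0 c0 show ?thesis using that by blast
qed

section \<open>Cutoff functions\<close>

lemma cut_partial:
 fixes x :: "'a::euclidean_space"
 shows "partial b (\<lambda>x. complex_of_real (bump k (c * (norm x)^2 + d))) x
  = of_real (bump (Suc k) (c * (norm x)^2 + d) * (2 * c * inner x b))"
proof -
 define g where "g x = c * (norm x)^2 + d" for x :: 'a
 have g: "(g has_derivative (\<lambda>h. c * (2 * inner x h))) (at x)" unfolding g_def
  by (rule has_derivative_eq_rhs[OF has_derivative_add[OF has_derivative_mult_right[OF norm_square_has_derivative] has_derivative_const]]) simp
 have "partial b (\<lambda>x. complex_of_real (bump k (g x))) x = complex_of_real (bump (Suc k) (g x) * partial b g x)"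
  by (rule partial_real_compose(2)[OF bump_has_derivative differentiableI[OF g]])
 then show ?thesis unfolding partial_eq[OF g] by (simp add: g_def mult_ac)
qed

lemma cut_partial2:
 fixes x :: "'a::euclidean_space"
 assumes b: "b \<in> Basis"
 shows "partial b (partial b (\<lambda>x. complex_of_real (bump 0 (c * (norm x)^2 + d)))) x
  = of_real (bump 2 (c * (norm x)^2 + d) * (2 * c * inner x b)^2 + bump 1 (c * (norm x)^2 + d) * (2 * c))"
proof -
 define f where "f x = complex_of_real (bump 1 (c * (norm x)^2 + d))" for x :: 'a
 define g where "g x = complex_of_real (2 * c) * of_real (inner x b)" for x :: 'a
 have f: "smooth f" unfolding f_def by (intro smooth_bump smooth_linear_norm_square)
 have g: "smooth g" unfolding g_def by (intro smooth_mult smooth_const smooth_inner)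
 have pg: "partial b g x = of_real (2 * c)"
  unfolding g_def using partial_mult[of "\<lambda>_. complex_of_real (2 * c)" x "\<lambda>x. of_real (inner x b)" b]
   smooth_differentiable[OF smooth_inner, of b x] b by (simp add: partial_inner)
 have "partial b (\<lambda>x. complex_of_real (bump 0 (c * (norm x)^2 + d))) = (\<lambda>x. f x * g x)"
  by (rule ext) (simp add: cut_partial f_def g_def mult_ac)
 then have "partial b (partial b (\<lambda>x. complex_of_real (bump 0 (c * (norm x)^2 + d)))) x = f x * partial b g x + partial b f x * g x"
  using partial_mult[OF smooth_differentiable[OF f] smooth_differentiable[OF g]] by simp
 also have "partial b f x = of_real (bump 2 (c * (norm x)^2 + d) * (2 * c * inner x b))"
  unfolding f_def using cut_partial[of b 1 c d x] by (simp add: numeral_2_eq_2)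
 finally show ?thesis unfolding pg by (simp add: f_def g_def power2_eq_square algebra_simps)
qed

text \<open>The bounds are scale invariant: each derivative of the cutoff is multiplied by a power
  of \<open>|x|\<close>, so that Leibniz terms split into a bounded factor tending to zero pointwise
  and a fixed function with an extra weight \<open>|x|^-1\<close> or \<open>|x|^-2\<close>.\<close>

locale cutoff_seq =
 fixes f :: "nat \<Rightarrow> 'a::euclidean_space \<Rightarrow> complex" and C :: real
 assumes smooth_f: "smooth (f n)"
  and bound: "cmod (f n x) \<le> C"
  and bound1: "b \<in> Basis \<Longrightarrow> cmod (of_real (norm x) * partial b (f n) x) \<le> C"
  and bound2: "b \<in> Basis \<Longrightarrow> cmod (of_real ((norm x)^2) * partial b (partial b (f n)) x) \<le> C"
  and lim: "x \<noteq> 0 \<Longrightarrow> (\<lambda>n. f n x) \<longlonglongrightarrow> 1"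
  and lim1: "b \<in> Basis \<Longrightarrow> x \<noteq> 0 \<Longrightarrow> (\<lambda>n. of_real (norm x) * partial b (f n) x) \<longlonglongrightarrow> 0"
  and lim2: "b \<in> Basis \<Longrightarrow> x \<noteq> 0 \<Longrightarrow> (\<lambda>n. of_real ((norm x)^2) * partial b (partial b (f n)) x) \<longlonglongrightarrow> 0"

lemma cut_bound:
 fixes c d :: real and x :: "'a::euclidean_space"
 assumes b: "b \<in> Basis"
 defines "t \<equiv> c * (norm x)^2 + d"
 defines "f \<equiv> (\<lambda>x. complex_of_real (bump 0 (c * (norm x)^2 + d)))"
 shows "cmod (of_real (norm x) * partial b f x) \<le> 2 * (\<bar>bump 1 t\<bar> * (\<bar>c\<bar> * (norm x)^2))"
  "cmod (of_real ((norm x)^2) * partial b (partial b f) x)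
   \<le> 4 * (\<bar>bump 2 t\<bar> * (\<bar>c\<bar> * (norm x)^2)^2) + 2 * (\<bar>bump 1 t\<bar> * (\<bar>c\<bar> * (norm x)^2))"
proof -
 have xb: "\<bar>inner x b\<bar> \<le> norm x" by (rule Basis_le_norm[OF b])
 have "cmod (of_real (norm x) * partial b f x) = 2 * (\<bar>bump 1 t\<bar> * (\<bar>c\<bar> * (norm x * \<bar>inner x b\<bar>)))"
  unfolding f_def cut_partial norm_mult norm_of_real by (simp add: abs_mult t_def)
 also have "\<dots> \<le> 2 * (\<bar>bump 1 t\<bar> * (\<bar>c\<bar> * (norm x * norm x)))" by (intro mult_left_mono xb) auto
 finally show "cmod (of_real (norm x) * partial b f x) \<le> 2 * (\<bar>bump 1 t\<bar> * (\<bar>c\<bar> * (norm x)^2))"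
  by (simp add: power2_eq_square)
 have "(inner x b)^2 \<le> (norm x)^2" using power_mono[OF xb, of 2] by simp
 then have "\<bar>bump 2 t * (2 * c * inner x b)^2\<bar> \<le> 4 * (\<bar>bump 2 t\<bar> * (\<bar>c\<bar>\<^sup>2 * (norm x)^2))"
  by (simp add: abs_mult power_mult_distrib mult_left_mono)
 moreover have "\<bar>bump 2 t * (2 * c * inner x b)^2 + bump 1 t * (2 * c)\<bar> \<le> \<bar>bump 2 t * (2 * c * inner x b)^2\<bar> + 2 * (\<bar>bump 1 t\<bar> * \<bar>c\<bar>)"
  using abs_triangle_ineq[of "bump 2 t * (2 * c * inner x b)^2" "bump 1 t * (2 * c)"] by (simp add: abs_mult)
 ultimately have "(norm x)^2 * \<bar>bump 2 t * (2 * c * inner x b)^2 + bump 1 t * (2 * c)\<bar>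
   \<le> (norm x)^2 * (4 * (\<bar>bump 2 t\<bar> * (\<bar>c\<bar>\<^sup>2 * (norm x)^2)) + 2 * (\<bar>bump 1 t\<bar> * \<bar>c\<bar>))"
  by (intro mult_left_mono) auto
 moreover have "n\<^sup>2 * (4 * (p * (a\<^sup>2 * n\<^sup>2)) + 2 * (r * a)) = 4 * (p * (a * n\<^sup>2)^2) + 2 * (r * (a * n\<^sup>2))" for n p a r :: real
  by (simp add: algebra_simps power2_eq_square)
 moreover have "cmod (of_real ((norm x)^2) * partial b (partial b f) x) = (norm x)^2 * \<bar>bump 2 t * (2 * c * inner x b)^2 + bump 1 t * (2 * c)\<bar>"
  unfolding f_def cut_partial2[OF b] norm_mult norm_of_real t_def by simp
 ultimately show "cmod (of_real ((norm x)^2) * partial b (partial b f) x)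
   \<le> 4 * (\<bar>bump 2 t\<bar> * (\<bar>c\<bar> * (norm x)^2)^2) + 2 * (\<bar>bump 1 t\<bar> * (\<bar>c\<bar> * (norm x)^2))" by (simp only:)
qed

lemma bump_weight_bound:
 assumes "0 \<le> s" "0 < t \<Longrightarrow> s \<le> t + 1"
 shows "\<bar>bump 1 t\<bar> * s \<le> 3" "\<bar>bump 2 t\<bar> * s\<^sup>2 \<le> 60"
proof -
 show "\<bar>bump 1 t\<bar> * s \<le> 3"
 proof (cases "0 < t")
  case True
  have "\<bar>bump 1 t\<bar> * s \<le> \<bar>bump 1 t\<bar> * (t + 1)" by (intro mult_left_mono assms(2)[OF True]) simp
  then show ?thesis using bump_1_bound[OF True] by simp
 qed (simp add: bump_nonpos)
 show "\<bar>bump 2 t\<bar> * s\<^sup>2 \<le> 60"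
 proof (cases "0 < t")
  case True
  have "\<bar>bump 2 t\<bar> * s\<^sup>2 \<le> \<bar>bump 2 t\<bar> * (t + 1)^2" by (intro mult_left_mono power_mono assms True) auto
  then show ?thesis using bump_2_bound[OF True] by (simp add: numeral_2_eq_2)
 qed (simp add: bump_nonpos)
qed

text \<open>For the cutoff near the origin the argument of the bump tends to infinity at each fixed
  nonzero point; the weighted derivatives then decay like \<open>1 / t\<close>.\<close>

lemma bump_decay:
 assumes t: "1 \<le> t"
 shows "\<bar>bump 1 t\<bar> * (t + 1) \<le> 2 / t" "\<bar>bump 2 t\<bar> * (t + 1)^2 \<le> 12 / t"
proof -
 define y where "y = 1 / t"
 have y: "0 < y" "y \<le> 1" "t = 1 / y" using t by (auto simp: y_def)
 have ey: "exp (- y) \<le> 1" "0 \<le> exp (- y)" using y by auto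
 have "\<bar>bump 1 t\<bar> = y\<^sup>2 * exp (- y)" using t bump_1[of t] by (simp add: y_def)
 then have "\<bar>bump 1 t\<bar> * (t + 1) \<le> y\<^sup>2 * 1 * (t + 1)"
  using ey t by (auto intro!: mult_right_mono mult_left_mono simp del: mult_1_right)
 also have "\<dots> = y + y\<^sup>2" using y by (simp add: field_simps power2_eq_square)
 also have "\<dots> \<le> y + y" using y by (simp add: power2_eq_square mult_left_le)
 finally show "\<bar>bump 1 t\<bar> * (t + 1) \<le> 2 / t" by (simp add: y_def)
 have "\<bar>bump 2 t\<bar> = \<bar>y ^ 4 - 2 * y ^ 3\<bar> * exp (- y)" using t bump_2[of t] by (simp add: y_def abs_mult numeral_2_eq_2)
 also have "\<dots> \<le> (y ^ 4 + 2 * y ^ 3) * 1"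
  using y ey abs_triangle_ineq4[of "y ^ 4" "2 * y ^ 3"] by (intro mult_mono) (auto simp: abs_mult)
 also have "\<dots> \<le> 3 * y ^ 3" using power_decreasing[of 3 4 y] y by simp
 finally have "\<bar>bump 2 t\<bar> * (t + 1)^2 \<le> 3 * y ^ 3 * (2 * t)^2"
  using t y(1) by (intro mult_mono power_mono) (linarith | simp)+
 also have "\<dots> = 12 * y" unfolding y(3) using y(1) by (simp add: field_simps power2_eq_square power3_eq_cube)
 finally show "\<bar>bump 2 t\<bar> * (t + 1)^2 \<le> 12 / t" by (simp add: y_def)
qed

text \<open>\<open>q\<close> is the limit of the bump, 1 for the cutoff near the origin and
  \<open>bump 0 1\<close> for the one near infinity, and dividing by it normalises the limit. The
  constant is \<open>246 = 4 * 60 + 2 * 3\<close>, from the bounds on the second and first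
  derivatives of the bump.\<close>

lemma cut_cutoff_seq:
 fixes c d :: "nat \<Rightarrow> real"
 assumes bd: "\<And>n s. 0 \<le> s \<Longrightarrow> 0 < c n * s + d n \<Longrightarrow> \<bar>c n\<bar> * s \<le> c n * s + d n + 1"
  and lim0: "\<And>s. 0 < s \<Longrightarrow> (\<lambda>n. bump 0 (c n * s + d n)) \<longlonglongrightarrow> q" and q: "0 < q"
  and lim1: "\<And>s. 0 < s \<Longrightarrow> (\<lambda>n. \<bar>bump 1 (c n * s + d n)\<bar> * (\<bar>c n\<bar> * s)) \<longlonglongrightarrow> 0"
  and lim2: "\<And>s. 0 < s \<Longrightarrow> (\<lambda>n. \<bar>bump 2 (c n * s + d n)\<bar> * (\<bar>c n\<bar> * s)^2) \<longlonglongrightarrow> 0"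
 shows "cutoff_seq (\<lambda>n x::'a::euclidean_space. complex_of_real (1 / q) * of_real (bump 0 (c n * (norm x)^2 + d n))) ((1 / q) * 246)"
proof -
 define f where "f n = (\<lambda>x::'a. complex_of_real (bump 0 (c n * (norm x)^2 + d n)))" for n
 have fs: "smooth (f n)" for n unfolding f_def by (intro smooth_bump smooth_linear_norm_square)
 have p: "partial b (\<lambda>x. complex_of_real (1 / q) * g x) x = complex_of_real (1 / q) * partial b g x" if "smooth g" for g :: "'a \<Rightarrow> complex" and b x
  using partial_bounded_linear[OF bounded_linear_mult_right smooth_differentiable[OF that]] .
 have p1: "partial b (\<lambda>x. complex_of_real (1 / q) * f n x) = (\<lambda>x. complex_of_real (1 / q) * partial b (f n) x)" for b n
  by (rule ext) (rule p[OF fs])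
 have p2: "partial b (\<lambda>x. complex_of_real (1 / q) * partial b (f n) x) x = complex_of_real (1 / q) * partial b (partial b (f n)) x"
  if "b \<in> Basis" for b n x by (rule p[OF smooth_partial[OF fs that]])
 have cb: "cmod (of_real (norm x) * partial b (f n) x) \<le> 2 * (\<bar>bump 1 (c n * (norm x)^2 + d n)\<bar> * (\<bar>c n\<bar> * (norm x)^2))"
  "cmod (of_real ((norm x)^2) * partial b (partial b (f n)) x)
   \<le> 4 * (\<bar>bump 2 (c n * (norm x)^2 + d n)\<bar> * (\<bar>c n\<bar> * (norm x)^2)^2) + 2 * (\<bar>bump 1 (c n * (norm x)^2 + d n)\<bar> * (\<bar>c n\<bar> * (norm x)^2))"
  if "b \<in> Basis" for b n x unfolding f_def by (rule cut_bound[OF that])+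
 have cb': "cmod (of_real (norm x) * partial b (f n) x) \<le> 6"
  "cmod (of_real ((norm x)^2) * partial b (partial b (f n)) x) \<le> 246" if b: "b \<in> Basis" for b x n
 proof -
  have w: "\<bar>bump 1 (c n * (norm x)^2 + d n)\<bar> * (\<bar>c n\<bar> * (norm x)^2) \<le> 3" "\<bar>bump 2 (c n * (norm x)^2 + d n)\<bar> * (\<bar>c n\<bar> * (norm x)^2)^2 \<le> 60"
   using bd[of "(norm x)^2" n] by (intro bump_weight_bound; simp)+
  show "cmod (of_real (norm x) * partial b (f n) x) \<le> 6" using cb(1)[OF b, where n = n and x = x] w(1) by linarith
  show "cmod (of_real ((norm x)^2) * partial b (partial b (f n)) x) \<le> 246" using cb(2)[OF b, where n = n and x = x] w by linarith
 qed
 have sc: "cmod (h * (complex_of_real (1 / q) * z)) \<le> (1 / q) * C" if "cmod (h * z) \<le> C" for h z C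
 proof -
  have "cmod (h * (complex_of_real (1 / q) * z)) = (1 / q) * cmod (h * z)" using q by (simp add: norm_mult norm_divide)
  also have "\<dots> \<le> (1 / q) * C" using that q by (intro mult_left_mono) auto
  finally show ?thesis .
 qed
 have fb: "cmod (f n x) \<le> 246" for n x
  using bump_0_nonneg[of "c n * (norm x)^2 + d n"] bump_0_le_1[of "c n * (norm x)^2 + d n"] by (simp add: f_def)
 have lims: "(\<lambda>n. complex_of_real (1 / q) * f n x) \<longlonglongrightarrow> 1 \<and> (\<lambda>n. of_real (norm x) * (complex_of_real (1 / q) * partial b (f n) x)) \<longlonglongrightarrow> 0
   \<and> (\<lambda>n. of_real ((norm x)^2) * (complex_of_real (1 / q) * partial b (partial b (f n)) x)) \<longlonglongrightarrow> 0"
  if x: "x \<noteq> 0" and b: "b \<in> Basis" for x b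
 proof (intro conjI)
  have s: "0 < (norm x)^2" using x by simp
  have "(\<lambda>n. complex_of_real (1 / q) * f n x) \<longlonglongrightarrow> complex_of_real (1 / q) * of_real q"
   unfolding f_def by (intro tendsto_mult tendsto_const tendsto_of_real lim0[OF s])
  then show "(\<lambda>n. complex_of_real (1 / q) * f n x) \<longlonglongrightarrow> 1" using q by simp
  have "(\<lambda>n. 2 * (\<bar>bump 1 (c n * (norm x)^2 + d n)\<bar> * (\<bar>c n\<bar> * (norm x)^2))) \<longlonglongrightarrow> 2 * 0"
   by (intro tendsto_mult tendsto_const lim1[OF s])
  then have l1: "(\<lambda>n. of_real (norm x) * partial b (f n) x) \<longlonglongrightarrow> 0"
   by (intro Lim_null_comparison[of "\<lambda>n. of_real (norm x) * partial b (f n) x", OF always_eventually[OF allI[OF cb(1)[OF b, where x = x]]]]) simp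
  from tendsto_mult[OF tendsto_const[of "complex_of_real (1 / q)"] l1]
  show "(\<lambda>n. of_real (norm x) * (complex_of_real (1 / q) * partial b (f n) x)) \<longlonglongrightarrow> 0" by (simp add: mult_ac)
  have "(\<lambda>n. 4 * (\<bar>bump 2 (c n * (norm x)^2 + d n)\<bar> * (\<bar>c n\<bar> * (norm x)^2)^2) + 2 * (\<bar>bump 1 (c n * (norm x)^2 + d n)\<bar> * (\<bar>c n\<bar> * (norm x)^2))) \<longlonglongrightarrow> 4 * 0 + 2 * 0"
   by (intro tendsto_mult tendsto_add tendsto_const lim1[OF s] lim2[OF s])
  then have l2: "(\<lambda>n. of_real ((norm x)^2) * partial b (partial b (f n)) x) \<longlonglongrightarrow> 0"
   by (intro Lim_null_comparison[of "\<lambda>n. of_real ((norm x)^2) * partial b (partial b (f n)) x", OF always_eventually[OF allI[OF cb(2)[OF b, where x = x]]]]) simp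
  from tendsto_mult[OF tendsto_const[of "complex_of_real (1 / q)"] l2]
  show "(\<lambda>n. of_real ((norm x)^2) * (complex_of_real (1 / q) * partial b (partial b (f n)) x)) \<longlonglongrightarrow> 0" by (simp add: mult_ac)
 qed
 obtain b0 :: 'a where b0: "b0 \<in> Basis" using nonempty_Basis by blast
 have "cutoff_seq (\<lambda>n x. complex_of_real (1 / q) * f n x) ((1 / q) * 246)"
 proof
  show "smooth (\<lambda>x. complex_of_real (1 / q) * f n x)" for n by (intro smooth_mult smooth_const fs)
  show "cmod (complex_of_real (1 / q) * f n x) \<le> (1 / q) * 246" for n x using sc[of 1 "f n x" 246] fb[of n x] by simp
  show "(\<lambda>n. complex_of_real (1 / q) * f n x) \<longlonglongrightarrow> 1" if "x \<noteq> 0" for x using lims[OF that b0] by blast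
  fix b :: 'a assume b: "b \<in> Basis"
  show "cmod (of_real (norm x) * partial b (\<lambda>x. complex_of_real (1 / q) * f n x) x) \<le> (1 / q) * 246" for n x
   unfolding p1 by (rule sc) (rule order_trans[OF cb'(1)[OF b]], simp)
  show "cmod (of_real ((norm x)^2) * partial b (partial b (\<lambda>x. complex_of_real (1 / q) * f n x)) x) \<le> (1 / q) * 246" for n x
   unfolding p1 p2[OF b] by (rule sc[OF cb'(2)[OF b]])
  fix x :: 'a assume x: "x \<noteq> 0"
  note l = lims[OF x b]
  show "(\<lambda>n. of_real (norm x) * partial b (\<lambda>x. complex_of_real (1 / q) * f n x) x) \<longlonglongrightarrow> 0"
   unfolding p1 using l by blast
  show "(\<lambda>n. of_real ((norm x)^2) * partial b (partial b (\<lambda>x. complex_of_real (1 / q) * f n x)) x) \<longlonglongrightarrow> 0"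
   unfolding p1 p2[OF b] using l by blast
 qed
 then show ?thesis by (simp only: f_def)
qed

text \<open>The product rule for a pure second derivative has four terms counted with multiplicity,
  each at most \<open>C * D\<close>.\<close>

lemma cutoff_seq_mult:
 fixes f g :: "nat \<Rightarrow> 'a::euclidean_space \<Rightarrow> complex"
 assumes f: "cutoff_seq f C" and g: "cutoff_seq g D"
 shows "cutoff_seq (\<lambda>n x. f n x * g n x) (4 * (C * D))"
proof -
 interpret F: cutoff_seq f C by fact
 interpret G: cutoff_seq g D by fact
 note fs = F.smooth_f and gs = G.smooth_f
 have p1: "partial b (\<lambda>x. f n x * g n x) = (\<lambda>x. f n x * partial b (g n) x + partial b (f n) x * g n x)" for b n
  by (intro ext partial_mult smooth_differentiable fs gs)
 have p2: "partial b (partial b (\<lambda>x. f n x * g n x)) x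
   = f n x * partial b (partial b (g n)) x + 2 * (partial b (f n) x * partial b (g n) x) + partial b (partial b (f n)) x * g n x"
  if b: "b \<in> Basis" for b n x
 proof -
  note d = smooth_differentiable[of _ x]
  have "partial b (partial b (\<lambda>x. f n x * g n x)) x
    = partial b (\<lambda>x. f n x * partial b (g n) x) x + partial b (\<lambda>x. partial b (f n) x * g n x) x"
   unfolding p1 by (intro partial_add d smooth_mult smooth_partial fs gs b)
  also have "partial b (\<lambda>x. f n x * partial b (g n) x) x = f n x * partial b (partial b (g n)) x + partial b (f n) x * partial b (g n) x"
   by (intro partial_mult d smooth_partial fs gs b)
  also have "partial b (\<lambda>x. partial b (f n) x * g n x) x = partial b (f n) x * partial b (g n) x + partial b (partial b (f n)) x * g n x"
   by (intro partial_mult d smooth_partial fs gs b)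
  finally show ?thesis by simp
 qed
 have e1: "of_real (norm x) * partial b (\<lambda>x. f n x * g n x) x
   = f n x * (of_real (norm x) * partial b (g n) x) + (of_real (norm x) * partial b (f n) x) * g n x" for n x b
  unfolding p1 by (simp add: algebra_simps)
 have e2: "of_real ((norm x)^2) * partial b (partial b (\<lambda>x. f n x * g n x)) x
   = f n x * (of_real ((norm x)^2) * partial b (partial b (g n)) x)
    + 2 * ((of_real (norm x) * partial b (f n) x) * (of_real (norm x) * partial b (g n) x))
    + (of_real ((norm x)^2) * partial b (partial b (f n)) x) * g n x" if "b \<in> Basis" for n x b
  unfolding p2[OF that] by (simp add: algebra_simps power2_eq_square)
 have m: "cmod (y * z) \<le> C * D" if "cmod y \<le> C" "cmod z \<le> D" for y z
  unfolding norm_mult using that by (intro mult_mono) (auto intro: order_trans[OF norm_ge_zero])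
 have CD: "0 \<le> C * D" by (rule order_trans[OF norm_ge_zero m[OF F.bound[of 0 0] G.bound[of 0 0]]])
 show ?thesis
 proof
  show "smooth (\<lambda>x. f n x * g n x)" for n by (intro smooth_mult fs gs)
  show "cmod (f n x * g n x) \<le> 4 * (C * D)" for n x using m[OF F.bound[of n x] G.bound[of n x]] CD by linarith
  show "(\<lambda>n. f n x * g n x) \<longlonglongrightarrow> 1" if "x \<noteq> 0" for x using tendsto_mult[OF F.lim[OF that] G.lim[OF that]] by simp
  fix b :: 'a assume b: "b \<in> Basis"
  show "cmod (of_real (norm x) * partial b (\<lambda>x. f n x * g n x) x) \<le> 4 * (C * D)" for n x
  proof -
   have "cmod (f n x * (of_real (norm x) * partial b (g n) x) + (of_real (norm x) * partial b (f n) x) * g n x) \<le> C * D + C * D"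
    by (intro norm_triangle_mono m F.bound G.bound F.bound1[OF b] G.bound1[OF b])
   then show ?thesis unfolding e1 using CD by linarith
  qed
  show "cmod (of_real ((norm x)^2) * partial b (partial b (\<lambda>x. f n x * g n x)) x) \<le> 4 * (C * D)" for n x
  proof -
   have 2: "cmod (2 * ((of_real (norm x) * partial b (f n) x) * (of_real (norm x) * partial b (g n) x))) \<le> 2 * (C * D)"
    unfolding norm_mult[of 2] using m[OF F.bound1[OF b, where n = n and x = x] G.bound1[OF b, where n = n and x = x]] by simp
   have "cmod (of_real ((norm x)^2) * partial b (partial b (\<lambda>x. f n x * g n x)) x) \<le> C * D + 2 * (C * D) + C * D"
    unfolding e2[OF b] by (intro norm_triangle_mono 2 m F.bound G.bound F.bound2[OF b] G.bound2[OF b])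
   then show ?thesis using CD by linarith
  qed
  fix x :: 'a assume x: "x \<noteq> 0"
  show "(\<lambda>n. of_real (norm x) * partial b (\<lambda>x. f n x * g n x) x) \<longlonglongrightarrow> 0"
   unfolding e1 using tendsto_add[OF tendsto_mult[OF F.lim[OF x] G.lim1[OF b x]] tendsto_mult[OF F.lim1[OF b x] G.lim[OF x]]] by simp
  show "(\<lambda>n. of_real ((norm x)^2) * partial b (partial b (\<lambda>x. f n x * g n x)) x) \<longlonglongrightarrow> 0" unfolding e2[OF b]
   using tendsto_add[OF tendsto_add[OF tendsto_mult[OF F.lim[OF x] G.lim2[OF b x]] tendsto_mult[OF tendsto_const[of 2] tendsto_mult[OF F.lim1[OF b x] G.lim1[OF b x]]]] tendsto_mult[OF F.lim2[OF b x] G.lim[OF x]]]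
   by simp
 qed
qed

text \<open>The product of a cutoff that vanishes for \<open>|x| \<le> 1 / (n + 1)\<close> with one
  that vanishes for \<open>|x| \<ge> n + 1\<close>.\<close>

lemma cutoff_exists:
 obtains \<zeta> :: "nat \<Rightarrow> 'a::euclidean_space \<Rightarrow> complex" and C where "cutoff_seq \<zeta> C" "\<And>n. \<zeta> n \<in> test_functions (- {0})"
proof -
 define m where "m n = (real (Suc n))^2" for n
 have m1: "1 \<le> m n" for n by (simp add: m_def del: of_nat_Suc)
 have mlim: "filterlim m at_top sequentially"
  unfolding m_def by (intro filterlim_pow_at_top filterlim_compose[OF filterlim_real_sequentially filterlim_Suc]) auto
 have tlim: "filterlim (\<lambda>n. m n * s + - 1) at_top sequentially" if "0 < s" for s
  by (subst add.commute) (intro filterlim_tendsto_add_at_top[OF tendsto_const] filterlim_at_top_mult_tendsto_pos[OF tendsto_const that mlim])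
 have "cutoff_seq (\<lambda>n x::'a. complex_of_real (1 / 1) * of_real (bump 0 (m n * (norm x)^2 + (- 1)))) ((1 / 1) * 246)"
 proof (rule cut_cutoff_seq)
  fix s :: real assume s: "0 < s"
  show "(\<lambda>n. bump 0 (m n * s + - 1)) \<longlonglongrightarrow> 1" by (rule bump_0_tendsto_1[OF tlim[OF s]])
  have ev: "\<forall>\<^sub>F n in sequentially. 1 \<le> m n * s + - 1" using tlim[OF s] unfolding filterlim_at_top by blast
  have inv: "(\<lambda>n. k / (m n * s + - 1)) \<longlonglongrightarrow> 0" for k :: real
   by (rule tendsto_divide_0[OF tendsto_const]) (rule filterlim_at_top_imp_at_infinity[OF tlim[OF s]])
  show "(\<lambda>n. \<bar>bump 1 (m n * s + - 1)\<bar> * (\<bar>m n\<bar> * s)) \<longlonglongrightarrow> 0"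
  proof (rule Lim_null_comparison[OF _ inv[of 2]])
   show "\<forall>\<^sub>F n in sequentially. norm (\<bar>bump 1 (m n * s + - 1)\<bar> * (\<bar>m n\<bar> * s)) \<le> 2 / (m n * s + - 1)" using ev
   proof eventually_elim
    case (elim n) then show ?case using bump_decay(1)[OF elim] m1[of n] s by (simp add: abs_mult)
   qed
  qed
  show "(\<lambda>n. \<bar>bump 2 (m n * s + - 1)\<bar> * (\<bar>m n\<bar> * s)^2) \<longlonglongrightarrow> 0"
  proof (rule Lim_null_comparison[OF _ inv[of 12]])
   show "\<forall>\<^sub>F n in sequentially. norm (\<bar>bump 2 (m n * s + - 1)\<bar> * (\<bar>m n\<bar> * s)^2) \<le> 12 / (m n * s + - 1)"
    using ev
   proof eventually_elim
    case (elim n) then show ?case using bump_decay(2)[OF elim] m1[of n] s by (simp add: abs_mult)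
   qed
  qed
 next
  fix n and s :: real assume "0 \<le> s" "0 < m n * s + - 1"
  then show "\<bar>m n\<bar> * s \<le> m n * s + - 1 + 1" using m1[of n] by simp
 qed simp
 moreover have "cutoff_seq (\<lambda>n x::'a. complex_of_real (1 / bump 0 1) * of_real (bump 0 (- (1 / m n) * (norm x)^2 + 1))) ((1 / bump 0 1) * 246)"
 proof (rule cut_cutoff_seq)
  fix s :: real assume s: "0 < s"
  have inv: "(\<lambda>n. 1 / m n) \<longlonglongrightarrow> 0"
   by (rule tendsto_divide_0[OF tendsto_const]) (rule filterlim_at_top_imp_at_infinity[OF mlim])
  have "(\<lambda>n. - (1 / m n) * s + 1) \<longlonglongrightarrow> - 0 * s + 1" by (intro tendsto_intros inv)
  then have t: "(\<lambda>n. - (1 / m n) * s + 1) \<longlonglongrightarrow> 1" by simp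
  have b: "(\<lambda>n. bump k (- (1 / m n) * s + 1)) \<longlonglongrightarrow> bump k 1" for k
   by (rule isCont_tendsto_compose[OF DERIV_isCont[OF bump_has_derivative] t])
  have c: "(\<lambda>n. \<bar>- (1 / m n)\<bar> * s) \<longlonglongrightarrow> \<bar>- 0\<bar> * s" by (intro tendsto_intros inv)
  show "(\<lambda>n. bump 0 (- (1 / m n) * s + 1)) \<longlonglongrightarrow> bump 0 1" by (rule b)
  show "(\<lambda>n. \<bar>bump 1 (- (1 / m n) * s + 1)\<bar> * (\<bar>- (1 / m n)\<bar> * s)) \<longlonglongrightarrow> 0"
   using tendsto_mult[OF tendsto_rabs[OF b[of 1]] c] by simp
  show "(\<lambda>n. \<bar>bump 2 (- (1 / m n) * s + 1)\<bar> * (\<bar>- (1 / m n)\<bar> * s)^2) \<longlonglongrightarrow> 0"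
   using tendsto_mult[OF tendsto_rabs[OF b[of 2]] tendsto_power[OF c, of 2]] by simp
 next
  fix n and s :: real assume "0 \<le> s" "0 < - (1 / m n) * s + 1"
  moreover have "\<bar>- (1 / m n)\<bar> * s = 1 / m n * s" "- (1 / m n) * s = - (1 / m n * s)" using m1[of n] by auto
  ultimately show "\<bar>- (1 / m n)\<bar> * s \<le> - (1 / m n) * s + 1 + 1" by linarith
 qed (rule bump_0_pos, simp)
 ultimately have cs: "cutoff_seq (\<lambda>n x::'a. (complex_of_real (1 / 1) * of_real (bump 0 (m n * (norm x)^2 + (- 1))))
   * (complex_of_real (1 / bump 0 1) * of_real (bump 0 (- (1 / m n) * (norm x)^2 + 1)))) (4 * ((1 / 1) * 246 * ((1 / bump 0 1) * 246)))" (is "cutoff_seq ?z _")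
  by (rule cutoff_seq_mult)
 moreover have "?z n \<in> test_functions (- {0})" for n
 proof (rule test_functionsI)
  show "smooth (?z n)" by (rule cutoff_seq.smooth_f[OF cs])
  define K where "K = cball (0::'a) (real (Suc n)) \<inter> {x. 1 \<le> m n * (norm x)^2}"
  have "closed {x::'a. 1 \<le> m n * (norm x)^2}" by (intro closed_Collect_le continuous_intros)
  then show "compact K" unfolding K_def by (intro compact_Int_closed compact_cball)
  show "K \<subseteq> - {0}" by (auto simp: K_def)
  fix x assume "x \<notin> K"
  then consider "m n * (norm x)^2 < 1" | "real (Suc n) < norm x" by (auto simp: K_def not_le)
  then show "?z n x = 0"
  proof cases
   case 1 then show ?thesis by (simp add: bump_nonpos)
  next
   case 2
   then have "m n \<le> (norm x)^2" unfolding m_def by (intro power_mono) auto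
   then have "- (1 / m n) * (norm x)^2 + 1 \<le> 0" using m1[of n] by (simp add: field_simps)
   then show ?thesis by (simp only: bump_nonpos of_real_0 mult_zero_right)
  qed
 qed
 ultimately show ?thesis using that by blast
qed

section \<open>The form domain\<close>

lemma bounded_multiplier_L2:
 fixes m f :: "'a::euclidean_space \<Rightarrow> complex"
 assumes [measurable]: "m \<in> borel_measurable borel" and C: "\<And>x. cmod (m x) \<le> C" and f: "f \<in> L2"
 shows "(\<lambda>x. m x * f x) \<in> L2"
proof -
 note [measurable] = L2_measurable[OF f]
 have "AE x in lborel. cmod (m x * f x) \<le> C * cmod (f x)"
  by (intro AE_I2) (simp add: norm_mult C mult_right_mono)
 then show ?thesis by (intro L2_bound(1)[OF f]) measurable
qed

lemma test_mult_L2: assumes z: "z \<in> test_functions \<Omega>" and f: "f \<in> L2" shows "(\<lambda>x. z x * f x) \<in> L2"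
proof -
 obtain B where B: "\<And>x. cmod (z x) \<le> B" by (rule test_bounded[OF z]) blast
 show ?thesis by (rule bounded_multiplier_L2[OF smooth_measurable[OF test_smooth[OF z]] B f])
qed

lemma multiplier_pointwise_tendsto:
 fixes m :: "nat \<Rightarrow> 'a::euclidean_space \<Rightarrow> complex"
 assumes [measurable]: "\<And>n. m n \<in> borel_measurable borel" and C: "\<And>n x. cmod (m n x) \<le> C" and f: "f \<in> L2"
  and lim: "\<And>x. x \<noteq> 0 \<Longrightarrow> (\<lambda>n. m n x) \<longlonglongrightarrow> c"
 shows "(\<lambda>n. l2of (\<lambda>x. m n x * f x)) \<longlonglongrightarrow> l2of (\<lambda>x. c * f x)"
proof (rule L2_dominated_convergence(2)[OF L2_cmult[OF f, of "of_real C"]])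
 note [measurable] = L2_measurable[OF f]
 show "(\<lambda>x. m n x * f x) \<in> borel_measurable borel" for n by measurable
 show "(\<lambda>x. c * f x) \<in> borel_measurable borel" by measurable
 have "0 \<le> C" using order_trans[OF norm_ge_zero C] .
 then show "AE x in lborel. cmod (m n x * f x) \<le> cmod (of_real C * f x)" for n
  by (intro AE_I2) (simp add: norm_mult C mult_right_mono)
 show "AE x in lborel. (\<lambda>n. m n x * f x) \<longlonglongrightarrow> c * f x" using AE_lborel_singleton[of "0::'a"]
 proof eventually_elim
  case (elim x) then show ?case by (intro tendsto_mult lim tendsto_const)
 qed
qed

lemma multiplier_tendsto:
 fixes m :: "'a::euclidean_space \<Rightarrow> complex"
 assumes m: "m \<in> borel_measurable borel" "\<And>x. cmod (m x) \<le> C" and f: "\<And>n. f n \<in> L2" "g \<in> L2" "(\<lambda>n. l2of (f n)) \<longlonglongrightarrow> l2of g"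
 shows "(\<lambda>n. l2of (\<lambda>x. m x * f n x)) \<longlonglongrightarrow> l2of (\<lambda>x. m x * g x)"
proof -
 note L = bounded_multiplier_L2[OF m f(1)] bounded_multiplier_L2[OF m f(2)]
 have C: "0 \<le> C" using order_trans[OF norm_ge_zero m(2)] .
 show ?thesis unfolding l2of_tendsto_iff[OF L]
 proof (rule Lim_null_comparison)
  have "(\<lambda>n. C * l2norm (\<lambda>x. f n x - g x)) \<longlonglongrightarrow> C * 0"
   using f(3) unfolding l2of_tendsto_iff[OF f(1,2)] by (intro tendsto_intros)
  then show "(\<lambda>n. C * l2norm (\<lambda>x. f n x - g x)) \<longlonglongrightarrow> 0" by simp
  have "l2norm (\<lambda>x. m x * f n x - m x * g x) \<le> C * l2norm (\<lambda>x. f n x - g x)" for n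
  proof (rule power2_le_imp_le)
   note [measurable] = L2_measurable[OF f(1)] L2_measurable[OF f(2)] m(1)
   have "AE x in lborel. cmod (m x * f n x - m x * g x) \<le> C * cmod (f n x - g x)"
    by (intro AE_I2) (simp add: norm_mult m(2) mult_right_mono flip: right_diff_distrib)
   then have "(l2norm (\<lambda>x. m x * f n x - m x * g x))^2 \<le> C\<^sup>2 * (l2norm (\<lambda>x. f n x - g x))^2"
    by (intro L2_bound(2)[OF L2_diff[OF f(1,2)]]) measurable
   then show "(l2norm (\<lambda>x. m x * f n x - m x * g x))^2 \<le> (C * l2norm (\<lambda>x. f n x - g x))^2"
    by (simp add: power_mult_distrib)
  qed (use C in simp)
  then show "\<forall>\<^sub>F n in sequentially. norm (l2norm (\<lambda>x. m x * f n x - m x * g x)) \<le> C * l2norm (\<lambda>x. f n x - g x)"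
   by simp
 qed
qed

abbreviation cut_grad :: "('a::euclidean_space \<Rightarrow> complex) \<Rightarrow> ('a \<Rightarrow> complex) \<Rightarrow> ('a \<Rightarrow> 'a \<Rightarrow> complex) \<Rightarrow> 'a \<Rightarrow> 'a \<Rightarrow> complex" where
 "cut_grad z u g b \<equiv> (\<lambda>x. z x * g b x + partial b z x * u x)"

text \<open>The Leibniz rule applied to \<open>cut_grad\<close>, with \<open>g\<close> and
  \<open>l\<close> standing for the first and second weak derivatives of \<open>u\<close>; the mixed
  terms are left separate so that the weak Leibniz lemma matches twice.\<close>

abbreviation cut_hess :: "('a::euclidean_space \<Rightarrow> complex) \<Rightarrow> ('a \<Rightarrow> complex) \<Rightarrow> ('a \<Rightarrow> 'a \<Rightarrow> complex)
  \<Rightarrow> ('a \<Rightarrow> 'a \<Rightarrow> complex) \<Rightarrow> 'a \<Rightarrow> 'a \<Rightarrow> complex" where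
 "cut_hess z u g l b \<equiv> (\<lambda>x. (z x * l b x + partial b z x * g b x) + (partial b z x * g b x + partial b (partial b z) x * u x))"

lemma cut_weak_partials:
 assumes z: "z \<in> test_functions \<Omega>" and u: "u \<in> L2" and b: "b \<in> Basis"
  and g: "g b \<in> L2" "has_weak_partial b u (g b)" and l: "l b \<in> L2" "has_weak_partial b (g b) (l b)"
 shows "cut_grad z u g b \<in> L2" "has_weak_partial b (\<lambda>x. z x * u x) (cut_grad z u g b)"
  "cut_hess z u g l b \<in> L2" "has_weak_partial b (cut_grad z u g b) (cut_hess z u g l b)"
proof -
 note tp = test_partial[OF z b]
 have L: "(\<lambda>x. z x * g b x) \<in> L2" "(\<lambda>x. partial b z x * u x) \<in> L2" "(\<lambda>x. z x * l b x) \<in> L2"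
  "(\<lambda>x. partial b z x * g b x) \<in> L2" "(\<lambda>x. partial b (partial b z) x * u x) \<in> L2"
  by (intro test_mult_L2[OF z] test_mult_L2[OF tp] test_mult_L2[OF test_partial[OF tp b]] u g(1) l(1))+
 show "cut_grad z u g b \<in> L2" "cut_hess z u g l b \<in> L2" by (intro L2_add L)+
 show "has_weak_partial b (\<lambda>x. z x * u x) (cut_grad z u g b)"
  by (rule has_weak_partial_leibniz[OF test_smooth[OF z] u g(1) b g(2)])
 show "has_weak_partial b (cut_grad z u g b) (cut_hess z u g l b)"
  by (intro has_weak_partial_add L2_add L b has_weak_partial_leibniz test_smooth[OF z] test_smooth[OF tp] u g l)
qed

text \<open>Localizing with a compactly supported bump reduces the weighted estimates of a function
 in \<open>H\<^sup>2\<close> near the origin to Rellich's inequality.\<close>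

lemma hardy_H2:
 fixes u :: "'a::euclidean_space \<Rightarrow> complex"
 assumes N: "DIM('a) \<ge> 5" and u: "u \<in> L2"
  and g: "\<And>b. b \<in> Basis \<Longrightarrow> g b \<in> L2" "\<And>b. b \<in> Basis \<Longrightarrow> has_weak_partial b u (g b)"
  and l: "\<And>b. b \<in> Basis \<Longrightarrow> l b \<in> L2" "\<And>b. b \<in> Basis \<Longrightarrow> has_weak_partial b (g b) (l b)"
 shows "npow (-2) \<odot> u \<in> L2" and "\<And>b. b \<in> Basis \<Longrightarrow> npow (-1) \<odot> g b \<in> L2"
proof -
 define z where "z x = complex_of_real (bump 0 (- 1 * (norm x)^2 + 1))" for x :: 'a
 have z0: "z x = 0" if "x \<notin> cball 0 1" for x
 proof -
  have "1\<^sup>2 \<le> (norm x)^2" using that by (intro power_mono) auto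
  then show ?thesis by (simp add: z_def bump_nonpos)
 qed
 have zs: "smooth z" unfolding z_def by (intro smooth_bump smooth_linear_norm_square)
 have zt: "z \<in> test_functions UNIV"
  by (rule test_functionsI[where K = "cball 0 1", OF zs compact_cball subset_UNIV z0])
 \<comment> \<open>A positive lower bound of the localising bump on the ball of radius
   \<open>1 / 2\<close>. There \<open>u\<close> is recovered from \<open>z u\<close> by division;
   outside this ball the negative powers of the norm are bounded.\<close>
 define q where "q = bump 0 (1 / 2)"
 have q: "0 < q" by (simp add: q_def bump_0_pos)
 have zq: "q \<le> cmod (z x)" if x: "norm x \<le> 1 / 2" for x
 proof -
  have "(norm x)^2 \<le> (1 / 2)^2" using x by (intro power_mono) auto
  then have t: "1 / 2 \<le> - 1 * (norm x)^2 + 1" by (simp add: power2_eq_square)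
  then have "1 / (- 1 * (norm x)^2 + 1) \<le> 1 / (1 / 2)" by (intro frac_le) auto
  then have "q \<le> bump 0 (- 1 * (norm x)^2 + 1)" using t bump_0[of "- 1 * (norm x)^2 + 1"] bump_0[of "1 / 2"] by (simp add: q_def)
  then show ?thesis by (simp add: z_def)
 qed
 define v where "v = (\<lambda>x. z x * u x)"
 let ?G = "cut_grad z u g" and ?H = "cut_hess z u g l"
 note cw = cut_weak_partials[where z = z and u = u and g = g and l = l, OF zt u _ g l]
 have GL: "?G b \<in> L2" and HL: "?H b \<in> L2" and Gw: "has_weak_partial b v (?G b)" and Hw: "has_weak_partial b (?G b) (?H b)"
  if b: "b \<in> Basis" for b unfolding v_def by (rule cw; rule b)+
 have vL: "v \<in> L2" unfolding v_def by (rule test_mult_L2[OF zt u])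
 have vz: "v x = 0" if "x \<notin> cball 0 1" for x using z0[OF that] by (simp add: v_def)
 obtain s K' where K': "compact K'" "cball 0 1 \<subseteq> K'" "K' \<subseteq> (UNIV::'a set)" and s: "\<And>n. s n \<in> test_functions UNIV" "\<And>n x. x \<notin> K' \<Longrightarrow> s n x = 0"
  and sl: "(\<lambda>n. l2of (s n)) \<longlonglongrightarrow> l2of v"
  "\<And>b. b \<in> Basis \<Longrightarrow> (\<lambda>n. l2of (partial b (s n))) \<longlonglongrightarrow> l2of (?G b)"
  "\<And>b. b \<in> Basis \<Longrightarrow> (\<lambda>n. l2of (partial b (partial b (s n)))) \<longlonglongrightarrow> l2of (?H b)"
  by (rule mollify[OF open_UNIV compact_cball subset_UNIV vL vz GL Gw HL Hw]) blast+
 have Hs: "l2of (\<lambda>x. \<Sum>b\<in>Basis. ?H b x) = (\<Sum>b\<in>Basis. l2of (?H b))" by (rule l2of_sum[OF HL])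
 have HsL: "(\<lambda>x. \<Sum>b\<in>Basis. ?H b x) \<in> L2" by (rule L2_sum[OF HL])
 have lap: "(\<lambda>n. l2of (laplacian (s n))) \<longlonglongrightarrow> l2of (\<lambda>x. \<Sum>b\<in>Basis. ?H b x)"
  unfolding l2of_laplacian[OF s(1)] Hs by (intro tendsto_sum sl(3))
 note R = rellich_limit[where s = s and g = ?G, OF N s(1) vL sl(1) GL sl(2) HsL lap]
 have R1: "npow (-2) \<odot> v \<in> L2" by (rule R)
 have R3: "npow (-1) \<odot> ?G b \<in> L2" if "b \<in> Basis" for b by (rule R(3)) (assumption | rule that)+
 have [measurable]: "z \<in> borel_measurable borel" by (rule smooth_measurable[OF zs])
 define a where "a x = (if norm x \<le> 1 / 2 then 1 / z x else 0)" for x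
 define c where "c k x = (if norm x \<le> 1 / 2 then 0 else complex_of_real (norm x powr k))" for k :: real and x :: 'a
 have am: "a \<in> borel_measurable borel" and cm: "c k \<in> borel_measurable borel" for k unfolding a_def c_def by measurable
 have ab: "cmod (a x) \<le> 1 / q" for x
  using zq[of x] q by (auto simp: a_def norm_divide intro!: divide_left_mono mult_pos_pos)
 have cb: "cmod (c k x) \<le> (1 / 2) powr k" if "k \<le> 0" for k x
  using powr_mono2'[of k "1 / 2" "norm x"] that by (auto simp: c_def)
 have za: "a x * (z x * w) + (if norm x \<le> 1 / 2 then 0 else w) = w" for x w
  using zq[of x] q by (auto simp: a_def)
 have "npow (-2) \<odot> u = (\<lambda>x. a x * (npow (-2) \<odot> v) x + c (-2) x * u x)"
 proof
  show "(npow (-2) \<odot> u) x = a x * (npow (-2) \<odot> v) x + c (-2) x * u x" for x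
   using za[of x "(npow (-2) \<odot> u) x"] by (cases "norm x \<le> 1 / 2") (simp_all only: v_def c_def if_True if_False mult_zero_left mult_ac)
 qed
 then show u2: "npow (-2) \<odot> u \<in> L2"
  using L2_add[OF bounded_multiplier_L2[OF am ab R1] bounded_multiplier_L2[OF cm cb u, of "-2"]] by simp
 \<comment> \<open>The Leibniz formula for the gradient of \<open>z u\<close> contains
   \<open>u\<close> times a derivative of \<open>z\<close>, so solving it for the weighted
   \<open>g b\<close> requires the weight \<open>|x|^-1\<close> on \<open>u\<close> as well.\<close>
 have u1: "npow (-1) \<odot> u \<in> L2"
 proof -
  have e: "norm x powr -1 = norm x * norm x powr -2" for x :: 'a using powr_add[of "norm x" 1 "-2"] by simp
  have "npow (-1) \<odot> u = (\<lambda>x. (if norm x \<le> 1 / 2 then of_real (norm x) else 0) * (npow (-2) \<odot> u) x + c (-1) x * u x)"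
  proof
   show "(npow (-1) \<odot> u) x = (if norm x \<le> 1 / 2 then of_real (norm x) else 0) * (npow (-2) \<odot> u) x + c (-1) x * u x" for x
    by (cases "norm x \<le> 1 / 2") (simp_all only: c_def e if_True if_False of_real_mult mult_zero_left add_0_right add_0_left mult.assoc)
  qed
  moreover have "(\<lambda>x. (if norm x \<le> 1 / 2 then of_real (norm x) else 0) * (npow (-2) \<odot> u) x) \<in> L2"
   by (rule bounded_multiplier_L2[OF _ _ u2, of _ 1]) auto
  ultimately show ?thesis using L2_add[OF _ bounded_multiplier_L2[OF cm cb u, of "-1"]] by simp
 qed
 fix b :: 'a assume b: "b \<in> Basis"
 have "npow (-1) \<odot> g b = (\<lambda>x. a x * ((npow (-1) \<odot> ?G b) x - partial b z x * (npow (-1) \<odot> u) x) + c (-1) x * g b x)"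
 proof
  fix x
  have "(npow (-1) \<odot> ?G b) x - partial b z x * (npow (-1) \<odot> u) x = z x * (npow (-1) \<odot> g b) x" by (simp only: algebra_simps)
  then show "(npow (-1) \<odot> g b) x = a x * ((npow (-1) \<odot> ?G b) x - partial b z x * (npow (-1) \<odot> u) x) + c (-1) x * g b x"
   using za[of x "(npow (-1) \<odot> g b) x"] by (cases "norm x \<le> 1 / 2") (simp_all only: c_def if_True if_False mult_zero_left)
 qed
 then show "npow (-1) \<odot> g b \<in> L2"
  using L2_add[OF bounded_multiplier_L2[OF am ab L2_diff[OF R3[OF b] test_mult_L2[OF test_partial[OF zt b] u1]]] bounded_multiplier_L2[OF cm cb g(1)[OF b], of "-1"]] by simp
qed

subsection \<open>The form domain as a closure\<close>

text \<open>A function is represented by the tuple of all the weighted terms that occur in the form,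
 so that the form norm becomes the norm of a Hilbert space.\<close>

type_synonym 'n form_space = "(real ^ 'n) l2 \<times> (real ^ 'n) l2 \<times> (real ^ 'n) l2 \<times> (real ^ 'n) l2 \<times> ((real ^ 'n) l2 ^ 'n)"

text \<open>Gradient and Laplacian are separate arguments, so the same tuple serves for classical
  derivatives, for weak derivatives and for the Leibniz expressions of a function that has been cut
  off.\<close>

definition embed :: "real \<Rightarrow> real \<Rightarrow> (real ^ 'n \<Rightarrow> complex) \<Rightarrow> (real ^ 'n \<Rightarrow> real ^ 'n \<Rightarrow> complex) \<Rightarrow> (real ^ 'n \<Rightarrow> complex) \<Rightarrow> 'n::finite form_space" where
 "embed \<alpha> \<beta> u g l = (l2of u, l2of (potential_V \<beta> \<odot> u), l2of (npow (\<alpha> - 2) \<odot> u),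
   l2of (coeff_a \<alpha> \<odot> l), \<chi> i. l2of (npow (\<alpha> - 1) \<odot> g (axis i 1)))"

definition test_embed :: "real \<Rightarrow> real \<Rightarrow> (real ^ 'n \<Rightarrow> complex) \<Rightarrow> 'n::finite form_space" where
 "test_embed \<alpha> \<beta> u = embed \<alpha> \<beta> u (\<lambda>b. partial b u) (laplacian u)"

definition weak_embed :: "real \<Rightarrow> real \<Rightarrow> (real ^ 'n \<Rightarrow> complex) \<Rightarrow> 'n::finite form_space" where
 "weak_embed \<alpha> \<beta> u = embed \<alpha> \<beta> u (\<lambda>b. weak_partial b u) (weak_laplacian u)"

lemma embed_tendsto:
 assumes "(\<lambda>n. l2of (u n)) \<longlonglongrightarrow> l2of u'"
  "(\<lambda>n. l2of (potential_V \<beta> \<odot> u n)) \<longlonglongrightarrow> l2of (potential_V \<beta> \<odot> u')"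
  "(\<lambda>n. l2of (npow (\<alpha> - 2) \<odot> u n)) \<longlonglongrightarrow> l2of (npow (\<alpha> - 2) \<odot> u')"
  "(\<lambda>n. l2of (coeff_a \<alpha> \<odot> l n)) \<longlonglongrightarrow> l2of (coeff_a \<alpha> \<odot> l')"
  "\<And>b. b \<in> Basis \<Longrightarrow> (\<lambda>n. l2of (npow (\<alpha> - 1) \<odot> g n b)) \<longlonglongrightarrow> l2of (npow (\<alpha> - 1) \<odot> g' b)"
 shows "(\<lambda>n. embed \<alpha> \<beta> (u n) (g n) (l n)) \<longlonglongrightarrow> embed \<alpha> \<beta> u' g' l'"
 unfolding embed_def by (intro tendsto_Pair assms vec_tendstoI) (simp add: assms(5))

lemma Cauchy_dist_le:
 assumes y: "Cauchy y" and z: "Cauchy z" and le: "\<And>m n. dist (x m) (x n) \<le> dist (y m) (y n) + dist (z m) (z n)"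
 shows "Cauchy x"
proof (rule metric_CauchyI)
 fix e :: real assume e: "0 < e"
 then have e2: "0 < e / 2" by simp
 obtain M1 M2 where M: "\<And>m n. M1 \<le> m \<Longrightarrow> M1 \<le> n \<Longrightarrow> dist (y m) (y n) < e / 2" "\<And>m n. M2 \<le> m \<Longrightarrow> M2 \<le> n \<Longrightarrow> dist (z m) (z n) < e / 2"
  using metric_CauchyD[OF y e2] metric_CauchyD[OF z e2] by blast
 have "dist (x m) (x n) < e" if "max M1 M2 \<le> m" "max M1 M2 \<le> n" for m n
  using le[of m n] M(1)[of m n] M(2)[of m n] that by simp
 then show "\<exists>M. \<forall>m\<ge>M. \<forall>n\<ge>M. dist (x m) (x n) < e" by blast
qed

lemma partial_diff:
 assumes "f differentiable (at x)" "g differentiable (at x)"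
 shows "partial b (\<lambda>x. f x - g x) x = partial b f x - partial b g x"
 using partial_eq[OF has_derivative_diff[OF assms[THEN has_derivative_partial]]] by (simp add: partial_def)

lemma test_partial_diff:
 assumes "f \<in> test_functions \<Omega>" "g \<in> test_functions \<Omega>"
 shows "partial b (\<lambda>x. f x - g x) = (\<lambda>x. partial b f x - partial b g x)"
 by (intro ext partial_diff test_differentiable[OF assms(1)] test_differentiable[OF assms(2)])

lemma test_laplacian_diff:
 assumes f: "f \<in> test_functions \<Omega>" and g: "g \<in> test_functions \<Omega>"
 shows "laplacian (\<lambda>x. f x - g x) = (\<lambda>x. laplacian f x - laplacian g x)" unfolding laplacian_eq
 by (simp add: test_partial_diff[OF f g] test_partial_diff[OF test_partial[OF f] test_partial[OF g]] sum_subtractf)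

lemma mult_closed_l2of:
 fixes m :: "'a::euclidean_space \<Rightarrow> complex"
 assumes f: "\<And>n. f n \<in> L2" and g: "g \<in> L2" and lim: "(\<lambda>n. l2of (f n)) \<longlonglongrightarrow> l2of g"
  and m[measurable]: "m \<in> borel_measurable borel"
  and mf: "\<And>n. (\<lambda>x. m x * f n x) \<in> L2" and lim': "(\<lambda>n. l2of (\<lambda>x. m x * f n x)) \<longlonglongrightarrow> k"
 shows "(\<lambda>x. m x * g x) \<in> L2" "l2of (\<lambda>x. m x * g x) = k"
proof -
 note [measurable] = L2_measurable[OF g]
 have AE: "AE x in lborel. m x * g x = rep_l2 k x"
  by (rule L2_mult_closed[OF f g lim mf rep_l2_L2]) (simp add: lim')
 show L: "(\<lambda>x. m x * g x) \<in> L2" by (rule L2_cong_AE[OF rep_l2_L2 _ AE]) measurable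
 have "l2of (\<lambda>x. m x * g x) = l2of (rep_l2 k)"
  using AE by (simp add: l2of_eq_iff[OF L rep_l2_L2] ae_eq_def del: l2of_rep)
 then show "l2of (\<lambda>x. m x * g x) = k" by simp
qed

text \<open>Since \<open>a \<ge> 1\<close>, the Laplacians converge; the Hessian and gradient bounds
  make all derivatives up to second order Cauchy, and their limits are weak derivatives of
  \<open>u\<close>. Closedness of multiplication then identifies the weighted components, so the
  first component determines the whole tuple.\<close>

lemma closure_imp_form_domain:
 fixes u :: "real ^ 'n::finite \<Rightarrow> complex"
 assumes s: "\<And>n. s n \<in> test_functions (- {0})" and lim: "(\<lambda>n. test_embed \<alpha> \<beta> (s n)) \<longlonglongrightarrow> k"
  and u: "u \<in> L2" "fst k = l2of u"
 shows "u \<in> form_domain \<alpha> \<beta>" "weak_embed \<alpha> \<beta> u = k"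
proof -
 obtain k0 kV kZ kA kG where k: "k = (k0, kV, kZ, kA, kG)" by (cases k) auto
 have sU: "s n \<in> test_functions UNIV" for n by (rule test_UNIV[OF s])
 note sL = test_L2[OF s]
 have lims: "(\<lambda>n. l2of (s n)) \<longlonglongrightarrow> l2of u"
  "(\<lambda>n. l2of (potential_V \<beta> \<odot> s n)) \<longlonglongrightarrow> kV"
  "(\<lambda>n. l2of (npow (\<alpha> - 2) \<odot> s n)) \<longlonglongrightarrow> kZ"
  "(\<lambda>n. l2of (coeff_a \<alpha> \<odot> laplacian (s n))) \<longlonglongrightarrow> kA"
  "(\<lambda>n. \<chi> i. l2of (npow (\<alpha> - 1) \<odot> partial (axis i 1) (s n))) \<longlonglongrightarrow> kG"
  using tendsto_fst[OF lim] tendsto_fst[OF tendsto_snd[OF lim]] tendsto_fst[OF tendsto_snd[OF tendsto_snd[OF lim]]]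
   tendsto_fst[OF tendsto_snd[OF tendsto_snd[OF tendsto_snd[OF lim]]]] tendsto_snd[OF tendsto_snd[OF tendsto_snd[OF tendsto_snd[OF lim]]]]
  using u(2) by (simp_all add: k test_embed_def embed_def)
 have limG: "(\<lambda>n. l2of (npow (\<alpha> - 1) \<odot> partial (axis i 1) (s n))) \<longlonglongrightarrow> kG $ i" for i
  using tendsto_vec_nth[OF lims(5), of i] by simp
 have AL: "(coeff_a \<alpha> \<odot> laplacian (s n)) \<in> L2" for n by (rule test_L2[OF test_coeff[OF test_laplacian[OF s]]])
 have lapL: "laplacian (s n) \<in> L2" for n by (rule test_L2[OF test_laplacian[OF s]])
 have Cs: "Cauchy (\<lambda>n. l2of (s n))" using lims(1) by (rule LIMSEQ_imp_Cauchy)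
 have Cl: "Cauchy (\<lambda>n. l2of (laplacian (s n)))"
 proof (rule Cauchy_dist_le)
  show "Cauchy (\<lambda>n. l2of (coeff_a \<alpha> \<odot> laplacian (s n)))" by (rule LIMSEQ_imp_Cauchy[OF lims(4)])
  show "Cauchy (\<lambda>n. 0::real)" by (rule LIMSEQ_imp_Cauchy[OF tendsto_const])
  fix m n
  have "l2norm (\<lambda>x. laplacian (s m) x - laplacian (s n) x)
    \<le> l2norm (\<lambda>x. complex_of_real (coeff_a \<alpha> x) * laplacian (s m) x - complex_of_real (coeff_a \<alpha> x) * laplacian (s n) x)"
  proof (rule l2norm_mono(2)[OF L2_diff[OF AL AL] L2_measurable[OF L2_diff[OF lapL lapL]] AE_I2])
   fix x :: "real ^ 'n"
   have "1 * cmod (laplacian (s m) x - laplacian (s n) x) \<le> \<bar>coeff_a \<alpha> x\<bar> * cmod (laplacian (s m) x - laplacian (s n) x)"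
    unfolding coeff_a_def by (intro mult_right_mono) auto
   then show "cmod (laplacian (s m) x - laplacian (s n) x)
     \<le> cmod (complex_of_real (coeff_a \<alpha> x) * laplacian (s m) x - complex_of_real (coeff_a \<alpha> x) * laplacian (s n) x)"
    unfolding right_diff_distrib[symmetric] by (simp add: norm_mult)
  qed
  then show "dist (l2of (laplacian (s m))) (l2of (laplacian (s n)))
    \<le> dist (l2of (coeff_a \<alpha> \<odot> laplacian (s m))) (l2of (coeff_a \<alpha> \<odot> laplacian (s n))) + dist (0::real) 0"
   by (simp add: dist_l2of[OF lapL lapL] dist_l2of[OF AL AL])
 qed
 have dl: "dist (l2of (laplacian (s m))) (l2of (laplacian (s n))) = norm (l2of (laplacian (\<lambda>x. s m x - s n x)))" for m n
  unfolding test_laplacian_diff[OF s s] dist_norm by (simp add: l2of_diff[OF lapL lapL])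
 have Ch: "Cauchy (\<lambda>n. l2of (partial b (partial c (s n))))" if b: "b \<in> Basis" and c: "c \<in> Basis" for b c
 proof (rule Cauchy_dist_le[OF Cl])
  show "Cauchy (\<lambda>n. 0::real)" by (rule LIMSEQ_imp_Cauchy[OF tendsto_const])
  fix m n
  have "dist (l2of (partial b (partial c (s m)))) (l2of (partial b (partial c (s n)))) = norm (l2of (partial b (partial c (\<lambda>x. s m x - s n x))))"
   unfolding test_partial_diff[OF s s] test_partial_diff[OF test_partial[OF s c] test_partial[OF s c]] dist_norm
   by (simp add: l2of_diff[OF test_L2[OF test_partial[OF test_partial[OF s c] b]] test_L2[OF test_partial[OF test_partial[OF s c] b]]])
  then show "dist (l2of (partial b (partial c (s m)))) (l2of (partial b (partial c (s n))))
    \<le> dist (l2of (laplacian (s m))) (l2of (laplacian (s n))) + dist (0::real) 0"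
   using hessian_bound[OF test_diff[OF s s] b c] by (simp add: dl)
 qed
 have Cg: "Cauchy (\<lambda>n. l2of (partial b (s n)))" if b: "b \<in> Basis" for b
 proof (rule Cauchy_dist_le[OF Cs Cl])
  fix m n
  have 1: "dist (l2of (partial b (s m))) (l2of (partial b (s n))) = norm (l2of (partial b (\<lambda>x. s m x - s n x)))"
   unfolding test_partial_diff[OF s s] dist_norm by (simp add: l2of_diff[OF test_L2[OF test_partial[OF s b]] test_L2[OF test_partial[OF s b]]])
  have 2: "dist (l2of (s m)) (l2of (s n)) = norm (l2of (\<lambda>x. s m x - s n x))"
   by (simp add: dist_norm l2of_diff[OF sL sL])
  let ?p = "norm (l2of (\<lambda>x. s m x - s n x))" and ?q = "norm (l2of (laplacian (\<lambda>x. s m x - s n x)))"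
  have "(norm (l2of (partial b (\<lambda>x. s m x - s n x))))^2 \<le> ?p * ?q" by (rule gradient_bound[OF test_diff[OF s s] b])
  also have "\<dots> \<le> (?p + ?q)^2" by (simp add: power2_sum)
  finally have "norm (l2of (partial b (\<lambda>x. s m x - s n x))) \<le> ?p + ?q" by (rule power2_le_imp_le) simp
  then show "dist (l2of (partial b (s m))) (l2of (partial b (s n)))
    \<le> dist (l2of (s m)) (l2of (s n)) + dist (l2of (laplacian (s m))) (l2of (laplacian (s n)))"
   unfolding 1 2 dl .
 qed
 define g where "g b = rep_l2 (lim (\<lambda>n. l2of (partial b (s n))))" for b
 define h where "h b c = rep_l2 (lim (\<lambda>n. l2of (partial b (partial c (s n)))))" for b c
 have gl: "(\<lambda>n. l2of (partial b (s n))) \<longlonglongrightarrow> l2of (g b)" if "b \<in> Basis" for b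
  unfolding g_def l2of_rep by (rule convergent_LIMSEQ_iff[THEN iffD1, OF Cauchy_convergent[OF Cg[OF that]]])
 have hl: "(\<lambda>n. l2of (partial b (partial c (s n)))) \<longlonglongrightarrow> l2of (h b c)" if "b \<in> Basis" "c \<in> Basis" for b c
  unfolding h_def l2of_rep by (rule convergent_LIMSEQ_iff[THEN iffD1, OF Cauchy_convergent[OF Ch[OF that]]])
 have gL: "g b \<in> L2" and hL: "h b c \<in> L2" for b c by (simp_all add: g_def h_def)
 have gw: "has_weak_partial b u (g b)" if b: "b \<in> Basis" for b
  by (rule has_weak_partial_limit[OF sL u(1) lims(1) test_L2[OF test_partial[OF s b]] gL gl[OF b] weak_partial_test[OF test_smooth[OF s] b] b])
 have hw: "has_weak_partial b (g c) (h b c)" if b: "b \<in> Basis" and c: "c \<in> Basis" for b c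
  by (rule has_weak_partial_limit[OF test_L2[OF test_partial[OF s c]] gL gl[OF c] test_L2[OF test_partial[OF test_partial[OF s c] b]] hL hl[OF b c]
     weak_partial_test[OF test_smooth[OF test_partial[OF s c]] b] b])
 have wL: "weak_partial b u \<in> L2" and wg: "ae_eq (weak_partial b u) (g b)" if b: "b \<in> Basis" for b
  using weak_partial_eqI[OF gL gw[OF b]] by auto
 have gw': "ae_eq (g b) (weak_partial b u)" if b: "b \<in> Basis" for b using wg[OF b] by (auto simp: ae_eq_def)
 have hw': "has_weak_partial b (weak_partial c u) (h b c)" if b: "b \<in> Basis" and c: "c \<in> Basis" for b c
  by (rule has_weak_partial_cong[OF hw[OF b c] gL hL wL[OF c] hL gw'[OF c] _ b]) (simp add: ae_eq_def)
 have H1: "u \<in> sobolev_H1" using u(1) gL gw unfolding sobolev_H1_def by blast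
 have H1': "weak_partial c u \<in> sobolev_H1" if c: "c \<in> Basis" for c
  using wL[OF c] hL hw'[OF _ c] unfolding sobolev_H1_def by blast
 have H2: "u \<in> sobolev_H2" using H1 H1' unfolding sobolev_H2_def by blast
 have wwL: "weak_partial b (weak_partial b u) \<in> L2" and wh: "ae_eq (weak_partial b (weak_partial b u)) (h b b)" if b: "b \<in> Basis" for b
  using weak_partial_eqI[OF hL hw'[OF b b]] by auto
 have we: "weak_laplacian u = (\<lambda>x. \<Sum>b\<in>Basis. weak_partial b (weak_partial b u) x)" by (rule ext) (simp add: weak_laplacian_def)
 have wlL: "weak_laplacian u \<in> L2" unfolding we by (rule L2_sum[OF wwL])
 have "l2of (weak_laplacian u) = (\<Sum>b\<in>Basis. l2of (weak_partial b (weak_partial b u)))" unfolding we by (rule l2of_sum[OF wwL])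
 also have "\<dots> = (\<Sum>b\<in>Basis. l2of (h b b))"
  by (rule sum.cong[OF refl]) (use wh wwL hL in \<open>simp add: l2of_eq_iff\<close>)
 finally have wl: "(\<lambda>n. l2of (laplacian (s n))) \<longlonglongrightarrow> l2of (weak_laplacian u)"
  unfolding l2of_laplacian[OF s] by (simp only:) (intro tendsto_sum hl)
 have wgl: "(\<lambda>n. l2of (partial b (s n))) \<longlonglongrightarrow> l2of (weak_partial b u)" if b: "b \<in> Basis" for b
  using gl[OF b] wg[OF b] wL[OF b] gL by (simp add: l2of_eq_iff[symmetric])
 have mV: "(\<lambda>x::real^'n. complex_of_real (potential_V \<beta> x)) \<in> borel_measurable borel" unfolding potential_V_def by measurable
 have mp: "(\<lambda>x::real^'n. complex_of_real (norm x powr \<gamma>)) \<in> borel_measurable borel" for \<gamma> by measurable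
 have ma: "(\<lambda>x::real^'n. complex_of_real (coeff_a \<alpha> x)) \<in> borel_measurable borel" unfolding coeff_a_def by measurable
 have VL: "(potential_V \<beta> \<odot> s n) \<in> L2" for n
  unfolding potential_V_def by (rule test_L2[OF test_powr(1)[OF s]])
 note V = mult_closed_l2of[OF sL u(1) lims(1) mV VL lims(2)]
 note Z = mult_closed_l2of[OF sL u(1) lims(1) mp test_L2[OF test_powr(1)[OF s]] lims(3)]
 note A = mult_closed_l2of[OF lapL wlL wl ma AL lims(4)]
 have ab: "axis i 1 \<in> (Basis :: (real^'n) set)" for i by (rule axis_in_Basis_iff[THEN iffD2]) simp
 have G: "(npow (\<alpha> - 1) \<odot> weak_partial (axis i 1) u) \<in> L2"
  "l2of (npow (\<alpha> - 1) \<odot> weak_partial (axis i 1) u) = kG $ i" for i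
  using mult_closed_l2of[OF test_L2[OF test_partial[OF s ab]] wL[OF ab] wgl[OF ab] mp test_L2[OF test_powr(1)[OF test_partial[OF s ab]]] limG]
  by auto
 have "\<forall>b\<in>Basis. (npow (\<alpha> - 1) \<odot> weak_partial b u) \<in> L2" using G(1) by (auto simp: Basis_vec_def)
 then show "u \<in> form_domain \<alpha> \<beta>" using H2 V(1) Z(1) A(1) by (simp add: form_domain_def coeff_a_def)
 show "weak_embed \<alpha> \<beta> u = k"
  using u(2) V(2) Z(2) A(2) G(2) by (simp add: weak_embed_def embed_def k vec_eq_iff)
qed

text \<open>On a compact set that avoids the origin a continuous weight is bounded, so weighted
  convergence follows from plain convergence.\<close>

lemma weight_tendsto:
 fixes w :: "'a::euclidean_space \<Rightarrow> real"
 assumes w: "continuous_on (- {0}) w" "w \<in> borel_measurable borel" and K: "compact K" "K \<subseteq> - {0}"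
  and f: "\<And>n. f n \<in> L2" "g \<in> L2" "(\<lambda>n. l2of (f n)) \<longlonglongrightarrow> l2of g"
  and z: "\<And>n x. x \<notin> K \<Longrightarrow> f n x = 0" "\<And>x. x \<notin> K \<Longrightarrow> g x = 0"
 shows "(\<lambda>n. l2of (w \<odot> f n)) \<longlonglongrightarrow> l2of (w \<odot> g)"
proof -
 have [measurable]: "K \<in> sets borel" by (rule borel_compact[OF K(1)])
 note [measurable] = w(2)
 define m where "m x = complex_of_real (indicat_real K x * w x)" for x
 have "compact (w ` K)" by (rule compact_continuous_image[OF continuous_on_subset[OF w(1) K(2)] K(1)])
 then have "bounded (w ` K)" by (rule compact_imp_bounded)
 then obtain B where B: "0 < B" "\<And>x. x \<in> K \<Longrightarrow> \<bar>w x\<bar> \<le> B" by (auto simp: bounded_pos)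
 have mb: "cmod (m x) \<le> B" for x using B by (cases "x \<in> K") (auto simp: m_def)
 have mm: "m \<in> borel_measurable borel" unfolding m_def by measurable
 have e: "(\<lambda>x. m x * h x) = (w \<odot> h)" if "\<And>x. x \<notin> K \<Longrightarrow> h x = 0" for h :: "'a \<Rightarrow> complex"
 proof
  fix x show "m x * h x = of_real (w x) * h x" using that[of x] by (cases "x \<in> K") (auto simp: m_def)
 qed
 have "(\<lambda>x. m x * f n x) = (w \<odot> f n)" for n by (rule e) (rule z(1))
 moreover have "(\<lambda>x. m x * g x) = (w \<odot> g)" by (rule e) (rule z(2))
 ultimately show ?thesis using multiplier_tendsto[OF mm mb f] by (simp only:)
qed

text \<open>Functions in \<open>H\<^sup>2\<close> are approximated in two steps: first by cutting off near the origin and near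
 infinity, where the weights and Rellich's inequality absorb the derivatives of the cutoff,
 then by mollification.\<close>

lemma cutoff_in_closure:
 fixes u :: "real ^ 'n::finite \<Rightarrow> complex"
 assumes z: "z \<in> test_functions (- {0})" and u: "u \<in> L2"
  and g: "\<And>b. b \<in> Basis \<Longrightarrow> g b \<in> L2" "\<And>b. b \<in> Basis \<Longrightarrow> has_weak_partial b u (g b)"
  and l: "\<And>b. b \<in> Basis \<Longrightarrow> l b \<in> L2" "\<And>b. b \<in> Basis \<Longrightarrow> has_weak_partial b (g b) (l b)"
 shows "embed \<alpha> \<beta> (\<lambda>x. z x * u x) (cut_grad z u g) (\<lambda>x. \<Sum>b\<in>Basis. cut_hess z u g l b x)
  \<in> closure (test_embed \<alpha> \<beta> ` test_functions (- {0}))"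
proof -
 define v where "v = (\<lambda>x. z x * u x)"
 define G where "G = cut_grad z u g"
 define H where "H = cut_hess z u g l"
 obtain K where K: "compact K" "K \<subseteq> - {0}" "\<And>x. x \<notin> K \<Longrightarrow> z x = 0" by (rule test_functionsD[OF z]) blast
 note clK = compact_imp_closed[OF K(1)]
 have z1: "partial b z x = 0" if "x \<notin> K" for b x by (rule partial_zero_outside[OF clK K(3) that])
 have z2: "partial b (partial b z) x = 0" if "x \<notin> K" for b x by (rule partial_zero_outside[OF clK z1 that])
 note cw = cut_weak_partials[where z = z and u = u and g = g and l = l, OF z u _ g l]
 have GL: "G b \<in> L2" and HL: "H b \<in> L2" and Gw: "has_weak_partial b v (G b)" and Hw: "has_weak_partial b (G b) (H b)"
  if b: "b \<in> Basis" for b unfolding v_def G_def H_def by (rule cw; rule b)+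
 have vL: "v \<in> L2" unfolding v_def by (rule test_mult_L2[OF z u])
 have vz: "v x = 0" if "x \<notin> K" for x using K(3)[OF that] by (simp add: v_def)
 have op: "open (- {0::real^'n})" by (simp add: open_Compl)
 obtain s K' where K': "compact K'" "K \<subseteq> K'" "K' \<subseteq> - {0}" and s: "\<And>n. s n \<in> test_functions (- {0})" "\<And>n x. x \<notin> K' \<Longrightarrow> s n x = 0"
  and sl: "(\<lambda>n. l2of (s n)) \<longlonglongrightarrow> l2of v"
  "\<And>b. b \<in> Basis \<Longrightarrow> (\<lambda>n. l2of (partial b (s n))) \<longlonglongrightarrow> l2of (G b)"
  "\<And>b. b \<in> Basis \<Longrightarrow> (\<lambda>n. l2of (partial b (partial b (s n)))) \<longlonglongrightarrow> l2of (H b)"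
  by (rule mollify[OF op K(1,2) vL vz GL Gw HL Hw]) blast+
 note clK' = compact_imp_closed[OF K'(1)]
 have s1: "partial b (s n) x = 0" if "x \<notin> K'" for b n x by (rule partial_zero_outside[OF clK' s(2) that])
 have s2: "laplacian (s n) x = 0" if "x \<notin> K'" for n x
  unfolding laplacian_def by (intro sum.neutral ballI partial_zero_outside[OF clK' s1 that])
 have vz': "v x = 0" and Gz': "G b x = 0" and Hz': "(\<Sum>b\<in>Basis. H b x) = 0" if "x \<notin> K'" for x b
 proof -
  have "x \<notin> K" using that K'(2) by blast
  then show "v x = 0" "G b x = 0" "(\<Sum>b\<in>Basis. H b x) = 0" by (simp_all add: v_def G_def H_def K(3) z1 z2)
 qed
 have Hs: "l2of (\<lambda>x. \<Sum>b\<in>Basis. H b x) = (\<Sum>b\<in>Basis. l2of (H b))" by (rule l2of_sum[OF HL])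
 have HsL: "(\<lambda>x. \<Sum>b\<in>Basis. H b x) \<in> L2" by (rule L2_sum[OF HL])
 have lap: "(\<lambda>n. l2of (laplacian (s n))) \<longlonglongrightarrow> l2of (\<lambda>x. \<Sum>b\<in>Basis. H b x)"
  unfolding l2of_laplacian[OF s(1)] Hs by (intro tendsto_sum sl(3))
 have cp: "continuous_on (- {0}) (\<lambda>x::real^'n. norm x powr \<gamma>)" "(\<lambda>x::real^'n. norm x powr \<gamma>) \<in> borel_measurable borel" for \<gamma>
  by (auto intro!: continuous_intros)
 have ca: "continuous_on (- {0}) (\<lambda>x::real^'n. coeff_a \<alpha> x)" "(\<lambda>x::real^'n. coeff_a \<alpha> x) \<in> borel_measurable borel"
  unfolding coeff_a_def by (auto intro!: continuous_intros)
 note sL = test_L2[OF s(1)]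
 have "(\<lambda>n. test_embed \<alpha> \<beta> (s n)) \<longlonglongrightarrow> embed \<alpha> \<beta> v G (\<lambda>x. \<Sum>b\<in>Basis. H b x)" unfolding test_embed_def
 proof (rule embed_tendsto[OF sl(1)])
  show "(\<lambda>n. l2of (potential_V \<beta> \<odot> s n)) \<longlonglongrightarrow> l2of (potential_V \<beta> \<odot> v)"
   unfolding potential_V_def by (rule weight_tendsto[OF cp K'(1,3) sL vL sl(1) s(2) vz'])
  show "(\<lambda>n. l2of (npow (\<alpha> - 2) \<odot> s n)) \<longlonglongrightarrow> l2of (npow (\<alpha> - 2) \<odot> v)"
   by (rule weight_tendsto[OF cp K'(1,3) sL vL sl(1) s(2) vz'])
  show "(\<lambda>n. l2of (coeff_a \<alpha> \<odot> laplacian (s n))) \<longlonglongrightarrow> l2of (\<lambda>x. of_real (coeff_a \<alpha> x) * (\<Sum>b\<in>Basis. H b x))"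
   by (rule weight_tendsto[OF ca K'(1,3) test_L2[OF test_laplacian[OF s(1)]] HsL lap s2 Hz'])
  fix b :: "real^'n" assume b: "b \<in> Basis"
  show "(\<lambda>n. l2of (npow (\<alpha> - 1) \<odot> partial b (s n))) \<longlonglongrightarrow> l2of (npow (\<alpha> - 1) \<odot> G b)"
   by (rule weight_tendsto[OF cp K'(1,3) test_L2[OF test_partial[OF s(1) b]] GL[OF b] sl(2)[OF b] s1 Gz'])
 qed
 then show ?thesis unfolding closure_sequential v_def G_def H_def
  by (intro exI[of _ "\<lambda>n. test_embed \<alpha> \<beta> (s n)"]) (simp add: s(1))
qed

text \<open>The Leibniz terms of \<open>a\<close> times the Laplacian of \<open>z u\<close> require
  \<open>a |x|^-2 u\<close> and \<open>a |x|^-1 D_b u\<close> in \<open>L2\<close>. For the summand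
  1 of \<open>a\<close> this is the Hardy-Rellich estimate, for the summand
  \<open>|x|^\<alpha>\<close> it is part of the definition of the form domain.\<close>

lemma form_domain_imp_closure:
 fixes u :: "real ^ 'n::finite \<Rightarrow> complex"
 assumes N: "CARD('n) \<ge> 5" and uD: "u \<in> form_domain \<alpha> \<beta>"
 shows "weak_embed \<alpha> \<beta> u \<in> closure (test_embed \<alpha> \<beta> ` test_functions (- {0}))"
proof -
 have N': "DIM(real^'n) \<ge> 5" using N by simp
 have H2: "u \<in> sobolev_H2" and AL: "(coeff_a \<alpha> \<odot> weak_laplacian u) \<in> L2"
  and GL: "\<And>b. b \<in> Basis \<Longrightarrow> (npow (\<alpha> - 1) \<odot> weak_partial b u) \<in> L2"
  and ZL: "(npow (\<alpha> - 2) \<odot> u) \<in> L2" and VL: "(potential_V \<beta> \<odot> u) \<in> L2"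
  using uD by (auto simp: form_domain_def coeff_a_def)
 have H1: "u \<in> sobolev_H1" and H1': "\<And>b. b \<in> Basis \<Longrightarrow> weak_partial b u \<in> sobolev_H1" using H2 by (auto simp: sobolev_H2_def)
 have u: "u \<in> L2" using H1 by (simp add: sobolev_H1_def)
 define g where "g b = weak_partial b u" for b
 define l where "l b = weak_partial b (weak_partial b u)" for b
 have g: "g b \<in> L2" "has_weak_partial b u (g b)" if "b \<in> Basis" for b
  unfolding g_def using weak_partial_spec[OF H1 that] by auto
 have l: "l b \<in> L2" "has_weak_partial b (g b) (l b)" if "b \<in> Basis" for b
  unfolding g_def l_def using weak_partial_spec[OF H1'[OF that] that] by auto
 have we: "weak_laplacian u = (\<lambda>x. \<Sum>b\<in>Basis. l b x)" by (rule ext) (simp add: weak_laplacian_def l_def)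
 have hu: "(npow (-2) \<odot> u) \<in> L2" by (rule hardy_H2(1)[OF N' u g l])
 have hg: "(npow (-1) \<odot> g b) \<in> L2" if "b \<in> Basis" for b by (rule hardy_H2(2)[OF N' u g l that])
 have aw: "(\<lambda>x. coeff_a \<alpha> x * norm x powr k) \<odot> f \<in> L2" if "npow k \<odot> f \<in> L2" "npow (\<alpha> + k) \<odot> f \<in> L2"
  for k and f :: "real ^ 'n \<Rightarrow> complex"
 proof -
  have "(\<lambda>x. coeff_a \<alpha> x * norm x powr k) \<odot> f = (\<lambda>x. (npow k \<odot> f) x + (npow (\<alpha> + k) \<odot> f) x)"
   by (rule ext) (simp only: distrib_right[symmetric] of_real_add[symmetric] coeff_a_def distrib_right mult_1 powr_add)
  then show ?thesis using L2_add[OF that] by (simp only:)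
 qed
 have au: "(\<lambda>x. coeff_a \<alpha> x * norm x powr -2) \<odot> u \<in> L2" by (rule aw[OF hu]) (use ZL in simp)
 have ag: "(\<lambda>x. coeff_a \<alpha> x * norm x powr -1) \<odot> g b \<in> L2" if b: "b \<in> Basis" for b
  by (rule aw[OF hg[OF b]]) (use GL[OF b] in \<open>simp add: g_def\<close>)
 obtain z :: "nat \<Rightarrow> real^'n \<Rightarrow> complex" and C where zc: "cutoff_seq z C" and z: "\<And>n. z n \<in> test_functions (- {0})"
  by (rule cutoff_exists) blast
 interpret Z: cutoff_seq z C by (rule zc)
 have m0: "z n \<in> borel_measurable borel" for n by (rule smooth_measurable[OF Z.smooth_f])
 have m1: "(norm \<odot> partial b (z n)) \<in> borel_measurable borel" if b: "b \<in> Basis" for b n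
 proof -
  note [measurable] = smooth_measurable[OF smooth_partial[OF Z.smooth_f b]]
  show ?thesis by measurable
 qed
 have m2: "(\<lambda>x. of_real ((norm x)^2) * partial b (partial b (z n)) x) \<in> borel_measurable borel" if b: "b \<in> Basis" for b n
 proof -
  note [measurable] = smooth_measurable[OF smooth_partial[OF smooth_partial[OF Z.smooth_f b] b]]
  show ?thesis by measurable
 qed
 have t0: "(\<lambda>n. l2of (\<lambda>x. z n x * f x)) \<longlonglongrightarrow> l2of f" "\<And>n. (\<lambda>x. z n x * f x) \<in> L2" if f: "f \<in> L2" for f
  using multiplier_pointwise_tendsto[OF m0 Z.bound f Z.lim] bounded_multiplier_L2[OF m0 Z.bound f] by simp_all
 have t1: "(\<lambda>n. l2of (\<lambda>x. of_real (norm x) * partial b (z n) x * f x)) \<longlonglongrightarrow> 0"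
   "\<And>n. (\<lambda>x. of_real (norm x) * partial b (z n) x * f x) \<in> L2" if f: "f \<in> L2" and b: "b \<in> Basis" for f b
  using multiplier_pointwise_tendsto[OF m1[OF b] Z.bound1[OF b] f Z.lim1[OF b]] bounded_multiplier_L2[OF m1[OF b] Z.bound1[OF b] f]
  by (simp_all add: l2of_zero)
 have t2: "(\<lambda>n. l2of (\<lambda>x. of_real ((norm x)^2) * partial b (partial b (z n)) x * f x)) \<longlonglongrightarrow> 0"
   "\<And>n. (\<lambda>x. of_real ((norm x)^2) * partial b (partial b (z n)) x * f x) \<in> L2" if f: "f \<in> L2" and b: "b \<in> Basis" for f b
  using multiplier_pointwise_tendsto[OF m2[OF b] Z.bound2[OF b] f Z.lim2[OF b]] bounded_multiplier_L2[OF m2[OF b] Z.bound2[OF b] f]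
  by (simp_all add: l2of_zero del: of_real_power)
 define T where "T n = embed \<alpha> \<beta> (\<lambda>x. z n x * u x) (cut_grad (z n) u g) (\<lambda>x. \<Sum>b\<in>Basis. cut_hess (z n) u g l b x)" for n
 have "T n \<in> closure (test_embed \<alpha> \<beta> ` test_functions (- {0}))" for n
  unfolding T_def by (rule cutoff_in_closure[OF z u g l])
 moreover have "T \<longlonglongrightarrow> embed \<alpha> \<beta> u g (weak_laplacian u)" unfolding T_def
 proof (rule embed_tendsto)
  show "(\<lambda>n. l2of (\<lambda>x. z n x * u x)) \<longlonglongrightarrow> l2of u" by (rule t0[OF u])
  show "(\<lambda>n. l2of (\<lambda>x. of_real (potential_V \<beta> x) * (z n x * u x))) \<longlonglongrightarrow> l2of (potential_V \<beta> \<odot> u)"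
   using t0(1)[OF VL] by (simp only: mult.left_commute)
  show "(\<lambda>n. l2of (\<lambda>x. of_real (norm x powr (\<alpha> - 2)) * (z n x * u x))) \<longlonglongrightarrow> l2of (npow (\<alpha> - 2) \<odot> u)"
   using t0(1)[OF ZL] by (simp only: mult.left_commute)
  show "(\<lambda>n. l2of (\<lambda>x. of_real (norm x powr (\<alpha> - 1)) * cut_grad (z n) u g b x))
    \<longlonglongrightarrow> l2of (npow (\<alpha> - 1) \<odot> g b)" if b: "b \<in> Basis" for b
  proof -
   have gb: "(npow (\<alpha> - 1) \<odot> g b) \<in> L2" using GL[OF b] by (simp only: g_def)
   have e: "(\<lambda>x. of_real (norm x powr (\<alpha> - 1)) * cut_grad (z n) u g b x)
     = (\<lambda>x. z n x * (of_real (norm x powr (\<alpha> - 1)) * g b x) + of_real (norm x) * partial b (z n) x * (of_real (norm x powr (\<alpha> - 2)) * u x))" for n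
   proof
    fix x :: "real^'n"
    have "norm x powr (\<alpha> - 1) = norm x * norm x powr (\<alpha> - 2)" using powr_add[of "norm x" 1 "\<alpha> - 2"] by simp
    then show "of_real (norm x powr (\<alpha> - 1)) * cut_grad (z n) u g b x
     = z n x * (of_real (norm x powr (\<alpha> - 1)) * g b x) + of_real (norm x) * partial b (z n) x * (of_real (norm x powr (\<alpha> - 2)) * u x)"
     by (simp add: algebra_simps)
   qed
   show ?thesis unfolding e l2of_add[OF t0(2)[OF gb] t1(2)[OF ZL b]]
    using tendsto_add[OF t0(1)[OF gb] t1(1)[OF ZL b]] by simp
  qed
  \<comment> \<open>The commutator of the Laplacian with the cutoff, written as scale invariant
    derivatives of the cutoff times fixed square integrable functions; it tends to zero by dominated
    convergence.\<close>
  define R where "R n b = (\<lambda>x. 2 * (of_real (norm x) * partial b (z n) x * (of_real (coeff_a \<alpha> x * norm x powr -1) * g b x))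
    + of_real ((norm x)^2) * partial b (partial b (z n)) x * (of_real (coeff_a \<alpha> x * norm x powr -2) * u x))" for n b
  have RL: "R n b \<in> L2" if b: "b \<in> Basis" for n b
   unfolding R_def by (intro L2_add L2_cmult t1(2) t2(2) ag au b)
  have Rl: "(\<lambda>n. l2of (R n b)) \<longlonglongrightarrow> 0" if b: "b \<in> Basis" for b
  proof -
   have "l2of (R n b) = 2 *\<^sub>C l2of (\<lambda>x. of_real (norm x) * partial b (z n) x * (of_real (coeff_a \<alpha> x * norm x powr -1) * g b x))
     + l2of (\<lambda>x. of_real ((norm x)^2) * partial b (partial b (z n)) x * (of_real (coeff_a \<alpha> x * norm x powr -2) * u x))" for n
    unfolding R_def l2of_add[OF L2_cmult[OF t1(2)[OF ag[OF b] b]] t2(2)[OF au b]] l2of_scaleC[OF t1(2)[OF ag[OF b] b]] ..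
   moreover have "(\<lambda>n. 2 *\<^sub>C l2of (\<lambda>x. of_real (norm x) * partial b (z n) x * (of_real (coeff_a \<alpha> x * norm x powr -1) * g b x))
     + l2of (\<lambda>x. of_real ((norm x)^2) * partial b (partial b (z n)) x * (of_real (coeff_a \<alpha> x * norm x powr -2) * u x))) \<longlonglongrightarrow> 2 *\<^sub>C 0 + 0"
    by (intro tendsto_add tendsto_scaleC tendsto_const t1(1)[OF ag[OF b] b] t2(1)[OF au b])
   ultimately show ?thesis by (simp only: scaleC_zero_right add_0_right)
  qed
  have e: "(\<lambda>x. of_real (coeff_a \<alpha> x) * (\<Sum>b\<in>Basis. cut_hess (z n) u g l b x))
    = (\<lambda>x. z n x * (of_real (coeff_a \<alpha> x) * weak_laplacian u x) + (\<Sum>b\<in>Basis. R n b x))" for n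
  proof
   fix x :: "real^'n"
   have "of_real (coeff_a \<alpha> x) * cut_hess (z n) u g l b x
     = z n x * (of_real (coeff_a \<alpha> x) * l b x) + R n b x" if b: "b \<in> Basis" for b
   proof (cases "x = 0")
    \<comment> \<open>At the origin the powers of the norm do not cancel, but the cutoff and its
      derivatives vanish there.\<close>
    case True
    have 0: "f 0 = 0" if "f \<in> test_functions (- {0})" for f :: "real^'n \<Rightarrow> complex"
     by (rule test_vanishes_near_0[OF that]) simp
    show ?thesis using 0[OF z, of n] 0[OF test_partial[OF z b], of n] 0[OF test_partial[OF test_partial[OF z b] b], of n]
     unfolding R_def True by simp
   next
    case False
    have 1: "complex_of_real (norm x) * of_real (norm x powr -1) = 1"
     unfolding of_real_mult[symmetric] using False by (simp add: powr_minus_divide)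
    have 2: "complex_of_real ((norm x)^2) * of_real (norm x powr -2) = 1"
     unfolding of_real_mult[symmetric] using False by (simp add: powr_minus_divide)
    have "R n b x = 2 * (complex_of_real (norm x) * of_real (norm x powr -1)) * (partial b (z n) x * (of_real (coeff_a \<alpha> x) * g b x))
      + (complex_of_real ((norm x)^2) * of_real (norm x powr -2)) * (partial b (partial b (z n)) x * (of_real (coeff_a \<alpha> x) * u x))"
     unfolding R_def of_real_mult by (simp only: mult_ac)
    then show ?thesis unfolding 1 2 by (simp add: algebra_simps)
   qed
   then show "of_real (coeff_a \<alpha> x) * (\<Sum>b\<in>Basis. cut_hess (z n) u g l b x)
    = z n x * (of_real (coeff_a \<alpha> x) * weak_laplacian u x) + (\<Sum>b\<in>Basis. R n b x)"
    unfolding we sum_distrib_left sum.distrib[symmetric] by (intro sum.cong refl)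
  qed
  have Rs: "l2of (\<lambda>x. \<Sum>b\<in>Basis. R n b x) = (\<Sum>b\<in>Basis. l2of (R n b))" "(\<lambda>x. \<Sum>b\<in>Basis. R n b x) \<in> L2" for n
   by (rule l2of_sum[OF RL] L2_sum[OF RL], assumption)+
  have "(\<lambda>n. l2of (\<lambda>x. z n x * (of_real (coeff_a \<alpha> x) * weak_laplacian u x)) + (\<Sum>b\<in>Basis. l2of (R n b)))
    \<longlonglongrightarrow> l2of (coeff_a \<alpha> \<odot> weak_laplacian u) + (\<Sum>b\<in>(Basis::(real^'n) set). 0)"
   by (intro tendsto_add tendsto_sum t0(1)[OF AL] Rl)
  then show "(\<lambda>n. l2of (\<lambda>x. of_real (coeff_a \<alpha> x) * (\<Sum>b\<in>Basis. cut_hess (z n) u g l b x))) \<longlonglongrightarrow> l2of (coeff_a \<alpha> \<odot> weak_laplacian u)"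
   unfolding e l2of_add[OF t0(2)[OF AL] Rs(2)] Rs(1) by simp
 qed
 ultimately have "embed \<alpha> \<beta> u g (weak_laplacian u) \<in> closure (test_embed \<alpha> \<beta> ` test_functions (- {0}))"
  using closed_sequentially[OF closed_closure] by blast
 then show ?thesis by (simp add: weak_embed_def g_def[abs_def])
qed

section \<open>From sectorial forms to semigroups\<close>

lemma bounded_bilinear_cinner: "bounded_bilinear (cinner :: 'a::complex_hilbert \<Rightarrow> 'a \<Rightarrow> complex)"
proof
 show "\<exists>K. \<forall>a b::'a. norm (cinner a b) \<le> norm a * norm b * K" by (rule exI[of _ 1]) (simp add: norm_cinner_le)
qed (simp_all add: cinner_add_left cinner_add_right cinner_scaleC_left cinner_scaleC_right scaleR_conv_of_real flip: scaleC_of_real)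

lemma bounded_bilinear_add:
 assumes f: "bounded_bilinear f" and g: "bounded_bilinear g"
 shows "bounded_bilinear (\<lambda>x y. f x y + g x y)"
proof -
 interpret f: bounded_bilinear f by fact
 interpret g: bounded_bilinear g by fact
 obtain K L where K: "\<And>x y. norm (f x y) \<le> norm x * norm y * K" and L: "\<And>x y. norm (g x y) \<le> norm x * norm y * L"
  using f.bounded g.bounded by blast
 show ?thesis
 proof
  have "norm (f x y + g x y) \<le> norm x * norm y * (K + L)" for x y
   using norm_triangle_mono[OF K L] by (simp add: distrib_left)
  then show "\<exists>K. \<forall>a b. norm (f a b + g a b) \<le> norm a * norm b * K" by blast
 qed (simp_all add: f.add_left f.add_right g.add_left g.add_right f.scaleR_left f.scaleR_right g.scaleR_left g.scaleR_right scaleR_add_right)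
qed

lemma bounded_bilinear_sum:
 assumes "\<And>i. i \<in> I \<Longrightarrow> bounded_bilinear (f i)"
 shows "bounded_bilinear (\<lambda>x y. \<Sum>i\<in>I. f i x y)"
proof -
 have z: "bounded_bilinear (\<lambda>x y. 0)" by standard (auto intro: exI[of _ 0])
 show ?thesis using assms
 proof (induction I rule: infinite_finite_induct)
  case (insert i I)
  have "bounded_bilinear (f i)" "bounded_bilinear (\<lambda>x y. \<Sum>i\<in>I. f i x y)" using insert by simp_all
  then show ?case using bounded_bilinear_add[of "f i"] insert(1,2) by simp
 qed (simp_all add: z)
qed

text \<open>\<open>W\<close> is the form domain, \<open>P\<close> its map into the Hilbert space and
  \<open>J\<close> complex scaling, passed separately because the type of \<open>W\<close> carries
  only a real structure. Coercivity bounds the real part of the form from below and boundedness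
  bounds the imaginary part, which together give a sector.\<close>

lemma form_sectorial:
 fixes B :: "'k::{real_inner,complete_space} \<Rightarrow> 'k \<Rightarrow> complex" and P :: "'k \<Rightarrow> 'h::complex_hilbert"
 assumes W: "closed W" "subspace W"
  and J: "\<And>a w. w \<in> W \<Longrightarrow> J a w \<in> W"
  and P: "bounded_linear P" "\<And>a w. P (J a w) = a *\<^sub>C P w" "closure (P ` W) = UNIV"
  and B: "bounded_bilinear B" "\<And>a v w. B (J a v) w = a * B v w" "\<And>a v w. B v (J a w) = cnj a * B v w"
  and c: "0 < c" "\<And>w. w \<in> W \<Longrightarrow> c * (norm w)^2 \<le> Re (B w w)"
 obtains \<tau> where "sectorial_operator {(P w, v) | w v. w \<in> W \<and> (\<forall>w'\<in>W. B w w' = cinner v (P w'))} \<tau>"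
proof -
 interpret P: bounded_linear P by fact
 interpret B: bounded_bilinear B by fact
 obtain M where M: "0 < M" "\<And>v w. cmod (B v w) \<le> norm v * norm w * M" using B.pos_bounded by blast
 \<comment> \<open>Small enough that the imaginary part of the form consumes at most half of the
   coercivity.\<close>
 define \<tau> where "\<tau> = c / (2 * M)"
 have tau: "0 < \<tau>" using c(1) M(1) by (simp add: \<tau>_def)
 have coer: "Re z * (c / 2) * (norm w)^2 \<le> Re (z * B w w)" if z: "z \<in> cone \<tau>" and w: "w \<in> W" for z w
 proof -
  have Rz: "0 < Re z" by (rule cone_Re_pos[OF tau z])
  have "\<bar>Im z * Im (B w w)\<bar> \<le> (\<tau> * Re z) * ((norm w)^2 * M)"
   unfolding abs_mult using z abs_Im_le_cmod[of "B w w"] M(2)[of w w]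
   by (intro mult_mono) (auto simp: cone_def power2_eq_square)
  also have "\<dots> = Re z * (c / 2) * (norm w)^2" using M(1) by (simp add: \<tau>_def)
  finally have 1: "Im z * Im (B w w) \<le> Re z * (c / 2) * (norm w)^2" by linarith
  have "Re z * (c * (norm w)^2) \<le> Re z * Re (B w w)" using c(2)[OF w] Rz by (intro mult_left_mono) auto
  with 1 show ?thesis by simp
 qed
 have PJ: "inner x (P (J \<i> w)) = inner x (\<i> *\<^sub>C P w)" for x w by (simp add: P(2))
 have "sectorial_operator {(P w, v) | w v. w \<in> W \<and> (\<forall>w'\<in>W. B w w' = cinner v (P w'))} \<tau>" (is "sectorial_operator ?A \<tau>")
 proof
  show "0 < \<tau>" by (rule tau)
  show "(u + u', v + v') \<in> ?A" if uv: "(u, v) \<in> ?A" and uv': "(u', v') \<in> ?A" for u v u' v'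
  proof -
   obtain w w' where w: "w \<in> W" "u = P w" "\<forall>x\<in>W. B w x = cinner v (P x)" and w': "w' \<in> W" "u' = P w'" "\<forall>x\<in>W. B w' x = cinner v' (P x)"
    using uv uv' by blast
   have "w + w' \<in> W \<and> u + u' = P (w + w') \<and> (\<forall>x\<in>W. B (w + w') x = cinner (v + v') (P x))"
    using w w' subspace_add[OF W(2)] by (simp add: P.add B.add_left cinner_add_left)
   then show ?thesis by blast
  qed
  show "(a *\<^sub>C u, a *\<^sub>C v) \<in> ?A" if uv: "(u, v) \<in> ?A" for u v a
  proof -
   obtain w where w: "w \<in> W" "u = P w" "\<forall>x\<in>W. B w x = cinner v (P x)" using uv by blast
   have "J a w \<in> W \<and> a *\<^sub>C u = P (J a w) \<and> (\<forall>x\<in>W. B (J a w) x = cinner (a *\<^sub>C v) (P x))"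
    using w J by (simp add: P(2) B(2) cinner_scaleC_left)
   then show ?thesis by blast
  qed
  show "v = 0" if v: "(0, v) \<in> ?A" for v
  proof -
   obtain w where w: "w \<in> W" "0 = P w" "\<And>x. x \<in> W \<Longrightarrow> B w x = cinner v (P x)" using v by blast
   have "B w w = 0" using w(3)[OF w(1)] by (simp add: w(2)[symmetric])
   then have "c * (norm w)^2 \<le> 0" using c(2)[OF w(1)] by simp
   then have w0: "w = 0" using c(1) by (simp add: mult_le_0_iff)
   have "inner v (P x) = 0" if x: "x \<in> W" for x
   proof -
    have "Re (cinner v (P x)) = 0" using w(3)[OF x] by (simp add: w0 B.zero_left flip: w(3)[OF x])
    then show ?thesis by (simp add: cinner_def)
   qed
   then have "P ` W \<subseteq> {y. inner v y = 0}" by auto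
   moreover have "closed {y. inner v y = 0}" by (intro closed_Collect_eq continuous_intros)
   ultimately have "closure (P ` W) \<subseteq> {y. inner v y = 0}" by (rule closure_minimal)
   then have "v \<in> {y. inner v y = 0}" using P(3) by blast
   then show ?thesis by simp
  qed
  show "0 \<le> inner (z *\<^sub>C v) u" if uv: "(u, v) \<in> ?A" and z: "z \<in> cone \<tau>" for u v z
  proof -
   obtain w where w: "w \<in> W" "u = P w" "\<forall>x\<in>W. B w x = cinner v (P x)" using uv by blast
   have "inner (z *\<^sub>C v) u = Re (cinner (z *\<^sub>C v) u)" by (simp add: cinner_def)
   also have "\<dots> = Re (z * B w w)" using w by (simp add: cinner_scaleC_left)
   finally have "inner (z *\<^sub>C v) u = Re (z * B w w)" .
   moreover have "0 \<le> Re z * (c / 2) * (norm w)^2" using cone_Re_pos[OF tau z] c(1) by simp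
   ultimately show ?thesis using coer[OF z w(1)] by linarith
  qed
  show "\<exists>u v. (u, v) \<in> ?A \<and> u + z *\<^sub>C v = f" if z: "z \<in> cone \<tau>" for z f
  proof -
   have z0: "z \<noteq> 0" by (rule cone_nonzero[OF tau z])
   \<comment> \<open>The real part of the weak formulation of \<open>u + z A u = f\<close>, to which
     the real Lax-Milgram lemma applies; the imaginary part is recovered by testing with
     \<open>J i x\<close>.\<close>
   define b where "b v w = Re (z * B v w) + inner (P v) (P w)" for v w
   have b1: "bounded_bilinear (\<lambda>v w. Re (z * B v w))"
   proof
    show "\<exists>K. \<forall>v w. norm (Re (z * B v w)) \<le> norm v * norm w * K"
    proof (intro exI allI)
     fix v w
     have "norm (Re (z * B v w)) \<le> cmod (z * B v w)" unfolding real_norm_def by (rule abs_Re_le_cmod)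
     also have "\<dots> \<le> cmod z * (norm v * norm w * M)" unfolding norm_mult by (intro mult_left_mono M(2)) simp
     finally show "norm (Re (z * B v w)) \<le> norm v * norm w * (cmod z * M)" by (simp add: mult_ac)
    qed
   qed (simp_all add: B.add_left B.add_right B.scaleR_left B.scaleR_right algebra_simps)
   have bb: "bounded_bilinear b"
    unfolding b_def by (intro bounded_bilinear_add b1 bounded_bilinear.comp[OF bounded_bilinear_inner P(1) P(1)])
   have F: "bounded_linear (\<lambda>x. inner f (P x))"
    by (rule bounded_linear_compose[OF bounded_linear_inner_right P(1)])
   have c': "0 < Re z * (c / 2)" using cone_Re_pos[OF tau z] c(1) by simp
   have co: "Re z * (c / 2) * (norm w)^2 \<le> b w w" if "w \<in> W" for w
    using coer[OF z that] by (simp add: b_def add_increasing2)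
   have "\<exists>w\<in>W. \<forall>x\<in>W. b w x = inner f (P x)"
   proof (rule lax_milgram[OF W bb F c'])
    show "Re z * (c / 2) * (norm w)^2 \<le> b w w" if "w \<in> W" for w by (rule co[OF that])
    show "\<exists>w\<in>W. \<forall>x\<in>W. b w x = inner f (P x)" if "w \<in> W" "\<And>x. x \<in> W \<Longrightarrow> b w x = inner f (P x)" for w
     using that by blast
   qed
   then obtain w where w: "w \<in> W" "\<And>x. x \<in> W \<Longrightarrow> b w x = inner f (P x)" by auto
   have Rez: "Re (z * B w x) = inner (f - P w) (P x)" if "x \<in> W" for x
    using w(2)[OF that] by (simp add: b_def inner_diff_left)
   have "B w x = cinner ((1 / z) *\<^sub>C (f - P w)) (P x)" if x: "x \<in> W" for x
   proof -
    have "Im (z * B w x) = Re (z * B w (J \<i> x))" by (simp add: B(3) algebra_simps)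
    also have "\<dots> = inner (f - P w) (\<i> *\<^sub>C P x)" unfolding Rez[OF J[OF x]] PJ ..
    finally have "z * B w x = cinner (f - P w) (P x)"
     unfolding cinner_def using Rez[OF x] by (simp add: complex_eq_iff)
    then show ?thesis using z0 by (simp add: cinner_scaleC_left field_simps)
   qed
   then have "(P w, (1 / z) *\<^sub>C (f - P w)) \<in> ?A" using w(1) by blast
   moreover have "P w + z *\<^sub>C ((1 / z) *\<^sub>C (f - P w)) = f" using z0 by simp
   ultimately show ?thesis by blast
  qed
 qed
 then show ?thesis using that by blast
qed

text \<open>Transfer from classes to functions: an operator on classes acts on functions through
  chosen representatives, so its laws hold almost everywhere. The sign occurs because
  \<open>A\<close> is accretive and the semigroup is generated by its negative.\<close>

lemma sectorial_generates:
 fixes G :: "(('a::euclidean_space \<Rightarrow> complex) \<times> ('a \<Rightarrow> complex)) set"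
 assumes A: "sectorial_operator A \<tau>"
  and G: "\<And>u v. (u, v) \<in> G \<longleftrightarrow> u \<in> L2 \<and> v \<in> L2 \<and> (l2of u, - l2of v) \<in> A"
 shows "generates_analytic_contraction_semigroup G"
proof -
 interpret sectorial_operator A \<tau> by fact
 define X where "X B f = rep_l2 (B (l2of f))" for B :: "'a l2 \<Rightarrow> 'a l2" and f
 have XL: "X B f \<in> L2" and lX: "l2of (X B f) = B (l2of f)" for B f by (simp_all add: X_def)
 have X_op: "bounded_op (X B)"
  if add: "\<And>f g. B (f + g) = B f + B g" and sc: "\<And>a f. B (a *\<^sub>C f) = a *\<^sub>C B f" and nb: "\<And>f. norm (B f) \<le> K * norm f" for B K
  unfolding bounded_op_def
 proof (intro conjI ballI allI exI[of _ K])
  fix f g :: "'a \<Rightarrow> complex" and a assume f: "f \<in> L2" and g: "g \<in> L2"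
  show "ae_eq (X B (\<lambda>x. a * f x + g x)) (\<lambda>x. a * X B f x + X B g x)"
   by (subst l2of_eq_iff[symmetric]) (simp_all add: XL lX l2of_add l2of_scaleC f g add sc)
 next
  fix f :: "'a \<Rightarrow> complex" assume f: "f \<in> L2"
  show "l2norm (X B f) \<le> K * l2norm f"
   using nb[of "l2of f"] by (simp add: norm_l2of[OF f] norm_l2of[OF XL] flip: lX)
 qed (rule XL)
 have S_op: "bounded_op (X (S z))" if "z \<in> C" for z
  by (rule X_op[where K = 1]) (simp_all add: S_add[OF that] S_scaleC[OF that] S_norm[OF that])
 have zero: "ae_eq (X (S 0) f) f" if "f \<in> L2" for f using rep_l2of[OF that] by (simp add: X_def)
 have semi: "ae_eq (X (S (z + w)) f) (X (S z) (X (S w) f))" if "z \<in> C" "w \<in> C" for z w f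
  by (subst l2of_eq_iff[symmetric]) (simp_all add: XL lX S_semigroup[OF that])
 have diff_norm: "l2norm (\<lambda>x. X (S z) f x - f x) = norm (S z (l2of f) - l2of f)" if f: "f \<in> L2" for f z
  by (simp add: norm_l2of[symmetric] l2of_diff XL lX f)
 have cont: "((\<lambda>z. l2norm (\<lambda>x. X (S z) f x - f x)) \<longlongrightarrow> 0) (at 0 within cone \<tau>)" if f: "f \<in> L2" for f
  unfolding diff_norm[OF f] using S_continuous_0 by (intro tendsto_norm_zero) (simp add: LIM_zero)
 define T where "T t = X (S (complex_of_real t))" for t
 have C0: "C0_semigroup T" unfolding C0_semigroup_def T_def
 proof (intro conjI allI impI ballI)
  show "bounded_op (X (S (complex_of_real t)))" if "0 \<le> t" for t by (rule S_op[OF of_real_C[OF that]])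
  show "ae_eq (X (S (complex_of_real 0)) f) f" if "f \<in> L2" for f using zero[OF that] by simp
  show "ae_eq (X (S (complex_of_real (s + t))) f) (X (S (complex_of_real s)) (X (S (complex_of_real t)) f))"
   if "0 \<le> s" "0 \<le> t" "f \<in> L2" for s t f using semi[OF of_real_C[OF that(1)] of_real_C[OF that(2)]] by simp
  show "((\<lambda>t. l2norm (\<lambda>x. X (S (complex_of_real t)) f x - f x)) \<longlongrightarrow> 0) (at_right 0)" if "f \<in> L2" for f
   by (rule tendsto_at_right_cone[OF cont[OF that]])
 qed
 have "generator T = G"
 proof -
  have key: "((\<lambda>t. l2norm (\<lambda>x. (T t u x - u x) / of_real t - v x)) \<longlongrightarrow> 0) (at_right 0) \<longleftrightarrow> (l2of u, l2of v) \<in> gen"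
   if u: "u \<in> L2" and v: "v \<in> L2" for u v
  proof -
   have "l2norm (\<lambda>x. (T t u x - u x) / of_real t - v x) = norm ((1 / t) *\<^sub>R (S (of_real t) (l2of u) - l2of u) - l2of v)" for t
   proof -
    have d: "(\<lambda>x. T t u x - u x) \<in> L2" by (simp add: T_def XL u)
    have e: "(\<lambda>x. (T t u x - u x) / of_real t - v x) = (\<lambda>x. of_real (1 / t) * (T t u x - u x) - v x)" by simp
    have "l2of (\<lambda>x. (T t u x - u x) / of_real t - v x) = of_real (1 / t) *\<^sub>C l2of (\<lambda>x. T t u x - u x) - l2of v"
     unfolding e by (simp only: l2of_diff[OF L2_cmult[OF d] v] l2of_scaleC[OF d])
    also have "l2of (\<lambda>x. T t u x - u x) = S (of_real t) (l2of u) - l2of u"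
     by (simp add: T_def l2of_diff XL lX u)
    finally have "l2of (\<lambda>x. (T t u x - u x) / of_real t - v x) = (1 / t) *\<^sub>R (S (of_real t) (l2of u) - l2of u) - l2of v"
     by (simp only: scaleC_of_real)
    moreover have "(\<lambda>x. (T t u x - u x) / of_real t - v x) \<in> L2" unfolding e by (intro L2_diff L2_cmult d v)
    ultimately show ?thesis by (simp add: norm_l2of[symmetric])
   qed
   then show ?thesis by (simp add: gen_def tendsto_norm_zero_iff LIM_zero_iff)
  qed
  have "(U, V) \<in> gen \<longleftrightarrow> (U, - V) \<in> A" for U V using A_imp_gen[of U "- V"] gen_imp_A[of U V] by auto
  then show ?thesis unfolding generator_def set_eq_iff using key by (auto simp: G)
 qed
 moreover have "\<forall>t\<ge>0. \<forall>f\<in>L2. l2norm (T t f) \<le> l2norm f"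
 proof (intro allI impI ballI)
  fix t :: real and f :: "'a \<Rightarrow> complex" assume "0 \<le> t" and f: "f \<in> L2"
  then show "l2norm (T t f) \<le> l2norm f"
   using S_norm[OF of_real_C, of t "l2of f"] by (simp add: T_def norm_l2of[OF f] norm_l2of[OF XL] flip: lX)
 qed
 moreover have "analytic_semigroup (arctan \<tau>) (\<lambda>z. X (S z))"
  unfolding analytic_semigroup_def sector_eq_cone[OF tau_pos]
 proof (intro conjI ballI allI impI)
  show "0 < arctan \<tau>" using tau_pos by simp
  show "arctan \<tau> \<le> pi / 2" using arctan_ubound[of \<tau>] by simp
  show "bounded_op (X (S z))" if "z \<in> C" for z by (rule S_op[OF that])
  show "ae_eq (X (S 0) f) f" if "f \<in> L2" for f by (rule zero[OF that])
  show "ae_eq (X (S (z + w)) f) (X (S z) (X (S w) f))" if "z \<in> C" "w \<in> C" for z w f by (rule semi[OF that])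
  show "\<exists>B. bounded_op B \<and> (\<forall>\<epsilon>>0. \<exists>r>0. \<forall>w\<in>cone \<tau>. cmod (w - z) < r \<longrightarrow>
      (\<forall>f\<in>L2. l2norm (\<lambda>x. X (S w) f x - X (S z) f x - (w - z) * B f x) \<le> \<epsilon> * cmod (w - z) * l2norm f))"
   if z: "z \<in> cone \<tau>" for z
  proof -
   obtain B c r where r: "0 < r" and c: "0 \<le> c" and add: "\<And>f g. B (f + g) = B f + B g" and sc: "\<And>a f. B (a *\<^sub>C f) = a *\<^sub>C B f"
    and nb: "\<And>f. norm (B f) \<le> c * norm f"
    and est: "\<And>w f. cmod (w - z) < r \<Longrightarrow> w \<in> cone \<tau> \<and> norm (S w f - S z f - (w - z) *\<^sub>C B f) \<le> c * (cmod (w - z))^2 * norm f"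
    by (rule S_differentiable[OF z]) blast
   have "\<exists>r>0. \<forall>w\<in>cone \<tau>. cmod (w - z) < r \<longrightarrow>
      (\<forall>f\<in>L2. l2norm (\<lambda>x. X (S w) f x - X (S z) f x - (w - z) * X B f x) \<le> \<epsilon> * cmod (w - z) * l2norm f)"
    if e: "0 < \<epsilon>" for \<epsilon>
   proof (intro exI[of _ "min r (\<epsilon> / (c + 1))"] conjI ballI impI)
    show "0 < min r (\<epsilon> / (c + 1))" using r e c by simp
    fix w and f :: "'a \<Rightarrow> complex" assume w: "cmod (w - z) < min r (\<epsilon> / (c + 1))" and f: "f \<in> L2"
    have "cmod (w - z) * (c + 1) \<le> \<epsilon>" using w c by (simp add: pos_less_divide_eq)
    moreover have "c * cmod (w - z) \<le> cmod (w - z) * (c + 1)" by (simp add: algebra_simps)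
    ultimately have cw: "c * cmod (w - z) \<le> \<epsilon>" by linarith
    have "l2norm (\<lambda>x. X (S w) f x - X (S z) f x - (w - z) * X B f x) = norm (S w (l2of f) - S z (l2of f) - (w - z) *\<^sub>C B (l2of f))"
     by (simp add: norm_l2of[symmetric] l2of_diff l2of_scaleC XL lX)
    also have "\<dots> \<le> c * (cmod (w - z))^2 * norm (l2of f)" using est[of w "l2of f"] w by simp
    also have "\<dots> = (c * cmod (w - z)) * (cmod (w - z) * l2norm f)" by (simp add: power2_eq_square norm_l2of[OF f])
    also have "\<dots> \<le> \<epsilon> * (cmod (w - z) * l2norm f)" by (intro mult_right_mono cw) simp
    finally show "l2norm (\<lambda>x. X (S w) f x - X (S z) f x - (w - z) * X B f x) \<le> \<epsilon> * cmod (w - z) * l2norm f"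
     by (simp only: mult.assoc)
   qed
   then show ?thesis using X_op[OF add sc nb] by blast
  qed
  show "((\<lambda>z. l2norm (\<lambda>x. X (S z) f x - f x)) \<longlongrightarrow> 0) (at 0 within sector \<delta>')"
   if "0 < \<delta>' \<and> \<delta>' < arctan \<tau>" "f \<in> L2" for \<delta>' f
  proof (rule tendsto_within_subset[OF cont[OF that(2)]])
   show "sector \<delta>' \<subseteq> cone \<tau>" using that(1) unfolding sector_eq_cone[OF tau_pos, symmetric] by (auto simp: sector_def)
  qed
 qed
 moreover have "\<forall>t\<ge>0. \<forall>f\<in>L2. ae_eq (X (S (of_real t)) f) (T t f)" by (simp add: T_def ae_eq_def)
 ultimately show ?thesis unfolding generates_analytic_contraction_semigroup_def using C0 by blast
qed

section \<open>The operator associated with the form\<close>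

instance l2 :: (euclidean_space) banach ..

text \<open>The form is to be defined on all tuples, also on those that do not come from a function,
  so multipliers have to act on classes.\<close>

definition l2_mult :: "('a::euclidean_space \<Rightarrow> real) \<Rightarrow> 'a l2 \<Rightarrow> 'a l2" where
 "l2_mult m x = l2of (\<lambda>y. of_real (m y) * rep_l2 x y)"

lemma l2_mult:
 fixes m :: "'a::euclidean_space \<Rightarrow> real"
 assumes m: "m \<in> borel_measurable borel" "\<And>x. \<bar>m x\<bar> \<le> C"
 shows l2_mult_l2of: "f \<in> L2 \<Longrightarrow> l2_mult m (l2of f) = l2of (\<lambda>y. of_real (m y) * f y)"
  and l2_mult_scaleC: "l2_mult m (c *\<^sub>C x) = c *\<^sub>C l2_mult m x"
  and l2_mult_bounded_linear: "bounded_linear (l2_mult m)"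
proof -
 note L = multiplier_L2[OF m]
 show of: "l2_mult m (l2of f) = l2of (\<lambda>y. of_real (m y) * f y)" if f: "f \<in> L2" for f
  unfolding l2_mult_def using rep_l2of[OF f] by (subst l2of_eq_iff) (auto simp: L(1) f ae_eq_def)
 have add: "l2_mult m (x + y) = l2_mult m x + l2_mult m y" for x y
  using of[OF L2_add[OF rep_l2_L2[of x] rep_l2_L2[of y]]]
  by (simp add: l2of_add l2_mult_def distrib_left L(1))
 show sc: "l2_mult m (c *\<^sub>C x) = c *\<^sub>C l2_mult m x" for c x
  using of[OF L2_cmult[OF rep_l2_L2[of x], of c]] l2of_scaleC[OF L(1)[OF rep_l2_L2[of x]], of c]
  by (simp add: l2of_scaleC l2_mult_def mult.left_commute)
 show "bounded_linear (l2_mult m)"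
 proof (rule bounded_linear_intro[OF add])
  show "l2_mult m (r *\<^sub>R x) = r *\<^sub>R l2_mult m x" for r x using sc[of "of_real r" x] by (simp only: scaleC_of_real)
  show "norm (l2_mult m x) \<le> norm x * C" for x
  proof -
   have "norm (l2_mult m x) = l2norm (\<lambda>y. of_real (m y) * rep_l2 x y)"
    unfolding l2_mult_def by (rule norm_l2of[OF L(1)[OF rep_l2_L2]])
   moreover have "norm x = l2norm (rep_l2 x)" using norm_l2of[OF rep_l2_L2[of x]] by simp
   ultimately show ?thesis using L(2)[OF rep_l2_L2[of x]] by (simp only: mult.commute[of _ C])
  qed
 qed
qed

lemma axis_Basis: "axis i 1 \<in> (Basis :: (real ^ 'n::finite) set)" by (simp add: axis_in_Basis_iff)

lemma sum_Basis_axis: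
 fixes f :: "real ^ 'n::finite \<Rightarrow> 'b::comm_monoid_add"
 shows "(\<Sum>b\<in>Basis. f b) = (\<Sum>i\<in>UNIV. f (axis i 1))"
proof -
 have B: "Basis = range (\<lambda>i::'n. axis i (1::real))" by (auto simp: Basis_vec_def)
 have "inj (\<lambda>i::'n. axis i (1::real))" by (auto simp: inj_on_def axis_eq_axis)
 then show ?thesis unfolding B by (subst sum.reindex) (simp_all add: o_def)
qed

text \<open>The product space is used with its real Hilbert structure, so complex scaling is
  supplied as a separate map.\<close>

definition space_scale :: "complex \<Rightarrow> 'n::finite form_space \<Rightarrow> 'n form_space" where
 "space_scale c k = (case k of (u, v, z, a, g) \<Rightarrow> (c *\<^sub>C u, c *\<^sub>C v, c *\<^sub>C z, c *\<^sub>C a, \<chi> i. c *\<^sub>C g $ i))"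

text \<open>The identity \<open>form_eq\<close> turned into a definition on tuples. It ignores the
  relations between the components, so it is bounded on the whole space, while coercivity is claimed
  only on the closure of the test functions.\<close>

definition space_form :: "real \<Rightarrow> real \<Rightarrow> 'n::finite form_space \<Rightarrow> 'n form_space \<Rightarrow> complex" where
 "space_form \<alpha> \<mu> k k' = (case k of (u, v, z, a, g) \<Rightarrow> case k' of (u', v', z', a', g') \<Rightarrow>
   cinner a a' + (\<Sum>i\<in>UNIV. cinner (l2_mult (grad_mult \<alpha> (axis i 1)) a) (g' $ i)) + cinner (l2_mult (zero_mult \<alpha>) a) z'
    + cinner v v' + of_real \<mu> * cinner u u')"

lemma space_form_scale:
 fixes k :: "'n::finite form_space"
 shows "space_form \<alpha> \<mu> (space_scale c k) k' = c * space_form \<alpha> \<mu> k k'"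
 "space_form \<alpha> \<mu> k (space_scale c k') = cnj c * space_form \<alpha> \<mu> k k'"
proof -
 obtain C where C: "\<And>x::real^'n. \<bar>zero_mult \<alpha> x\<bar> \<le> C" using zero_mult_bound by blast
 note m = l2_mult_scaleC[OF grad_mult_measurable grad_mult_bound[OF axis_Basis]] l2_mult_scaleC[OF zero_mult_measurable C]
 show "space_form \<alpha> \<mu> (space_scale c k) k' = c * space_form \<alpha> \<mu> k k'"
  "space_form \<alpha> \<mu> k (space_scale c k') = cnj c * space_form \<alpha> \<mu> k k'"
  by (auto simp: space_form_def space_scale_def m cinner_scaleC_left cinner_scaleC_right sum_distrib_left algebra_simps split: prod.splits)
qed

lemma space_form_bounded_bilinear: "bounded_bilinear (space_form \<alpha> \<mu> :: 'n::finite form_space \<Rightarrow> _)"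
proof -
 obtain C where C: "\<And>x::real^'n. \<bar>zero_mult \<alpha> x\<bar> \<le> C" using zero_mult_bound by blast
 note m = l2_mult_bounded_linear[OF grad_mult_measurable grad_mult_bound[OF axis_Basis]] l2_mult_bounded_linear[OF zero_mult_measurable C]
 let ?a = "\<lambda>k::'n form_space. fst (snd (snd (snd k)))" and ?g = "\<lambda>k::'n form_space. snd (snd (snd (snd k)))"
  and ?z = "\<lambda>k::'n form_space. fst (snd (snd k))" and ?v = "\<lambda>k::'n form_space. fst (snd k)"
 note fs = bounded_linear_fst_comp bounded_linear_snd_comp bounded_linear_ident
 have a: "bounded_linear ?a" and g: "bounded_linear ?g" and z: "bounded_linear ?z" and v: "bounded_linear ?v"
  and u: "bounded_linear (fst :: 'n form_space \<Rightarrow> _)" by (intro fs bounded_linear_fst)+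
 have gi: "bounded_linear (\<lambda>k. ?g k $ i)" for i by (rule bounded_linear_compose[OF bounded_linear_vec_nth g])
 have e: "space_form \<alpha> \<mu> = (\<lambda>k k'. cinner (?a k) (?a k') + (\<Sum>i\<in>UNIV. cinner (l2_mult (grad_mult \<alpha> (axis i 1)) (?a k)) (?g k' $ i))
   + cinner (l2_mult (zero_mult \<alpha>) (?a k)) (?z k') + cinner (?v k) (?v k') + cinner (\<mu> *\<^sub>R fst k) (fst k'))"
  by (intro ext) (auto simp: space_form_def cinner_scaleC_left split: prod.splits simp flip: scaleC_of_real)
 show ?thesis unfolding e
  by (intro bounded_bilinear_add bounded_bilinear_sum bounded_bilinear.comp[OF bounded_bilinear_cinner] a g z v u gi
    bounded_linear_compose[OF m(1) a] bounded_linear_compose[OF m(2) a] bounded_linear_compose[OF bounded_linear_scaleR_right u])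
qed

lemma norm_form_space:
 "(norm ((u, v, z, a, g) :: 'n::finite form_space))^2 = (norm u)^2 + (norm v)^2 + (norm z)^2 + (norm a)^2 + (\<Sum>i\<in>UNIV. (norm (g $ i))^2)"
 unfolding power2_norm_eq_inner by (simp add: inner_vec_def)

section \<open>The closed form and the associated operator on tuples\<close>

context
 fixes \<alpha> \<beta> :: real
begin

abbreviation "test0 \<equiv> test_functions (- {0 :: real ^ 'n::finite})"

lemma test_embed_L2:
 assumes u: "u \<in> test0"
 shows "(potential_V \<beta> \<odot> u) \<in> L2" "(npow \<gamma> \<odot> u) \<in> L2"
  "(coeff_a \<alpha> \<odot> laplacian u) \<in> L2"
  "(npow \<gamma> \<odot> partial (axis i 1) u) \<in> L2" unfolding potential_V_def
 by (rule test_L2[OF test_powr(1)[OF u]] test_L2[OF test_coeff[OF test_laplacian[OF u]]]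
   test_L2[OF test_powr(1)[OF test_partial[OF u axis_Basis]]])+

lemma test_embed_lincomb:
 fixes u v :: "real ^ 'n::finite \<Rightarrow> complex"
 assumes u: "u \<in> test0" and v: "v \<in> test0"
 shows "test_embed \<alpha> \<beta> (\<lambda>x. c * u x + v x) = space_scale c (test_embed \<alpha> \<beta> u) + test_embed \<alpha> \<beta> v"
proof -
 have p: "partial b (\<lambda>x. c * f x + g x) = (\<lambda>x. c * partial b f x + partial b g x)"
  if f: "f \<in> test0" and g: "g \<in> test0" for f g :: "real ^ 'n \<Rightarrow> complex" and b
 proof
  fix x
  have "partial b (\<lambda>x. c * f x) x = c * partial b f x"
   by (rule partial_bounded_linear[OF bounded_linear_mult_right test_differentiable[OF f]])
  then show "partial b (\<lambda>x. c * f x + g x) x = c * partial b f x + partial b g x"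
   using partial_add[OF test_differentiable[OF test_cmult[OF f]] test_differentiable[OF g], of b c x] by simp
 qed
 have l: "laplacian (\<lambda>x. c * u x + v x) = (\<lambda>x. c * laplacian u x + laplacian v x)"
  unfolding laplacian_eq by (simp add: p[OF u v] p[OF test_partial[OF u] test_partial[OF v]] sum.distrib sum_distrib_left)
 have w: "l2of (\<lambda>x. of_real (w x) * (c * f x + g x)) = c *\<^sub>C l2of (w \<odot> f) + l2of (w \<odot> g)"
  if f: "(w \<odot> f) \<in> L2" and g: "(w \<odot> g) \<in> L2" for w :: "real ^ 'n \<Rightarrow> real" and f g
  using l2of_add[OF L2_cmult[OF f, of c] g] by (simp add: l2of_scaleC[OF f] distrib_left mult.left_commute)
 have "l2of (\<lambda>x. c * u x + v x) = c *\<^sub>C l2of u + l2of v"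
  using l2of_add[OF L2_cmult[OF test_L2[OF u], of c] test_L2[OF v]] by (simp add: l2of_scaleC[OF test_L2[OF u]])
 then show ?thesis unfolding test_embed_def embed_def p[OF u v] l
  by (simp add: w test_embed_L2[OF u] test_embed_L2[OF v] space_scale_def vec_eq_iff)
qed

lemma test_embed_diff:
 fixes u v :: "real ^ 'n::finite \<Rightarrow> complex"
 assumes u: "u \<in> test0" and v: "v \<in> test0"
 shows "test_embed \<alpha> \<beta> (\<lambda>x. u x - v x) = test_embed \<alpha> \<beta> u - test_embed \<alpha> \<beta> v"
proof -
 have "space_scale (- 1) k = - k" for k :: "'n form_space"
  by (simp add: space_scale_def vec_eq_iff split: prod.splits)
 then show ?thesis using test_embed_lincomb[OF v u, of "- 1"] by simp
qed

lemma form_a_eq_space_form: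
 fixes u v :: "real ^ 'n::finite \<Rightarrow> complex"
 assumes u: "u \<in> test0" and v: "v \<in> test0"
 shows "form_a \<alpha> \<beta> \<mu> u v = space_form \<alpha> \<mu> (test_embed \<alpha> \<beta> u) (test_embed \<alpha> \<beta> v)"
proof -
 obtain C where C: "\<And>x::real^'n. \<bar>zero_mult \<alpha> x\<bar> \<le> C" using zero_mult_bound by blast
 note A = test_embed_L2(3)[OF u]
 note m = l2_mult_l2of[OF grad_mult_measurable grad_mult_bound[OF axis_Basis] A] l2_mult_l2of[OF zero_mult_measurable C A]
 note mL = multiplier_L2(1)[OF grad_mult_measurable grad_mult_bound[OF axis_Basis] A] multiplier_L2(1)[OF zero_mult_measurable C A]
 show ?thesis unfolding form_eq[OF u v] sum_Basis_axis
  by (simp add: space_form_def test_embed_def embed_def m cinner_l2of mL test_embed_L2[OF u] test_embed_L2[OF v] test_L2[OF u] test_L2[OF v])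
qed

lemma norm_test_embed:
 fixes u :: "real ^ 'n::finite \<Rightarrow> complex"
 assumes u: "u \<in> test0"
 shows "(norm (test_embed \<alpha> \<beta> u))^2 = (l2norm u)^2 + (l2norm (potential_V \<beta> \<odot> u))^2
    + (l2norm (npow (\<alpha> - 2) \<odot> u))^2
    + (l2norm (coeff_a \<alpha> \<odot> laplacian u))^2
    + (\<Sum>b\<in>Basis. (l2norm (npow (\<alpha> - 1) \<odot> partial b u))^2)"
 unfolding test_embed_def embed_def norm_form_space sum_Basis_axis
 by (simp add: norm_l2of test_embed_L2[OF u] test_L2[OF u])

text \<open>Coercivity turns Cauchy sequences for the form norm into Cauchy sequences of tuples; the
  first component of the limit is \<open>u\<close>, and this determines the rest.\<close>

lemma form_approx_limit:
 fixes s :: "nat \<Rightarrow> real ^ 'n::finite \<Rightarrow> complex"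
 assumes c: "0 < c" "\<And>u. u \<in> test0 \<Longrightarrow> c * (norm (test_embed \<alpha> \<beta> u :: 'n form_space))^2 \<le> Re (form_a \<alpha> \<beta> \<mu> u u)"
  and u: "u \<in> form_domain \<alpha> \<beta>"
  and s: "form_approx test0 (form_a \<alpha> \<beta> \<mu>) s u"
 shows "(\<lambda>n. test_embed \<alpha> \<beta> (s n)) \<longlonglongrightarrow> weak_embed \<alpha> \<beta> u"
proof -
 have sQ: "s n \<in> test0" for n using s by (simp add: form_approx_def)
 have uL: "u \<in> L2" using u by (auto simp: form_domain_def sobolev_H2_def sobolev_H1_def)
 have "Cauchy (\<lambda>n. test_embed \<alpha> \<beta> (s n))"
 proof (rule metric_CauchyI)
  fix e :: real assume e: "0 < e"
  then have "0 < c * e\<^sup>2" using c(1) by simp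
  then obtain M where M: "\<And>m n. M \<le> m \<Longrightarrow> M \<le> n \<Longrightarrow>
    Re (form_a \<alpha> \<beta> \<mu> (\<lambda>x. s m x - s n x) (\<lambda>x. s m x - s n x)) + (l2norm (\<lambda>x. s m x - s n x))^2 < c * e\<^sup>2"
   using s unfolding form_approx_def by blast
  have "dist (test_embed \<alpha> \<beta> (s m)) (test_embed \<alpha> \<beta> (s n)) < e" if mn: "M \<le> m" "M \<le> n" for m n
  proof -
   have "c * (norm (test_embed \<alpha> \<beta> (\<lambda>x. s m x - s n x)))^2 < c * e\<^sup>2"
    using c(2)[OF test_diff[OF sQ sQ], of m n] M[OF mn] zero_le_power2[of "l2norm (\<lambda>x. s m x - s n x)"] by linarith
   then have "(norm (test_embed \<alpha> \<beta> (\<lambda>x. s m x - s n x)))^2 < e\<^sup>2" using c(1) by simp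
   then have "norm (test_embed \<alpha> \<beta> (\<lambda>x. s m x - s n x)) < e" using e by (intro power2_less_imp_less[of _ e]) auto
   then show ?thesis by (simp add: dist_norm test_embed_diff[OF sQ sQ])
  qed
  then show "\<exists>M. \<forall>m\<ge>M. \<forall>n\<ge>M. dist (test_embed \<alpha> \<beta> (s m)) (test_embed \<alpha> \<beta> (s n)) < e" by blast
 qed
 then obtain k where k: "(\<lambda>n. test_embed \<alpha> \<beta> (s n)) \<longlonglongrightarrow> k" using Cauchy_convergent convergent_def by blast
 have "(\<lambda>n. l2of (s n)) \<longlonglongrightarrow> fst k" using tendsto_fst[OF k] by (simp add: test_embed_def embed_def)
 moreover have "(\<lambda>n. l2of (s n)) \<longlonglongrightarrow> l2of u"
  using s unfolding form_approx_def l2of_tendsto_iff[OF test_L2[OF sQ] uL] by blast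
 ultimately have "fst k = l2of u" by (rule LIMSEQ_unique)
 then show ?thesis using closure_imp_form_domain(2)[OF sQ k uL] k by simp
qed

text \<open>Density supplies tuples converging to that of \<open>u\<close>, and boundedness of the
  form makes them Cauchy for the form norm. Without such sequences the condition that defines the
  closed form would be vacuous and its value undetermined.\<close>

lemma form_approx_exists:
 fixes u :: "real ^ 'n::finite \<Rightarrow> complex"
 assumes N: "CARD('n) \<ge> 5" and u: "u \<in> form_domain \<alpha> \<beta>"
 obtains s where "form_approx test0 (form_a \<alpha> \<beta> \<mu>) s u"
proof -
 interpret B: bounded_bilinear "space_form \<alpha> \<mu> :: 'n form_space \<Rightarrow> _" by (rule space_form_bounded_bilinear)
 obtain M where M: "0 < M" "\<And>k k' :: 'n form_space. cmod (space_form \<alpha> \<mu> k k') \<le> norm k * norm k' * M" using B.pos_bounded by blast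
 have uL: "u \<in> L2" using u by (auto simp: form_domain_def sobolev_H2_def sobolev_H1_def)
 have "weak_embed \<alpha> \<beta> u \<in> closure (test_embed \<alpha> \<beta> ` test0)" by (rule form_domain_imp_closure[OF N u])
 then obtain k where k: "\<And>n. k n \<in> test_embed \<alpha> \<beta> ` test0" "k \<longlonglongrightarrow> weak_embed \<alpha> \<beta> u" by (auto simp: closure_sequential)
 have "\<forall>n. \<exists>s. s \<in> test0 \<and> k n = test_embed \<alpha> \<beta> s" using k(1) by blast
 then obtain s where s: "\<And>n. s n \<in> test0" "\<And>n. k n = test_embed \<alpha> \<beta> (s n)" by metis
 have "k = (\<lambda>n. test_embed \<alpha> \<beta> (s n))" using s(2) by (rule ext)
 then have lim: "(\<lambda>n. test_embed \<alpha> \<beta> (s n)) \<longlonglongrightarrow> weak_embed \<alpha> \<beta> u" using k(2) by simp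
 have "form_approx test0 (form_a \<alpha> \<beta> \<mu>) s u" unfolding form_approx_def
 proof (intro conjI allI impI)
  show "s n \<in> test0" for n by (rule s(1))
  have "(\<lambda>n. l2of (s n)) \<longlonglongrightarrow> l2of u" using tendsto_fst[OF lim] by (simp add: test_embed_def weak_embed_def embed_def)
  then show "(\<lambda>n. l2norm (\<lambda>x. s n x - u x)) \<longlonglongrightarrow> 0" unfolding l2of_tendsto_iff[OF test_L2[OF s(1)] uL] .
  fix e :: real assume e: "0 < e"
  \<comment> \<open>Solves \<open>(M + 1) d^2 = e\<close>: the form contributes \<open>M\<close>
    times the squared tuple norm, and the \<open>L2\<close> norm contributes once more.\<close>
  define d where "d = sqrt (e / (M + 1))"
  have d: "0 < d" "(M + 1) * d\<^sup>2 = e" using e M(1) by (auto simp: d_def)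
  obtain m0 where m0: "\<And>m n. m0 \<le> m \<Longrightarrow> m0 \<le> n \<Longrightarrow> dist (test_embed \<alpha> \<beta> (s m)) (test_embed \<alpha> \<beta> (s n)) < d"
   using metric_CauchyD[OF LIMSEQ_imp_Cauchy[OF lim] d(1)] by blast
  have "Re (form_a \<alpha> \<beta> \<mu> (\<lambda>x. s m x - s n x) (\<lambda>x. s m x - s n x)) + (l2norm (\<lambda>x. s m x - s n x))^2 < e"
   if mn: "m0 \<le> m" "m0 \<le> n" for m n
  proof -
   let ?w = "\<lambda>x. s m x - s n x" and ?t = "test_embed \<alpha> \<beta> (\<lambda>x. s m x - s n x)"
   have w: "?w \<in> test0" by (rule test_diff[OF s(1) s(1)])
   have n: "norm ?t < d" using m0[OF mn] by (simp add: dist_norm test_embed_diff[OF s(1) s(1)])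
   have "Re (form_a \<alpha> \<beta> \<mu> ?w ?w) \<le> norm ?t * norm ?t * M"
    unfolding form_a_eq_space_form[OF w w] using complex_Re_le_cmod M(2) by (rule order_trans)
   moreover have "l2norm ?w = norm (fst ?t)" by (simp add: test_embed_def embed_def norm_l2of test_L2[OF w])
   moreover have "norm (fst ?t) \<le> norm ?t" using norm_fst_le[of "fst ?t" "snd ?t"] by simp
   ultimately have "Re (form_a \<alpha> \<beta> \<mu> ?w ?w) + (l2norm ?w)^2 \<le> norm ?t * norm ?t * M + (norm ?t)^2"
    by (intro add_mono power_mono) auto
   also have "\<dots> = (M + 1) * (norm ?t)^2" by (simp add: power2_eq_square algebra_simps)
   also have "\<dots> < (M + 1) * d\<^sup>2" using n M(1) by (intro mult_strict_left_mono power_strict_mono) auto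
   finally show ?thesis unfolding d(2) .
  qed
  then show "\<exists>M. \<forall>m\<ge>M. \<forall>n\<ge>M. Re (form_a \<alpha> \<beta> \<mu> (\<lambda>x. s m x - s n x) (\<lambda>x. s m x - s n x)) + (l2norm (\<lambda>x. s m x - s n x))^2 < e"
   by blast
 qed
 then show ?thesis using that by blast
qed

text \<open>All approximating sequences give the same limit by continuity of the tuple form, and at
  least one pair of sequences exists, so the definite description is determined.\<close>

lemma closed_form_a_eq:
 fixes u h :: "real ^ 'n::finite \<Rightarrow> complex"
 assumes N: "CARD('n) \<ge> 5"
  and c: "0 < c" "\<And>u. u \<in> test0 \<Longrightarrow> c * (norm (test_embed \<alpha> \<beta> u :: 'n form_space))^2 \<le> Re (form_a \<alpha> \<beta> \<mu> u u)"
  and u: "u \<in> form_domain \<alpha> \<beta>" and h: "h \<in> form_domain \<alpha> \<beta>"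
 shows "closed_form_a \<alpha> \<beta> \<mu> u h = space_form \<alpha> \<mu> (weak_embed \<alpha> \<beta> u) (weak_embed \<alpha> \<beta> h)"
 unfolding closed_form_a_def form_closure_def
proof (rule the_equality)
 interpret B: bounded_bilinear "space_form \<alpha> \<mu> :: 'n form_space \<Rightarrow> _" by (rule space_form_bounded_bilinear)
 have lim: "(\<lambda>n. form_a \<alpha> \<beta> \<mu> (s n) (t n)) \<longlonglongrightarrow> space_form \<alpha> \<mu> (weak_embed \<alpha> \<beta> u) (weak_embed \<alpha> \<beta> h)"
  if s: "form_approx test0 (form_a \<alpha> \<beta> \<mu>) s u" and t: "form_approx test0 (form_a \<alpha> \<beta> \<mu>) t h" for s t
 proof -
  have "s n \<in> test0" "t n \<in> test0" for n using s t by (simp_all add: form_approx_def)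
  then show ?thesis
   using B.tendsto[OF form_approx_limit[OF c u s] form_approx_limit[OF c h t]] by (simp add: form_a_eq_space_form)
 qed
 then show "\<forall>s t. form_approx test0 (form_a \<alpha> \<beta> \<mu>) s u \<and> form_approx test0 (form_a \<alpha> \<beta> \<mu>) t h \<longrightarrow>
   (\<lambda>n. form_a \<alpha> \<beta> \<mu> (s n) (t n)) \<longlonglongrightarrow> space_form \<alpha> \<mu> (weak_embed \<alpha> \<beta> u) (weak_embed \<alpha> \<beta> h)" by blast
 fix l assume l: "\<forall>s t. form_approx test0 (form_a \<alpha> \<beta> \<mu>) s u \<and> form_approx test0 (form_a \<alpha> \<beta> \<mu>) t h \<longrightarrow>
   (\<lambda>n. form_a \<alpha> \<beta> \<mu> (s n) (t n)) \<longlonglongrightarrow> l"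
 obtain s where s: "form_approx test0 (form_a \<alpha> \<beta> \<mu>) s u" by (rule form_approx_exists[OF N u])
 obtain t where t: "form_approx test0 (form_a \<alpha> \<beta> \<mu>) t h" by (rule form_approx_exists[OF N h])
 have "(\<lambda>n. form_a \<alpha> \<beta> \<mu> (s n) (t n)) \<longlonglongrightarrow> l" using l s t by blast
 then show "l = space_form \<alpha> \<mu> (weak_embed \<alpha> \<beta> u) (weak_embed \<alpha> \<beta> h)" using lim[OF s t] by (rule LIMSEQ_unique)
qed

text \<open>Functions in the form domain and elements of \<open>W\<close> correspond through
  \<open>weak_embed\<close> and \<open>rep_l2 (fst w)\<close>, so testing against all
  \<open>h\<close> in the form domain is testing against all of \<open>W\<close>.\<close>

lemma op_A_iff:
 fixes u v :: "real ^ 'n::finite \<Rightarrow> complex"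
 assumes N: "CARD('n) \<ge> 5"
  and c: "0 < c" "\<And>u. u \<in> test0 \<Longrightarrow> c * (norm (test_embed \<alpha> \<beta> u :: 'n form_space))^2 \<le> Re (form_a \<alpha> \<beta> \<mu> u u)"
 defines "W \<equiv> closure (test_embed \<alpha> \<beta> ` test0) :: 'n form_space set"
 shows "(u, v) \<in> op_A \<alpha> \<beta> \<mu> \<longleftrightarrow> u \<in> L2 \<and> v \<in> L2 \<and>
  (l2of u, l2of v) \<in> {(fst w, f) | w f. w \<in> W \<and> (\<forall>w'\<in>W. space_form \<alpha> \<mu> w w' = cinner f (fst w'))}"
proof -
 have dom_L2: "u \<in> L2" if "u \<in> form_domain \<alpha> \<beta>" for u :: "real ^ 'n \<Rightarrow> complex"
  using that by (auto simp: form_domain_def sobolev_H2_def sobolev_H1_def)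
 have emb: "weak_embed \<alpha> \<beta> u \<in> W" if "u \<in> form_domain \<alpha> \<beta>" for u unfolding W_def by (rule form_domain_imp_closure[OF N that])
 have fst_emb: "fst (weak_embed \<alpha> \<beta> u) = l2of u" for u :: "real ^ 'n \<Rightarrow> complex" by (simp add: weak_embed_def embed_def)
 have dom: "u \<in> form_domain \<alpha> \<beta> \<and> weak_embed \<alpha> \<beta> u = w" if w: "w \<in> W" and u: "u \<in> L2" "fst w = l2of u" for u w
 proof -
  obtain k where k: "\<And>n. k n \<in> test_embed \<alpha> \<beta> ` test0" "k \<longlonglongrightarrow> w" using w by (auto simp: W_def closure_sequential)
  have "\<forall>n. \<exists>s. s \<in> test0 \<and> k n = test_embed \<alpha> \<beta> s" using k(1) by blast
  then obtain s where s: "\<And>n. s n \<in> test0" "\<And>n. k n = test_embed \<alpha> \<beta> (s n)" by metis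
  have "k = (\<lambda>n. test_embed \<alpha> \<beta> (s n))" using s(2) by (rule ext)
  then have lim: "(\<lambda>n. test_embed \<alpha> \<beta> (s n)) \<longlonglongrightarrow> w" using k(2) by simp
  show ?thesis using closure_imp_form_domain[where s = s, OF s(1) lim u] by blast
 qed
 have cf: "closed_form_a \<alpha> \<beta> \<mu> u h = l2inner v h \<longleftrightarrow> space_form \<alpha> \<mu> (weak_embed \<alpha> \<beta> u) (weak_embed \<alpha> \<beta> h) = cinner (l2of v) (l2of h)"
  if "u \<in> form_domain \<alpha> \<beta>" "v \<in> L2" "h \<in> form_domain \<alpha> \<beta>" for u v h :: "real ^ 'n \<Rightarrow> complex"
  by (simp add: closed_form_a_eq[OF N c that(1,3)] cinner_l2of that(2) dom_L2[OF that(3)])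
 show ?thesis
 proof
  assume "(u, v) \<in> op_A \<alpha> \<beta> \<mu>"
  then have u: "u \<in> form_domain \<alpha> \<beta>" and v: "v \<in> L2" and eq: "\<And>h. h \<in> form_domain \<alpha> \<beta> \<Longrightarrow> closed_form_a \<alpha> \<beta> \<mu> u h = l2inner v h"
   by (auto simp: op_A_def)
  have eq': "space_form \<alpha> \<mu> (weak_embed \<alpha> \<beta> u) w' = cinner (l2of v) (fst w')" if w': "w' \<in> W" for w'
  proof -
   have h: "rep_l2 (fst w') \<in> form_domain \<alpha> \<beta>" "weak_embed \<alpha> \<beta> (rep_l2 (fst w')) = w'" using dom[OF w', of "rep_l2 (fst w')"] by auto
   then show ?thesis using cf[OF u v h(1)] eq[OF h(1)] by simp
  qed
  have "(fst (weak_embed \<alpha> \<beta> u), l2of v) \<in> {(fst w, f) | w f. w \<in> W \<and> (\<forall>w'\<in>W. space_form \<alpha> \<mu> w w' = cinner f (fst w'))}"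
   by (intro CollectI exI[of _ "weak_embed \<alpha> \<beta> u"] exI[of _ "l2of v"] conjI refl emb[OF u] ballI eq')
  then show "u \<in> L2 \<and> v \<in> L2 \<and> (l2of u, l2of v) \<in> {(fst w, f) | w f. w \<in> W \<and> (\<forall>w'\<in>W. space_form \<alpha> \<mu> w w' = cinner f (fst w'))}"
   unfolding fst_emb using dom_L2[OF u] v by blast
 next
  assume r: "u \<in> L2 \<and> v \<in> L2 \<and> (l2of u, l2of v) \<in> {(fst w, f) | w f. w \<in> W \<and> (\<forall>w'\<in>W. space_form \<alpha> \<mu> w w' = cinner f (fst w'))}"
  then obtain w where w: "w \<in> W" "fst w = l2of u" "\<And>w'. w' \<in> W \<Longrightarrow> space_form \<alpha> \<mu> w w' = cinner (l2of v) (fst w')" by auto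
  have uL: "u \<in> L2" and v: "v \<in> L2" using r by auto
  have u: "u \<in> form_domain \<alpha> \<beta>" "weak_embed \<alpha> \<beta> u = w" using dom[OF w(1) uL w(2)] by auto
  have "closed_form_a \<alpha> \<beta> \<mu> u h = l2inner v h" if h: "h \<in> form_domain \<alpha> \<beta>" for h
   unfolding cf[OF u(1) v h] u(2) using w(3)[OF emb[OF h]] by (simp add: fst_emb)
  then show "(u, v) \<in> op_A \<alpha> \<beta> \<mu>" using u(1) v by (simp add: op_A_def)
 qed
qed

lemma neg_op_A_generates:
 assumes N: "CARD('n::finite) \<ge> 5"
  and c: "0 < c" "\<And>u. u \<in> test0 \<Longrightarrow> c * (norm (test_embed \<alpha> \<beta> u :: 'n form_space))^2 \<le> Re (form_a \<alpha> \<beta> \<mu> u u)"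
 shows "generates_analytic_contraction_semigroup
      (neg_op (op_A \<alpha> \<beta> \<mu> :: ((real ^ 'n \<Rightarrow> complex) \<times> (real ^ 'n \<Rightarrow> complex)) set))"
proof -
 interpret B: bounded_bilinear "space_form \<alpha> \<mu> :: 'n form_space \<Rightarrow> _" by (rule space_form_bounded_bilinear)
 define W where "W = (closure (test_embed \<alpha> \<beta> ` test0) :: 'n form_space set)"
 have T0: "test_embed \<alpha> \<beta> (\<lambda>x::real^'n. 0) = 0" using test_embed_diff[OF test_zero test_zero] by simp
 have scR: "space_scale (of_real r) k = r *\<^sub>R k" for r and k :: "'n form_space"
  by (simp add: space_scale_def scaleC_of_real vec_eq_iff split: prod.splits)
 have sc: "space_scale a (test_embed \<alpha> \<beta> u) = test_embed \<alpha> \<beta> (\<lambda>x. a * u x)" if "u \<in> test0" for a and u :: "real^'n \<Rightarrow> complex"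
  using test_embed_lincomb[OF that test_zero, of a] by (simp add: T0)
 have "subspace (test_embed \<alpha> \<beta> ` test0 :: 'n form_space set)"
 proof (rule subspaceI)
  show "(0 :: 'n form_space) \<in> test_embed \<alpha> \<beta> ` test0" unfolding T0[symmetric] by (rule imageI[OF test_zero])
  show "x + y \<in> test_embed \<alpha> \<beta> ` test0" if xy: "x \<in> test_embed \<alpha> \<beta> ` test0" "y \<in> test_embed \<alpha> \<beta> ` test0" for x y :: "'n form_space"
  proof -
   obtain u v where uv: "u \<in> test0" "x = test_embed \<alpha> \<beta> u" "v \<in> test0" "y = test_embed \<alpha> \<beta> v" using xy by blast
   have "x + y = test_embed \<alpha> \<beta> (\<lambda>x. 1 * u x + v x)"
    using test_embed_lincomb[OF uv(1,3), of 1] scR[of 1] by (simp add: uv(2,4))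
   then show ?thesis using test_add[OF test_cmult[OF uv(1), of 1] uv(3)] by blast
  qed
  show "r *\<^sub>R x \<in> test_embed \<alpha> \<beta> ` test0" if x: "x \<in> test_embed \<alpha> \<beta> ` test0" for r and x :: "'n form_space"
  proof -
   obtain u where u: "u \<in> test0" "x = test_embed \<alpha> \<beta> u" using x by blast
   show ?thesis unfolding u(2) scR[symmetric] sc[OF u(1)] using test_cmult[OF u(1)] by blast
  qed
 qed
 then have sub: "subspace W" unfolding W_def by (rule subspace_closure)
 \<comment> \<open>Complex scaling is continuous and preserves tuples of test functions, hence also
   their closure.\<close>
 have J: "space_scale a w \<in> W" if w: "w \<in> W" for a w
 proof -
  obtain k where k: "\<And>n. k n \<in> test_embed \<alpha> \<beta> ` test0" "k \<longlonglongrightarrow> w" using w by (auto simp: W_def closure_sequential)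
  have e: "space_scale a k = (a *\<^sub>C fst k, a *\<^sub>C fst (snd k), a *\<^sub>C fst (snd (snd k)), a *\<^sub>C fst (snd (snd (snd k))), \<chi> i. a *\<^sub>C snd (snd (snd (snd k))) $ i)" for k :: "'n form_space"
   by (simp add: space_scale_def split: prod.splits)
  have "(\<lambda>n. space_scale a (k n)) \<longlonglongrightarrow> space_scale a w"
   unfolding e by (intro tendsto_Pair vec_tendstoI; (simp only: vec_lambda_beta)?; intro tendsto_scaleC tendsto_const tendsto_fst tendsto_snd tendsto_vec_nth k(2))
  moreover have "space_scale a (k n) \<in> test_embed \<alpha> \<beta> ` test0" for n
  proof -
   obtain u where u: "u \<in> test0" "k n = test_embed \<alpha> \<beta> u" using k(1)[of n] by blast
   show ?thesis unfolding u(2) sc[OF u(1)] using test_cmult[OF u(1)] by blast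
  qed
  ultimately show ?thesis unfolding W_def closure_sequential by (intro exI[of _ "\<lambda>n. space_scale a (k n)"] conjI) auto
 qed
 have Pd: "closure (fst ` W) = UNIV"
 proof -
  have "l2of ` test_functions (- {0}) \<subseteq> fst ` W"
  proof
   fix f :: "(real ^ 'n) l2" assume "f \<in> l2of ` test_functions (- {0})"
   then obtain u where u: "u \<in> test0" "f = l2of u" by blast
   have "test_embed \<alpha> \<beta> u \<in> W" unfolding W_def by (rule subsetD[OF closure_subset imageI[OF u(1)]])
   then have "fst (test_embed \<alpha> \<beta> u) \<in> fst ` W" by (rule imageI)
   then show "f \<in> fst ` W" by (simp add: test_embed_def embed_def u(2))
  qed
  from closure_mono[OF this] show ?thesis unfolding test_dense by auto
 qed
 have Ps: "fst (space_scale a w) = a *\<^sub>C fst w" for a and w :: "'n form_space"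
  by (simp add: space_scale_def split: prod.splits)
 \<comment> \<open>The inequality describes a closed set of tuples, so it passes from test functions
   to their closure.\<close>
 have coer: "c * (norm w)^2 \<le> Re (space_form \<alpha> \<mu> w w)" if w: "w \<in> W" for w
 proof -
  have cont: "continuous_on UNIV (\<lambda>w. Re (space_form \<alpha> \<mu> w (w :: 'n form_space)))"
   by (intro continuous_on_Re B.continuous_on[OF continuous_on_id continuous_on_id])
  have "closed {w :: 'n form_space. c * (norm w)^2 \<le> Re (space_form \<alpha> \<mu> w w)}"
   by (rule closed_Collect_le[OF _ cont]) (intro continuous_intros)
  moreover have "test_embed \<alpha> \<beta> ` test0 \<subseteq> {w :: 'n form_space. c * (norm w)^2 \<le> Re (space_form \<alpha> \<mu> w w)}"
   using c(2) by (auto simp: form_a_eq_space_form)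
  ultimately have "W \<subseteq> {w. c * (norm w)^2 \<le> Re (space_form \<alpha> \<mu> w w)}" unfolding W_def by (intro closure_minimal)
  then show ?thesis using w by blast
 qed
 have clW: "closed W" by (simp add: W_def)
 have "\<exists>\<tau>. sectorial_operator {(fst w, v) | w v. w \<in> W \<and> (\<forall>w'\<in>W. space_form \<alpha> \<mu> w w' = cinner v (fst w'))} \<tau>"
  by (rule form_sectorial[OF clW sub J bounded_linear_fst Ps Pd space_form_bounded_bilinear space_form_scale c(1) coer])
   (assumption | erule exI)+
 then obtain \<tau> where "sectorial_operator {(fst w, v) | w v. w \<in> W \<and> (\<forall>w'\<in>W. space_form \<alpha> \<mu> w w' = cinner v (fst w'))} \<tau>" ..
 then show ?thesis
 proof (rule sectorial_generates)
  fix u v :: "real ^ 'n \<Rightarrow> complex"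
  have 1: "(u, v) \<in> neg_op (op_A \<alpha> \<beta> \<mu>) \<longleftrightarrow> (u, \<lambda>x. - v x) \<in> op_A \<alpha> \<beta> \<mu>"
  proof
   assume a: "(u, \<lambda>x. - v x) \<in> op_A \<alpha> \<beta> \<mu>"
   have "(u, \<lambda>x. - (- v x)) \<in> neg_op (op_A \<alpha> \<beta> \<mu>)"
    unfolding neg_op_def by (rule CollectI, rule exI[of _ u], rule exI[of _ "\<lambda>x. - v x"], rule conjI[OF refl a])
   then show "(u, v) \<in> neg_op (op_A \<alpha> \<beta> \<mu>)" by simp
  qed (auto simp: neg_op_def)
  have m: "(\<lambda>x. - v x) \<in> L2 \<longleftrightarrow> v \<in> L2" using L2_uminus[of v] L2_uminus[of "\<lambda>x. - v x"] by auto
  have 2: "(u, \<lambda>x. - v x) \<in> op_A \<alpha> \<beta> \<mu> \<longleftrightarrow> u \<in> L2 \<and> (\<lambda>x. - v x) \<in> L2 \<and> (l2of u, l2of (\<lambda>x. - v x))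
    \<in> {(fst w, v) | w v. w \<in> W \<and> (\<forall>w'\<in>W. space_form \<alpha> \<mu> w w' = cinner v (fst w'))}"
   unfolding W_def by (rule op_A_iff[OF N c])
  show "(u, v) \<in> neg_op (op_A \<alpha> \<beta> \<mu>) \<longleftrightarrow> u \<in> L2 \<and> v \<in> L2 \<and> (l2of u, - l2of v)
    \<in> {(fst w, v) | w v. w \<in> W \<and> (\<forall>w'\<in>W. space_form \<alpha> \<mu> w w' = cinner v (fst w'))}"
  proof (cases "v \<in> L2")
   case True
   show ?thesis unfolding 1 2 m l2of_uminus[OF True] ..
  next
   case False
   then show ?thesis unfolding 1 2 m by blast
  qed
 qed
qed

end

theorem theorem1:
 fixes \<alpha> \<beta> :: real
 assumes "CARD('n::finite) \<ge> 5"
  and "\<alpha> > 0"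
  and "\<beta> > max (\<alpha> - 2) 0"
 shows "\<exists>\<mu>\<^sub>0>0. \<forall>\<mu>\<ge>\<mu>\<^sub>0. generates_analytic_contraction_semigroup
      (neg_op (op_A \<alpha> \<beta> \<mu> :: ((real ^ 'n \<Rightarrow> complex) \<times> (real ^ 'n \<Rightarrow> complex)) set))"
proof -
 have N: "DIM(real ^ 'n) \<ge> 5" using assms(1) by simp
 obtain \<mu>0 c where m: "0 < \<mu>0" and c: "0 < c"
  "\<And>\<mu> u. \<mu>0 \<le> \<mu> \<Longrightarrow> u \<in> test_functions (- {0::real^'n}) \<Longrightarrow>
   c * ((l2norm u)^2 + (l2norm (potential_V \<beta> \<odot> u))^2
    + (l2norm (npow (\<alpha> - 2) \<odot> u))^2
    + (l2norm (coeff_a \<alpha> \<odot> laplacian u))^2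
    + (\<Sum>b\<in>Basis. (l2norm (npow (\<alpha> - 1) \<odot> partial b u))^2))
   \<le> Re (form_a \<alpha> \<beta> \<mu> u u)" by (rule form_coercive[OF N assms(2,3)]) blast
 have "generates_analytic_contraction_semigroup
      (neg_op (op_A \<alpha> \<beta> \<mu> :: ((real ^ 'n \<Rightarrow> complex) \<times> (real ^ 'n \<Rightarrow> complex)) set))" if "\<mu>0 \<le> \<mu>" for \<mu>
  by (rule neg_op_A_generates[OF assms(1) c(1)]) (simp only: norm_test_embed c(2)[OF that])
 with m show ?thesis by blast
qed

end
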